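(* Let $M$ be a connected smooth manifold of dimension $n$, let $f_0,f_1,\ldots,f_m$ be smooth vector fields on $M$ such that $\{f_1,\ldots,f_m\}$ satisfies the Hörmander condition, and let $q\in M$ be regular with respect to the drift $f_0$. Assume, moreover, that $z=(z_1,\ldots,z_n)$ is a system of privileged coordinates at $q$ for $\{f_1,\ldots,f_m\}$ such that $z_*f_0=\partial_{z_k}$ for some $1\le k\le n$. Then there exist $T_0,\varepsilon_0,C>0$ such that, for all $0<T<T_0$ and $0<\varepsilon<\varepsilon_0$, $$\frac1C\,\operatorname{dist}\big(z(q'),z(e^{[0,T]f_0}q)\big)\le\rho_T^{f_0}(q,q')\le C\,\operatorname{dist}\big(z(q'),z(e^{[0,T]f_0}q)\big)^{1/r}\qquad\text{for every } q'\in\mathcal R_T^{f_0}(q,\varepsilon),$$ where $r$ is the degree of non-holonomy of $\{f_1,\ldots,f_m\}$ at $q$.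
   Context: Let $\Delta^1$ be the $C^\infty(M)$-module generated by $f_1,\ldots,f_m$, $\Delta^{k+1}=\Delta^k+[\Delta^k,\Delta^1]$, $\Delta^k(p)=\{f(p):f\in\Delta^k\}$. Hörmander condition: $\bigcup_k\Delta^k(p)=T_pM$ for all $p\in M$. The degree of non-holonomy at $q$ is the minimal $r$ with $\Delta^r(q)=T_qM$. Weights at $q$: with $n_k=\dim\Delta^k(q)$, $n_0=0$, set $w_i=k$ if $n_{k-1}<i\le n_k$. For a smooth function $a$ near a point $p$, $\operatorname{ord}_p(a)$ is the minimal $k\ge0$ such that $(f_{i_1}\cdots f_{i_k}a)(p)\ne0$ for some indices in $\{1,\ldots,m\}$; for a smooth vector field $f\not\equiv 0$ near $p$, $\operatorname{ord}_p(f)=\max\{\sigma\in\mathbb Z:\operatorname{ord}_p(fa)\ge\sigma+\operatorname{ord}_p(a)\ \forall a\}$. The point $q$ is regular with respect to $f_0$ if $p\mapsto\operatorname{ord}_p(f_0)$ is locally constant at $q$. Privileged coordinates at $q$: local coordinates $z$ centered at $q$ with $\operatorname{ord}_q(z_i)=w_i$ for all $i$. Control-affine system: an absolutely continuous curve $\gamma:[0,T']\to M$ is admissible if $\dot\gamma=f_0(\gamma)+\sum_iu_if_i(\gamma)$ a.e. for some $u\in L^1([0,T'],\mathbb R^m)$; its cost is the minimum of $\int_0^{T'}|u|\,dt$ over all such $u$. $\rho_T^{f_0}(q,q')$ is the infimum of the costs of admissible curves $\gamma:[0,T']\to M$ with $T'\le T$, $\gamma(0)=q$, $\gamma(T')=q'$,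 and $\mathcal R_T^{f_0}(q,\varepsilon)=\{q'\in M:\rho_T^{f_0}(q,q')<\varepsilon\}$. $e^{tf_0}$ is the flow of $f_0$, $e^{[0,T]f_0}q=\{e^{tf_0}q:0\le t\le T\}$, and $\operatorname{dist}(x,A)=\inf_{y\in A}|x-y|$ is the Euclidean distance in $\mathbb R^n$. *)

theory Defs
  imports "HOL-Analysis.Analysis" "HOL-Library.Function_Algebras"
begin

section \<open>Functions into a real vector space form a real vector space\<close>

instantiation "fun" :: (type, real_vector) real_vector
begin

definition scaleR_fun :: "real \<Rightarrow> ('a \<Rightarrow> 'b) \<Rightarrow> 'a \<Rightarrow> 'b" where
  "scaleR_fun c f = (\<lambda>x. c *\<^sub>R f x)"

instance
  by standard (auto simp: scaleR_fun_def fun_eq_iff scaleR_add_right scaleR_add_left)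

end


section \<open>Smooth manifolds\<close>

text \<open>The sets \<open>S\<close> are meant to be open, so that the Frechet derivatives \<open>at x\<close> are unique.\<close>

fun Ck_on :: "nat \<Rightarrow> 'a::real_normed_vector set \<Rightarrow> ('a \<Rightarrow> 'b::real_normed_vector) \<Rightarrow> bool" where
  "Ck_on 0 S g \<longleftrightarrow> continuous_on S g"
| "Ck_on (Suc k) S g \<longleftrightarrow>
     (\<forall>x\<in>S. g differentiable (at x)) \<and> (\<forall>v. Ck_on k S (\<lambda>x. frechet_derivative g (at x) v))"

definition smooth_on :: "'a::real_normed_vector set \<Rightarrow> ('a \<Rightarrow> 'b::real_normed_vector) \<Rightarrow> bool" where
  "smooth_on S g \<longleftrightarrow> (\<forall>k. Ck_on k S g)"

text \<open>A chart is a pair of a domain and a coordinate map; the values of the coordinate map outside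
  the domain are irrelevant.\<close>

type_synonym ('a, 'n) chart = "'a set \<times> ('a \<Rightarrow> real ^ 'n)"

definition is_chart :: "('a::topological_space, 'n::finite) chart \<Rightarrow> bool" where
  "is_chart = (\<lambda>(U, \<phi>). open U \<and> open (\<phi> ` U) \<and> (\<exists>\<psi>. homeomorphism U (\<phi> ` U) \<phi> \<psi>))"

definition smoothly_compatible :: "('a, 'n::finite) chart \<Rightarrow> ('a, 'n) chart \<Rightarrow> bool" where
  "smoothly_compatible = (\<lambda>(U, \<phi>) (V, \<psi>).
     smooth_on (\<phi> ` (U \<inter> V)) (\<psi> \<circ> inv_into U \<phi>) \<and>
     smooth_on (\<psi> ` (U \<inter> V)) (\<phi> \<circ> inv_into V \<psi>))"

definition smooth_atlas :: "('a::topological_space, 'n::finite) chart set \<Rightarrow> bool" where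
  "smooth_atlas \<A> \<longleftrightarrow>
     (\<forall>c\<in>\<A>. is_chart c) \<and> (\<forall>c\<in>\<A>. \<forall>d\<in>\<A>. smoothly_compatible c d) \<and> (\<Union>c\<in>\<A>. fst c) = UNIV"

text \<open>Local coordinates are the charts of the maximal atlas determined by \<open>\<A>\<close>.\<close>

definition local_coordinates ::
    "('a::topological_space, 'n::finite) chart set \<Rightarrow> ('a, 'n) chart \<Rightarrow> bool" where
  "local_coordinates \<A> c \<longleftrightarrow> is_chart c \<and> (\<forall>d\<in>\<A>. smoothly_compatible c d)"

definition smooth_fun_on :: "('a, 'n::finite) chart set \<Rightarrow> 'a set \<Rightarrow> ('a \<Rightarrow> real) \<Rightarrow> bool" where
  "smooth_fun_on \<A> W a \<longleftrightarrow> (\<forall>(U, \<phi>)\<in>\<A>. smooth_on (\<phi> ` (U \<inter> W)) (a \<circ> inv_into U \<phi>))"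

definition smooth_near ::
    "('a::topological_space, 'n::finite) chart set \<Rightarrow> 'a \<Rightarrow> ('a \<Rightarrow> real) \<Rightarrow> bool" where
  "smooth_near \<A> p a \<longleftrightarrow> (\<exists>W. open W \<and> p \<in> W \<and> smooth_fun_on \<A> W a)"


section \<open>Tangent vectors and vector fields\<close>

text \<open>Tangent vectors at \<open>p\<close> are the derivations on germs at \<open>p\<close> of smooth functions. A germ is
  represented by any total function that is smooth near \<open>p\<close>; on all other functions, a tangent
  vector takes the value 0, so that distinct tangent vectors are distinct as functions and the
  tangent space is a linear subspace of the function space.\<close>

type_synonym 'a tangent_vector = "('a \<Rightarrow> real) \<Rightarrow> real"
type_synonym 'a vector_field = "'a \<Rightarrow> 'a tangent_vector"

definition tangent_space ::
    "('a::topological_space, 'n::finite) chart set \<Rightarrow> 'a \<Rightarrow> 'a tangent_vector set" where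
  "tangent_space \<A> p = {v.
     (\<forall>a. \<not> smooth_near \<A> p a \<longrightarrow> v a = 0) \<and>
     (\<forall>a b. smooth_near \<A> p a \<and> smooth_near \<A> p b \<longrightarrow>
        (eventually (\<lambda>x. a x = b x) (nhds p) \<longrightarrow> v a = v b) \<and>
        v (\<lambda>x. a x + b x) = v a + v b \<and>
        v (\<lambda>x. a x * b x) = a p * v b + b p * v a) \<and>
     (\<forall>a c. smooth_near \<A> p a \<longrightarrow> v (\<lambda>x. c * a x) = c * v a)}"

text \<open>For a vector field \<open>X\<close> and a function \<open>a\<close>, the derivative \<open>X a\<close> is \<open>\<lambda>p. X p a\<close>.\<close>

definition smooth_vector_field ::
    "('a::topological_space, 'n::finite) chart set \<Rightarrow> 'a vector_field \<Rightarrow> bool" where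
  "smooth_vector_field \<A> X \<longleftrightarrow>
     (\<forall>p. X p \<in> tangent_space \<A> p) \<and>
     (\<forall>W a. open W \<and> smooth_fun_on \<A> W a \<longrightarrow> smooth_fun_on \<A> W (\<lambda>p. X p a))"

definition lie_bracket ::
    "('a::topological_space, 'n::finite) chart set \<Rightarrow> 'a vector_field \<Rightarrow> 'a vector_field \<Rightarrow> 'a vector_field"
  where
  "lie_bracket \<A> X Y = (\<lambda>p a.
     if smooth_near \<A> p a then X p (\<lambda>x. Y x a) - Y p (\<lambda>x. X x a) else 0)"

text \<open>The coordinates of the pushforward \<open>z\<^sub>* v\<close> are \<open>v z\<^sub>1, \<dots>, v z\<^sub>n\<close>.\<close>

definition pushforward :: "('a \<Rightarrow> real ^ 'n::finite) \<Rightarrow> 'a tangent_vector \<Rightarrow> real ^ 'n" where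
  "pushforward z v = (\<chi> i. v (\<lambda>x. z x $ i))"

definition has_velocity ::
    "('a::topological_space, 'n::finite) chart set \<Rightarrow> (real \<Rightarrow> 'a) \<Rightarrow> 'a tangent_vector \<Rightarrow> real \<Rightarrow> real set \<Rightarrow> bool"
  where
  "has_velocity \<A> \<gamma> v t I \<longleftrightarrow>
     (\<forall>a. smooth_near \<A> (\<gamma> t) a \<longrightarrow> ((\<lambda>s. a (\<gamma> s)) has_real_derivative v a) (at t within I))"


section \<open>The flag of a family of vector fields\<close>

text \<open>The bracket of two submodules is spanned by the brackets of their elements. The real span is
  enough here: \<open>a [X, Y] = [a X, Y] + (Y a) X\<close>, so the sum with \<open>\<Delta>\<^sup>k\<close> is the same as for the
  \<open>C\<^sup>\<infinity>\<close>-span. The case 0 is \<open>{0}\<close>, which yields \<open>n\<^sub>0 = 0\<close>.\<close>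

fun Delta ::
    "('a::topological_space, 'n::finite) chart set \<Rightarrow> ('m::finite \<Rightarrow> 'a vector_field) \<Rightarrow> nat \<Rightarrow> 'a vector_field set"
  where
  "Delta \<A> f 0 = {0}"
| "Delta \<A> f (Suc 0) =
     {(\<lambda>p. \<Sum>i\<in>UNIV. b i p *\<^sub>R f i p) | b. \<forall>i. smooth_fun_on \<A> UNIV (b i)}"
| "Delta \<A> f (Suc (Suc k)) =
     {X + Y | X Y. X \<in> Delta \<A> f (Suc k) \<and>
        Y \<in> span {lie_bracket \<A> V W | V W. V \<in> Delta \<A> f (Suc k) \<and> W \<in> Delta \<A> f (Suc 0)}}"

definition Delta_at ::
    "('a::topological_space, 'n::finite) chart set \<Rightarrow> ('m::finite \<Rightarrow> 'a vector_field) \<Rightarrow> nat \<Rightarrow> 'a \<Rightarrow> 'a tangent_vector set"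
  where
  "Delta_at \<A> f k p = (\<lambda>X. X p) ` Delta \<A> f k"

definition hoermander ::
    "('a::topological_space, 'n::finite) chart set \<Rightarrow> ('m::finite \<Rightarrow> 'a vector_field) \<Rightarrow> bool" where
  "hoermander \<A> f \<longleftrightarrow> (\<forall>p. (\<Union>k\<in>{1..}. Delta_at \<A> f k p) = tangent_space \<A> p)"

definition nonholonomy_degree ::
    "('a::topological_space, 'n::finite) chart set \<Rightarrow> ('m::finite \<Rightarrow> 'a vector_field) \<Rightarrow> 'a \<Rightarrow> nat" where
  "nonholonomy_degree \<A> f q = (LEAST r. 1 \<le> r \<and> Delta_at \<A> f r q = tangent_space \<A> q)"

text \<open>The coordinate index type \<open>'n\<close> is linearly ordered, and \<open>i\<close> is its \<open>card {..i}\<close>-th element,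
  counting from 1.\<close>

definition weight ::
    "('a::topological_space, 'n::{finite,linorder}) chart set \<Rightarrow> ('m::finite \<Rightarrow> 'a vector_field) \<Rightarrow> 'a \<Rightarrow> 'n \<Rightarrow> nat"
  where
  "weight \<A> f q i = (THE k. 1 \<le> k \<and>
     dim (Delta_at \<A> f (k - 1) q) < card {..i} \<and> card {..i} \<le> dim (Delta_at \<A> f k q))"


section \<open>Nonholonomic orders\<close>

text \<open>The order is \<open>\<infinity>\<close> if all iterated derivatives vanish at \<open>p\<close>.\<close>

definition ord_fun :: "('m \<Rightarrow> 'a vector_field) \<Rightarrow> 'a \<Rightarrow> ('a \<Rightarrow> real) \<Rightarrow> enat" where
  "ord_fun f p a =
     (INF is\<in>{is. foldr (\<lambda>i b x. f i x b) is a p \<noteq> 0}. enat (length is))"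

text \<open>The supremum of a nonempty set of integers that is bounded above is its maximum; the value is
  \<open>\<infinity>\<close> for vector fields that are flat at \<open>p\<close>.\<close>

definition ord_field ::
    "('a::topological_space, 'n::finite) chart set \<Rightarrow> ('m \<Rightarrow> 'a vector_field) \<Rightarrow> 'a \<Rightarrow> 'a vector_field \<Rightarrow> ereal"
  where
  "ord_field \<A> f p X = (SUP \<sigma>\<in>{\<sigma>::int. \<forall>a. smooth_near \<A> p a \<longrightarrow>
     ereal_of_enat (ord_fun f p (\<lambda>x. X x a)) \<ge> ereal (of_int \<sigma>) + ereal_of_enat (ord_fun f p a)}.
     ereal (of_int \<sigma>))"

definition regular_point ::
    "('a::topological_space, 'n::finite) chart set \<Rightarrow> ('m \<Rightarrow> 'a vector_field) \<Rightarrow> 'a vector_field \<Rightarrow> 'a \<Rightarrow> bool"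
  where
  "regular_point \<A> f f0 q \<longleftrightarrow> (\<forall>\<^sub>F p in nhds q. ord_field \<A> f p f0 = ord_field \<A> f q f0)"

definition privileged_coordinates ::
    "('a::topological_space, 'n::{finite,linorder}) chart set \<Rightarrow> ('m::finite \<Rightarrow> 'a vector_field) \<Rightarrow> 'a \<Rightarrow>
     'a set \<Rightarrow> ('a \<Rightarrow> (real, 'n) vec) \<Rightarrow> bool"
  where
  "privileged_coordinates \<A> f q U z \<longleftrightarrow>
     local_coordinates \<A> (U, z) \<and> q \<in> U \<and> z q = 0 \<and>
     (\<forall>i. ord_fun f q (\<lambda>x. z x $ i) = enat (weight \<A> f q i))"


section \<open>Control-affine systems\<close>

definition abs_continuous_on_ivl :: "real \<Rightarrow> real \<Rightarrow> (real \<Rightarrow> 'b::real_normed_vector) \<Rightarrow> bool" where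
  "abs_continuous_on_ivl s t g \<longleftrightarrow> (\<forall>\<epsilon>>0. \<exists>\<delta>>0. \<forall>D.
     finite D \<and> (\<forall>(x, y)\<in>D. s \<le> x \<and> x \<le> y \<and> y \<le> t) \<and>
     disjoint_family_on (\<lambda>(x, y). {x<..<y}) D \<and> (\<Sum>(x, y)\<in>D. y - x) < \<delta>
     \<longrightarrow> (\<Sum>(x, y)\<in>D. norm (g y - g x)) < \<epsilon>)"

definition abs_continuous_curve ::
    "('a::topological_space, 'n::finite) chart set \<Rightarrow> real \<Rightarrow> (real \<Rightarrow> 'a) \<Rightarrow> bool" where
  "abs_continuous_curve \<A> T \<gamma> \<longleftrightarrow> continuous_on {0..T} \<gamma> \<and>
     (\<forall>(U, \<phi>)\<in>\<A>. \<forall>s t. 0 \<le> s \<and> s \<le> t \<and> t \<le> T \<and> \<gamma> ` {s..t} \<subseteq> U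
        \<longrightarrow> abs_continuous_on_ivl s t (\<phi> \<circ> \<gamma>))"

definition controls ::
    "('a::topological_space, 'n::finite) chart set \<Rightarrow> 'a vector_field \<Rightarrow> ('m::finite \<Rightarrow> 'a vector_field) \<Rightarrow>
     real \<Rightarrow> (real \<Rightarrow> 'a) \<Rightarrow> (real \<Rightarrow> real ^ 'm) set"
  where
  "controls \<A> f0 f T \<gamma> = {u. u absolutely_integrable_on {0..T} \<and>
     (AE t\<in>{0..T} in lebesgue.
        has_velocity \<A> \<gamma> (f0 (\<gamma> t) + (\<Sum>i\<in>UNIV. (u t $ i) *\<^sub>R f i (\<gamma> t))) t {0..T})}"

definition admissible ::
    "('a::topological_space, 'n::finite) chart set \<Rightarrow> 'a vector_field \<Rightarrow> ('m::finite \<Rightarrow> 'a vector_field) \<Rightarrow>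
     real \<Rightarrow> (real \<Rightarrow> 'a) \<Rightarrow> bool"
  where
  "admissible \<A> f0 f T \<gamma> \<longleftrightarrow> abs_continuous_curve \<A> T \<gamma> \<and> controls \<A> f0 f T \<gamma> \<noteq> {}"

text \<open>For admissible curves the infimum is attained: take \<open>u t\<close> to be the solution of minimal norm
  of the linear system for the velocity at time \<open>t\<close>.\<close>

definition cost ::
    "('a::topological_space, 'n::finite) chart set \<Rightarrow> 'a vector_field \<Rightarrow> ('m::finite \<Rightarrow> 'a vector_field) \<Rightarrow>
     real \<Rightarrow> (real \<Rightarrow> 'a) \<Rightarrow> ereal"
  where
  "cost \<A> f0 f T \<gamma> = (INF u\<in>controls \<A> f0 f T \<gamma>. ereal (LINT t:{0..T}|lebesgue. norm (u t)))"

definition value_fun ::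
    "('a::topological_space, 'n::finite) chart set \<Rightarrow> 'a vector_field \<Rightarrow> ('m::finite \<Rightarrow> 'a vector_field) \<Rightarrow>
     real \<Rightarrow> 'a \<Rightarrow> 'a \<Rightarrow> ereal"
  where
  "value_fun \<A> f0 f T q q' = Inf {cost \<A> f0 f T' \<gamma> | T' \<gamma>.
     0 \<le> T' \<and> T' \<le> T \<and> admissible \<A> f0 f T' \<gamma> \<and> \<gamma> 0 = q \<and> \<gamma> T' = q'}"

definition reachable_set ::
    "('a::topological_space, 'n::finite) chart set \<Rightarrow> 'a vector_field \<Rightarrow> ('m::finite \<Rightarrow> 'a vector_field) \<Rightarrow>
     real \<Rightarrow> 'a \<Rightarrow> real \<Rightarrow> 'a set"
  where
  "reachable_set \<A> f0 f T q \<epsilon> = {q'. value_fun \<A> f0 f T q q' < ereal \<epsilon>}"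

definition integral_curve ::
    "('a::topological_space, 'n::finite) chart set \<Rightarrow> 'a vector_field \<Rightarrow> real \<Rightarrow> (real \<Rightarrow> 'a) \<Rightarrow> bool" where
  "integral_curve \<A> X t \<gamma> \<longleftrightarrow> (\<forall>s\<in>{0..t}. has_velocity \<A> \<gamma> (X (\<gamma> s)) s {0..t})"

text \<open>\<open>flow_segment \<A> X T q\<close> is the set of the points \<open>e\<^bsup>tX\<^esup>q\<close> for those \<open>t \<in> [0,T]\<close> for which the
  flow is defined at \<open>q\<close>.\<close>

definition flow_segment ::
    "('a::topological_space, 'n::finite) chart set \<Rightarrow> 'a vector_field \<Rightarrow> real \<Rightarrow> 'a \<Rightarrow> 'a set" where
  "flow_segment \<A> X T q =
     {\<gamma> t | \<gamma> t. 0 \<le> t \<and> t \<le> T \<and> integral_curve \<A> X t \<gamma> \<and> \<gamma> 0 = q}"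

end

theory Submission
  imports Defs
begin

text \<open>In the coordinates \<open>z\<close> the drift is a constant field \<open>e\<close>. For the lower bound, an admissible
  curve of small cost stays in a compact ball of the chart, and its distance from the drift segment
  is at most a constant times the integral of the norm of the control. For the upper bound, one
  follows the drift to a point of the segment close to the target and then moves the remaining
  distance \<open>D\<close> in an arbitrarily short time \<open>\<delta>\<close>: running the flows of \<open>\<delta> e + s f\<^sub>i\<close> for unit time along
  commutators of length at most \<open>r\<close>, with \<open>s\<close> of size \<open>D\<close> to the power \<open>1 / r\<close>, displaces the point
  by prescribed bracket directions up to an error that is small compared to \<open>D\<close>, and Brouwer's
  fixed point theorem turns this approximate solution into an exact one. The expansion of the
  displacement is computed in the ring of formal power series in noncommuting letters.\<close>

subsection \<open>Calculus of smooth functions\<close>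

text \<open>A target has to be reached within total time T, and the drift alone moves the point by
  the order of the time spent. So the correction must be possible in a time \<delta> as short as
  desired, at a cost that does not grow as \<delta> shrinks. A control of size s / \<delta> during
  time \<delta> costs s, and after rescaling time the drift is only the small perturbation \<delta>
  e. Hence all expansions carry an additive error of order \<delta> with constants independent of
  \<delta>, and \<delta> is chosen last. The exponent 1 / r arises because a commutator of length l,
  run with times t, displaces by the order t ^ l. The moves depend on the prescribed coefficients
  through roots, so only continuity of the endpoint map is at hand, not a derivative to invert; this
  is why a fixed point theorem is used. For the lower bound the obstacle is regularity: velocities
  exist almost everywhere, controls are merely integrable, and absolute continuity is known in the
  charts of the atlas, whereas the estimate is wanted in z.\<close>

lemma Ck_on_subset: "Ck_on k S g \<Longrightarrow> T \<subseteq> S \<Longrightarrow> Ck_on k T g"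
  by (induction k arbitrary: g) (auto intro: continuous_on_subset)

lemma frechet_derivative_cong_open:
  assumes "open S" "\<And>x. x \<in> S \<Longrightarrow> f x = g x" "x \<in> S"
  shows "frechet_derivative f (at x) = frechet_derivative g (at x)"
proof -
  have "(f has_derivative F) (at x) \<longleftrightarrow> (g has_derivative F) (at x)" for F
    using has_derivative_transform_within_open[OF _ assms(1,3), of f F UNIV g]
      has_derivative_transform_within_open[OF _ assms(1,3), of g F UNIV f] assms(2) by auto
  then show ?thesis unfolding frechet_derivative_def by simp
qed

lemma differentiable_cong_open:
  assumes "open S" "\<And>x. x \<in> S \<Longrightarrow> f x = g x" "x \<in> S" "f differentiable (at x)"
  shows "g differentiable (at x)"
  using assms has_derivative_transform_within_open[of f _ x UNIV S g]
  unfolding differentiable_def by metis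

lemma Ck_on_cong:
  assumes "open S" "\<And>x. x \<in> S \<Longrightarrow> f x = g x" "Ck_on k S f"
  shows "Ck_on k S g"
  using assms(2,3)
proof (induction k arbitrary: f g)
  case 0
  have "continuous_on S f \<longleftrightarrow> continuous_on S g"
    by (rule continuous_on_cong) (use 0 in auto)
  then show ?case using 0 by simp
next
  case (Suc k)
  have eq: "frechet_derivative f (at x) = frechet_derivative g (at x)" if "x \<in> S" for x
    using Suc.prems(1) that by (rule frechet_derivative_cong_open[OF assms(1)])
  have "Ck_on k S (\<lambda>x. frechet_derivative g (at x) v)" for v
  proof (rule Suc.IH)
    show "Ck_on k S (\<lambda>x. frechet_derivative f (at x) v)" using Suc.prems(2) by simp
  qed (simp add: eq)
  moreover have "g differentiable (at x)" if "x \<in> S" for x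
    using Suc.prems(1) that by (rule differentiable_cong_open[OF assms(1)]) (use Suc.prems(2) in \<open>auto simp: that\<close>)
  ultimately show ?case by simp
qed

lemma Ck_on_locally:
  assumes "\<And>x. x \<in> S \<Longrightarrow> \<exists>T. open T \<and> x \<in> T \<and> Ck_on k T f"
  shows "Ck_on k S f"
  using assms
proof (induction k arbitrary: f)
  case 0
  then show ?case
    by (metis Ck_on.simps(1) continuous_at_imp_continuous_on continuous_on_eq_continuous_at)
next
  case (Suc k)
  have "f differentiable (at x)" if "x \<in> S" for x
    using Suc.prems[OF that] by auto
  moreover have "Ck_on k S (\<lambda>x. frechet_derivative f (at x) v)" for v
    using Suc.prems by (intro Suc.IH) (metis Ck_on.simps(2))
  ultimately show ?case by auto
qed

lemma Ck_on_SucD: "Ck_on (Suc k) S g \<Longrightarrow> Ck_on k S g"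
proof (induction k arbitrary: g)
  case 0
  then show ?case
    by (auto intro!: continuous_at_imp_continuous_on differentiable_imp_continuous_within)
next
  case (Suc k)
  then show ?case by (simp only: Ck_on.simps) blast
qed

lemma Ck_on_SucI:
  assumes "open S" "\<And>x. x \<in> S \<Longrightarrow> (g has_derivative D x) (at x)" "\<And>v. Ck_on k S (\<lambda>x. D x v)"
  shows "Ck_on (Suc k) S g"
proof -
  have "D x = frechet_derivative g (at x)" if "x \<in> S" for x
    using assms(2)[OF that] by (rule frechet_derivative_at)
  then have "Ck_on k S (\<lambda>x. frechet_derivative g (at x) v)" for v
    by (intro Ck_on_cong[OF assms(1) _ assms(3)[of v]]) simp
  moreover have "g differentiable (at x)" if "x \<in> S" for x
    using assms(2)[OF that] by (auto simp: differentiable_def)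
  ultimately show ?thesis by simp
qed

lemma Ck_on_SucE:
  assumes "Ck_on (Suc k) S g"
  obtains "\<And>x. x \<in> S \<Longrightarrow> (g has_derivative frechet_derivative g (at x)) (at x)"
    "\<And>v. Ck_on k S (\<lambda>x. frechet_derivative g (at x) v)"
  using assms by (auto simp: frechet_derivative_works)

lemma Ck_on_const: "open S \<Longrightarrow> Ck_on k S (\<lambda>x. c)"
proof (induction k arbitrary: c)
  case (Suc k)
  show ?case
    by (rule Ck_on_SucI[of _ _ "\<lambda>_ _. 0"]) (auto simp: Suc)
qed simp

lemma Ck_on_linear:
  assumes "bounded_linear h" "open S" "Ck_on k S g"
  shows "Ck_on k S (\<lambda>x. h (g x))"
  using assms(3)
proof (induction k arbitrary: g)
  case 0
  then show ?case
    using continuous_on_compose2[OF linear_continuous_on[OF assms(1), of UNIV]] by fastforce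
next
  case (Suc k)
  from Suc.prems show ?case
    by (elim Ck_on_SucE, intro Ck_on_SucI[of _ _ "\<lambda>x v. h (frechet_derivative g (at x) v)"])
       (auto intro!: Suc.IH bounded_linear.has_derivative[OF assms(1)] simp: assms)
qed

lemma Ck_on_id: "open S \<Longrightarrow> Ck_on k S (\<lambda>x. x)"
proof (cases k)
  case (Suc j)
  assume "open S"
  then show ?thesis unfolding Suc
    by (intro Ck_on_SucI[of _ _ "\<lambda>x v. v"]) (auto intro: Ck_on_const has_derivative_ident)
qed simp

lemma Ck_on_add:
  assumes "open S" "Ck_on k S g" "Ck_on k S h"
  shows "Ck_on k S (\<lambda>x. g x + h x)"
  using assms(2,3)
proof (induction k arbitrary: g h)
  case 0
  then show ?case by (simp add: continuous_on_add continuous_on_mult continuous_on_scaleR)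
next
  case (Suc k)
  from Suc.prems show ?case
    by (elim Ck_on_SucE, intro Ck_on_SucI[of _ _ "\<lambda>x v. frechet_derivative g (at x) v + frechet_derivative h (at x) v"])
       (auto intro!: Suc.IH derivative_eq_intros simp: assms)
qed

lemma Ck_on_mult:
  fixes g h :: "'a::real_normed_vector \<Rightarrow> real"
  assumes "open S" "Ck_on k S g" "Ck_on k S h"
  shows "Ck_on k S (\<lambda>x. g x * h x)"
  using assms(2,3)
proof (induction k arbitrary: g h)
  case 0
  then show ?case by (simp add: continuous_on_add continuous_on_mult continuous_on_scaleR)
next
  case (Suc k)
  note gh = Suc.prems[THEN Ck_on_SucD]
  from Suc.prems show ?case
    by (elim Ck_on_SucE, intro Ck_on_SucI[of _ _ "\<lambda>x v. g x * frechet_derivative h (at x) v + frechet_derivative g (at x) v * h x"])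
       (auto intro!: Suc.IH derivative_eq_intros Ck_on_add gh simp: assms)
qed

lemma Ck_on_sum:
  assumes "open S" "\<And>i. i \<in> A \<Longrightarrow> Ck_on k S (g i)"
  shows "Ck_on k S (\<lambda>x. \<Sum>i\<in>A. g i x)"
  using assms(2) by (induction A rule: infinite_finite_induct) (auto intro!: Ck_on_add Ck_on_const assms(1))

text \<open>\<open>Ck_on\<close> controls derivatives in fixed directions only, whereas the chain
  rule in \<open>Ck_on_compose\<close> evaluates the outer derivative in a direction that varies
  with the point. The expansion over \<open>Basis\<close> moves this variation into scalar
  factors.\<close>

lemma frechet_derivative_sum_Basis:
  fixes f :: "'a::euclidean_space \<Rightarrow> 'b::real_normed_vector"
  assumes "f differentiable (at x)"
  shows "frechet_derivative f (at x) v = (\<Sum>b\<in>Basis. (v \<bullet> b) *\<^sub>R frechet_derivative f (at x) b)"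
proof -
  interpret linear "frechet_derivative f (at x)" using assms by (rule linear_frechet_derivative)
  have "frechet_derivative f (at x) (\<Sum>b\<in>Basis. (v \<bullet> b) *\<^sub>R b)
      = (\<Sum>b\<in>Basis. (v \<bullet> b) *\<^sub>R frechet_derivative f (at x) b)"
    by (simp only: sum scale)
  then show ?thesis by (simp only: euclidean_representation)
qed

lemma Ck_on_scaleR:
  fixes g :: "'a::real_normed_vector \<Rightarrow> real" and h :: "'a::real_normed_vector \<Rightarrow> 'b::real_normed_vector"
  assumes "open S" "Ck_on k S g" "Ck_on k S h"
  shows "Ck_on k S (\<lambda>x. g x *\<^sub>R h x)"
  using assms(2,3)
proof (induction k arbitrary: g h)
  case 0
  then show ?case by (simp add: continuous_on_add continuous_on_mult continuous_on_scaleR)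
next
  case (Suc k)
  note gh = Suc.prems[THEN Ck_on_SucD]
  from Suc.prems show ?case
    by (elim Ck_on_SucE, intro Ck_on_SucI[of _ _ "\<lambda>x v. g x *\<^sub>R frechet_derivative h (at x) v + frechet_derivative g (at x) v *\<^sub>R h x"])
       (auto intro!: Suc.IH derivative_eq_intros Ck_on_add gh simp: assms)
qed

lemma Ck_on_compose:
  fixes h :: "'a::real_normed_vector \<Rightarrow> 'b::euclidean_space" and g :: "'b \<Rightarrow> 'c::real_normed_vector"
  assumes "open S" "open T" "Ck_on k S h" "Ck_on k T g" "h ` S \<subseteq> T"
  shows "Ck_on k S (\<lambda>x. g (h x))"
  using assms(3,4)
proof (induction k arbitrary: g)
  case 0
  then show ?case using assms(5) by (auto intro: continuous_on_compose2)
next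
  case (Suc k)
  note h = Suc.prems(1)[THEN Ck_on_SucD]
  have hT: "h x \<in> T" if "x \<in> S" for x using that assms(5) by auto
  show ?case
  proof (rule Ck_on_SucI[OF assms(1)])
    fix x assume "x \<in> S"
    show "((\<lambda>x. g (h x)) has_derivative (\<lambda>v. \<Sum>b\<in>Basis. (frechet_derivative h (at x) v \<bullet> b) *\<^sub>R frechet_derivative g (at (h x)) b)) (at x)"
    proof -
      have g: "g differentiable at (h x)" using Suc.prems(2) hT[OF \<open>x \<in> S\<close>] by auto
      have h': "h differentiable at x" using Suc.prems(1) \<open>x \<in> S\<close> by auto
      have "((\<lambda>x. g (h x)) has_derivative (\<lambda>v. frechet_derivative g (at (h x)) (frechet_derivative h (at x) v))) (at x)"
        using has_derivative_compose[OF h'[unfolded frechet_derivative_works] g[unfolded frechet_derivative_works]] .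
      then show ?thesis
        by (simp only: frechet_derivative_sum_Basis[OF g, symmetric])
    qed
  next
    fix v
    have "Ck_on k S (\<lambda>x. frechet_derivative g (at (h x)) b)" for b
      using Suc.prems(2) by (intro Suc.IH[OF h]) simp
    moreover have "Ck_on k S (\<lambda>x. frechet_derivative h (at x) v \<bullet> b)" for b
      using Suc.prems(1) by (intro Ck_on_linear[OF bounded_linear_inner_left assms(1)]) simp
    ultimately show "Ck_on k S (\<lambda>x. \<Sum>b\<in>Basis. (frechet_derivative h (at x) v \<bullet> b) *\<^sub>R frechet_derivative g (at (h x)) b)"
      by (intro Ck_on_sum Ck_on_scaleR assms(1))
  qed
qed

lemma smooth_on_subset: "smooth_on S g \<Longrightarrow> T \<subseteq> S \<Longrightarrow> smooth_on T g"
  unfolding smooth_on_def by (blast intro: Ck_on_subset)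

lemma smooth_on_cong: "smooth_on S f \<Longrightarrow> open S \<Longrightarrow> (\<And>x. x \<in> S \<Longrightarrow> f x = g x) \<Longrightarrow> smooth_on S g"
  unfolding smooth_on_def using Ck_on_cong[of S f g] by simp

lemma smooth_on_locally:
  assumes "\<And>x. x \<in> S \<Longrightarrow> \<exists>T. open T \<and> x \<in> T \<and> smooth_on T f"
  shows "smooth_on S f"
  unfolding smooth_on_def
proof
  fix k show "Ck_on k S f"
    by (rule Ck_on_locally) (use assms in \<open>unfold smooth_on_def, blast\<close>)
qed

lemma smooth_on_const: "open S \<Longrightarrow> smooth_on S (\<lambda>x. c)"
  by (simp add: smooth_on_def Ck_on_const)

lemma smooth_on_id: "open S \<Longrightarrow> smooth_on S (\<lambda>x. x)"
  by (simp add: smooth_on_def Ck_on_id)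

lemma smooth_on_linear: "bounded_linear h \<Longrightarrow> open S \<Longrightarrow> smooth_on S g \<Longrightarrow> smooth_on S (\<lambda>x. h (g x))"
  by (simp add: smooth_on_def Ck_on_linear)

lemma smooth_on_add: "open S \<Longrightarrow> smooth_on S g \<Longrightarrow> smooth_on S h \<Longrightarrow> smooth_on S (\<lambda>x. g x + h x)"
  by (simp add: smooth_on_def Ck_on_add)

lemma smooth_on_mult:
  "open S \<Longrightarrow> smooth_on S g \<Longrightarrow> smooth_on S h \<Longrightarrow> smooth_on S (\<lambda>x. g x * h x :: real)"
  by (simp add: smooth_on_def Ck_on_mult)

lemma smooth_on_cmult: "open S \<Longrightarrow> smooth_on S h \<Longrightarrow> smooth_on S (\<lambda>x. c * h x :: real)"
  by (simp add: smooth_on_mult smooth_on_const)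

lemma smooth_on_diff:
  "open S \<Longrightarrow> smooth_on S g \<Longrightarrow> smooth_on S h \<Longrightarrow> smooth_on S (\<lambda>x. g x - h x :: real)"
  using smooth_on_add[OF _ _ smooth_on_cmult[of S h "-1"]] by force

lemma smooth_on_scaleR:
  "open S \<Longrightarrow> smooth_on S g \<Longrightarrow> smooth_on S h \<Longrightarrow> smooth_on S (\<lambda>x. g x *\<^sub>R h x)"
  by (simp add: smooth_on_def Ck_on_scaleR)

lemma smooth_on_sum:
  "open S \<Longrightarrow> (\<And>i. i \<in> A \<Longrightarrow> smooth_on S (g i)) \<Longrightarrow> smooth_on S (\<lambda>x. \<Sum>i\<in>A. g i x)"
  by (simp add: smooth_on_def Ck_on_sum)

lemma smooth_on_compose:
  fixes h :: "'a::real_normed_vector \<Rightarrow> 'b::euclidean_space"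
  shows "open S \<Longrightarrow> open T \<Longrightarrow> smooth_on S h \<Longrightarrow> smooth_on T g \<Longrightarrow> h ` S \<subseteq> T \<Longrightarrow> smooth_on S (\<lambda>x. g (h x))"
  unfolding smooth_on_def by (blast intro: Ck_on_compose)

lemma smooth_on_frechet_derivative:
  "smooth_on S g \<Longrightarrow> smooth_on S (\<lambda>x. frechet_derivative g (at x) v)"
  unfolding smooth_on_def using Ck_on.simps(2) by blast

lemma smooth_on_continuous: "smooth_on S g \<Longrightarrow> continuous_on S g"
  unfolding smooth_on_def using Ck_on.simps(1) by blast

lemma smooth_on_differentiable: "smooth_on S g \<Longrightarrow> x \<in> S \<Longrightarrow> g differentiable (at x)"
  unfolding smooth_on_def using Ck_on.simps(2) by blast

lemma smooth_on_has_derivative: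
  "smooth_on S g \<Longrightarrow> x \<in> S \<Longrightarrow> (g has_derivative frechet_derivative g (at x)) (at x)"
  using smooth_on_differentiable frechet_derivative_works by blast

lemma smooth_on_nth: "open S \<Longrightarrow> smooth_on S g \<Longrightarrow> smooth_on S (\<lambda>x. g x $ i)"
  by (rule smooth_on_linear[OF bounded_linear_vec_nth])

lemma sum_axis: "(\<Sum>i\<in>UNIV. (v $ i) *\<^sub>R axis i 1) = (v :: real ^ 'n)"
  by (simp add: vec_eq_iff axis_def if_distrib cong: if_cong)

lemma smooth_on_vec:
  fixes g :: "'a::real_normed_vector \<Rightarrow> real ^ 'n"
  assumes "open S" "\<And>i. smooth_on S (\<lambda>x. g x $ i)"
  shows "smooth_on S g"
proof -
  have "smooth_on S (\<lambda>x. \<Sum>i\<in>UNIV. (g x $ i) *\<^sub>R (axis i 1 :: real ^ 'n))"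
    by (intro smooth_on_sum smooth_on_scaleR assms smooth_on_const)
  then show ?thesis
    by (simp only: sum_axis)
qed

lemma frechet_derivative_sum_axis:
  fixes f :: "real ^ 'n \<Rightarrow> 'b::real_normed_vector"
  assumes "f differentiable (at x)"
  shows "frechet_derivative f (at x) v = (\<Sum>i\<in>UNIV. (v $ i) *\<^sub>R frechet_derivative f (at x) (axis i 1))"
proof -
  interpret linear "frechet_derivative f (at x)" using assms by (rule linear_frechet_derivative)
  have "frechet_derivative f (at x) (\<Sum>i\<in>UNIV. (v $ i) *\<^sub>R axis i 1)
      = (\<Sum>i\<in>UNIV. (v $ i) *\<^sub>R frechet_derivative f (at x) (axis i 1))"
    by (simp only: sum scale)
  then show ?thesis by (simp only: sum_axis)
qed

lemma smooth_on_directional_derivative: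
  fixes f :: "real ^ 'n \<Rightarrow> 'b::real_normed_vector"
  assumes "open S" "smooth_on S f" "smooth_on S X"
  shows "smooth_on S (\<lambda>x. frechet_derivative f (at x) (X x))"
proof -
  have "smooth_on S (\<lambda>x. \<Sum>i\<in>UNIV. (X x $ i) *\<^sub>R frechet_derivative f (at x) (axis i 1))"
    by (intro smooth_on_sum smooth_on_scaleR smooth_on_nth smooth_on_frechet_derivative assms)
  then show ?thesis
    by (rule smooth_on_cong)
       (auto simp: assms(1) frechet_derivative_sum_axis[OF smooth_on_differentiable[OF assms(2)], symmetric])
qed

lemma smooth_on_bounded_compact:
  assumes "smooth_on S g" "compact K" "K \<subseteq> S"
  obtains B where "B > 0" "\<And>x. x \<in> K \<Longrightarrow> norm (g x) \<le> B"
proof -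
  have "compact (g ` K)"
    using assms by (intro compact_continuous_image continuous_on_subset[OF smooth_on_continuous])
  then show ?thesis using compact_imp_bounded bounded_pos that by (metis imageI)
qed

lemma smooth_on_derivative_bounded:
  fixes g :: "real ^ 'n \<Rightarrow> 'b::real_normed_vector"
  assumes "smooth_on S g" "compact K" "K \<subseteq> S"
  obtains B where "B > 0" "\<And>x v. x \<in> K \<Longrightarrow> norm (frechet_derivative g (at x) v) \<le> B * norm v"
proof -
  have "\<exists>B>0. \<forall>x\<in>K. norm (frechet_derivative g (at x) (axis i 1)) \<le> B" for i
    using smooth_on_bounded_compact[OF smooth_on_frechet_derivative[OF assms(1), of "axis i 1"] assms(2,3)]
    by metis
  then obtain B where B: "\<And>i. B i > 0" "\<And>i x. x \<in> K \<Longrightarrow> norm (frechet_derivative g (at x) (axis i 1)) \<le> B i"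
    by metis
  show ?thesis
  proof
    show "(\<Sum>i\<in>UNIV. B i) > 0" using B(1) by (intro sum_pos) auto
  next
    fix x v assume x: "x \<in> K"
    have "norm (frechet_derivative g (at x) v) = norm (\<Sum>i\<in>UNIV. (v $ i) *\<^sub>R frechet_derivative g (at x) (axis i 1))"
      using x assms(3)
      by (subst frechet_derivative_sum_axis[OF smooth_on_differentiable[OF assms(1)]]) auto
    also have "\<dots> \<le> (\<Sum>i\<in>UNIV. B i * norm v)"
      by (rule sum_norm_le)
         (auto simp: mult.commute[of "B _"] intro!: mult_mono component_le_norm_cart B(2) x)
    finally show "norm (frechet_derivative g (at x) v) \<le> (\<Sum>i\<in>UNIV. B i) * norm v"
      by (simp only: sum_distrib_right)
  qed
qed

lemma smooth_on_lipschitz: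
  fixes g :: "real ^ 'n \<Rightarrow> 'b::real_normed_vector"
  assumes "smooth_on S g" "compact K" "K \<subseteq> S" "convex K"
  obtains B where "B > 0" "B-lipschitz_on K g"
proof -
  obtain B where B: "B > 0" "\<And>x v. x \<in> K \<Longrightarrow> norm (frechet_derivative g (at x) v) \<le> B * norm v"
    using smooth_on_derivative_bounded[OF assms(1-3)] by blast
  have "B-lipschitz_on K g"
  proof (rule lipschitz_onI)
    fix x y assume xy: "x \<in> K" "y \<in> K"
    have "norm (g x - g y) \<le> B * norm (x - y)"
    proof (rule differentiable_bound[OF assms(4) _ _ xy])
      fix w assume w: "w \<in> K"
      show "(g has_derivative frechet_derivative g (at w)) (at w within K)"
        using smooth_on_has_derivative[OF assms(1)] w assms(3) by (blast intro: has_derivative_at_withinI)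
      show "onorm (frechet_derivative g (at w)) \<le> B"
        using B w by (intro onorm_bound) auto
    qed
    then show "dist (g x) (g y) \<le> B * dist x y" by (simp add: dist_norm)
  qed (use B in simp)
  then show ?thesis using B that by blast
qed

section \<open>Integrals along rays and Hadamard's lemma\<close>

lemma segment_in_ball:
  fixes c :: "'a::real_normed_vector"
  assumes "x \<in> ball c r" "0 \<le> t" "t \<le> 1"
  shows "c + t *\<^sub>R (x - c) \<in> ball c r"
proof -
  have "norm (t *\<^sub>R (x - c)) \<le> 1 * norm (x - c)"
    using assms by (simp add: mult_left_le_one_le)
  then show ?thesis using assms(1) by (simp add: dist_norm norm_minus_commute)
qed

lemma continuous_on_ray_integrand:
  fixes G :: "'a::real_normed_vector \<Rightarrow> real"
  assumes "continuous_on (ball c r) G"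
  shows "continuous_on (ball c r \<times> {0..1}) (\<lambda>(x, t). t ^ j * G (c + t *\<^sub>R (x - c)))"
proof -
  have "continuous_on (ball c r \<times> {0..1}) (\<lambda>p. G (c + snd p *\<^sub>R (fst p - c)))"
  proof (rule continuous_on_compose2[OF assms])
    show "continuous_on (ball c r \<times> {0..1}) (\<lambda>p. c + snd p *\<^sub>R (fst p - c))"
      by (intro continuous_on_add continuous_on_scaleR continuous_on_diff continuous_on_const
          continuous_on_snd continuous_on_fst continuous_on_id)
    show "(\<lambda>p. c + snd p *\<^sub>R (fst p - c)) ` (ball c r \<times> {0..1}) \<subseteq> ball c r"
      using segment_in_ball[of _ c r] by fastforce
  qed
  then show ?thesis
    by (auto simp: split_beta intro!: continuous_on_mult continuous_on_power continuous_on_snd continuous_on_id)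
qed

text \<open>Differentiation under the integral sign; the chain rule contributes a factor t.
  Integrals with an arbitrary weight \<open>t ^ j\<close> therefore form a class closed under
  differentiation, which is what the induction in \<open>smooth_on_ray_integral\<close> runs
  on.\<close>

lemma has_derivative_ray_integral:
  fixes G :: "real ^ 'n \<Rightarrow> real"
  assumes G: "smooth_on (ball c r) G" and x: "x \<in> ball c r"
  shows "((\<lambda>x. integral {0..1} (\<lambda>t. t ^ j * G (c + t *\<^sub>R (x - c)))) has_derivative
     (\<lambda>v. integral {0..1} (\<lambda>t. t ^ Suc j * frechet_derivative G (at (c + t *\<^sub>R (x - c))) v))) (at x)"
proof -
  let ?B = "ball c r"
  \<comment> \<open>The Leibniz rule wants the derivative of the integrand as a bounded linear map;
    \<open>Blinfun\<close> has the intended values only where its argument is known to be bounded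
    linear, hence the side conditions in \<open>fx\<close>.\<close>
  define fx where "fx x t = Blinfun (\<lambda>v. t ^ Suc j * frechet_derivative G (at (c + t *\<^sub>R (x - c))) v)" for x t
  have bl: "bounded_linear (\<lambda>v. t ^ Suc j * frechet_derivative G (at (c + t *\<^sub>R (x - c))) v)"
    if "x \<in> ?B" "t \<in> {0..1}" for x t
    using smooth_on_has_derivative[OF G segment_in_ball[OF that(1), of t]] that(2)
    by (intro bounded_linear_const_mult) (auto dest: has_derivative_bounded_linear)
  have fx: "blinfun_apply (fx x t) v = t ^ Suc j * frechet_derivative G (at (c + t *\<^sub>R (x - c))) v"
    if "x \<in> ?B" "t \<in> {0..1}" for x t v
    unfolding fx_def by (subst bounded_linear_Blinfun_apply[OF bl[OF that]]) simp
  have contfx: "continuous_on (?B \<times> {0..1}) (\<lambda>p. blinfun_apply (fx (fst p) (snd p)) v)" for v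
  proof -
    have "continuous_on (?B \<times> {0..1}) (\<lambda>(x, t). t ^ Suc j * frechet_derivative G (at (c + t *\<^sub>R (x - c))) v)"
      by (rule continuous_on_ray_integrand[OF smooth_on_continuous[OF smooth_on_frechet_derivative[OF G]]])
    then show ?thesis
      by (rule continuous_on_cong[THEN iffD1, rotated -1]) (auto simp: fx)
  qed
  have cont: "continuous_on (?B \<times> cbox 0 1) (\<lambda>(x, t). fx x t)"
    using contfx by (intro continuous_on_blinfun_componentwise) (auto simp: split_beta cbox_interval)
  have cont1: "continuous_on {0..1} (fx x)"
    by (intro continuous_on_blinfun_componentwise continuous_on_compose2[OF contfx, of _ "\<lambda>t. (x, t)", simplified])
       (use x in \<open>auto intro!: continuous_on_Pair continuous_on_const continuous_on_id\<close>)
  have der: "((\<lambda>x. t ^ j * G (c + t *\<^sub>R (x - c))) has_derivative blinfun_apply (fx x t)) (at x within ?B)"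
    if "x \<in> ?B" "t \<in> cbox 0 1" for x t
  proof -
    have t: "t \<in> {0..1}" using that(2) by (simp add: cbox_interval)
    have "((\<lambda>x. c + t *\<^sub>R (x - c)) has_derivative (\<lambda>v. t *\<^sub>R v)) (at x)"
      by (auto intro!: derivative_eq_intros)
    moreover have d: "(G has_derivative frechet_derivative G (at (c + t *\<^sub>R (x - c)))) (at (c + t *\<^sub>R (x - c)))"
      using t by (intro smooth_on_has_derivative[OF G] segment_in_ball[OF that(1)]) auto
    ultimately have "((\<lambda>x. G (c + t *\<^sub>R (x - c))) has_derivative
        (\<lambda>v. frechet_derivative G (at (c + t *\<^sub>R (x - c))) (t *\<^sub>R v))) (at x)"
      by (rule has_derivative_compose)
    then have "((\<lambda>x. t ^ j * G (c + t *\<^sub>R (x - c))) has_derivative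
        (\<lambda>v. t ^ j * frechet_derivative G (at (c + t *\<^sub>R (x - c))) (t *\<^sub>R v))) (at x)"
      by (rule has_derivative_mult_right)
    moreover have "t ^ j * frechet_derivative G (at (c + t *\<^sub>R (x - c))) (t *\<^sub>R v) = blinfun_apply (fx x t) v" for v
      by (simp add: fx[OF that(1) t] linear_cmul[OF has_derivative_linear[OF d]])
    ultimately show ?thesis by (simp add: has_derivative_at_withinI)
  qed
  have int: "(\<lambda>t. t ^ j * G (c + t *\<^sub>R (y - c))) integrable_on cbox 0 1" if "y \<in> ?B" for y
    using that
    by (intro integrable_continuous continuous_on_compose2[OF continuous_on_ray_integrand[OF smooth_on_continuous[OF G]],
          of _ "\<lambda>t. (y, t)", simplified split_beta fst_conv snd_conv])
       (auto intro!: continuous_on_Pair continuous_on_const continuous_on_id simp: cbox_interval)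
  have "((\<lambda>x. integral (cbox 0 1) (\<lambda>t. t ^ j * G (c + t *\<^sub>R (x - c)))) has_derivative
     blinfun_apply (integral (cbox 0 1) (fx x))) (at x within ?B)"
    by (rule leibniz_rule[OF der int cont x convex_ball])
  moreover have "blinfun_apply (integral (cbox 0 1) (fx x))
      = (\<lambda>v. integral {0..1} (\<lambda>t. t ^ Suc j * frechet_derivative G (at (c + t *\<^sub>R (x - c))) v))"
  proof (rule ext)
    fix v
    have "blinfun_apply (integral {0..1} (fx x)) v = integral {0..1} (\<lambda>t. blinfun_apply (fx x t) v)"
      using integrable_continuous_interval[OF cont1] by (simp add: blinfun_apply_integral)
    also have "\<dots> = integral {0..1} (\<lambda>t. t ^ Suc j * frechet_derivative G (at (c + t *\<^sub>R (x - c))) v)"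
      by (rule integral_cong) (use fx[OF x] in auto)
    finally show "blinfun_apply (integral (cbox 0 1) (fx x)) v
        = integral {0..1} (\<lambda>t. t ^ Suc j * frechet_derivative G (at (c + t *\<^sub>R (x - c))) v)"
      by (simp add: cbox_interval)
  qed
  ultimately show ?thesis
    using x by (simp only: at_within_open[OF _ open_ball] cbox_interval)
qed

lemma smooth_on_ray_integral:
  fixes G :: "real ^ 'n \<Rightarrow> real"
  assumes "smooth_on (ball c r) G"
  shows "smooth_on (ball c r) (\<lambda>x. integral {0..1} (\<lambda>t. t ^ j * G (c + t *\<^sub>R (x - c))))"
  unfolding smooth_on_def
proof
  fix k
  show "Ck_on k (ball c r) (\<lambda>x. integral {0..1} (\<lambda>t. t ^ j * G (c + t *\<^sub>R (x - c))))"
    using assms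
  proof (induction k arbitrary: G j)
    case 0
    show ?case
      using integral_continuous_on_param[of "ball c r" 0 1 "\<lambda>x t. t ^ j * G (c + t *\<^sub>R (x - c))"]
        continuous_on_ray_integrand[OF smooth_on_continuous[OF 0]] by (simp add: cbox_interval)
  next
    case (Suc k)
    show ?case
      by (rule Ck_on_SucI[OF open_ball has_derivative_ray_integral[OF Suc.prems]
            Suc.IH[OF smooth_on_frechet_derivative[OF Suc.prems]]])
  qed
qed

text \<open>The fundamental theorem of calculus along the segment from c to x, with the partial
  derivatives averaged over the segment as the functions \<open>h i\<close>. It is what identifies
  derivations with directional derivatives in \<open>tangent_formula\<close>.\<close>

lemma hadamard:
  fixes g :: "real ^ 'n \<Rightarrow> real"
  assumes g: "smooth_on (ball c r) g" and r: "r > 0"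
  obtains h where "\<And>i. smooth_on (ball c r) (h i)"
    "\<And>x. x \<in> ball c r \<Longrightarrow> g x = g c + (\<Sum>i\<in>UNIV. (x $ i - c $ i) * h i x)"
    "\<And>i. h i c = frechet_derivative g (at c) (axis i 1)"
proof
  \<comment> \<open>The factor \<open>t ^ 0\<close> puts the average into the form of the ray
    integrals.\<close>
  let ?h = "\<lambda>i x. integral {0..1} (\<lambda>t. t ^ 0 * frechet_derivative g (at (c + t *\<^sub>R (x - c))) (axis i 1))"
  show "smooth_on (ball c r) (?h i)" for i
    by (rule smooth_on_ray_integral[OF smooth_on_frechet_derivative[OF g]])
  show "?h i c = frechet_derivative g (at c) (axis i 1)" for i by simp
  fix x assume x: "x \<in> ball c r"
  have seg: "c + t *\<^sub>R (x - c) \<in> ball c r" if "t \<in> {0..1}" for t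
    using segment_in_ball[OF x] that by auto
  have "((\<lambda>t. g (c + t *\<^sub>R (x - c))) has_vector_derivative frechet_derivative g (at (c + t *\<^sub>R (x - c))) (x - c)) (at t within {0..1})"
    if "t \<in> {0..1}" for t
  proof -
    have d: "(g has_derivative frechet_derivative g (at (c + t *\<^sub>R (x - c)))) (at (c + t *\<^sub>R (x - c)))"
      by (rule smooth_on_has_derivative[OF g seg[OF that]])
    have "((\<lambda>t. c + t *\<^sub>R (x - c)) has_derivative (\<lambda>s. s *\<^sub>R (x - c))) (at t)"
      by (auto intro!: derivative_eq_intros)
    from has_derivative_compose[OF this d] show ?thesis
      unfolding has_vector_derivative_def
      by (simp add: linear_cmul[OF has_derivative_linear[OF d]] has_derivative_at_withinI)
  qed
  then have "((\<lambda>t. frechet_derivative g (at (c + t *\<^sub>R (x - c))) (x - c)) has_integral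
      g (c + 1 *\<^sub>R (x - c)) - g (c + 0 *\<^sub>R (x - c))) {0..1}"
    by (intro fundamental_theorem_of_calculus) auto
  then have "integral {0..1} (\<lambda>t. frechet_derivative g (at (c + t *\<^sub>R (x - c))) (x - c)) = g x - g c"
    by (simp add: integral_unique)
  moreover have "integral {0..1} (\<lambda>t. frechet_derivative g (at (c + t *\<^sub>R (x - c))) (x - c))
      = integral {0..1} (\<lambda>t. \<Sum>i\<in>UNIV. (x $ i - c $ i) * frechet_derivative g (at (c + t *\<^sub>R (x - c))) (axis i 1))"
    using seg by (intro integral_cong, subst frechet_derivative_sum_axis) (auto intro: smooth_on_differentiable[OF g])
  moreover have "\<dots> = (\<Sum>i\<in>UNIV. (x $ i - c $ i) * ?h i x)"
  proof -
    have "(\<lambda>t. (x $ i - c $ i) * frechet_derivative g (at (c + t *\<^sub>R (x - c))) (axis i 1)) integrable_on {0..1}" for i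
      using seg
      by (intro integrable_continuous_interval continuous_on_mult continuous_on_const
          continuous_on_compose2[OF smooth_on_continuous[OF smooth_on_frechet_derivative[OF g]]]
          continuous_on_add continuous_on_scaleR continuous_on_id) auto
    then show ?thesis by (subst integral_sum) auto
  qed
  ultimately show "g x = g c + (\<Sum>i\<in>UNIV. (x $ i - c $ i) * ?h i x)" by simp
qed

subsection \<open>Noncommutative formal power series\<close>

text \<open>Functions already carry the pointwise product from \<open>Function_Algebras\<close>; the
  product here splits words, so it lives on a type of its own.\<close>

typedef 'm word_series = "UNIV :: ('m list \<Rightarrow> real) set"
  morphisms wcoeff Word_Series ..

setup_lifting type_definition_word_series

lemma word_series_eqI: "(\<And>w. wcoeff S w = wcoeff T w) \<Longrightarrow> S = T"
  by (auto simp: wcoeff_inject[symmetric] fun_eq_iff)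

instantiation word_series :: (type) ring_1
begin

lift_definition zero_word_series :: "'a word_series" is "\<lambda>w. 0" .
lift_definition one_word_series :: "'a word_series" is "\<lambda>w. if w = [] then 1 else 0" .
lift_definition plus_word_series :: "'a word_series \<Rightarrow> 'a word_series \<Rightarrow> 'a word_series" is
  "\<lambda>S T w. S w + T w" .
lift_definition minus_word_series :: "'a word_series \<Rightarrow> 'a word_series \<Rightarrow> 'a word_series" is
  "\<lambda>S T w. S w - T w" .
lift_definition uminus_word_series :: "'a word_series \<Rightarrow> 'a word_series" is
  "\<lambda>S w. - S w" .
lift_definition times_word_series :: "'a word_series \<Rightarrow> 'a word_series \<Rightarrow> 'a word_series" is
  "\<lambda>S T w. \<Sum>i\<le>length w. S (take i w) * T (drop i w)" .

instance
proof
  fix S T R :: "'a word_series"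
  show "S * T * R = S * (T * R)"
  proof (rule word_series_eqI)
    fix w :: "'a list"
    let ?n = "length w"
    have "wcoeff (S * T * R) w
        = (\<Sum>i\<le>?n. \<Sum>j\<le>i. wcoeff S (take j w) * wcoeff T (drop j (take i w)) * wcoeff R (drop i w))"
      unfolding times_word_series.rep_eq
      by (auto simp: sum_distrib_right min_def intro!: sum.cong)
    also have "\<dots> = (\<Sum>(i, j)\<in>(SIGMA i:{..?n}. {..i}).
        wcoeff S (take j w) * wcoeff T (drop j (take i w)) * wcoeff R (drop i w))"
      by (rule sum.Sigma) auto
    \<comment> \<open>In the pair (i, j) both entries are cut positions, j inside the prefix of
      length i. The new pair (j, k) consists of the lengths of the parts taken by S and T.\<close>
    also have "\<dots> = (\<Sum>(j, k)\<in>(SIGMA j:{..?n}. {..?n - j}).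
        wcoeff S (take j w) * wcoeff T (take k (drop j w)) * wcoeff R (drop (j + k) w))"
      by (rule sum.reindex_bij_witness[of _ "\<lambda>(j, k). (j + k, j)" "\<lambda>(i, j). (j, i - j)"])
         (auto simp: drop_take add.commute)
    also have "\<dots> = (\<Sum>j\<le>?n. \<Sum>k\<le>?n - j.
        wcoeff S (take j w) * wcoeff T (take k (drop j w)) * wcoeff R (drop (j + k) w))"
      by (rule sum.Sigma[symmetric]) auto
    also have "\<dots> = wcoeff (S * (T * R)) w"
      unfolding times_word_series.rep_eq
      by (auto simp: sum_distrib_left mult.assoc add.commute intro!: sum.cong)
    finally show "wcoeff (S * T * R) w = wcoeff (S * (T * R)) w" .
  qed
  show "(S + T) * R = S * R + T * R"
    by (rule word_series_eqI)
       (simp add: times_word_series.rep_eq plus_word_series.rep_eq distrib_right sum.distrib)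
  show "S * (T + R) = S * T + S * R"
    by (rule word_series_eqI)
       (simp add: times_word_series.rep_eq plus_word_series.rep_eq distrib_left sum.distrib)
  show "1 * S = S"
  proof (rule word_series_eqI)
    fix w
    have "wcoeff (1 * S) w = (\<Sum>i\<le>length w. if i = 0 then wcoeff S w else 0)"
      unfolding times_word_series.rep_eq one_word_series.rep_eq by (rule sum.cong) auto
    then show "wcoeff (1 * S) w = wcoeff S w" by simp
  qed
  show "S * 1 = S"
  proof (rule word_series_eqI)
    fix w
    have "wcoeff (S * 1) w = (\<Sum>i\<le>length w. if i = length w then wcoeff S w else 0)"
      unfolding times_word_series.rep_eq one_word_series.rep_eq by (rule sum.cong) auto
    then show "wcoeff (S * 1) w = wcoeff S w" by simp
  qed
  show "(0::'a word_series) \<noteq> 1"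
    by (metis one_word_series.rep_eq zero_neq_one zero_word_series.rep_eq)
qed (auto intro!: word_series_eqI simp: plus_word_series.rep_eq zero_word_series.rep_eq
      minus_word_series.rep_eq uminus_word_series.rep_eq)

end

lemmas wcoeff_simps = plus_word_series.rep_eq zero_word_series.rep_eq one_word_series.rep_eq
  minus_word_series.rep_eq uminus_word_series.rep_eq

definition order_ge :: "nat \<Rightarrow> 'm word_series \<Rightarrow> bool" where
  "order_ge n S \<longleftrightarrow> (\<forall>w. length w < n \<longrightarrow> wcoeff S w = 0)"

lemma order_ge_0: "order_ge 0 S"
  and order_ge_mono: "order_ge n S \<Longrightarrow> m \<le> n \<Longrightarrow> order_ge m S"
  and order_ge_add: "order_ge n S \<Longrightarrow> order_ge n T \<Longrightarrow> order_ge n (S + T)"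
  and order_ge_diff: "order_ge n S \<Longrightarrow> order_ge n T \<Longrightarrow> order_ge n (S - T)"
  and order_ge_minus: "order_ge n S \<Longrightarrow> order_ge n (- S)"
  by (auto simp: order_ge_def wcoeff_simps)

lemma order_ge_mult:
  assumes "order_ge a S" "order_ge b T"
  shows "order_ge (a + b) (S * T)"
  unfolding order_ge_def times_word_series.rep_eq
proof (intro allI impI sum.neutral ballI)
  fix w :: "'a list" and i assume w: "length w < a + b" and i: "i \<in> {..length w}"
  show "wcoeff S (take i w) * wcoeff T (drop i w) = 0"
  proof (cases "i < a")
    case True
    then have "wcoeff S (take i w) = 0" using assms(1) by (simp add: order_ge_def)
    then show ?thesis by simp
  next
    case False
    then have "wcoeff T (drop i w) = 0" using assms(2) w i by (simp add: order_ge_def)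
    then show ?thesis by simp
  qed
qed

lift_definition letter :: "'m \<Rightarrow> 'm word_series" is "\<lambda>i w. if w = [i] then 1 else 0" .

text \<open>The exponential of c times the letter i: it is supported on the powers of that letter,
  with the Taylor coefficients of a flow run for time c.\<close>

lift_definition word_exp :: "'m \<Rightarrow> real \<Rightarrow> 'm word_series" is
  "\<lambda>i c w. if w = replicate (length w) i then c ^ length w / fact (length w) else 0" .

text \<open>On a power of the letter i the Cauchy product is the binomial expansion of
  \<open>(c + - c) ^ n / fact n\<close>. Any other word has, for every cut, a part that is not a
  power of i.\<close>

lemma word_exp_inverse: "word_exp (i :: 'm) c * word_exp i (- c) = 1"
proof (rule word_series_eqI)
  fix w :: "'m list"
  let ?n = "length w"
  show "wcoeff (word_exp i c * word_exp i (- c)) w = wcoeff 1 w"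
  proof (cases "w = replicate ?n i")
    case True
    have "wcoeff (word_exp i c * word_exp i (- c)) w
        = (\<Sum>j\<le>?n. (c ^ j / fact j) * ((- c) ^ (?n - j) / fact (?n - j)))"
      unfolding times_word_series.rep_eq word_exp.rep_eq
    proof (rule sum.cong)
      fix j assume "j \<in> {..?n}"
      then have "take j w = replicate j i" "drop j w = replicate (?n - j) i"
        by (subst True, simp add: min_def)+
      then show "(if take j w = replicate (length (take j w)) i then c ^ length (take j w) / fact (length (take j w)) else 0)
         * (if drop j w = replicate (length (drop j w)) i then (- c) ^ length (drop j w) / fact (length (drop j w)) else 0)
         = (c ^ j / fact j) * ((- c) ^ (?n - j) / fact (?n - j))" by simp
    qed simp
    also have "\<dots> = (\<Sum>j\<le>?n. of_nat (?n choose j) * c ^ j * (- c) ^ (?n - j)) / fact ?n"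
      unfolding sum_divide_distrib by (rule sum.cong) (auto simp: binomial_fact)
    also have "\<dots> = (c + - c) ^ ?n / fact ?n"
      by (simp only: binomial_ring)
    also have "\<dots> = wcoeff 1 w"
      by (simp add: one_word_series.rep_eq power_0_left)
    finally show ?thesis .
  next
    case False
    have "\<not> (take j w = replicate (length (take j w)) i \<and> drop j w = replicate (length (drop j w)) i)" for j
    proof
      assume *: "take j w = replicate (length (take j w)) i \<and> drop j w = replicate (length (drop j w)) i"
      have "w = take j w @ drop j w" by simp
      also have "\<dots> = replicate (length (take j w) + length (drop j w)) i"
        using * by (metis replicate_add)
      finally show False using False by (metis length_replicate)
    qed
    then have "wcoeff (word_exp i c * word_exp i (- c)) w = 0"
      unfolding times_word_series.rep_eq word_exp.rep_eq by (intro sum.neutral) auto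
    moreover have "w \<noteq> []" using False by auto
    ultimately show ?thesis by (simp add: one_word_series.rep_eq)
  qed
qed

lemma word_exp_order: "order_ge 2 (word_exp (i :: 'm) 1 - 1 - letter i)"
  unfolding order_ge_def
proof (intro allI impI)
  fix w :: "'m list" assume "length w < 2"
  then consider "w = []" | j where "w = [j]"
    by (cases w; cases "tl w") auto
  then show "wcoeff (word_exp i 1 - 1 - letter i) w = 0"
    by cases (auto simp: wcoeff_simps word_exp.rep_eq letter.rep_eq)
qed

text \<open>A letter \<open>(i, c)\<close> of a program stands for the time-\<open>c\<close> flow of the \<open>i\<close>-th field. The first letter
  is run first, and so the series of a program acts on functions as an operator from the left.\<close>

type_synonym 'm program = "('m \<times> real) list"

text \<open>Exactly inverse on the level of series, but not for the controlled flows: the drift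
  cannot be run backwards, so undoing a program by its inverse leaves an error of order
  \<delta>.\<close>

definition inverse_program :: "'m program \<Rightarrow> 'm program" where
  "inverse_program W = rev (map (\<lambda>(i, c). (i, - c)) W)"

fun program_series :: "'m program \<Rightarrow> 'm word_series" where
  "program_series [] = 1"
| "program_series ((i, c) # W) = word_exp i c * program_series W"

lemma program_series_append: "program_series (W @ V) = program_series W * program_series V"
  by (induction W rule: program_series.induct) (auto simp: mult.assoc)

lemma program_series_inverse: "program_series W * program_series (inverse_program W) = 1"
proof (induction W rule: program_series.induct)
  case (2 i c W)
  have "program_series ((i, c) # W) * program_series (inverse_program ((i, c) # W))
      = word_exp i c * (program_series W * program_series (inverse_program W)) * word_exp i (- c)"
    by (simp add: inverse_program_def program_series_append mult.assoc)
  then show ?case using 2 by (simp add: word_exp_inverse)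
qed (simp add: inverse_program_def)

lemma inverse_program_inverse: "inverse_program (inverse_program W) = W"
  by (induction W) (auto simp: inverse_program_def)

lemma program_series_inverse': "program_series (inverse_program W) * program_series W = 1"
  using program_series_inverse[of "inverse_program W"] by (simp add: inverse_program_inverse)

text \<open>The group commutator of the program for the tail with the flow of the head. After the
  constant 1 its series starts with the corresponding ring commutator, so running it with times t
  displaces by t to the power of the length of the list.\<close>

fun bracket_program :: "'m list \<Rightarrow> 'm program" where
  "bracket_program [] = []"
| "bracket_program [j] = [(j, 1)]"
| "bracket_program (j # i # I) = bracket_program (i # I) @ [(j, 1)] @
     inverse_program (bracket_program (i # I)) @ inverse_program [(j, 1)]"

text \<open>The iterated commutator in which the head of the list is bracketed last and stands on
  the right, as the generators do in the step from one level of the flag to the next.\<close>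

fun bracket_polynomial :: "'m list \<Rightarrow> 'm word_series" where
  "bracket_polynomial [] = 0"
| "bracket_polynomial [j] = letter j"
| "bracket_polynomial (j # i # I) =
     bracket_polynomial (i # I) * letter j - letter j * bracket_polynomial (i # I)"

lemma bracket_polynomial_homogeneous:
  "length w \<noteq> length I \<Longrightarrow> wcoeff (bracket_polynomial I) w = 0"
proof (induction I arbitrary: w rule: bracket_polynomial.induct)
  case (3 j i I)
  have "wcoeff (bracket_polynomial (i # I)) (take k w) * wcoeff (letter j) (drop k w) = 0"
    if "k \<le> length w" for k
    using 3 that by (cases "drop k w = [j]") (auto simp: letter.rep_eq dest!: arg_cong[of "drop k w" _ length])
  moreover have "wcoeff (letter j) (take k w) * wcoeff (bracket_polynomial (i # I)) (drop k w) = 0"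
    if "k \<le> length w" for k
    using 3 that by (cases "take k w = [j]") (auto simp: letter.rep_eq dest!: arg_cong[of "take k w" _ length])
  ultimately have "wcoeff (bracket_polynomial (i # I) * letter j) w = 0"
    "wcoeff (letter j * bracket_polynomial (i # I)) w = 0"
    unfolding times_word_series.rep_eq by (auto intro!: sum.neutral)
  then show ?case by (simp add: wcoeff_simps)
qed (auto simp: wcoeff_simps letter.rep_eq)

lemma bracket_polynomial_order: "order_ge (length I) (bracket_polynomial I)"
  by (simp add: order_ge_def bracket_polynomial_homogeneous)

text \<open>From A' A = 1 follows A' - 1 + P = - (A - 1 - P) - (A' - 1) (A - 1), and the last
  product has order 2 n, which is at least n + 1.\<close>

lemma inverse_order:
  assumes "A' * A = 1" "order_ge (Suc n) (A - 1 - P)" "order_ge n P" "n \<ge> 1"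
  shows "order_ge (Suc n) (A' - 1 + P)"
proof -
  have a: "order_ge n (A - 1)"
    using order_ge_add[OF order_ge_mono[OF assms(2)] assms(3)] by simp
  have "A' - 1 = - (A' * (A - 1))"
    using assms(1) by (simp add: algebra_simps)
  then have a': "order_ge n (A' - 1)"
    using order_ge_minus[OF order_ge_mult[OF order_ge_0 a]] by simp
  have eq: "A' - 1 + P = - (A - 1 - P) - (A' - 1) * (A - 1)"
    using assms(1) by (simp add: algebra_simps)
  have "order_ge (Suc n) ((A' - 1) * (A - 1))"
    using order_ge_mult[OF a' a] order_ge_mono assms(4) by fastforce
  then show ?thesis
    unfolding eq using order_ge_diff order_ge_minus assms(2) by blast
qed

text \<open>\<open>A B A' B' - 1 = (A B - B A) A' B'\<close>, and the leading term of \<open>A B - B A\<close> is \<open>P Q - Q P\<close>.\<close>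

lemma commutator_order:
  assumes A: "A * A' = 1" "A' * A = 1" "order_ge (Suc n) (A - 1 - P)" "order_ge n P" "n \<ge> 1"
    and B: "B * B' = 1" "B' * B = 1" "order_ge (Suc m) (B - 1 - Q)" "order_ge m Q" "m \<ge> 1"
  shows "order_ge (Suc (n + m)) (A * B * A' * B' - 1 - (P * Q - Q * P))"
proof -
  let ?D = "A * B - B * A"
  have a: "order_ge n (A - 1)"
    using order_ge_add[OF order_ge_mono[OF A(3)] A(4)] by simp
  have b: "order_ge m (B - 1)"
    using order_ge_add[OF order_ge_mono[OF B(3)] B(4)] by simp
  have a': "order_ge 1 (A' - 1)"
  proof -
    have "A' - 1 = - (A' * (A - 1))" using A by (simp add: algebra_simps)
    then show ?thesis
      using order_ge_minus[OF order_ge_mult[OF order_ge_0 a]] A(5) order_ge_mono by fastforce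
  qed
  have b': "order_ge 1 (B' - 1)"
  proof -
    have "B' - 1 = - (B' * (B - 1))" using B by (simp add: algebra_simps)
    then show ?thesis
      using order_ge_minus[OF order_ge_mult[OF order_ge_0 b]] B(5) order_ge_mono by fastforce
  qed
  \<comment> \<open>Since A B - B A = (A - 1) (B - 1) - (B - 1) (A - 1), replacing one factor at a
    time by its leading term leaves products with exactly one error factor, of order n + m +
    1.\<close>
  have D: "?D - (P * Q - Q * P) =
      ((A - 1 - P) * (B - 1) + P * (B - 1 - Q)) - ((B - 1 - Q) * (A - 1) + Q * (A - 1 - P))"
    by (simp add: algebra_simps)
  have Dlow: "order_ge (Suc (n + m)) (?D - (P * Q - Q * P))"
    unfolding D
    using order_ge_mult[OF A(3) b] order_ge_mult[OF A(4) B(3)] order_ge_mult[OF B(3) a] order_ge_mult[OF B(4) A(3)]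
    by (intro order_ge_diff order_ge_add) (simp_all add: add.commute)
  have PQ: "order_ge (n + m) (P * Q - Q * P)"
    using order_ge_mult[OF A(4) B(4)] order_ge_mult[OF B(4) A(4)] by (intro order_ge_diff) (simp_all add: add.commute)
  have Dnm: "order_ge (n + m) ?D"
    using order_ge_add[OF order_ge_mono[OF Dlow] PQ] by simp
  have AB: "order_ge 1 (A' * B' - 1)"
  proof -
    have "A' * B' - 1 = (A' - 1) * B' + (B' - 1)" by (simp add: algebra_simps)
    then show ?thesis using order_ge_add[OF order_ge_mult[OF a' order_ge_0[of B'], unfolded add_0_right] b'] by (simp only:)
  qed
  have inv: "B * A * A' * B' = 1"
  proof -
    have "B * A * A' * B' = B * (A * A') * B'" by (simp only: mult.assoc)
    then show ?thesis using A(1) B(1) by simp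
  qed
  \<comment> \<open>A' B' differs from 1 in order at least 1, so this factor changes
    \<open>?D\<close> only beyond its leading degree.\<close>
  have "A * B * A' * B' - 1 = ?D * (A' * B')"
    using inv by (simp add: algebra_simps)
  also have "\<dots> = ?D + ?D * (A' * B' - 1)" by (simp add: algebra_simps)
  finally have eq: "A * B * A' * B' - 1 - (P * Q - Q * P)
      = (?D - (P * Q - Q * P)) + ?D * (A' * B' - 1)" by simp
  show ?thesis
    unfolding eq using order_ge_mult[OF Dnm AB] Dlow by (intro order_ge_add) simp_all
qed

text \<open>The passage from group commutators to ring commutators, one letter at a time; the base
  case is the linear term of the exponential.\<close>

lemma bracket_program_order:
  assumes "I \<noteq> []"
  shows "order_ge (Suc (length I)) (program_series (bracket_program I) - 1 - bracket_polynomial I)"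
  using assms
proof (induction I rule: bracket_program.induct)
  case (2 j)
  then show ?case using word_exp_order[of j] by (simp add: numeral_2_eq_2)
next
  case (3 j i I)
  have b: "order_ge (Suc 1) (program_series [(j, 1)] - 1 - letter j)"
    using word_exp_order[of j] by (simp add: numeral_2_eq_2)
  have l: "order_ge 1 (letter j)"
    by (simp add: order_ge_def letter.rep_eq)
  show ?case
    using commutator_order[OF program_series_inverse program_series_inverse' 3(1) bracket_polynomial_order _
        program_series_inverse program_series_inverse' b l]
    by (simp add: program_series_append mult.assoc)
qed simp

lemma inverse_bracket_program_order:
  assumes "I \<noteq> []"
  shows "order_ge (Suc (length I))
    (program_series (inverse_program (bracket_program I)) - 1 + bracket_polynomial I)"
  using inverse_order[OF program_series_inverse' bracket_program_order[OF assms] bracket_polynomial_order] assms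
  by (cases I) auto

lemma bracket_program_coeff: "(i, c) \<in> set (bracket_program I) \<Longrightarrow> \<bar>c\<bar> \<le> 1"
  by (induction I arbitrary: i c rule: bracket_program.induct) (auto simp: inverse_program_def)

lemma inverse_program_coeff:
  "(\<And>i c. (i, c) \<in> set W \<Longrightarrow> \<bar>c\<bar> \<le> 1) \<Longrightarrow> (i, c) \<in> set (inverse_program W) \<Longrightarrow> \<bar>c\<bar> \<le> 1"
  by (auto simp: inverse_program_def)

subsection \<open>Flows\<close>

lemma vector_derivative_bound:
  fixes g :: "real \<Rightarrow> 'a::real_normed_vector"
  assumes "\<And>t. t \<in> {a..b} \<Longrightarrow> (g has_vector_derivative D t) (at t within {a..b})"
    "\<And>t. t \<in> {a..b} \<Longrightarrow> norm (D t) \<le> c" "s \<in> {a..b}" "t \<in> {a..b}"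
  shows "norm (g t - g s) \<le> c * \<bar>t - s\<bar>"
proof -
  have "norm (g t - g s) \<le> c * norm (t - s)"
  proof (rule differentiable_bound[OF _ _ _ assms(4,3)])
    fix u assume u: "u \<in> {a..b}"
    show "(g has_derivative (\<lambda>h. h *\<^sub>R D u)) (at u within {a..b})"
      using assms(1)[OF u] by (simp add: has_vector_derivative_def)
    show "onorm (\<lambda>h. h *\<^sub>R D u) \<le> c"
      using assms(2)[OF u] by (intro onorm_le) (simp add: mult.commute[of "\<bar>_\<bar>"] mult_right_mono)
  qed simp
  then show ?thesis by simp
qed

text \<open>A Lipschitz constant below 1 makes the Picard operator on the unit interval a
  contraction for the supremum norm, so one application of Banach's theorem yields the whole
  solution.\<close>

lemma picard_solution:
  fixes F :: "'a::euclidean_space \<Rightarrow> 'a"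
  assumes F: "K-lipschitz_on UNIV F" and K: "K < 1"
  obtains y :: "real \<Rightarrow> 'a" where "y 0 = x"
    "\<And>t. t \<in> {0..1} \<Longrightarrow> (y has_vector_derivative F (y t)) (at t within {0..1})"
proof -
  have K0: "0 \<le> K" using F by (rule lipschitz_on_nonneg)
  have contF: "continuous_on A (\<lambda>s. F (h s))" if "continuous_on A h" for A and h :: "real \<Rightarrow> 'a"
    using continuous_on_compose2[OF lipschitz_on_continuous_on[OF F] that] by simp
  have conth: "continuous_on A (apply_bcontfun h)" for A and h :: "real \<Rightarrow>\<^sub>C 'a"
    by (rule continuous_on_apply_bcontfun)
  \<comment> \<open>Bounded continuous functions are defined on the whole line; \<open>clamp\<close>
    continues the integral constantly outside the unit interval.\<close>
  have "\<exists>g :: real \<Rightarrow>\<^sub>C 'a. \<forall>t. apply_bcontfun g t = x + integral {0..clamp 0 1 t} (\<lambda>s. F (h s))"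
    for h :: "real \<Rightarrow>\<^sub>C 'a"
  proof -
    have "continuous_on (cbox 0 1) (\<lambda>t. x + integral {0..t} (\<lambda>s. F (h s)))"
      unfolding cbox_interval
      by (intro continuous_on_add continuous_on_const indefinite_integral_continuous_1
          integrable_continuous_real contF conth)
    then obtain g :: "real \<Rightarrow>\<^sub>C 'a" where
      "\<And>t. apply_bcontfun g t = x + integral {0..clamp 0 1 t} (\<lambda>s. F (h s))"
      by (rule continuous_on_cbox_bcontfunE) (rule that, assumption)
    then show ?thesis by blast
  qed
  then have "\<forall>h :: real \<Rightarrow>\<^sub>C 'a. \<exists>g. \<forall>t. apply_bcontfun g t = x + integral {0..clamp 0 1 t} (\<lambda>s. F (h s))"
    by blast
  from choice[OF this] obtain P :: "(real \<Rightarrow>\<^sub>C 'a) \<Rightarrow> (real \<Rightarrow>\<^sub>C 'a)" where "\<forall>(h :: real \<Rightarrow>\<^sub>C 'a) t. apply_bcontfun (P h) t = x + integral {0..clamp 0 1 t} (\<lambda>s. F (h s))"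
    by (elim exE) (rule that, assumption)
  then have P: "apply_bcontfun (P h) t = x + integral {0..clamp 0 1 t} (\<lambda>s. F (h s))" for h :: "real \<Rightarrow>\<^sub>C 'a" and t
    by blast
  have cl: "clamp 0 1 t \<in> {0..1}" for t :: real
    using clamp_in_interval[of 0 1 t] by (simp add: cbox_interval)
  have "dist (P g) (P h) \<le> K * dist g h" for g h
  proof (rule dist_bound)
    fix t
    let ?c = "clamp 0 1 t :: real"
    have bd: "norm (F (g s) - F (h s)) \<le> K * dist g h" for s
    proof -
      have "dist (F (g s)) (F (h s)) \<le> K * dist (g s) (h s)"
        using F by (auto simp: lipschitz_on_def)
      also have "\<dots> \<le> K * dist g h" using K0 by (intro mult_left_mono dist_bounded)
      finally show ?thesis by (simp add: dist_norm)
    qed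
    have "dist (P g t) (P h t) = norm (integral {0..?c} (\<lambda>s. F (g s) - F (h s)))"
      by (subst integral_diff) (auto simp: P dist_norm intro!: integrable_continuous_real contF conth)
    also have "\<dots> \<le> K * dist g h * (?c - 0)"
      using cl[of t] by (intro integral_bound bd continuous_on_diff contF conth) auto
    also have "\<dots> \<le> K * dist g h * 1"
      using cl[of t] K0 by (intro mult_left_mono) auto
    finally show "dist (P g t) (P h t) \<le> K * dist g h" by simp
  qed
  then have "\<exists>!g. P g = g" by (intro banach_fix_type[OF K0 K]) auto
  then obtain g where g: "P g = g" by blast
  have gt: "apply_bcontfun g t = x + integral {0..t} (\<lambda>s. F (g s))" if "t \<in> {0..1}" for t
    using P[of g t] clamp_cancel_cbox[of t 0 1] that by (simp add: g cbox_interval)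
  show ?thesis
  proof
    show "apply_bcontfun g 0 = x" using gt[of 0] by simp
    fix t :: real assume t: "t \<in> {0..1}"
    have "((\<lambda>t. x + integral {0..t} (\<lambda>s. F (g s))) has_vector_derivative 0 + F (g t)) (at t within {0..1})"
      by (intro has_vector_derivative_add has_vector_derivative_const integral_has_vector_derivative contF conth t)
    then have "((\<lambda>t. x + integral {0..t} (\<lambda>s. F (g s))) has_vector_derivative F (g t)) (at t within {0..1})"
      by (simp only: add_0_left)
    then show "(apply_bcontfun g has_vector_derivative F (g t)) (at t within {0..1})"
      by (rule has_vector_derivative_transform[OF t, rotated]) (rule gt)
  qed
qed

text \<open>A substitute for Gronwall's inequality: at the time m of largest distance the Lipschitz
  term amounts to at most half of that distance, which is absorbed into the left side.\<close>

lemma solutions_dist: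
  fixes X :: "'a::real_normed_vector \<Rightarrow> 'a"
  assumes X: "L-lipschitz_on UNIV X" "\<And>x. norm (X x) \<le> B" and s2: "\<bar>s2\<bar> * L \<le> 1 / 2"
    and y1: "\<And>t. t \<in> {0..1} \<Longrightarrow> (y1 has_vector_derivative v + s1 *\<^sub>R X (y1 t)) (at t within {0..1})"
    and y2: "\<And>t. t \<in> {0..1} \<Longrightarrow> (y2 has_vector_derivative v + s2 *\<^sub>R X (y2 t)) (at t within {0..1})"
  shows "norm (y1 1 - y2 1) \<le> 2 * (norm (y1 0 - y2 0) + \<bar>s1 - s2\<bar> * B)"
proof -
  define d where "d t = y1 t - y2 t" for t
  have L0: "L \<ge> 0" using X(1) by (rule lipschitz_on_nonneg)
  have d': "(d has_vector_derivative (s1 - s2) *\<^sub>R X (y1 t) + s2 *\<^sub>R (X (y1 t) - X (y2 t))) (at t within {0..1})"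
    if "t \<in> {0..1}" for t
    unfolding d_def using has_vector_derivative_diff[OF y1[OF that] y2[OF that]]
    by (simp add: algebra_simps)
  then have "continuous_on {0..1} d"
    by (meson continuous_on_eq_continuous_within has_vector_derivative_continuous)
  then have "continuous_on {0..1} (\<lambda>t. norm (d t))" by (rule continuous_on_norm)
  then obtain m where m: "m \<in> {0..1}" "\<And>t. t \<in> {0..1} \<Longrightarrow> norm (d t) \<le> norm (d m)"
    using continuous_attains_sup[of "{0..1::real}" "\<lambda>t. norm (d t)"] by auto
  let ?M = "norm (d m)"
  have bd: "norm ((s1 - s2) *\<^sub>R X (y1 t) + s2 *\<^sub>R (X (y1 t) - X (y2 t))) \<le> \<bar>s1 - s2\<bar> * B + ?M / 2"
    if "t \<in> {0..1}" for t
  proof -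
    have "norm (X (y1 t) - X (y2 t)) \<le> L * norm (d t)"
      using lipschitz_onD[OF X(1)] by (auto simp: dist_norm d_def)
    also have "\<dots> \<le> L * ?M" using m(2)[OF that] L0 by (rule mult_left_mono)
    finally have "\<bar>s2\<bar> * norm (X (y1 t) - X (y2 t)) \<le> (\<bar>s2\<bar> * L) * ?M"
      by (simp add: mult.assoc mult_left_mono)
    also have "\<dots> \<le> (1 / 2) * ?M" using s2 by (intro mult_right_mono) auto
    finally have "\<bar>s2\<bar> * norm (X (y1 t) - X (y2 t)) \<le> ?M / 2" by simp
    moreover have "\<bar>s1 - s2\<bar> * norm (X (y1 t)) \<le> \<bar>s1 - s2\<bar> * B"
      using X(2) by (intro mult_left_mono) auto
    ultimately show ?thesis by (intro norm_triangle_le) simp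
  qed
  have B: "B \<ge> 0" using X(2) norm_ge_zero order_trans by blast
  have est: "norm (d t - d 0) \<le> \<bar>s1 - s2\<bar> * B + ?M / 2" if t: "t \<in> {0..1}" for t
  proof -
    have "norm (d t - d 0) \<le> (\<bar>s1 - s2\<bar> * B + ?M / 2) * \<bar>t - 0\<bar>"
      by (rule vector_derivative_bound[OF d' bd _ t]) auto
    also have "\<dots> \<le> (\<bar>s1 - s2\<bar> * B + ?M / 2) * 1"
      using t B by (intro mult_left_mono) auto
    finally show ?thesis by simp
  qed
  have "?M \<le> norm (d 0) + norm (d m - d 0)" using norm_triangle_sub[of "d m" "d 0"] by simp
  then have "?M \<le> 2 * (norm (d 0) + \<bar>s1 - s2\<bar> * B)" using est[OF m(1)] by simp
  then show ?thesis using m(2)[of 1] by (simp add: d_def)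
qed

text \<open>The fixed point argument needs the endpoint as a jointly continuous function of the
  parameter s and the initial point.\<close>

lemma parametrised_flow:
  fixes X :: "'a::euclidean_space \<Rightarrow> 'a"
  assumes X: "L-lipschitz_on UNIV X" "\<And>x. norm (X x) \<le> B" and s0: "s0 > 0" "s0 * L \<le> 1 / 2"
  obtains Y :: "real \<Rightarrow> 'a \<Rightarrow> real \<Rightarrow> 'a" where "\<And>s x. Y s x 0 = x"
    "\<And>s x t. \<bar>s\<bar> \<le> s0 \<Longrightarrow> t \<in> {0..1} \<Longrightarrow>
      (Y s x has_vector_derivative v + s *\<^sub>R X (Y s x t)) (at t within {0..1})"
    "continuous_on UNIV (\<lambda>(s, x). Y s x 1)"
proof -
  have L0: "L \<ge> 0" using X(1) by (rule lipschitz_on_nonneg)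
  have B: "B \<ge> 0" using X(2) norm_ge_zero order_trans by blast
  have sL: "\<bar>s\<bar> * L \<le> 1 / 2" if "\<bar>s\<bar> \<le> s0" for s
    using mult_right_mono[OF that L0] s0(2) by linarith
  have "\<exists>y. y 0 = x \<and> (\<forall>t\<in>{0..1}. (y has_vector_derivative v + s *\<^sub>R X (y t)) (at t within {0..1}))"
    if "\<bar>s\<bar> \<le> s0" for s and x :: 'a
  proof -
    have "(\<bar>s\<bar> * L)-lipschitz_on UNIV (\<lambda>x. v + s *\<^sub>R X x)"
    proof (rule lipschitz_onI)
      fix x y
      have "\<bar>s\<bar> * dist (X x) (X y) \<le> \<bar>s\<bar> * (L * dist x y)"
        using lipschitz_onD[OF X(1), of x y] by (intro mult_left_mono) auto
      then show "dist (v + s *\<^sub>R X x) (v + s *\<^sub>R X y) \<le> \<bar>s\<bar> * L * dist x y"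
        by (simp add: dist_norm scaleR_diff_right[symmetric] mult.assoc)
    qed (use L0 in simp)
    moreover have "\<bar>s\<bar> * L < 1" using sL[OF that] by linarith
    ultimately show ?thesis by (rule picard_solution[of _ _ x]) blast
  qed
  then have "\<forall>s x. \<exists>y. \<bar>s\<bar> \<le> s0 \<longrightarrow>
      y 0 = x \<and> (\<forall>t\<in>{0..1}. (y has_vector_derivative v + s *\<^sub>R X (y t)) (at t within {0..1}))"
    by blast
  then have "\<exists>Y0. \<forall>s x. \<bar>s\<bar> \<le> s0 \<longrightarrow>
      Y0 s x 0 = x \<and> (\<forall>t\<in>{0..1}. (Y0 s x has_vector_derivative v + s *\<^sub>R X (Y0 s x t)) (at t within {0..1}))"
    by (simp only: choice_iff)
  then obtain Y0 where Y0: "\<And>s x. \<bar>s\<bar> \<le> s0 \<Longrightarrow> Y0 s x 0 = x"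
    "\<And>s x t. \<bar>s\<bar> \<le> s0 \<Longrightarrow> t \<in> {0..1} \<Longrightarrow> (Y0 s x has_vector_derivative v + s *\<^sub>R X (Y0 s x t)) (at t within {0..1})"
    by blast
  \<comment> \<open>Truncating s to the admissible range makes the endpoint map continuous on the
    whole space without changing the flows for \<bar>s\<bar> \<le> s0.\<close>
  define c where "c s = max (- s0) (min s0 s)" for s
  have c: "\<bar>c s\<bar> \<le> s0" "\<bar>c s - c s'\<bar> \<le> \<bar>s - s'\<bar>" for s s'
    using s0 by (auto simp: c_def max_def min_def)
  have cs: "c s = s" if "\<bar>s\<bar> \<le> s0" for s
    using that by (auto simp: c_def max_def min_def)
  have lip: "(2 * (1 + B))-lipschitz_on UNIV (\<lambda>(s, x). Y0 (c s) x 1)"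
  proof (rule lipschitz_onI)
    fix p p' :: "real \<times> 'a"
    obtain s x s' x' where p: "p = (s, x)" "p' = (s', x')" by (cases p, cases p')
    have "norm (Y0 (c s) x 1 - Y0 (c s') x' 1) \<le> 2 * (norm (x - x') + \<bar>c s - c s'\<bar> * B)"
      using solutions_dist[OF X sL[OF c(1)] Y0(2)[OF c(1)] Y0(2)[OF c(1)]] Y0(1)[OF c(1)] by metis
    also have "\<dots> \<le> 2 * (dist p p' + dist p p' * B)"
    proof -
      have "norm (x - x') \<le> dist p p'"
        using dist_snd_le[of p p'] by (simp add: p dist_norm)
      moreover have "\<bar>c s - c s'\<bar> \<le> dist p p'"
        using dist_fst_le[of p p'] c(2)[of s s'] by (simp add: p dist_norm)
      ultimately show ?thesis using B by (intro mult_left_mono add_mono mult_right_mono) auto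
    qed
    finally show "dist (case p of (s, x) \<Rightarrow> Y0 (c s) x 1) (case p' of (s, x) \<Rightarrow> Y0 (c s) x 1) \<le> 2 * (1 + B) * dist p p'"
      by (simp add: p dist_norm algebra_simps)
  qed (use B in simp)
  show ?thesis
  proof (rule that[of "\<lambda>s. Y0 (c s)"])
    show "continuous_on UNIV (\<lambda>(s, x). Y0 (c s) x 1)"
      using lip by (rule lipschitz_on_continuous_on)
  qed (use Y0 c cs in auto)
qed

section \<open>Absolutely continuous functions\<close>

text \<open>A mean value inequality that asks neither for measurability of the derivative nor for
  differentiability on N. In a fine tagged division, intervals with tag outside N are handled by the
  derivative at the tag; those with tag in N lie in an open set of small measure and are handled by
  absolute continuity.\<close>

lemma abs_continuous_norm_bound:
  fixes g :: "real \<Rightarrow> 'b::real_normed_vector"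
  assumes ab: "a \<le> b" and AC: "abs_continuous_on_ivl a b g"
    and w: "w integrable_on {a..b}" and N: "negligible N"
    and g': "\<And>t. t \<in> {a..b} - N \<Longrightarrow> \<exists>D. (g has_vector_derivative D) (at t within {a..b}) \<and> norm D \<le> w t"
  shows "norm (g b - g a) \<le> integral {a..b} w"
proof (rule field_le_epsilon)
  fix e :: real assume e: "e > 0"
  \<comment> \<open>One share of \<eta> is spent on the Riemann sum of w, one per unit of length on
    the difference quotients, and one on the intervals tagged in N.\<close>
  define \<eta> where "\<eta> = e / (b - a + 2)"
  have \<eta>: "\<eta> > 0" using e ab by (simp add: \<eta>_def)
  \<comment> \<open>The sign of w on N is unknown; with the value 0 there, the intervals tagged in N
    may be added back to the Riemann sum without decreasing it.\<close>
  define w' where "w' t = (if t \<in> N then 0 else w t)" for t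
  have hw: "(w' has_integral integral {a..b} w) {a..b}"
    by (rule has_integral_spike[OF N _ integrable_integral[OF w]]) (simp add: w'_def)
  have "\<exists>\<gamma>. gauge \<gamma> \<and> (\<forall>p. p tagged_division_of {a..b} \<and> \<gamma> fine p \<longrightarrow>
       norm ((\<Sum>(x, K)\<in>p. measure lborel K *\<^sub>R w' x) - integral {a..b} w) < \<eta>)"
    using hw \<eta> unfolding has_integral_real by simp
  then obtain \<gamma>1 where \<gamma>1: "gauge \<gamma>1"
    and sums: "\<forall>p. p tagged_division_of {a..b} \<and> \<gamma>1 fine p \<longrightarrow>
       norm ((\<Sum>(x, K)\<in>p. measure lborel K *\<^sub>R w' x) - integral {a..b} w) < \<eta>"
    by (elim exE conjE)
  have "\<exists>\<delta>>0. \<forall>D. finite D \<and> (\<forall>(x, y)\<in>D. a \<le> x \<and> x \<le> y \<and> y \<le> b) \<and>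
      disjoint_family_on (\<lambda>(x, y). {x<..<y}) D \<and> (\<Sum>(x, y)\<in>D. y - x) < \<delta> \<longrightarrow>
      (\<Sum>(x, y)\<in>D. norm (g y - g x)) < \<eta>"
    using AC \<eta> unfolding abs_continuous_on_ivl_def by simp
  then obtain \<delta> where \<delta>: "\<delta> > 0"
    and AC\<delta>: "\<forall>D. finite D \<and> (\<forall>(x, y)\<in>D. a \<le> x \<and> x \<le> y \<and> y \<le> b) \<and>
      disjoint_family_on (\<lambda>(x, y). {x<..<y}) D \<and> (\<Sum>(x, y)\<in>D. y - x) < \<delta> \<longrightarrow>
      (\<Sum>(x, y)\<in>D. norm (g y - g x)) < \<eta>"
    by (elim exE conjE)
  have Nm: "N \<in> lmeasurable" "measure lebesgue N = 0"
    using N by (auto simp: negligible_iff_null_sets null_sets_def fmeasurable_def measure_def)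
  \<comment> \<open>Outer regularity: the null set is covered by an open set whose measure is below
    the threshold of absolute continuity.\<close>
  obtain Q where Q': "open Q" "N \<subseteq> Q" "Q - N \<in> lmeasurable" "emeasure lebesgue (Q - N) < ennreal \<delta>"
    using sets_lebesgue_outer_open[OF fmeasurableD[OF Nm(1)] \<delta>] by blast
  have Q: "open Q" "N \<subseteq> Q" "Q \<in> lmeasurable" "measure lebesgue Q < \<delta>"
  proof -
    have "Q = (Q - N) \<union> N" using Q'(2) by auto
    then show "Q \<in> lmeasurable" using fmeasurable.Un[OF Q'(3) Nm(1)] by simp
    have "measure lebesgue Q = measure lebesgue (Q - N)"
      using measure_Un_null_set[of "Q - N" lebesgue N] Q' N \<open>Q = (Q - N) \<union> N\<close>
      by (simp add: negligible_iff_null_sets fmeasurableD)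
    also have "\<dots> < \<delta>"
      using Q'(3,4) \<delta> by (simp add: emeasure_eq_measure2 ennreal_less_iff)
    finally show "measure lebesgue Q < \<delta>" .
  qed (use Q' in auto)
  have "\<exists>d>0. (x \<in> N \<longrightarrow> ball x d \<subseteq> Q) \<and>
     (x \<in> {a..b} - N \<longrightarrow> (\<forall>y\<in>{a..b}. \<bar>y - x\<bar> < d \<longrightarrow> norm (g y - g x) \<le> (w x + \<eta>) * \<bar>y - x\<bar>))" for x
  proof (cases "x \<in> N")
    case True
    then show ?thesis using Q(1,2) open_contains_ball by blast
  next
    case xN: False
    show ?thesis
    proof (cases "x \<in> {a..b}")
      case True
      then obtain D where D: "(g has_vector_derivative D) (at x within {a..b})" "norm D \<le> w x"
        using g'[of x] xN by auto
      then obtain d where d: "d > 0" "\<And>y. y \<in> {a..b} \<Longrightarrow> norm (y - x) < d \<Longrightarrow>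
          norm (g y - g x - (y - x) *\<^sub>R D) \<le> \<eta> * norm (y - x)"
        using \<eta> unfolding has_vector_derivative_def has_derivative_within_alt by metis
      have "norm (g y - g x) \<le> (w x + \<eta>) * \<bar>y - x\<bar>" if "y \<in> {a..b}" "\<bar>y - x\<bar> < d" for y
      proof -
        have "norm (g y - g x) \<le> norm (g y - g x - (y - x) *\<^sub>R D) + norm ((y - x) *\<^sub>R D)"
          using norm_triangle_ineq[of "g y - g x - (y - x) *\<^sub>R D" "(y - x) *\<^sub>R D"] by simp
        also have "\<dots> \<le> \<eta> * \<bar>y - x\<bar> + \<bar>y - x\<bar> * w x"
          using d(2)[of y] that D(2) by (intro add_mono) (auto intro: mult_left_mono)
        finally show ?thesis by (simp add: algebra_simps)
      qed
      then show ?thesis using d(1) xN by blast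
    qed (use xN in \<open>auto intro: exI[of _ 1]\<close>)
  qed
  then obtain d where d: "\<And>x. d x > 0" "\<And>x. x \<in> N \<Longrightarrow> ball x (d x) \<subseteq> Q"
    "\<And>x y. x \<in> {a..b} - N \<Longrightarrow> y \<in> {a..b} \<Longrightarrow> \<bar>y - x\<bar> < d x \<Longrightarrow> norm (g y - g x) \<le> (w x + \<eta>) * \<bar>y - x\<bar>"
    by metis
  have "gauge (\<lambda>x. \<gamma>1 x \<inter> ball x (d x))"
    using \<gamma>1 d(1) by (intro gauge_Int gauge_ball_dependent) auto
  then obtain p where p: "p tagged_division_of {a..b}" "(\<lambda>x. \<gamma>1 x \<inter> ball x (d x)) fine p"
    using fine_division_exists_real by blast
  have fin: "finite p" using p(1) by auto
  have pK: "K \<noteq> {} \<and> (\<exists>u v. u \<le> v \<and> K = {u..v} \<and> a \<le> u \<and> v \<le> b \<and> u \<le> x \<and> x \<le> v) \<and> K \<subseteq> ball x (d x)"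
    if xK: "(x, K) \<in> p" for x K
  proof -
    obtain u v where K: "K = cbox u v" using tagged_division_ofD(4)[OF p(1) xK] by blast
    have "x \<in> K" "K \<subseteq> {a..b}" using tagged_division_ofD(2,3)[OF p(1) xK] by auto
    moreover have "K \<subseteq> ball x (d x)" using p(2) xK unfolding fine_def by blast
    ultimately show ?thesis unfolding K cbox_interval by fastforce
  qed
  let ?\<Delta> = "\<lambda>(x::real, K). norm (g (Sup K) - g (Inf K))"
  \<comment> \<open>In \<open>?p3\<close> degenerate intervals, which contribute nothing, are
    dropped: an interval with nonempty interior occurs only once, so these tagged intervals can be
    counted by their endpoints.\<close>
  let ?p1 = "{(x, K)\<in>p. x \<notin> N}" and ?p2 = "{(x, K)\<in>p. x \<in> N}" and ?p3 = "{(x, K)\<in>p. x \<in> N \<and> Inf K < Sup K}"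
  have sub: "?p1 \<subseteq> p" "?p3 \<subseteq> p" "?p3 \<subseteq> ?p2" "?p2 \<subseteq> p" by auto
  have "norm (g b - g a) = norm (\<Sum>(x, K)\<in>p. g (Sup K) - g (Inf K))"
    using additive_tagged_division_1[OF ab p(1), of g] by simp
  also have "\<dots> \<le> sum ?\<Delta> p" by (rule sum_norm_le) auto
  also have "\<dots> = sum ?\<Delta> ?p1 + sum ?\<Delta> ?p2"
    using fin sub by (subst sum.union_disjoint[symmetric]) (auto intro!: sum.cong finite_subset[OF _ fin])
  also have "sum ?\<Delta> ?p2 = sum ?\<Delta> ?p3"
  proof (rule sum.mono_neutral_right)
    show "finite ?p2" using fin sub finite_subset by blast
    show "\<forall>i\<in>?p2 - ?p3. ?\<Delta> i = 0"
    proof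
      fix i assume i: "i \<in> ?p2 - ?p3"
      obtain x K where xK: "i = (x, K)" by (cases i)
      then have "(x, K) \<in> p" "\<not> Inf K < Sup K" using i by auto
      then show "?\<Delta> i = 0" using pK[of x K] xK by auto
    qed
  qed auto
  also have "sum ?\<Delta> ?p1 \<le> integral {a..b} w + \<eta> + \<eta> * (b - a)"
  proof -
    have "sum ?\<Delta> ?p1 \<le> (\<Sum>(x, K)\<in>?p1. measure lborel K *\<^sub>R w' x + \<eta> * measure lborel K)"
    proof (rule sum_mono, clarify)
      fix x K assume xK: "(x, K) \<in> p" "x \<notin> N"
      obtain u v where K: "u \<le> v" "K = {u..v}" "a \<le> u" "v \<le> b" "u \<le> x" "x \<le> v" "K \<subseteq> ball x (d x)"
        using pK[OF xK(1)] by auto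
      \<comment> \<open>The derivative controls increments from the tag x only, so the interval is
        split at its tag.\<close>
      have "\<bar>v - x\<bar> < d x" "\<bar>u - x\<bar> < d x"
        using K(1,7) unfolding K(2) by (auto simp: dist_real_def subset_iff)
      then have "norm (g v - g x) \<le> (w x + \<eta>) * \<bar>v - x\<bar>" "norm (g u - g x) \<le> (w x + \<eta>) * \<bar>u - x\<bar>"
        using d(3)[of x v] d(3)[of x u] xK(2) K by auto
      then have "norm (g v - g u) \<le> (w x + \<eta>) * (v - x) + (w x + \<eta>) * (x - u)"
        using norm_triangle_ineq4[of "g v - g x" "g u - g x"] K by simp
      also have "\<dots> = measure lborel K *\<^sub>R w' x + \<eta> * measure lborel K"
        using K xK(2) by (simp add: w'_def algebra_simps)
      finally show "norm (g (Sup K) - g (Inf K)) \<le> measure lborel K *\<^sub>R w' x + \<eta> * measure lborel K"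
        using K by simp
    qed
    also have "\<dots> \<le> (\<Sum>(x, K)\<in>p. measure lborel K *\<^sub>R w' x + \<eta> * measure lborel K)"
    proof (rule sum_mono2[OF fin sub(1)])
      fix i assume "i \<in> p - ?p1"
      then show "0 \<le> (case i of (x, K) \<Rightarrow> measure lborel K *\<^sub>R w' x + \<eta> * measure lborel K)"
        using \<eta> by (auto simp: w'_def)
    qed
    also have "\<dots> = (\<Sum>(x, K)\<in>p. measure lborel K *\<^sub>R w' x) + \<eta> * (\<Sum>(x, K)\<in>p. measure lborel K)"
      by (simp add: split_beta sum.distrib sum_distrib_left)
    also have "(\<Sum>(x, K)\<in>p. measure lborel K) = b - a"
      using additive_content_tagged_division[of p a b] p(1) ab by (simp add: cbox_interval)
    also have "(\<Sum>(x, K)\<in>p. measure lborel K *\<^sub>R w' x) \<le> integral {a..b} w + \<eta>"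
    proof -
      have "\<gamma>1 fine p" using p(2) unfolding fine_def by blast
      then have "norm ((\<Sum>(x, K)\<in>p. measure lborel K *\<^sub>R w' x) - integral {a..b} w) < \<eta>"
        using sums p(1) by simp
      then show ?thesis by (simp add: abs_if split: if_splits)
    qed
    finally show ?thesis by simp
  qed
  also have "sum ?\<Delta> ?p3 \<le> \<eta>"
  proof -
    let ?f = "\<lambda>(x::real, K). (Inf K, Sup K) :: real \<times> real"
    have fin3: "finite ?p3" using fin sub finite_subset by blast
    have disj: "interior K \<inter> interior K' = {}" if "(x, K) \<in> ?p3" "(x', K') \<in> ?p3" "(x, K) \<noteq> (x', K')" for x K x' K'
      using tagged_division_ofD(5)[OF p(1), of x K x' K'] that by auto
    have rep: "K = {Inf K..Sup K} \<and> Inf K < Sup K \<and> a \<le> Inf K \<and> Sup K \<le> b \<and> interior K = {Inf K<..<Sup K}" if "(x, K) \<in> ?p3" for x K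
      using pK[of x K] that by (auto simp: interior_atLeastAtMost_real)
    have inj: "inj_on ?f ?p3"
    proof (rule inj_onI, clarify)
      fix x K x' K' assume h: "(x, K) \<in> p" "x \<in> N" "Inf K < Sup K" "(x', K') \<in> p" "x' \<in> N" "Inf K' < Sup K'"
        "Inf K = Inf K'" "Sup K = Sup K'"
      then have m: "(x, K) \<in> ?p3" "(x', K') \<in> ?p3" by auto
      then have "K = K'" using rep[OF m(1)] rep[OF m(2)] h by metis
      then show "x = x' \<and> K = K'"
        using disj[OF m] rep[OF m(1)] h(3) greaterThanLessThan_empty_iff by (metis Int_absorb not_le prod.inject)
    qed
    have injs: "inj_on snd ?p3"
    proof (rule inj_onI)
      fix i j assume m: "i \<in> ?p3" "j \<in> ?p3" "snd i = snd j"
      then have "?f i = ?f j" by (simp add: split_beta)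
      then show "i = j" using inj_onD[OF inj _ m(1,2)] by simp
    qed
    have "(\<Sum>(x, y)\<in>?f ` ?p3. norm (g y - g x)) < \<eta>"
    proof (rule AC\<delta>[rule_format], intro conjI)
      show "\<forall>(x, y)\<in>?f ` ?p3. a \<le> x \<and> x \<le> y \<and> y \<le> b"
        using rep by fastforce
      show "disjoint_family_on (\<lambda>(x, y). {x<..<y}) (?f ` ?p3)"
        unfolding disjoint_family_on_def
      proof (intro ballI impI)
        fix i j assume "i \<in> ?f ` ?p3" "j \<in> ?f ` ?p3" "i \<noteq> j"
        then obtain x K x' K' where m: "(x, K) \<in> ?p3" "i = (Inf K, Sup K)" "(x', K') \<in> ?p3" "j = (Inf K', Sup K')"
          by auto
        then have "(x, K) \<noteq> (x', K')" using \<open>i \<noteq> j\<close> by auto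
        then show "(case i of (x, y) \<Rightarrow> {x<..<y}) \<inter> (case j of (x, y) \<Rightarrow> {x<..<y}) = {}"
          using disj[OF m(1,3)] rep[OF m(1)] rep[OF m(3)] m(2,4) by auto
      qed
      have "(\<Sum>(x, y)\<in>?f ` ?p3. y - x) = (\<Sum>i\<in>?p3. measure lebesgue (snd i))"
        unfolding sum.reindex[OF inj] o_def
      proof (rule sum.cong)
        fix i assume "i \<in> ?p3"
        then obtain x K where i: "i = (x, K)" "(x, K) \<in> ?p3" by auto
        obtain u v where uv: "u \<le> v" "K = {u..v}" using pK[of x K] i by auto
        show "(case ?f i of (x, y) \<Rightarrow> y - x) = measure lebesgue (snd i)" unfolding i(1) using uv by (simp add: measure_completion)
      qed simp
      also have "\<dots> = sum (measure lebesgue) (snd ` ?p3)"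
        by (simp add: sum.reindex[OF injs])
      also have "\<dots> = measure lebesgue (\<Union> (snd ` ?p3))"
      proof -
        have "?p3 tagged_partial_division_of {a..b}"
          using p(1) sub(2) unfolding tagged_division_of_def by (blast intro: tagged_partial_division_subset)
        from content_division[OF partial_division_of_tagged_division[OF this]] show ?thesis by simp
      qed
      also have "\<dots> \<le> measure lebesgue Q"
      proof (rule measure_mono_fmeasurable[OF _ _ Q(3)])
        show "\<Union> (snd ` ?p3) \<subseteq> Q" using pK d(2) by fastforce
        show "\<Union> (snd ` ?p3) \<in> sets lebesgue"
        proof (rule sets.finite_Union)
          show "snd ` ?p3 \<subseteq> sets lebesgue"
          proof clarify
            fix x K assume "(x, K) \<in> p"
            then obtain u v where "K = {u..v}" using pK by blast
            then show "snd (x, K) \<in> sets lebesgue" by simp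
          qed
        qed (use fin3 in simp)
      qed
      also have "\<dots> < \<delta>" by (rule Q(4))
      finally show "(\<Sum>(x, y)\<in>?f ` ?p3. y - x) < \<delta>" .
    qed (use fin3 in simp)
    then show ?thesis unfolding sum.reindex[OF inj] o_def by (simp add: split_beta)
  qed
  finally have "norm (g b - g a) \<le> integral {a..b} w + \<eta> * (b - a + 2)"
    by (simp add: algebra_simps)
  then show "norm (g b - g a) \<le> integral {a..b} w + e"
    using ab by (simp add: \<eta>_def)
qed

lemma abs_continuous_on_ivl_lipschitz_compose:
  assumes AC: "abs_continuous_on_ivl s t g" and h: "B-lipschitz_on K h" and gK: "g ` {s..t} \<subseteq> K"
  shows "abs_continuous_on_ivl s t (\<lambda>x. h (g x))"
  unfolding abs_continuous_on_ivl_def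
proof (intro allI impI)
  fix e :: real assume e: "e > 0"
  have B: "B \<ge> 0" using h by (rule lipschitz_on_nonneg)
  have "e / (B + 1) > 0" using e B by simp
  then obtain \<delta> where \<delta>: "\<delta> > 0" "\<And>D. finite D \<and> (\<forall>(x, y)\<in>D. s \<le> x \<and> x \<le> y \<and> y \<le> t) \<and>
     disjoint_family_on (\<lambda>(x, y). {x<..<y}) D \<and> (\<Sum>(x, y)\<in>D. y - x) < \<delta> \<Longrightarrow>
     (\<Sum>(x, y)\<in>D. norm (g y - g x)) < e / (B + 1)"
    using AC unfolding abs_continuous_on_ivl_def by blast
  show "\<exists>\<delta>>0. \<forall>D. finite D \<and> (\<forall>(x, y)\<in>D. s \<le> x \<and> x \<le> y \<and> y \<le> t) \<and>
     disjoint_family_on (\<lambda>(x, y). {x<..<y}) D \<and> (\<Sum>(x, y)\<in>D. y - x) < \<delta> \<longrightarrow>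
     (\<Sum>(x, y)\<in>D. norm (h (g y) - h (g x))) < e"
  proof (intro exI[of _ \<delta>] conjI allI impI)
    fix D assume D: "finite D \<and> (\<forall>(x, y)\<in>D. s \<le> x \<and> x \<le> y \<and> y \<le> t) \<and>
     disjoint_family_on (\<lambda>(x, y). {x<..<y}) D \<and> (\<Sum>(x, y)\<in>D. y - x) < \<delta>"
    have "(\<Sum>(x, y)\<in>D. norm (h (g y) - h (g x))) \<le> (\<Sum>(x, y)\<in>D. (B + 1) * norm (g y - g x))"
    proof (rule sum_mono, clarify)
      fix x y assume "(x, y) \<in> D"
      then have "s \<le> x" "x \<le> y" "y \<le> t" using D by auto
      then have "g x \<in> K" "g y \<in> K" using gK by auto
      then have "norm (h (g y) - h (g x)) \<le> B * norm (g y - g x)"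
        using h by (auto simp: lipschitz_on_def dist_norm)
      then show "norm (h (g y) - h (g x)) \<le> (B + 1) * norm (g y - g x)"
        by (smt (verit) mult_right_mono norm_ge_zero)
    qed
    also have "\<dots> = (B + 1) * (\<Sum>(x, y)\<in>D. norm (g y - g x))"
      by (simp add: sum_distrib_left split_beta)
    also have "\<dots> < (B + 1) * (e / (B + 1))"
      using \<delta>(2)[OF D] B by (intro mult_strict_left_mono) auto
    also have "\<dots> = e" using B by simp
    finally show "(\<Sum>(x, y)\<in>D. norm (h (g y) - h (g x))) < e" .
  qed (rule \<delta>(1))
qed

text \<open>In a family of total length below d every single interval is shorter than d, so a
  Lipschitz bound at small scale suffices.\<close>

lemma abs_continuous_on_ivl_locally_lipschitz:
  assumes d: "d > 0" and B: "B \<ge> 0"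
    and g: "\<And>x y. s \<le> x \<Longrightarrow> x \<le> y \<Longrightarrow> y \<le> t \<Longrightarrow> y - x < d \<Longrightarrow> norm (g y - g x) \<le> B * (y - x)"
  shows "abs_continuous_on_ivl s t g"
  unfolding abs_continuous_on_ivl_def
proof (intro allI impI)
  fix e :: real assume e: "e > 0"
  show "\<exists>\<delta>>0. \<forall>D. finite D \<and> (\<forall>(x, y)\<in>D. s \<le> x \<and> x \<le> y \<and> y \<le> t) \<and>
     disjoint_family_on (\<lambda>(x, y). {x<..<y}) D \<and> (\<Sum>(x, y)\<in>D. y - x) < \<delta> \<longrightarrow>
     (\<Sum>(x, y)\<in>D. norm (g y - g x)) < e"
  proof (intro exI[of _ "min d (e / (B + 1))"] conjI allI impI)
    show "min d (e / (B + 1)) > 0" using e d B by simp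
  next
    fix D assume D: "finite D \<and> (\<forall>(x, y)\<in>D. s \<le> x \<and> x \<le> y \<and> y \<le> t) \<and>
     disjoint_family_on (\<lambda>(x, y). {x<..<y}) D \<and> (\<Sum>(x, y)\<in>D. y - x) < min d (e / (B + 1))"
    have le: "y - x \<le> (\<Sum>(x, y)\<in>D. y - x)" if "(x, y) \<in> D" for x y
      using member_le_sum[OF that, of "\<lambda>(x, y). y - x"] D by fastforce
    have "(\<Sum>(x, y)\<in>D. norm (g y - g x)) \<le> (\<Sum>(x, y)\<in>D. B * (y - x))"
    proof (rule sum_mono, clarify)
      fix x y assume xy: "(x, y) \<in> D"
      then have "s \<le> x" "x \<le> y" "y \<le> t" using D by auto
      moreover have "y - x < d" using le[OF xy] D by linarith
      ultimately show "norm (g y - g x) \<le> B * (y - x)" by (rule g)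
    qed
    also have "\<dots> = B * (\<Sum>(x, y)\<in>D. y - x)"
      by (simp add: sum_distrib_left split_beta)
    also have "\<dots> \<le> B * (e / (B + 1))"
      using D B by (intro mult_left_mono) auto
    also have "\<dots> < e" using B e by (simp add: field_simps)
    finally show "(\<Sum>(x, y)\<in>D. norm (g y - g x)) < e" .
  qed
qed

subsection \<open>Expansion of endpoints along concatenations of flows\<close>

text \<open>\<open>t \<mapsto> Y \<delta> i s x t\<close> is the integral curve of \<open>\<delta> e + s X\<^sub>i\<close> from \<open>x\<close>. After rescaling time it is
  an admissible curve of duration \<open>\<delta>\<close> and cost \<open>\<bar>s\<bar>\<close>. All bounds are uniform as \<open>\<delta>\<close> tends to 0, where
  the drift disappears.\<close>

locale local_system =
  fixes \<Omega> :: "(real ^ 'n) set" and X :: "'m::finite \<Rightarrow> real ^ 'n \<Rightarrow> real ^ 'n" and e :: "real ^ 'n"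
    and R B s0 :: real and Y :: "real \<Rightarrow> 'm \<Rightarrow> real \<Rightarrow> real ^ 'n \<Rightarrow> real \<Rightarrow> real ^ 'n"
  assumes open_\<Omega>: "open \<Omega>" and smooth_X: "smooth_on \<Omega> (X i)"
    and R: "R > 0" and R_\<Omega>: "cball 0 R \<subseteq> \<Omega>"
    and B: "B > 0" and s0: "0 < s0" "s0 \<le> 1"
    and e: "norm e \<le> 1"
    and Y_start: "Y \<delta> i s x 0 = x"
    and Y_deriv: "\<bar>s\<bar> \<le> s0 \<Longrightarrow> 0 \<le> \<delta> \<Longrightarrow> norm x + (B * \<bar>s\<bar> + \<delta>) \<le> R \<Longrightarrow> t \<in> {0..1} \<Longrightarrow>
      (Y \<delta> i s x has_vector_derivative \<delta> *\<^sub>R e + s *\<^sub>R X i (Y \<delta> i s x t)) (at t within {0..1})"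
    and Y_dist: "\<bar>s\<bar> \<le> s0 \<Longrightarrow> 0 \<le> \<delta> \<Longrightarrow> norm x + (B * \<bar>s\<bar> + \<delta>) \<le> R \<Longrightarrow> t \<in> {0..1} \<Longrightarrow>
      norm (Y \<delta> i s x t - x) \<le> B * \<bar>s\<bar> + \<delta>"
    and Y_cont: "continuous_on UNIV (\<lambda>(s, x). Y \<delta> i s x 1)"

text \<open>The fields are composed with the nearest point projection onto a ball, which makes them
  bounded and Lipschitz on the whole space. Solutions that start at distance at least
  \<open>B * \<bar>s\<bar> + \<delta>\<close> from the boundary stay in the ball, where the
  projection is the identity.\<close>

lemma local_system_exists:
  fixes X :: "'m::finite \<Rightarrow> real ^ 'n \<Rightarrow> real ^ 'n"
  assumes "open \<Omega>" "0 \<in> \<Omega>" "\<And>i. smooth_on \<Omega> (X i)" "norm e \<le> 1"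
  obtains R B s0 Y where "local_system \<Omega> X e R B s0 Y"
proof -
  obtain R where R: "R > 0" "cball 0 R \<subseteq> \<Omega>"
    using assms(1,2) open_contains_cball by blast
  have "\<exists>K>0. K-lipschitz_on (cball 0 R) (X i) \<and> (\<forall>x\<in>cball 0 R. norm (X i x) \<le> K)" for i
  proof -
    obtain L where L: "L > 0" "L-lipschitz_on (cball 0 R) (X i)"
      by (rule smooth_on_lipschitz[OF assms(3)[of i] compact_cball R(2) convex_cball])
    obtain C where C: "C > 0" "\<And>x. x \<in> cball 0 R \<Longrightarrow> norm (X i x) \<le> C"
      by (rule smooth_on_bounded_compact[OF assms(3)[of i] compact_cball R(2)]) blast
    have "\<forall>x\<in>cball 0 R. norm (X i x) \<le> L + C"
      using C L(1) by (smt (verit))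
    moreover have "(L + C)-lipschitz_on (cball 0 R) (X i)"
      using L(2) C(1) by (auto intro: lipschitz_on_le)
    ultimately show ?thesis using L(1) C(1) by (intro exI[of _ "L + C"]) auto
  qed
  then have "\<forall>i. \<exists>K>0. K-lipschitz_on (cball 0 R) (X i) \<and> (\<forall>x\<in>cball 0 R. norm (X i x) \<le> K)" by blast
  from choice[OF this] obtain K where K: "\<And>i. K i > 0" "\<And>i. (K i)-lipschitz_on (cball 0 R) (X i)"
    "\<And>i x. x \<in> cball 0 R \<Longrightarrow> norm (X i x) \<le> K i" by blast
  define B where "B = (\<Sum>i\<in>UNIV. K i)"
  have KB: "K i \<le> B" for i
    unfolding B_def using K(1) by (intro member_le_sum) (auto intro: less_imp_le)
  have B: "B > 0" using K(1)[of undefined] KB[of undefined] by linarith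
  \<comment> \<open>The second bound gives \<open>s0 * B \<le> 1 / 2\<close>, as
    \<open>parametrised_flow\<close> demands; \<open>s0 \<le> 1\<close> makes powers of
    \<bar>s\<bar> decrease in the exponent.\<close>
  define s0 where "s0 = min 1 (1 / (2 * B))"
  have s0: "0 < s0" "s0 \<le> 1" using B by (auto simp: s0_def)
  have "s0 * B \<le> 1 / (2 * B) * B" unfolding s0_def using B by (intro mult_right_mono) auto
  then have s0B: "s0 * B \<le> 1 / 2" using B by simp
  define c where "c = closest_point (cball (0 :: real ^ 'n) R)"
  have c_in: "c x \<in> cball 0 R" for x
    unfolding c_def using R(1) by (intro closest_point_in_set) auto
  have c_self: "c x = x" if "x \<in> cball 0 R" for x
    unfolding c_def using that by (rule closest_point_self)
  have lip: "B-lipschitz_on UNIV (\<lambda>x. X i (c x))" for i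
  proof (rule lipschitz_onI)
    fix x y
    have "dist (X i (c x)) (X i (c y)) \<le> K i * dist (c x) (c y)"
      by (rule lipschitz_onD[OF K(2) c_in c_in])
    also have "\<dots> \<le> B * dist x y"
      unfolding c_def using R(1) KB[of i] B
      by (intro mult_mono closest_point_lipschitz) auto
    finally show "dist (X i (c x)) (X i (c y)) \<le> B * dist x y" .
  qed (use B in simp)
  have bd: "norm (X i (c x)) \<le> B" for i x
    using K(3)[OF c_in, of i x] KB[of i] by linarith
  have "\<exists>Y :: real \<Rightarrow> real ^ 'n \<Rightarrow> real \<Rightarrow> real ^ 'n. (\<forall>s x. Y s x 0 = x) \<and>
    (\<forall>s x. \<forall>t\<in>{0..1}. \<bar>s\<bar> \<le> s0 \<longrightarrow>
      (Y s x has_vector_derivative \<delta> *\<^sub>R e + s *\<^sub>R X i (c (Y s x t))) (at t within {0..1})) \<and>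
    continuous_on UNIV (\<lambda>(s, x). Y s x 1)" for \<delta> i
    by (rule parametrised_flow[OF lip[of i] bd s0(1) s0B, of "\<delta> *\<^sub>R e"]) blast
  then have "\<forall>\<delta> i. \<exists>Y :: real \<Rightarrow> real ^ 'n \<Rightarrow> real \<Rightarrow> real ^ 'n. (\<forall>s x. Y s x 0 = x) \<and>
    (\<forall>s x. \<forall>t\<in>{0..1}. \<bar>s\<bar> \<le> s0 \<longrightarrow>
      (Y s x has_vector_derivative \<delta> *\<^sub>R e + s *\<^sub>R X i (c (Y s x t))) (at t within {0..1})) \<and>
    continuous_on UNIV (\<lambda>(s, x). Y s x 1)" by blast
  then have "\<exists>Y :: real \<Rightarrow> 'm \<Rightarrow> real \<Rightarrow> real ^ 'n \<Rightarrow> real \<Rightarrow> real ^ 'n. \<forall>\<delta> i. (\<forall>s x. Y \<delta> i s x 0 = x) \<and>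
    (\<forall>s x. \<forall>t\<in>{0..1}. \<bar>s\<bar> \<le> s0 \<longrightarrow>
      (Y \<delta> i s x has_vector_derivative \<delta> *\<^sub>R e + s *\<^sub>R X i (c (Y \<delta> i s x t))) (at t within {0..1})) \<and>
    continuous_on UNIV (\<lambda>(s, x). Y \<delta> i s x 1)" by (simp only: choice_iff)
  then obtain Y :: "real \<Rightarrow> 'm \<Rightarrow> real \<Rightarrow> real ^ 'n \<Rightarrow> real \<Rightarrow> real ^ 'n" where
    Y: "\<And>\<delta> i s x. Y \<delta> i s x 0 = x"
    "\<And>\<delta> i s x t. \<bar>s\<bar> \<le> s0 \<Longrightarrow> t \<in> {0..1} \<Longrightarrow>
      (Y \<delta> i s x has_vector_derivative \<delta> *\<^sub>R e + s *\<^sub>R X i (c (Y \<delta> i s x t))) (at t within {0..1})"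
    "\<And>\<delta> i. continuous_on UNIV (\<lambda>(s, x). Y \<delta> i s x 1)"
    by blast
  have dist: "norm (Y \<delta> i s x t - x) \<le> B * \<bar>s\<bar> + \<delta>"
    if s: "\<bar>s\<bar> \<le> s0" and \<delta>: "0 \<le> \<delta>" and t: "t \<in> {0..1}" for \<delta> i s x t
  proof -
    have nb: "norm (\<delta> *\<^sub>R e + s *\<^sub>R X i (c (Y \<delta> i s x u))) \<le> B * \<bar>s\<bar> + \<delta>" for u
    proof -
      have "norm (\<delta> *\<^sub>R e) \<le> \<delta>" using assms(4) \<delta> by (simp add: mult_left_le)
      moreover have "norm (s *\<^sub>R X i (c (Y \<delta> i s x u))) \<le> B * \<bar>s\<bar>"
        using bd[of i "Y \<delta> i s x u"] by (simp add: mult.commute[of B] mult_left_mono)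
      ultimately show ?thesis by (intro norm_triangle_le) linarith
    qed
    have "norm (Y \<delta> i s x t - Y \<delta> i s x 0) \<le> (B * \<bar>s\<bar> + \<delta>) * \<bar>t - 0\<bar>"
      by (rule vector_derivative_bound[OF Y(2)[OF s] nb _ t]) auto
    also have "\<dots> \<le> (B * \<bar>s\<bar> + \<delta>) * 1"
      using t B \<delta> by (intro mult_left_mono) auto
    finally show ?thesis by (simp add: Y(1))
  qed
  have "local_system \<Omega> X e R B s0 Y"
  proof
    fix \<delta> s t :: real and i and x :: "real ^ 'n"
    assume h: "\<bar>s\<bar> \<le> s0" "0 \<le> \<delta>" "norm x + (B * \<bar>s\<bar> + \<delta>) \<le> R" "t \<in> {0..1}"
    show d: "norm (Y \<delta> i s x t - x) \<le> B * \<bar>s\<bar> + \<delta>" by (rule dist[OF h(1,2,4)])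
    have "norm (Y \<delta> i s x t) \<le> R"
      using norm_triangle_sub[of "Y \<delta> i s x t" x] d h(3) by linarith
    then have "c (Y \<delta> i s x t) = Y \<delta> i s x t" by (intro c_self) simp
    then show "(Y \<delta> i s x has_vector_derivative \<delta> *\<^sub>R e + s *\<^sub>R X i (Y \<delta> i s x t)) (at t within {0..1})"
      using Y(2)[OF h(1,4), of \<delta> i x] by simp
  qed (use assms R B s0 Y in auto)
  then show ?thesis by (rule that)
qed

lemma finite_words: "finite {w :: 'm::finite list. length w < N}"
  by (rule finite_subset[OF _ finite_lists_length_le[of UNIV N]]) auto

text \<open>A word of length below N together with a cut is the same as a pair of words of total
  length below N. The part w after the cut belongs to the later flows of a program, whose expansion
  is carried out before that of the first flow.\<close>

lemma sum_words_split:
  fixes G :: "'m::finite list \<Rightarrow> 'm list \<Rightarrow> real"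
  shows "(\<Sum>u | length u < N. \<Sum>k\<le>length u. G (take k u) (drop k u))
    = (\<Sum>w | length w < N. \<Sum>v | length v < N - length w. G v w)"
proof -
  have "(\<Sum>u | length u < N. \<Sum>k\<le>length u. G (take k u) (drop k u))
    = (\<Sum>(u, k)\<in>(SIGMA u:{u. length u < N}. {..length u}). G (take k u) (drop k u))"
    by (rule sum.Sigma) (auto simp: finite_words)
  also have "\<dots> = (\<Sum>(w, v)\<in>(SIGMA w:{w. length w < N}. {v. length v < N - length w}). G v w)"
    by (rule sum.reindex_bij_witness[of _ "\<lambda>(w, v). (v @ w, length v)" "\<lambda>(u, k). (drop k u, take k u)"]) auto
  also have "\<dots> = (\<Sum>w | length w < N. \<Sum>v | length v < N - length w. G v w)"
    by (rule sum.Sigma[symmetric]) (auto simp: finite_words)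
  finally show ?thesis .
qed

lemma sum_words_replicate:
  fixes H :: "'m::finite list \<Rightarrow> real"
  shows "(\<Sum>v | length v < M. if v = replicate (length v) i then H v else 0) = (\<Sum>j<M. H (replicate j i))"
proof -
  have "(\<Sum>v | length v < M. if v = replicate (length v) i then H v else 0)
      = (\<Sum>v\<in>(\<lambda>j. replicate j i) ` {..<M}. H v)"
    by (rule sum.mono_neutral_cong_right) (auto simp: finite_words)
  also have "\<dots> = (\<Sum>j<M. H (replicate j i))"
    by (rule sum.reindex_cong[of "\<lambda>j. replicate j i"])
       (auto simp: inj_on_def dest: arg_cong[of "replicate _ _" _ length])
  finally show ?thesis .
qed

section \<open>Taylor expansion along flows and programs\<close>

context local_system
begin

definition lie_derivative :: "'m \<Rightarrow> (real ^ 'n \<Rightarrow> real) \<Rightarrow> real ^ 'n \<Rightarrow> real" where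
  "lie_derivative i a = (\<lambda>x. frechet_derivative a (at x) (X i x))"

abbreviation word_derivative :: "'m list \<Rightarrow> (real ^ 'n \<Rightarrow> real) \<Rightarrow> real ^ 'n \<Rightarrow> real" where
  "word_derivative \<equiv> foldr lie_derivative"

lemma smooth_lie_derivative: "smooth_on \<Omega> a \<Longrightarrow> smooth_on \<Omega> (lie_derivative i a)"
  unfolding lie_derivative_def by (rule smooth_on_directional_derivative[OF open_\<Omega> _ smooth_X])

lemma smooth_word_derivative: "smooth_on \<Omega> a \<Longrightarrow> smooth_on \<Omega> (word_derivative w a)"
  by (induction w) (auto intro: smooth_lie_derivative)

lemma Y_in: "\<bar>s\<bar> \<le> s0 \<Longrightarrow> 0 \<le> \<delta> \<Longrightarrow> norm x + (B * \<bar>s\<bar> + \<delta>) \<le> R \<Longrightarrow> t \<in> {0..1} \<Longrightarrow> Y \<delta> i s x t \<in> cball 0 R"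
  using Y_dist[of s \<delta> x t i] norm_triangle_sub[of "Y \<delta> i s x t" x] by (simp add: dist_norm)

lemma Y_comp_deriv:
  assumes a: "smooth_on \<Omega> a"
    and h: "\<bar>s\<bar> \<le> s0" "0 \<le> \<delta>" "norm x + (B * \<bar>s\<bar> + \<delta>) \<le> R" "t \<in> {0..1}"
  shows "((\<lambda>t. a (Y \<delta> i s x t)) has_real_derivative
    \<delta> * frechet_derivative a (at (Y \<delta> i s x t)) e + s * lie_derivative i a (Y \<delta> i s x t)) (at t within {0..1})"
proof -
  let ?y = "Y \<delta> i s x t"
  have "?y \<in> \<Omega>" using Y_in[OF h] R_\<Omega> by blast
  from smooth_on_has_derivative[OF a this]
  have d: "(a has_derivative frechet_derivative a (at ?y)) (at ?y within Y \<delta> i s x ` {0..1})"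
    by (rule has_derivative_at_withinI)
  interpret linear "frechet_derivative a (at ?y)"
    using d by (rule has_derivative_linear)
  have "(Y \<delta> i s x has_derivative (\<lambda>h. h *\<^sub>R (\<delta> *\<^sub>R e + s *\<^sub>R X i ?y))) (at t within {0..1})"
    using Y_deriv[OF h] by (simp add: has_vector_derivative_def)
  from diff_chain_within[OF this d] show ?thesis
    unfolding has_field_derivative_def o_def
    by (simp add: add scale lie_derivative_def mult_commute_abs)
qed

text \<open>Taylor's formula for the driftless flow, with the drift as a perturbation of order
  \<delta>. The derivative of the remainder is a drift term plus s times the remainder of one order
  less for \<open>lie_derivative i a\<close>; the mean value inequality then raises the order by
  one.\<close>

lemma flow_expansion:
  assumes "smooth_on \<Omega> a"
  shows "\<exists>C\<ge>0. \<forall>s x \<delta> t. \<bar>s\<bar> \<le> s0 \<longrightarrow> 0 \<le> \<delta> \<longrightarrow> norm x + (B * \<bar>s\<bar> + \<delta>) \<le> R \<longrightarrow> t \<in> {0..1} \<longrightarrow>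
    \<bar>a (Y \<delta> i s x t) - (\<Sum>j<N. (s * t) ^ j / fact j * word_derivative (replicate j i) a x)\<bar> \<le> C * (\<bar>s\<bar> ^ N + \<delta>)"
  using assms
proof (induction N arbitrary: a)
  case 0
  obtain C where C: "C > 0" "\<And>x. x \<in> cball 0 R \<Longrightarrow> norm (a x) \<le> C"
    by (rule smooth_on_bounded_compact[OF 0 compact_cball R_\<Omega>]) blast
  have "\<bar>a (Y \<delta> i s x t) - (\<Sum>j<0. (s * t) ^ j / fact j * word_derivative (replicate j i) a x)\<bar> \<le> C * (\<bar>s\<bar> ^ 0 + \<delta>)"
    if h: "\<bar>s\<bar> \<le> s0" "0 \<le> \<delta>" "norm x + (B * \<bar>s\<bar> + \<delta>) \<le> R" "t \<in> {0..1}" for s x \<delta> t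
  proof -
    have "\<bar>a (Y \<delta> i s x t)\<bar> \<le> C" using C(2)[OF Y_in[OF h, of i]] by simp
    also have "\<dots> \<le> C * (1 + \<delta>)" using C(1) h(2) by (simp add: algebra_simps)
    finally show ?thesis by simp
  qed
  then show ?case using C(1) by (intro exI[of _ C]) (auto intro: less_imp_le)
next
  case (Suc N)
  obtain C where C: "C \<ge> 0" and IH: "\<And>s x \<delta> t. \<bar>s\<bar> \<le> s0 \<Longrightarrow> 0 \<le> \<delta> \<Longrightarrow> norm x + (B * \<bar>s\<bar> + \<delta>) \<le> R \<Longrightarrow> t \<in> {0..1} \<Longrightarrow>
    \<bar>lie_derivative i a (Y \<delta> i s x t) - (\<Sum>j<N. (s * t) ^ j / fact j * word_derivative (replicate j i) (lie_derivative i a) x)\<bar> \<le> C * (\<bar>s\<bar> ^ N + \<delta>)"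
    using Suc.IH[OF smooth_lie_derivative[OF Suc.prems, of i]] by blast
  obtain K where K: "K > 0" "\<And>x v. x \<in> cball 0 R \<Longrightarrow> norm (frechet_derivative a (at x) v) \<le> K * norm v"
    by (rule smooth_on_derivative_bounded[OF Suc.prems compact_cball R_\<Omega>]) blast
  have "\<bar>a (Y \<delta> i s x t) - (\<Sum>j<Suc N. (s * t) ^ j / fact j * word_derivative (replicate j i) a x)\<bar> \<le> (K + C) * (\<bar>s\<bar> ^ Suc N + \<delta>)"
    if h: "\<bar>s\<bar> \<le> s0" "0 \<le> \<delta>" "norm x + (B * \<bar>s\<bar> + \<delta>) \<le> R" and t: "t \<in> {0..1}" for s x \<delta> t
  proof -
    let ?y = "Y \<delta> i s x"
    let ?c = "\<lambda>j. word_derivative (replicate j i) a x"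
    define g where "g t = a (?y t) - (\<Sum>j<Suc N. (s * t) ^ j / fact j * ?c j)" for t
    define D where "D t = \<delta> * frechet_derivative a (at (?y t)) e +
      s * (lie_derivative i a (?y t) - (\<Sum>j<N. (s * t) ^ j / fact j * ?c (Suc j)))" for t
    have monomial: "((\<lambda>t. (s * t) ^ Suc j / fact (Suc j) * k) has_real_derivative s * ((s * t) ^ j / fact j * k)) (at t within {0..1})"
      for j t and k :: real
    proof -
      have "((\<lambda>t. (s * t) ^ Suc j) has_real_derivative real (Suc j) * (s * t) ^ j * s) (at t within {0..1})"
        by (rule derivative_eq_intros refl | simp)+
      then have "((\<lambda>t. (s * t) ^ Suc j * (k / fact (Suc j))) has_real_derivative (real (Suc j) * (s * t) ^ j * s) * (k / fact (Suc j))) (at t within {0..1})"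
        by (rule DERIV_cmult_right)
      moreover have "(real (Suc j) * (s * t) ^ j * s) * (k / fact (Suc j)) = s * ((s * t) ^ j / fact j * k)"
        unfolding fact_Suc of_nat_mult by (simp add: divide_simps del: of_nat_Suc)
      moreover have "(s * t) ^ Suc j * (k / fact (Suc j)) = (s * t) ^ Suc j / fact (Suc j) * k" for t
        by (simp only: times_divide_eq_left times_divide_eq_right)
      ultimately show ?thesis by (simp only:)
    qed
    have "(g has_vector_derivative D u) (at u within {0..1})" if u: "u \<in> {0..1}" for u
    proof -
      have "((\<lambda>t. \<Sum>j<N. (s * t) ^ Suc j / fact (Suc j) * ?c (Suc j)) has_real_derivative
          (\<Sum>j<N. s * ((s * u) ^ j / fact j * ?c (Suc j)))) (at u within {0..1})"
        by (rule DERIV_sum) (rule monomial)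
      from DERIV_diff[OF Y_comp_deriv[OF Suc.prems h u] DERIV_add[OF DERIV_const[of "?c 0"] this]]
      have "(g has_real_derivative D u) (at u within {0..1})"
        unfolding g_def D_def sum.lessThan_Suc_shift
        by (simp add: sum_distrib_left algebra_simps del: fact_Suc power_Suc replicate_Suc)
      then show ?thesis by (simp add: has_real_derivative_iff_has_vector_derivative)
    qed
    moreover have "norm (D u) \<le> (K + C) * (\<bar>s\<bar> ^ Suc N + \<delta>)" if u: "u \<in> {0..1}" for u
    proof -
      \<comment> \<open>The induction hypothesis has the additional derivative on the inside, the
        Taylor coefficient has it on the outside; for powers of a single field the two
        agree.\<close>
      have "?c (Suc j) = word_derivative (replicate j i) (lie_derivative i a) x" for j
        by (simp only: replicate_Suc replicate_append_same[symmetric] foldr_append foldr.simps o_apply id_apply)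
      then have "\<bar>lie_derivative i a (?y u) - (\<Sum>j<N. (s * u) ^ j / fact j * ?c (Suc j))\<bar> \<le> C * (\<bar>s\<bar> ^ N + \<delta>)"
        using IH[OF h u] by simp
      then have "\<bar>s\<bar> * \<bar>lie_derivative i a (?y u) - (\<Sum>j<N. (s * u) ^ j / fact j * ?c (Suc j))\<bar> \<le> \<bar>s\<bar> * (C * (\<bar>s\<bar> ^ N + \<delta>))"
        by (rule mult_left_mono) simp
      also have "\<dots> = C * (\<bar>s\<bar> ^ Suc N + \<bar>s\<bar> * \<delta>)" by (simp add: algebra_simps)
      also have "\<dots> \<le> C * (\<bar>s\<bar> ^ Suc N + \<delta>)"
        using h(1,2) s0 C by (intro mult_left_mono add_left_mono mult_left_le_one_le) auto
      finally have 1: "\<bar>s * (lie_derivative i a (?y u) - (\<Sum>j<N. (s * u) ^ j / fact j * ?c (Suc j)))\<bar> \<le> C * (\<bar>s\<bar> ^ Suc N + \<delta>)"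
        by (simp only: abs_mult)
      have "\<bar>frechet_derivative a (at (?y u)) e\<bar> \<le> K * norm e"
        using K(2)[OF Y_in[OF h u]] by simp
      also have "\<dots> \<le> K * 1" using e K(1) by (intro mult_left_mono) auto
      finally have "\<delta> * \<bar>frechet_derivative a (at (?y u)) e\<bar> \<le> \<delta> * K"
        using h(2) by (intro mult_left_mono) auto
      also have "\<dots> \<le> K * (\<bar>s\<bar> ^ Suc N + \<delta>)" using K(1) by (simp add: algebra_simps)
      finally have 2: "\<bar>\<delta> * frechet_derivative a (at (?y u)) e\<bar> \<le> K * (\<bar>s\<bar> ^ Suc N + \<delta>)"
        using h(2) by (simp add: abs_mult)
      show ?thesis unfolding D_def real_norm_def distrib_right
        using abs_triangle_ineq 1 2 by (intro order_trans[OF abs_triangle_ineq] add_mono)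
    qed
    ultimately have "norm (g t - g 0) \<le> (K + C) * (\<bar>s\<bar> ^ Suc N + \<delta>) * \<bar>t - 0\<bar>"
      by (rule vector_derivative_bound) (use t in auto)
    also have "\<dots> \<le> (K + C) * (\<bar>s\<bar> ^ Suc N + \<delta>) * 1"
      using t K(1) C h(2) by (intro mult_left_mono) auto
    finally have "norm (g t - g 0) \<le> (K + C) * (\<bar>s\<bar> ^ Suc N + \<delta>)" by simp
    moreover have "g 0 = 0"
      unfolding g_def sum.lessThan_Suc_shift by (simp add: Y_start)
    ultimately show ?thesis by (simp add: g_def)
  qed
  then show ?case using K(1) C by (intro exI[of _ "K + C"]) auto
qed

text \<open>The Taylor polynomial is rewritten as a sum over all words, so that successive flows
  multiply their series.\<close>

lemma flow_expansion_words:
  assumes "smooth_on \<Omega> a" "\<bar>c\<bar> \<le> 1"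
  shows "\<exists>C\<ge>0. \<forall>t x \<delta>. \<bar>t\<bar> \<le> s0 \<longrightarrow> 0 \<le> \<delta> \<longrightarrow> norm x + (B * \<bar>t\<bar> + \<delta>) \<le> R \<longrightarrow>
    \<bar>a (Y \<delta> i (c * t) x 1) - (\<Sum>v | length v < N. t ^ length v * wcoeff (word_exp i c) v * word_derivative v a x)\<bar>
      \<le> C * (\<bar>t\<bar> ^ N + \<delta>)"
proof -
  obtain C where C: "C \<ge> 0" "\<And>s x \<delta> t. \<bar>s\<bar> \<le> s0 \<Longrightarrow> 0 \<le> \<delta> \<Longrightarrow> norm x + (B * \<bar>s\<bar> + \<delta>) \<le> R \<Longrightarrow> t \<in> {0..1} \<Longrightarrow>
    \<bar>a (Y \<delta> i s x t) - (\<Sum>j<N. (s * t) ^ j / fact j * word_derivative (replicate j i) a x)\<bar> \<le> C * (\<bar>s\<bar> ^ N + \<delta>)"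
    using flow_expansion[OF assms(1), of i N] by blast
  have "\<bar>a (Y \<delta> i (c * t) x 1) - (\<Sum>v | length v < N. t ^ length v * wcoeff (word_exp i c) v * word_derivative v a x)\<bar>
      \<le> C * (\<bar>t\<bar> ^ N + \<delta>)"
    if t: "\<bar>t\<bar> \<le> s0" and \<delta>: "0 \<le> \<delta>" and x: "norm x + (B * \<bar>t\<bar> + \<delta>) \<le> R" for t x \<delta>
  proof -
    have ct: "\<bar>c * t\<bar> \<le> \<bar>t\<bar>" using assms(2) by (simp add: abs_mult mult_left_le_one_le)
    have ct': "\<bar>c * t\<bar> \<le> s0" using ct t by linarith
    have x': "norm x + (B * \<bar>c * t\<bar> + \<delta>) \<le> R"
      using mult_left_mono[OF ct, of B] B x by linarith
    have "(\<Sum>v | length v < N. t ^ length v * wcoeff (word_exp i c) v * word_derivative v a x)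
      = (\<Sum>v | length v < N. if v = replicate (length v) i
           then t ^ length v * (c ^ length v / fact (length v)) * word_derivative v a x else 0)"
      by (rule sum.cong) (auto simp: word_exp.rep_eq)
    also have "\<dots> = (\<Sum>j<N. (c * t * 1) ^ j / fact j * word_derivative (replicate j i) a x)"
      unfolding sum_words_replicate by (rule sum.cong) (auto simp: power_mult_distrib)
    finally have "\<bar>a (Y \<delta> i (c * t) x 1) - (\<Sum>v | length v < N. t ^ length v * wcoeff (word_exp i c) v * word_derivative v a x)\<bar>
        \<le> C * (\<bar>c * t\<bar> ^ N + \<delta>)"
      using C(2)[OF ct' \<delta> x', of 1] by simp
    also have "\<dots> \<le> C * (\<bar>t\<bar> ^ N + \<delta>)"
      using ct C(1) by (intro mult_left_mono add_right_mono power_mono) auto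
    finally show ?thesis .
  qed
  then show ?thesis using C(1) by blast
qed

fun run :: "real \<Rightarrow> real \<Rightarrow> 'm program \<Rightarrow> real ^ 'n \<Rightarrow> real ^ 'n" where
  "run \<delta> t [] x = x"
| "run \<delta> t ((i, c) # W) x = run \<delta> t W (Y \<delta> i (c * t) x 1)"

definition unit_program :: "'m program \<Rightarrow> bool" where
  "unit_program W \<longleftrightarrow> (\<forall>(i, c)\<in>set W. \<bar>c\<bar> \<le> 1)"

lemma unit_program_Cons: "unit_program ((i, c) # W) \<longleftrightarrow> \<bar>c\<bar> \<le> 1 \<and> unit_program W"
  by (auto simp: unit_program_def)

lemma Y_step:
  assumes "\<bar>c\<bar> \<le> 1" "\<bar>t\<bar> \<le> s0" "0 \<le> \<delta>" "norm x + (B * \<bar>t\<bar> + \<delta>) \<le> R"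
  shows "\<bar>c * t\<bar> \<le> s0" "norm x + (B * \<bar>c * t\<bar> + \<delta>) \<le> R" "norm (Y \<delta> i (c * t) x 1 - x) \<le> B * \<bar>t\<bar> + \<delta>"
proof -
  have ct: "\<bar>c * t\<bar> \<le> \<bar>t\<bar>" using assms(1) by (simp add: abs_mult mult_left_le_one_le)
  show 1: "\<bar>c * t\<bar> \<le> s0" using ct assms(2) by linarith
  have Bct: "B * \<bar>c * t\<bar> \<le> B * \<bar>t\<bar>" using ct B by (intro mult_left_mono) auto
  then show 2: "norm x + (B * \<bar>c * t\<bar> + \<delta>) \<le> R" using assms(4) by linarith
  show "norm (Y \<delta> i (c * t) x 1 - x) \<le> B * \<bar>t\<bar> + \<delta>"
    using Y_dist[OF 1 assms(3) 2, of 1 i] Bct by simp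
qed

lemma run_dist:
  assumes "unit_program W" "\<bar>t\<bar> \<le> s0" "0 \<le> \<delta>" "norm x + length W * (B * \<bar>t\<bar> + \<delta>) \<le> R"
  shows "norm (run \<delta> t W x - x) \<le> length W * (B * \<bar>t\<bar> + \<delta>)"
  using assms(1,4)
proof (induction W arbitrary: x)
  case (Cons ic W)
  obtain i c where ic: "ic = (i, c)" by (cases ic)
  let ?b = "B * \<bar>t\<bar> + \<delta>" and ?x = "Y \<delta> i (c * t) x 1"
  have b: "?b \<ge> 0" using B assms(3) by simp
  have c: "\<bar>c\<bar> \<le> 1" and W: "unit_program W" using Cons.prems(1) by (auto simp: ic unit_program_Cons)
  have "norm x + ?b \<le> R" using Cons.prems(2) mult_nonneg_nonneg[OF of_nat_0_le_iff b, of "length W"] by (simp add: algebra_simps)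
  from Y_step(3)[OF c assms(2,3) this] have d: "norm (?x - x) \<le> ?b" .
  have "norm ?x + length W * ?b \<le> R"
    using d norm_triangle_sub[of ?x x] Cons.prems(2) by (simp add: algebra_simps)
  from Cons.IH[OF W this] have "norm (run \<delta> t W ?x - ?x) \<le> length W * ?b" .
  then have "norm (run \<delta> t W ?x - x) \<le> length W * ?b + ?b"
    using d norm_triangle_ineq[of "run \<delta> t W ?x - ?x" "?x - x"] by simp
  then show ?case by (simp add: ic algebra_simps)
qed simp

text \<open>Along \<open>(i, c) # W\<close> the rest of the program is expanded at the endpoint of
  the first flow, and every derivative that occurs there is then expanded at x along that flow. The
  letters of the first flow end up outermost, which is the order of factors in
  \<open>program_series\<close>.\<close>

lemma run_expansion:
  assumes "unit_program W" "smooth_on \<Omega> a"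
  shows "\<exists>C\<ge>0. \<forall>t x \<delta>. \<bar>t\<bar> \<le> s0 \<longrightarrow> 0 \<le> \<delta> \<longrightarrow> norm x + length W * (B * \<bar>t\<bar> + \<delta>) \<le> R \<longrightarrow>
    \<bar>a (run \<delta> t W x) - (\<Sum>w | length w < N. t ^ length w * wcoeff (program_series W) w * word_derivative w a x)\<bar>
      \<le> C * (\<bar>t\<bar> ^ N + \<delta>)"
  using assms
proof (induction W)
  case Nil
  obtain C where C: "C > 0" "\<And>x. x \<in> cball 0 R \<Longrightarrow> norm (a x) \<le> C"
    by (rule smooth_on_bounded_compact[OF Nil(2) compact_cball R_\<Omega>]) blast
  have "\<bar>a x - (\<Sum>w | length w < N. t ^ length w * wcoeff 1 w * word_derivative w a x)\<bar> \<le> C * (\<bar>t\<bar> ^ N + \<delta>)"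
    if \<delta>: "0 \<le> \<delta>" and x: "norm x \<le> R" for t x \<delta>
  proof -
    have "(\<Sum>w | length w < N. t ^ length w * wcoeff 1 w * word_derivative w a x)
        = (\<Sum>w :: 'm list | length w < N. if w = [] then a x else 0)"
      by (rule sum.cong) (auto simp: one_word_series.rep_eq)
    also have "\<dots> = (if N > 0 then a x else 0)"
      by (simp add: finite_words)
    finally show ?thesis
      using C(1) C(2)[of x] x \<delta> by (auto simp: algebra_simps add_increasing2)
  qed
  then show ?case using C(1) by (intro exI[of _ C]) (auto intro: less_imp_le)
next
  case (Cons ic W)
  obtain i c where ic: "ic = (i, c)" by (cases ic)
  have c: "\<bar>c\<bar> \<le> 1" and W: "unit_program W" using Cons.prems(1) by (auto simp: ic unit_program_Cons)
  let ?S = "wcoeff (program_series W)" and ?E = "wcoeff (word_exp i c)"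
  obtain C where C: "C \<ge> 0" "\<And>t x \<delta>. \<bar>t\<bar> \<le> s0 \<Longrightarrow> 0 \<le> \<delta> \<Longrightarrow> norm x + length W * (B * \<bar>t\<bar> + \<delta>) \<le> R \<Longrightarrow>
    \<bar>a (run \<delta> t W x) - (\<Sum>w | length w < N. t ^ length w * ?S w * word_derivative w a x)\<bar> \<le> C * (\<bar>t\<bar> ^ N + \<delta>)"
    using Cons.IH[OF W Cons.prems(2)] by blast
  \<comment> \<open>The term of w already carries \<open>t ^ length w\<close>, so its derivative is
    expanded only up to the order \<open>N - length w\<close>.\<close>
  have "\<forall>w. \<exists>K. K \<ge> 0 \<and> (\<forall>t x \<delta>. \<bar>t\<bar> \<le> s0 \<longrightarrow> 0 \<le> \<delta> \<longrightarrow> norm x + (B * \<bar>t\<bar> + \<delta>) \<le> R \<longrightarrow>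
    \<bar>word_derivative w a (Y \<delta> i (c * t) x 1) - (\<Sum>v | length v < N - length w. t ^ length v * ?E v * word_derivative v (word_derivative w a) x)\<bar>
      \<le> K * (\<bar>t\<bar> ^ (N - length w) + \<delta>))"
    using flow_expansion_words[OF smooth_word_derivative[OF Cons.prems(2)] c] by blast
  from choice[OF this] obtain K where K: "\<And>w. K w \<ge> 0" "\<And>w t x \<delta>. \<bar>t\<bar> \<le> s0 \<Longrightarrow> 0 \<le> \<delta> \<Longrightarrow> norm x + (B * \<bar>t\<bar> + \<delta>) \<le> R \<Longrightarrow>
    \<bar>word_derivative w a (Y \<delta> i (c * t) x 1) - (\<Sum>v | length v < N - length w. t ^ length v * ?E v * word_derivative v (word_derivative w a) x)\<bar>
      \<le> K w * (\<bar>t\<bar> ^ (N - length w) + \<delta>)"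
    by blast
  define C' where "C' = C + (\<Sum>w | length w < N. \<bar>?S w\<bar> * K w)"
  have "\<bar>a (run \<delta> t (ic # W) x) - (\<Sum>w | length w < N. t ^ length w * wcoeff (program_series (ic # W)) w * word_derivative w a x)\<bar>
      \<le> C' * (\<bar>t\<bar> ^ N + \<delta>)"
    if t: "\<bar>t\<bar> \<le> s0" and \<delta>: "0 \<le> \<delta>" and x: "norm x + length (ic # W) * (B * \<bar>t\<bar> + \<delta>) \<le> R" for t x \<delta>
  proof -
    let ?b = "B * \<bar>t\<bar> + \<delta>" and ?x = "Y \<delta> i (c * t) x 1"
    have b: "?b \<ge> 0" using B \<delta> by simp
    have xb: "norm x + ?b \<le> R"
      using x mult_nonneg_nonneg[OF of_nat_0_le_iff b, of "length W"] by (simp add: algebra_simps)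
    have "norm ?x + length W * ?b \<le> R"
      using Y_step(3)[OF c t \<delta> xb, of i] norm_triangle_sub[of ?x x] x by (simp add: algebra_simps)
    from C(2)[OF t \<delta> this]
    have 1: "\<bar>a (run \<delta> t W ?x) - (\<Sum>w | length w < N. t ^ length w * ?S w * word_derivative w a ?x)\<bar> \<le> C * (\<bar>t\<bar> ^ N + \<delta>)" .
    let ?T = "\<lambda>w. \<Sum>v | length v < N - length w. t ^ length v * ?E v * word_derivative v (word_derivative w a) x"
    have "\<bar>(\<Sum>w | length w < N. t ^ length w * ?S w * word_derivative w a ?x) - (\<Sum>w | length w < N. t ^ length w * ?S w * ?T w)\<bar>
        \<le> (\<Sum>w | length w < N. \<bar>t ^ length w * ?S w * (word_derivative w a ?x - ?T w)\<bar>)"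
      unfolding sum_subtractf[symmetric] right_diff_distrib[symmetric] by (rule sum_abs)
    also have "\<dots> \<le> (\<Sum>w | length w < N. \<bar>?S w\<bar> * K w * (\<bar>t\<bar> ^ N + \<delta>))"
    proof (rule sum_mono)
      fix w :: "'m list" assume w: "w \<in> {w. length w < N}"
      have t1: "\<bar>t\<bar> ^ length w \<le> 1" using t s0 by (intro power_le_one) auto
      have "\<bar>t ^ length w * ?S w * (word_derivative w a ?x - ?T w)\<bar>
          = \<bar>?S w\<bar> * (\<bar>t\<bar> ^ length w * \<bar>word_derivative w a ?x - ?T w\<bar>)"
        by (simp add: abs_mult power_abs)
      also have "\<dots> \<le> \<bar>?S w\<bar> * (\<bar>t\<bar> ^ length w * (K w * (\<bar>t\<bar> ^ (N - length w) + \<delta>)))"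
        using K(2)[OF t \<delta> xb, of w] by (intro mult_left_mono) auto
      also have "\<bar>t\<bar> ^ length w * (K w * (\<bar>t\<bar> ^ (N - length w) + \<delta>))
          = K w * (\<bar>t\<bar> ^ (length w + (N - length w)) + \<bar>t\<bar> ^ length w * \<delta>)"
        by (simp add: power_add algebra_simps)
      also have "\<dots> \<le> K w * (\<bar>t\<bar> ^ N + \<delta>)"
        using K(1) w t1 \<delta> by (intro mult_left_mono add_mono mult_left_le_one_le) auto
      finally show "\<bar>t ^ length w * ?S w * (word_derivative w a ?x - ?T w)\<bar> \<le> \<bar>?S w\<bar> * K w * (\<bar>t\<bar> ^ N + \<delta>)"
        by (simp add: mult_left_mono mult.assoc)
    qed
    finally have 2: "\<bar>(\<Sum>w | length w < N. t ^ length w * ?S w * word_derivative w a ?x) - (\<Sum>w | length w < N. t ^ length w * ?S w * ?T w)\<bar>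
        \<le> (\<Sum>w | length w < N. \<bar>?S w\<bar> * K w) * (\<bar>t\<bar> ^ N + \<delta>)"
      by (simp only: sum_distrib_right)
    have 3: "(\<Sum>w | length w < N. t ^ length w * ?S w * ?T w)
        = (\<Sum>u | length u < N. t ^ length u * wcoeff (program_series (ic # W)) u * word_derivative u a x)"
    proof -
      have "(\<Sum>w | length w < N. t ^ length w * ?S w * ?T w)
          = (\<Sum>w | length w < N. \<Sum>v | length v < N - length w. t ^ length (v @ w) * (?E v * ?S w) * word_derivative (v @ w) a x)"
        by (simp add: sum_distrib_left power_add algebra_simps)
      also have "\<dots> = (\<Sum>u | length u < N. \<Sum>k\<le>length u. t ^ length u * (?E (take k u) * ?S (drop k u)) * word_derivative u a x)"
        by (simp only: sum_words_split[of _ N, symmetric] append_take_drop_id)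
      also have "\<dots> = (\<Sum>u | length u < N. t ^ length u * wcoeff (program_series (ic # W)) u * word_derivative u a x)"
        by (simp add: ic times_word_series.rep_eq sum_distrib_left sum_distrib_right)
      finally show ?thesis .
    qed
    have "\<bar>a (run \<delta> t W ?x) - (\<Sum>u | length u < N. t ^ length u * wcoeff (program_series (ic # W)) u * word_derivative u a x)\<bar>
        \<le> C * (\<bar>t\<bar> ^ N + \<delta>) + (\<Sum>w | length w < N. \<bar>?S w\<bar> * K w) * (\<bar>t\<bar> ^ N + \<delta>)"
      using 1 2 unfolding 3 by linarith
    then show ?thesis by (simp add: ic C'_def distrib_right)
  qed
  moreover have "C' \<ge> 0" unfolding C'_def using C(1) K(1) by (simp add: sum_nonneg)
  ultimately show ?case by blast
qed

end

subsection \<open>Trajectories in coordinates\<close>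

text \<open>Trajectories of the system in coordinates with cost at most c, in the class in which the
  upper bound constructs them: concatenations of finitely many integral curves. Their Lipschitz
  continuity yields absolute continuity in every chart of the atlas.\<close>

definition traj ::
    "(real ^ 'n) set \<Rightarrow> ('m::finite \<Rightarrow> real ^ 'n \<Rightarrow> real ^ 'n) \<Rightarrow> real ^ 'n \<Rightarrow> real \<Rightarrow> real \<Rightarrow> real ^ 'n \<Rightarrow> real ^ 'n \<Rightarrow> bool"
  where
  "traj \<Omega> X e T c x y \<longleftrightarrow> 0 \<le> T \<and> (\<exists>\<gamma> (u :: real \<Rightarrow> real ^ 'm) L S. finite S \<and> L-lipschitz_on {0..T} \<gamma> \<and>
     \<gamma> ` {0..T} \<subseteq> \<Omega> \<and> \<gamma> 0 = x \<and> \<gamma> T = y \<and> u absolutely_integrable_on {0..T} \<and>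
     integral {0..T} (\<lambda>t. norm (u t)) \<le> c \<and>
     (\<forall>t\<in>{0..T} - S. (\<gamma> has_vector_derivative (e + (\<Sum>i\<in>UNIV. (u t $ i) *\<^sub>R X i (\<gamma> t)))) (at t within {0..T})))"

lemma trajI:
  fixes u :: "real \<Rightarrow> real ^ 'm::finite"
  assumes "0 \<le> T" "finite S" "L-lipschitz_on {0..T} \<gamma>" "\<gamma> ` {0..T} \<subseteq> \<Omega>" "\<gamma> 0 = x" "\<gamma> T = y"
    "u absolutely_integrable_on {0..T}" "integral {0..T} (\<lambda>t. norm (u t)) \<le> c"
    "\<And>t. t \<in> {0..T} - S \<Longrightarrow> (\<gamma> has_vector_derivative (e + (\<Sum>i\<in>UNIV. (u t $ i) *\<^sub>R X i (\<gamma> t)))) (at t within {0..T})"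
  shows "traj \<Omega> X e T c x y"
  using assms unfolding traj_def by blast

lemma traj_refl: "x \<in> \<Omega> \<Longrightarrow> traj \<Omega> X e 0 0 x x"
  unfolding traj_def
  \<comment> \<open>The interval is the single point 0, and declaring it exceptional removes the
    derivative condition.\<close>
  by (intro conjI exI[of _ "\<lambda>_. x"] exI[of _ "\<lambda>_. 0"] exI[of _ 0] exI[of _ "{0}"])
     (auto intro: lipschitz_intros simp: absolutely_integrable_on_def)

lemma traj_mono_cost: "traj \<Omega> X e T c x y \<Longrightarrow> c \<le> c' \<Longrightarrow> traj \<Omega> X e T c' x y"
  unfolding traj_def by (elim conjE exE, intro conjI exI; (assumption | simp))

lemma traj_snoc:
  fixes X :: "'m::finite \<Rightarrow> real ^ 'n \<Rightarrow> real ^ 'n" and u0 :: "real ^ 'm"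
  assumes tr: "traj \<Omega> X e T c x y" and \<delta>: "0 \<le> \<delta>" and \<eta>0: "\<eta> 0 = y"
    and lip: "M-lipschitz_on {0..\<delta>} \<eta>" and in\<Omega>: "\<eta> ` {0..\<delta>} \<subseteq> \<Omega>"
    and der: "\<And>t. t \<in> {0..\<delta>} \<Longrightarrow> (\<eta> has_vector_derivative (e + (\<Sum>i\<in>UNIV. (u0 $ i) *\<^sub>R X i (\<eta> t)))) (at t within {0..\<delta>})"
  shows "traj \<Omega> X e (T + \<delta>) (c + \<delta> * norm u0) x (\<eta> \<delta>)"
proof -
  obtain \<gamma> and u :: "real \<Rightarrow> real ^ 'm" and L S where T: "0 \<le> T" and g: "finite S" "L-lipschitz_on {0..T} \<gamma>"
     "\<gamma> ` {0..T} \<subseteq> \<Omega>" "\<gamma> 0 = x" "\<gamma> T = y" "u absolutely_integrable_on {0..T}"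
     "integral {0..T} (\<lambda>t. norm (u t)) \<le> c"
     and g': "\<And>t. t \<in> {0..T} - S \<Longrightarrow> (\<gamma> has_vector_derivative (e + (\<Sum>i\<in>UNIV. (u t $ i) *\<^sub>R X i (\<gamma> t)))) (at t within {0..T})"
    using tr unfolding traj_def by blast
  define \<gamma>' where "\<gamma>' t = (if t \<le> T then \<gamma> t else \<eta> (t - T))" for t
  define u' where "u' t = (if t \<le> T then u t else u0)" for t
  have g2: "\<gamma>' t = \<eta> (t - T)" if "t \<ge> T" for t
    using that g(5) \<eta>0 by (cases "t = T") (auto simp: \<gamma>'_def)
  have un: "{0..T} \<union> {T<..T + \<delta>} = {0..T + \<delta>}" using T \<delta> by auto
  have "(max L M)-lipschitz_on {0..T + \<delta>} \<gamma>'"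
    unfolding \<gamma>'_def
  proof (rule lipschitz_on_concat_max[OF g(2)])
    have "M-lipschitz_on {T..T + \<delta>} (\<lambda>t. \<eta> (t - T))"
    proof (rule lipschitz_onI)
      fix s t assume "s \<in> {T..T + \<delta>}" "t \<in> {T..T + \<delta>}"
      then show "dist (\<eta> (s - T)) (\<eta> (t - T)) \<le> M * dist s t"
        using lipschitz_onD[OF lip, of "s - T" "t - T"] by (simp add: dist_real_def)
    qed (rule lipschitz_on_nonneg[OF lip])
    then show "M-lipschitz_on {T..T + \<delta>} (\<lambda>t. \<eta> (t - T))" .
  qed (use g(5) \<eta>0 in simp)
  moreover have "\<gamma>' ` {0..T + \<delta>} \<subseteq> \<Omega>"
  proof
    fix p assume "p \<in> \<gamma>' ` {0..T + \<delta>}"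
    then obtain t where t: "t \<in> {0..T + \<delta>}" "p = \<gamma>' t" by blast
    show "p \<in> \<Omega>"
    proof (cases "t \<le> T")
      case True
      then show ?thesis using t g(3) by (auto simp: \<gamma>'_def)
    next
      case False
      then have "\<eta> (t - T) \<in> \<eta> ` {0..\<delta>}" using t by auto
      then show ?thesis using False t in\<Omega> by (auto simp: \<gamma>'_def)
    qed
  qed
  moreover have "\<gamma>' 0 = x" using T g(4) by (simp add: \<gamma>'_def)
  moreover have "\<gamma>' (T + \<delta>) = \<eta> \<delta>" using g2[of "T + \<delta>"] \<delta> by simp
  moreover have ui: "u' absolutely_integrable_on {0..T + \<delta>}"
  proof -
    have "u' absolutely_integrable_on {0..T} \<longleftrightarrow> u absolutely_integrable_on {0..T}"
      by (rule set_integrable_cong) (auto simp: u'_def)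
    moreover have "u' absolutely_integrable_on {T<..T + \<delta>} \<longleftrightarrow> (\<lambda>_. u0) absolutely_integrable_on {T<..T + \<delta>}"
      by (rule set_integrable_cong) (auto simp: u'_def)
    moreover have "{T<..T + \<delta>} \<in> lmeasurable"
      by (rule bounded_set_imp_lmeasurable) auto
    ultimately have "u' absolutely_integrable_on {0..T}" "u' absolutely_integrable_on {T<..T + \<delta>}"
      using g(6) absolutely_integrable_on_const by auto
    then have "u' absolutely_integrable_on ({0..T} \<union> {T<..T + \<delta>})"
      by (rule set_integrable_Un) auto
    then show ?thesis by (simp only: un)
  qed
  moreover have "integral {0..T + \<delta>} (\<lambda>t. norm (u' t)) \<le> c + \<delta> * norm u0"
  proof -
    have "integral {0..T + \<delta>} (\<lambda>t. norm (u' t))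
        = integral {0..T} (\<lambda>t. norm (u' t)) + integral {T..T + \<delta>} (\<lambda>t. norm (u' t))"
      using ui T \<delta> by (intro Henstock_Kurzweil_Integration.integral_combine[symmetric])
         (auto simp: absolutely_integrable_on_def)
    moreover have "integral {0..T} (\<lambda>t. norm (u' t)) = integral {0..T} (\<lambda>t. norm (u t))"
      by (rule integral_cong) (auto simp: u'_def)
    moreover have "integral {T..T + \<delta>} (\<lambda>t. norm (u' t)) = integral {T..T + \<delta>} (\<lambda>t. norm u0)"
      by (rule integral_spike[of "{T}"]) (auto simp: u'_def)
    ultimately show ?thesis using g(7) \<delta> by simp
  qed
  \<comment> \<open>The junction T joins the exceptional set, since the one-sided derivatives may
    differ there.\<close>
  moreover have "(\<gamma>' has_vector_derivative (e + (\<Sum>i\<in>UNIV. (u' t $ i) *\<^sub>R X i (\<gamma>' t)))) (at t within {0..T + \<delta>})"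
    if t: "t \<in> {0..T + \<delta>} - insert T S" for t
  proof (cases "t < T")
    case True
    have "at t within {0..T + \<delta>} = at t within {0..T}"
      by (rule at_within_nhd[of t "{..<T}"]) (use True \<delta> in auto)
    moreover have "(\<gamma>' has_vector_derivative (e + (\<Sum>i\<in>UNIV. (u t $ i) *\<^sub>R X i (\<gamma> t)))) (at t within {0..T})"
      by (rule has_vector_derivative_transform[OF _ _ g']) (use t True in \<open>auto simp: \<gamma>'_def\<close>)
    ultimately show ?thesis using True by (simp add: \<gamma>'_def u'_def)
  next
    case False
    then have tT: "t > T" using t by auto
    have "at t within {0..T + \<delta>} = at t within {T..T + \<delta>}"
      by (rule at_within_nhd[of t "{T<..}"]) (use tT T in auto)
    moreover have "((\<eta> \<circ> (\<lambda>t. t - T)) has_vector_derivative 1 *\<^sub>R (e + (\<Sum>i\<in>UNIV. (u0 $ i) *\<^sub>R X i (\<eta> (t - T))))) (at t within {T..T + \<delta>})"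
    proof (rule vector_diff_chain_within)
      show "((\<lambda>t. t - T) has_vector_derivative 1) (at t within {T..T + \<delta>})"
        by (auto intro!: derivative_eq_intros)
      show "(\<eta> has_vector_derivative (e + (\<Sum>i\<in>UNIV. (u0 $ i) *\<^sub>R X i (\<eta> (t - T))))) (at (t - T) within (\<lambda>t. t - T) ` {T..T + \<delta>})"
        by (rule has_vector_derivative_within_subset[OF der]) (use t tT in auto)
    qed
    then have "(\<gamma>' has_vector_derivative (e + (\<Sum>i\<in>UNIV. (u0 $ i) *\<^sub>R X i (\<eta> (t - T))))) (at t within {T..T + \<delta>})"
      by (intro has_vector_derivative_transform[of t _ \<gamma>' "\<eta> \<circ> (\<lambda>t. t - T)"]) (use t tT g2 in auto)
    ultimately show ?thesis using tT g2[of t] by (simp add: u'_def)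
  qed
  moreover have "finite (insert T S)" using g(1) by simp
  moreover have "0 \<le> T + \<delta>" using T \<delta> by simp
  ultimately show ?thesis by (intro trajI[of "T + \<delta>" "insert T S" "max L M" \<gamma>' \<Omega> x _ u'])
qed

lemma traj_drift:
  fixes X :: "'m::finite \<Rightarrow> real ^ 'n \<Rightarrow> real ^ 'n"
  assumes "0 \<le> T" "(\<lambda>t. x + t *\<^sub>R e) ` {0..T} \<subseteq> \<Omega>"
  shows "traj \<Omega> X e T 0 x (x + T *\<^sub>R e)"
proof -
  have x: "x \<in> \<Omega>" using assms by (auto dest!: subsetD[of _ _ "x + 0 *\<^sub>R e"])
  have lip: "(norm e)-lipschitz_on {0..T} (\<lambda>t. x + t *\<^sub>R e)"
    by (rule lipschitz_onI) (auto simp: dist_norm scaleR_diff_left[symmetric] mult.commute)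
  have "traj \<Omega> X e (0 + T) (0 + T * norm (0 :: real ^ 'm)) x ((\<lambda>t. x + t *\<^sub>R e) T)"
    by (rule traj_snoc[OF traj_refl[OF x] assms(1) _ lip assms(2)]) (auto intro!: derivative_eq_intros)
  then show ?thesis by simp
qed

section \<open>Displacement by bracket programs\<close>

context local_system
begin

text \<open>The bracket polynomial, read as a differential operator, applied to the coordinate
  functions. It is the iterated Lie bracket in coordinates, by
  \<open>pushforward_iterated_bracket\<close>; in this form the expansion of programs produces it
  directly.\<close>

definition bracket_field :: "'m list \<Rightarrow> real ^ 'n \<Rightarrow> real ^ 'n" where
  "bracket_field I x = (\<chi> j. \<Sum>w | length w = length I.
     wcoeff (bracket_polynomial I) w * word_derivative w (\<lambda>x. x $ j) x)"

lemma smooth_coordinate: "smooth_on \<Omega> (\<lambda>x. x $ j)"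
  by (rule smooth_on_nth[OF open_\<Omega> smooth_on_id[OF open_\<Omega>]])

lemma smooth_bracket_field: "smooth_on \<Omega> (bracket_field I)"
  unfolding bracket_field_def
  by (rule smooth_on_vec[OF open_\<Omega>], simp only: vec_lambda_beta,
      intro smooth_on_sum smooth_on_cmult smooth_word_derivative smooth_coordinate open_\<Omega>)

text \<open>The coordinate functions are expanded up to words of the length of I, and homogeneity of
  the bracket polynomial leaves a single power of t. The factor \<sigma> is 1 for the bracket
  program and -1 for its inverse.\<close>

lemma run_leading_term:
  assumes W: "unit_program W" and I: "I \<noteq> []"
    and S: "\<And>w. length w \<le> length I \<Longrightarrow>
      wcoeff (program_series W) w = wcoeff 1 w + \<sigma> * wcoeff (bracket_polynomial I) w"
  shows "\<exists>C\<ge>0. \<forall>t x \<delta>. 0 \<le> t \<longrightarrow> t \<le> s0 \<longrightarrow> 0 \<le> \<delta> \<longrightarrow> norm x + length W * (B * t + \<delta>) \<le> R \<longrightarrow>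
    norm (run \<delta> t W x - (x + (\<sigma> * t ^ length I) *\<^sub>R bracket_field I x)) \<le> C * (t ^ Suc (length I) + \<delta>)"
proof -
  let ?l = "length I"
  have "\<forall>j. \<exists>C. C \<ge> 0 \<and> (\<forall>t x \<delta>. \<bar>t\<bar> \<le> s0 \<longrightarrow> 0 \<le> \<delta> \<longrightarrow> norm x + length W * (B * \<bar>t\<bar> + \<delta>) \<le> R \<longrightarrow>
    \<bar>run \<delta> t W x $ j - (\<Sum>w | length w < Suc ?l. t ^ length w * wcoeff (program_series W) w * word_derivative w (\<lambda>x. x $ j) x)\<bar>
      \<le> C * (\<bar>t\<bar> ^ Suc ?l + \<delta>))"
    using run_expansion[OF W smooth_coordinate] by blast
  from choice[OF this] obtain C where C: "\<And>j. C j \<ge> 0" "\<And>j t x \<delta>. \<bar>t\<bar> \<le> s0 \<Longrightarrow> 0 \<le> \<delta> \<Longrightarrow> norm x + length W * (B * \<bar>t\<bar> + \<delta>) \<le> R \<Longrightarrow>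
    \<bar>run \<delta> t W x $ j - (\<Sum>w | length w < Suc ?l. t ^ length w * wcoeff (program_series W) w * word_derivative w (\<lambda>x. x $ j) x)\<bar>
      \<le> C j * (\<bar>t\<bar> ^ Suc ?l + \<delta>)" by blast
  have sum: "(\<Sum>w | length w < Suc ?l. t ^ length w * wcoeff (program_series W) w * word_derivative w (\<lambda>x. x $ j) x)
      = (x + (\<sigma> * t ^ ?l) *\<^sub>R bracket_field I x) $ j" for t x j
  proof -
    let ?D = "\<lambda>w. word_derivative w (\<lambda>x. x $ j) x"
    have "(\<Sum>w | length w < Suc ?l. t ^ length w * wcoeff (program_series W) w * ?D w)
        = (\<Sum>w | length w < Suc ?l. t ^ length w * wcoeff 1 w * ?D w)
          + (\<Sum>w | length w < Suc ?l. \<sigma> * (t ^ length w * wcoeff (bracket_polynomial I) w * ?D w))"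
      unfolding sum.distrib[symmetric] by (rule sum.cong) (auto simp: S algebra_simps)
    also have "(\<Sum>w | length w < Suc ?l. t ^ length w * wcoeff 1 w * ?D w)
        = (\<Sum>w :: 'm list | length w < Suc ?l. if w = [] then x $ j else 0)"
      by (rule sum.cong) (auto simp: one_word_series.rep_eq)
    also have "\<dots> = x $ j" by (simp add: finite_words)
    also have "(\<Sum>w | length w < Suc ?l. \<sigma> * (t ^ length w * wcoeff (bracket_polynomial I) w * ?D w))
        = (\<Sum>w | length w = ?l. (\<sigma> * t ^ ?l) * (wcoeff (bracket_polynomial I) w * ?D w))"
      by (rule sum.mono_neutral_cong_right) (auto simp: finite_words bracket_polynomial_homogeneous)
    also have "\<dots> = (\<sigma> * t ^ ?l) * bracket_field I x $ j"
      by (simp add: bracket_field_def sum_distrib_left)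
    finally show ?thesis by simp
  qed
  have "norm (run \<delta> t W x - (x + (\<sigma> * t ^ ?l) *\<^sub>R bracket_field I x)) \<le> sum C UNIV * (t ^ Suc ?l + \<delta>)"
    if t: "0 \<le> t" "t \<le> s0" and \<delta>: "0 \<le> \<delta>" and x: "norm x + length W * (B * t + \<delta>) \<le> R" for t x \<delta>
  proof -
    have "norm (run \<delta> t W x - (x + (\<sigma> * t ^ ?l) *\<^sub>R bracket_field I x))
        \<le> (\<Sum>j\<in>UNIV. \<bar>(run \<delta> t W x - (x + (\<sigma> * t ^ ?l) *\<^sub>R bracket_field I x)) $ j\<bar>)"
      by (rule norm_le_l1_cart)
    also have "\<dots> \<le> (\<Sum>j\<in>UNIV. C j * (t ^ Suc ?l + \<delta>))"
    proof (rule sum_mono)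
      fix j
      show "\<bar>(run \<delta> t W x - (x + (\<sigma> * t ^ ?l) *\<^sub>R bracket_field I x)) $ j\<bar> \<le> C j * (t ^ Suc ?l + \<delta>)"
        using C(2)[of t \<delta> x j] t \<delta> x unfolding sum vector_minus_component by simp
    qed
    also have "\<dots> = sum C UNIV * (t ^ Suc ?l + \<delta>)" by (simp only: sum_distrib_right)
    finally show ?thesis .
  qed
  moreover have "sum C UNIV \<ge> 0" using C(1) by (intro sum_nonneg)
  ultimately show ?thesis by blast
qed

lemma unit_bracket_program: "unit_program (bracket_program I)"
  unfolding unit_program_def by (clarify, rule bracket_program_coeff)

lemma unit_inverse_bracket_program: "unit_program (inverse_program (bracket_program I))"
  unfolding unit_program_def by (clarify, rule inverse_program_coeff[OF bracket_program_coeff])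

lemma length_inverse_program: "length (inverse_program W) = length W"
  by (simp add: inverse_program_def)

lemma Y_continuous_on:
  assumes "continuous_on S f" "continuous_on S g"
  shows "continuous_on S (\<lambda>v. Y \<delta> i (f v) (g v) 1)"
  using continuous_on_compose2[OF Y_cont continuous_on_Pair[OF assms]] by simp

lemma run_continuous_on:
  assumes "continuous_on S f" "continuous_on S g"
  shows "continuous_on S (\<lambda>v. run \<delta> (f v) W (g v))"
  using assms(2)
proof (induction W arbitrary: g)
  case (Cons ic W)
  obtain i c where ic: "ic = (i, c)" by (cases ic)
  have "continuous_on S (\<lambda>v. Y \<delta> i (c * f v) (g v) 1)"
    by (intro Y_continuous_on continuous_on_mult continuous_on_const assms(1) Cons.prems)
  then show ?case unfolding ic run.simps by (rule Cons.IH)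
qed simp

text \<open>Time \<open>t\<close> along a bracket program of length \<open>l\<close> displaces by the order \<open>t ^ l\<close>, hence the root.
  At most one of the two factors moves: the inverse program realises negative \<open>s\<close>.\<close>

definition bracket_move :: "real \<Rightarrow> 'm list \<Rightarrow> real \<Rightarrow> real ^ 'n \<Rightarrow> real ^ 'n" where
  "bracket_move \<delta> I s x = run \<delta> (root (length I) (max (- s) 0)) (inverse_program (bracket_program I))
     (run \<delta> (root (length I) (max s 0)) (bracket_program I) x)"

lemma bracket_move_continuous_on:
  assumes "continuous_on S f" "continuous_on S g"
  shows "continuous_on S (\<lambda>v. bracket_move \<delta> I (f v) (g v))"
  unfolding bracket_move_def
  by (intro run_continuous_on continuous_on_real_root continuous_on_max continuous_on_minus
      continuous_on_const assms)

text \<open>Brackets of different lengths l are compared at one scale: for s up to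
  \<open>\<tau> ^ r\<close> with \<tau> \<le> 1 the running time t is at most \<tau>, and the
  remainder \<open>t ^ Suc l = t * s\<close> is at most \<open>\<tau> ^ Suc r\<close>, whatever l
  is.\<close>

lemma root_bounds:
  assumes "0 < l" "l \<le> r" "0 \<le> \<tau>" "\<tau> \<le> 1" "0 \<le> s" "s \<le> \<tau> ^ r"
  shows "0 \<le> root l s" "root l s \<le> \<tau>" "root l s ^ l = s" "root l s ^ Suc l \<le> \<tau> ^ Suc r"
proof -
  show 0: "0 \<le> root l s" using assms by simp
  have "s \<le> \<tau> ^ l" using assms power_decreasing[of l r \<tau>] by linarith
  then have "root l s \<le> root l (\<tau> ^ l)" using assms(1) by simp
  then show 1: "root l s \<le> \<tau>" using assms by (simp add: real_root_power_cancel)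
  show 2: "root l s ^ l = s" using assms by simp
  have "root l s ^ Suc l = root l s * s" by (simp add: 2)
  also have "\<dots> \<le> \<tau> * \<tau> ^ r" using 0 1 assms by (intro mult_mono) auto
  finally show "root l s ^ Suc l \<le> \<tau> ^ Suc r" by simp
qed

text \<open>One of the two programs runs with time 0 and contributes only its drift, an error of
  order \<delta>. For negative s the idle program comes first, so the inverse program starts at y
  instead of x and the Lipschitz constant of the bracket field enters.\<close>

lemma bracket_move_estimate:
  assumes I: "I \<noteq> []" "length I \<le> r"
  shows "\<exists>K>0. \<forall>s \<tau> x \<delta>. 0 \<le> \<tau> \<longrightarrow> \<tau> \<le> s0 \<longrightarrow> \<bar>s\<bar> \<le> \<tau> ^ r \<longrightarrow> 0 \<le> \<delta> \<longrightarrow> norm x + K * (\<tau> + \<delta>) \<le> R \<longrightarrow>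
    norm (bracket_move \<delta> I s x - x) \<le> K * (\<tau> + \<delta>) \<and>
    norm (bracket_move \<delta> I s x - (x + s *\<^sub>R bracket_field I x)) \<le> K * (\<tau> ^ Suc r + \<delta>)"
proof -
  let ?l = "length I" and ?W = "bracket_program I" and ?V = "inverse_program (bracket_program I)"
  let ?f = "bracket_field I"
  have l: "0 < ?l" using I by simp
  have 1: "wcoeff (program_series ?W) w = wcoeff 1 w + 1 * wcoeff (bracket_polynomial I) w" if "length w \<le> ?l" for w
    using bracket_program_order[OF I(1)] that by (simp add: order_ge_def wcoeff_simps algebra_simps)
  obtain C1 where C1: "C1 \<ge> 0" "\<And>t x \<delta>. 0 \<le> t \<Longrightarrow> t \<le> s0 \<Longrightarrow> 0 \<le> \<delta> \<Longrightarrow> norm x + length ?W * (B * t + \<delta>) \<le> R \<Longrightarrow>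
    norm (run \<delta> t ?W x - (x + (1 * t ^ ?l) *\<^sub>R ?f x)) \<le> C1 * (t ^ Suc ?l + \<delta>)"
    using run_leading_term[OF unit_bracket_program I(1) 1] by blast
  have 2: "wcoeff (program_series ?V) w = wcoeff 1 w + (- 1) * wcoeff (bracket_polynomial I) w" if "length w \<le> ?l" for w
    using inverse_bracket_program_order[OF I(1)] that by (simp add: order_ge_def wcoeff_simps algebra_simps)
  obtain C2 where C2: "C2 \<ge> 0" "\<And>t x \<delta>. 0 \<le> t \<Longrightarrow> t \<le> s0 \<Longrightarrow> 0 \<le> \<delta> \<Longrightarrow> norm x + length ?V * (B * t + \<delta>) \<le> R \<Longrightarrow>
    norm (run \<delta> t ?V x - (x + ((- 1) * t ^ ?l) *\<^sub>R ?f x)) \<le> C2 * (t ^ Suc ?l + \<delta>)"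
    using run_leading_term[OF unit_inverse_bracket_program I(1) 2] by blast
  obtain L where L: "L > 0" "L-lipschitz_on (cball 0 R) ?f"
    by (rule smooth_on_lipschitz[OF smooth_bracket_field compact_cball R_\<Omega> convex_cball])
  define n where "n = real (length ?W)"
  have n: "n \<ge> 0" by (simp add: n_def)
  \<comment> \<open>\<open>2 * n * (B + 1)\<close> covers the path of two programs of n letters, C1
    and C2 their remainders, and \<open>L * C1\<close> the shift of the base point.\<close>
  define K where "K = 2 * n * (B + 1) + C1 + C2 + L * C1 + 1"
  have LC: "L * C1 \<ge> 0" using L(1) C1(1) by simp
  have nB: "n * (B + 1) \<ge> 0" using n B by simp
  have K: "K > 0" "C1 + C2 \<le> K" "C1 + C2 + L * C1 \<le> K" "2 * n * (B + 1) \<le> K"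
    unfolding K_def using C1(1) C2(1) LC nB by linarith+
  have "norm (bracket_move \<delta> I s x - x) \<le> K * (\<tau> + \<delta>) \<and>
    norm (bracket_move \<delta> I s x - (x + s *\<^sub>R ?f x)) \<le> K * (\<tau> ^ Suc r + \<delta>)"
    if \<tau>: "0 \<le> \<tau>" "\<tau> \<le> s0" and s: "\<bar>s\<bar> \<le> \<tau> ^ r" and \<delta>: "0 \<le> \<delta>" and x: "norm x + K * (\<tau> + \<delta>) \<le> R" for s \<tau> x \<delta>
  proof -
    have \<tau>1: "\<tau> \<le> 1" using \<tau> s0 by simp
    define t1 t2 where "t1 = root ?l (max s 0)" and "t2 = root ?l (max (- s) 0)"
    have s12: "0 \<le> max s 0" "max s 0 \<le> \<tau> ^ r" "0 \<le> max (- s) 0" "max (- s) 0 \<le> \<tau> ^ r" using s by auto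
    note t1 = root_bounds[OF l I(2) \<tau>(1) \<tau>1 s12(1,2), folded t1_def]
    note t2 = root_bounds[OF l I(2) \<tau>(1) \<tau>1 s12(3,4), folded t2_def]
    define y where "y = run \<delta> t1 ?W x"
    define v where "v = run \<delta> t2 ?V y"
    have v: "bracket_move \<delta> I s x = v" by (simp add: bracket_move_def v_def y_def t1_def t2_def)
    have bt: "n * (B * t + \<delta>) \<le> n * (B + 1) * (\<tau> + \<delta>)" if "0 \<le> t" "t \<le> \<tau>" for t
    proof -
      have "B * t + \<delta> \<le> (B + 1) * (\<tau> + \<delta>)"
      proof -
        have "B * t \<le> B * \<tau>" "0 \<le> B * \<delta>" using that(2) B \<delta> by auto
        moreover have "(B + 1) * (\<tau> + \<delta>) = B * \<tau> + B * \<delta> + \<tau> + \<delta>" by (simp add: algebra_simps)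
        ultimately show ?thesis using \<tau>(1) by linarith
      qed
      then show ?thesis using n by (simp add: mult.assoc mult_left_mono)
    qed
    have two: "n * (B + 1) * (\<tau> + \<delta>) + n * (B + 1) * (\<tau> + \<delta>) \<le> K * (\<tau> + \<delta>)"
    proof -
      have "2 * n * (B + 1) * (\<tau> + \<delta>) \<le> K * (\<tau> + \<delta>)" using K(4) \<tau> \<delta> by (intro mult_right_mono) auto
      then show ?thesis by simp
    qed
    have nn: "n * (B + 1) * (\<tau> + \<delta>) \<ge> 0" using nB \<tau> \<delta> by simp
    have x1: "norm x + length ?W * (B * t1 + \<delta>) \<le> R"
      using bt[OF t1(1,2)] two x nn by (simp add: n_def[symmetric])
    have y1: "norm (y - x) \<le> n * (B + 1) * (\<tau> + \<delta>)"
      using run_dist[OF unit_bracket_program, of t1 \<delta> x I] t1 \<tau> \<delta> x1 bt[OF t1(1,2)]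
      by (simp add: y_def n_def[symmetric])
    have y2: "norm y + length ?V * (B * t2 + \<delta>) \<le> R"
      using y1 norm_triangle_sub[of y x] bt[OF t2(1,2)] two x
      by (simp add: n_def[symmetric] length_inverse_program)
    have v1: "norm (v - y) \<le> n * (B + 1) * (\<tau> + \<delta>)"
      using run_dist[OF unit_inverse_bracket_program, of t2 \<delta> y I] t2 \<tau> \<delta> y2 bt[OF t2(1,2)]
      by (simp add: v_def n_def[symmetric] length_inverse_program)
    have vx: "norm (v - x) \<le> K * (\<tau> + \<delta>)"
      using norm_triangle_ineq[of "v - y" "y - x"] v1 y1 two by simp
    have xR: "x \<in> cball 0 R" using x K(1) \<tau> \<delta> by (simp add: add_nonneg_nonneg) (smt (verit) mult_nonneg_nonneg)
    have yR: "y \<in> cball 0 R" using y1 norm_triangle_sub[of y x] two x nn by simp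
    have E1: "norm (y - (x + t1 ^ ?l *\<^sub>R ?f x)) \<le> C1 * (t1 ^ Suc ?l + \<delta>)"
      using C1(2)[OF t1(1) _ \<delta> x1] t1(2) \<tau>(2) by (simp add: y_def)
    have E2: "norm (v - (y - t2 ^ ?l *\<^sub>R ?f y)) \<le> C2 * (t2 ^ Suc ?l + \<delta>)"
      using C2(2)[OF t2(1) _ \<delta> y2] t2(2) \<tau>(2) by (simp add: v_def)
    have C1b: "C1 * (t1 ^ Suc ?l + \<delta>) \<le> C1 * (\<tau> ^ Suc r + \<delta>)"
      using t1(4) C1(1) by (intro mult_left_mono) auto
    have C2b: "C2 * (t2 ^ Suc ?l + \<delta>) \<le> C2 * (\<tau> ^ Suc r + \<delta>)"
      using t2(4) C2(1) by (intro mult_left_mono) auto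
    have \<tau>\<delta>: "\<tau> ^ Suc r + \<delta> \<ge> 0" using \<tau> \<delta> by simp
    have "norm (v - (x + s *\<^sub>R ?f x)) \<le> (C1 + C2 + L * C1) * (\<tau> ^ Suc r + \<delta>)"
    proof (cases "s \<ge> 0")
      case True
      then have t12: "t2 ^ ?l = 0" "t1 ^ ?l = s" using t1(3) t2(3) by auto
      then have "norm (v - y) \<le> C2 * (\<tau> ^ Suc r + \<delta>)" "norm (y - (x + s *\<^sub>R ?f x)) \<le> C1 * (\<tau> ^ Suc r + \<delta>)"
        using E1[unfolded t12] E2[unfolded t12] C1b C2b by (simp_all del: power_Suc)
      then have "norm (v - (x + s *\<^sub>R ?f x)) \<le> C2 * (\<tau> ^ Suc r + \<delta>) + C1 * (\<tau> ^ Suc r + \<delta>)"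
        using norm_diff_triangle_le[of v y _ "x + s *\<^sub>R ?f x"] by blast
      moreover have "L * C1 * (\<tau> ^ Suc r + \<delta>) \<ge> 0" using LC \<tau>\<delta> by simp
      ultimately show ?thesis by (simp add: distrib_right)
    next
      case False
      then have t12: "t2 ^ ?l = - s" "t1 ^ ?l = 0" using t1(3) t2(3) by auto
      then have yx: "norm (y - x) \<le> C1 * (\<tau> ^ Suc r + \<delta>)" using E1[unfolded t12] C1b by (simp del: power_Suc)
      have e2: "norm (v - (y + s *\<^sub>R ?f y)) \<le> C2 * (\<tau> ^ Suc r + \<delta>)" using E2[unfolded t12] C2b by (simp del: power_Suc)
      have "\<tau> ^ r \<le> 1" using \<tau>(1) \<tau>1 by (rule power_le_one)
      then have s1: "\<bar>s\<bar> \<le> 1" using s by linarith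
      have "norm (s *\<^sub>R (?f y - ?f x)) \<le> 1 * norm (?f y - ?f x)"
        using s1 unfolding norm_scaleR by (intro mult_right_mono) auto
      also have "norm (?f y - ?f x) \<le> L * norm (y - x)"
        using lipschitz_onD[OF L(2) yR xR] by (simp add: dist_norm)
      also have "\<dots> \<le> L * (C1 * (\<tau> ^ Suc r + \<delta>))" using yx L(1) by (intro mult_left_mono) auto
      finally have fe: "norm (s *\<^sub>R (?f y - ?f x)) \<le> L * C1 * (\<tau> ^ Suc r + \<delta>)" by (simp add: mult.assoc)
      have "v - (x + s *\<^sub>R ?f x) = (v - (y + s *\<^sub>R ?f y)) + ((y - x) + s *\<^sub>R (?f y - ?f x))"
        by (simp add: algebra_simps)
      then have "norm (v - (x + s *\<^sub>R ?f x)) \<le> norm (v - (y + s *\<^sub>R ?f y)) + (norm (y - x) + norm (s *\<^sub>R (?f y - ?f x)))"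
        by (metis add_left_mono norm_triangle_ineq norm_triangle_le)
      then show ?thesis using e2 yx fe by (simp add: distrib_right)
    qed
    also have "\<dots> \<le> K * (\<tau> ^ Suc r + \<delta>)" using K(3) \<tau>\<delta> by (rule mult_right_mono)
    finally show ?thesis using vx v by simp
  qed
  then show ?thesis using K(1) by blast
qed

fun move_along :: "real \<Rightarrow> 'm list list \<Rightarrow> ('m list \<Rightarrow> real) \<Rightarrow> real ^ 'n \<Rightarrow> real ^ 'n" where
  "move_along \<delta> [] \<sigma> x = x"
| "move_along \<delta> (I # Is) \<sigma> x = move_along \<delta> Is \<sigma> (bracket_move \<delta> I (\<sigma> I) x)"

lemma move_along_continuous_on:
  assumes "\<And>I. continuous_on S (\<lambda>v. \<sigma> v I)" "continuous_on S g"
  shows "continuous_on S (\<lambda>v. move_along \<delta> Is (\<sigma> v) (g v))"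
  using assms(2)
proof (induction Is arbitrary: g)
  case (Cons I Is)
  show ?case unfolding move_along.simps
    by (rule Cons.IH[OF bracket_move_continuous_on[OF assms(1) Cons.prems]])
qed simp

text \<open>All bracket fields are frozen at 0, to make the displacement linear in \<sigma>. The
  price is the term \<open>\<tau> ^ r * norm x\<close>, which for x near 0 is small against a
  displacement of order \<open>\<tau> ^ r\<close>.\<close>

lemma move_along_estimate:
  assumes "\<And>I. I \<in> set Is \<Longrightarrow> I \<noteq> [] \<and> length I \<le> r"
  shows "\<exists>K>0. \<forall>\<sigma> \<tau> x \<delta>. 0 \<le> \<tau> \<longrightarrow> \<tau> \<le> s0 \<longrightarrow> (\<forall>I\<in>set Is. \<bar>\<sigma> I\<bar> \<le> \<tau> ^ r) \<longrightarrow> 0 \<le> \<delta> \<longrightarrow>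
    norm x + K * (\<tau> + \<delta>) \<le> R \<longrightarrow>
    norm (move_along \<delta> Is \<sigma> x - (x + (\<Sum>I\<leftarrow>Is. \<sigma> I *\<^sub>R bracket_field I 0)))
      \<le> K * (\<tau> ^ r * norm x + \<tau> ^ Suc r + \<delta>)"
  using assms
proof (induction Is)
  case Nil
  then show ?case by (intro exI[of _ 1]) auto
next
  case (Cons I Is)
  have I: "I \<noteq> []" "length I \<le> r" using Cons.prems by auto
  obtain K1 where K1: "K1 > 0" "\<And>\<sigma> \<tau> x \<delta>. 0 \<le> \<tau> \<Longrightarrow> \<tau> \<le> s0 \<Longrightarrow> (\<forall>I\<in>set Is. \<bar>\<sigma> I\<bar> \<le> \<tau> ^ r) \<Longrightarrow> 0 \<le> \<delta> \<Longrightarrow>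
    norm x + K1 * (\<tau> + \<delta>) \<le> R \<Longrightarrow>
    norm (move_along \<delta> Is \<sigma> x - (x + (\<Sum>I\<leftarrow>Is. \<sigma> I *\<^sub>R bracket_field I 0)))
      \<le> K1 * (\<tau> ^ r * norm x + \<tau> ^ Suc r + \<delta>)"
    using Cons by auto
  obtain K2 where K2: "K2 > 0" "\<And>s \<tau> x \<delta>. 0 \<le> \<tau> \<Longrightarrow> \<tau> \<le> s0 \<Longrightarrow> \<bar>s\<bar> \<le> \<tau> ^ r \<Longrightarrow> 0 \<le> \<delta> \<Longrightarrow> norm x + K2 * (\<tau> + \<delta>) \<le> R \<Longrightarrow>
    norm (bracket_move \<delta> I s x - x) \<le> K2 * (\<tau> + \<delta>) \<and>
    norm (bracket_move \<delta> I s x - (x + s *\<^sub>R bracket_field I x)) \<le> K2 * (\<tau> ^ Suc r + \<delta>)"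
    using bracket_move_estimate[OF I] by blast
  obtain L where L: "L > 0" "L-lipschitz_on (cball 0 R) (bracket_field I)"
    by (rule smooth_on_lipschitz[OF smooth_bracket_field compact_cball R_\<Omega> convex_cball])
  define K where "K = K1 * K2 + K1 + K2 + L"
  have KK: "K1 * K2 > 0" using K1(1) K2(1) by simp
  have K: "K > 0" "K1 + K2 \<le> K" "K1 + L \<le> K" "K1 * K2 + K1 + K2 \<le> K"
    unfolding K_def using K1(1) K2(1) L(1) KK by linarith+
  have "norm (move_along \<delta> (I # Is) \<sigma> x - (x + (\<Sum>I\<leftarrow>I # Is. \<sigma> I *\<^sub>R bracket_field I 0)))
      \<le> K * (\<tau> ^ r * norm x + \<tau> ^ Suc r + \<delta>)"
    if \<tau>: "0 \<le> \<tau>" "\<tau> \<le> s0" and \<sigma>: "\<forall>I\<in>set (I # Is). \<bar>\<sigma> I\<bar> \<le> \<tau> ^ r" and \<delta>: "0 \<le> \<delta>"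
      and x: "norm x + K * (\<tau> + \<delta>) \<le> R" for \<sigma> \<tau> x \<delta>
  proof -
    let ?s = "\<sigma> I"
    define y where "y = bracket_move \<delta> I ?s x"
    have \<tau>\<delta>: "0 \<le> \<tau> + \<delta>" using \<tau> \<delta> by simp
    have "(K1 + K2) * (\<tau> + \<delta>) \<le> K * (\<tau> + \<delta>)" using K(2) \<tau>\<delta> by (rule mult_right_mono)
    then have K12: "K1 * (\<tau> + \<delta>) + K2 * (\<tau> + \<delta>) \<le> K * (\<tau> + \<delta>)" by (simp add: distrib_right)
    have nn: "K1 * (\<tau> + \<delta>) \<ge> 0" "K2 * (\<tau> + \<delta>) \<ge> 0" using K1(1) K2(1) \<tau>\<delta> by auto
    have "norm x + K2 * (\<tau> + \<delta>) \<le> R" using x K12 nn by linarith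
    from K2(2)[OF \<tau> _ \<delta> this, of ?s] \<sigma>
    have y: "norm (y - x) \<le> K2 * (\<tau> + \<delta>)" "norm (y - (x + ?s *\<^sub>R bracket_field I x)) \<le> K2 * (\<tau> ^ Suc r + \<delta>)"
      unfolding y_def by auto
    have ny: "norm y \<le> norm x + K2 * (\<tau> + \<delta>)" using norm_triangle_sub[of y x] y(1) by linarith
    have E1: "norm (move_along \<delta> Is \<sigma> y - (y + (\<Sum>I\<leftarrow>Is. \<sigma> I *\<^sub>R bracket_field I 0)))
      \<le> K1 * (\<tau> ^ r * norm y + \<tau> ^ Suc r + \<delta>)"
      using ny x K12 \<sigma> by (intro K1(2)[OF \<tau> _ \<delta>]) auto
    have \<tau>r: "0 \<le> \<tau> ^ r" "\<tau> ^ r \<le> 1" using \<tau> s0 by (auto intro: power_le_one)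
    have "\<tau> ^ r * norm y \<le> \<tau> ^ r * norm x + K2 * (\<tau> ^ r * \<tau> + \<tau> ^ r * \<delta>)"
      using mult_left_mono[OF ny \<tau>r(1)] by (simp add: algebra_simps)
    also have "\<tau> ^ r * \<delta> \<le> \<delta>" using \<tau>r \<delta> by (intro mult_left_le_one_le) auto
    finally have ty: "\<tau> ^ r * norm y \<le> \<tau> ^ r * norm x + K2 * (\<tau> ^ Suc r + \<delta>)"
      using K2(1) by (simp add: mult.commute)
    have "norm (?s *\<^sub>R (bracket_field I x - bracket_field I 0)) \<le> \<tau> ^ r * (L * norm x)"
    proof -
      have "norm x \<le> R" using x K(1) \<tau>\<delta> by (smt (verit) mult_nonneg_nonneg)
      then have "norm (bracket_field I x - bracket_field I 0) \<le> L * norm x"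
        using lipschitz_onD[OF L(2), of x 0] R by (simp add: dist_norm)
      then show ?thesis using \<sigma> unfolding norm_scaleR by (intro mult_mono \<tau>r) auto
    qed
    then have E2: "norm (?s *\<^sub>R (bracket_field I x - bracket_field I 0)) \<le> L * (\<tau> ^ r * norm x)"
      by (simp add: mult.left_commute)
    let ?S = "\<Sum>I\<leftarrow>Is. \<sigma> I *\<^sub>R bracket_field I 0"
    have eq: "move_along \<delta> Is \<sigma> y - (x + (?s *\<^sub>R bracket_field I 0 + ?S))
      = (move_along \<delta> Is \<sigma> y - (y + ?S)) + ((y - (x + ?s *\<^sub>R bracket_field I x)) + ?s *\<^sub>R (bracket_field I x - bracket_field I 0))"
      by (simp add: algebra_simps)
    have "norm (move_along \<delta> Is \<sigma> y - (x + (?s *\<^sub>R bracket_field I 0 + ?S)))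
      \<le> K1 * (\<tau> ^ r * norm y + \<tau> ^ Suc r + \<delta>) + (K2 * (\<tau> ^ Suc r + \<delta>) + L * (\<tau> ^ r * norm x))"
      unfolding eq by (intro order_trans[OF norm_triangle_ineq] add_mono E1 y(2) E2)
    also have "\<dots> \<le> K1 * (\<tau> ^ r * norm x + K2 * (\<tau> ^ Suc r + \<delta>) + \<tau> ^ Suc r + \<delta>) + (K2 * (\<tau> ^ Suc r + \<delta>) + L * (\<tau> ^ r * norm x))"
      using ty K1(1) by (intro add_right_mono mult_left_mono) auto
    also have "\<dots> = (K1 + L) * (\<tau> ^ r * norm x) + (K1 * K2 + K1 + K2) * (\<tau> ^ Suc r + \<delta>)"
      by (simp add: algebra_simps)
    also have "\<dots> \<le> K * (\<tau> ^ r * norm x) + K * (\<tau> ^ Suc r + \<delta>)"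
      using K \<tau>r \<tau>(1) \<delta> by (intro add_mono mult_right_mono) auto
    finally show ?thesis by (simp add: y_def[symmetric] algebra_simps)
  qed
  then show ?case using K(1) by blast
qed

section \<open>Duration and cost of the moves\<close>

lemma traj_flow:
  assumes tr: "traj \<Omega> X e T c x0 x" and s: "\<bar>s\<bar> \<le> s0" and \<delta>: "0 < \<delta>" and x: "norm x + (B * \<bar>s\<bar> + \<delta>) \<le> R"
  shows "traj \<Omega> X e (T + \<delta>) (c + \<bar>s\<bar>) x0 (Y \<delta> i s x 1)"
proof -
  define \<eta> where "\<eta> t = Y \<delta> i s x (t / \<delta>)" for t
  \<comment> \<open>A constant control of norm \<bar>s\<bar> / \<delta> over time \<delta>: the cost
    \<bar>s\<bar> does not see \<delta>.\<close>
  define u0 :: "real ^ 'm" where "u0 = (s / \<delta>) *\<^sub>R axis i 1"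
  have in01: "t / \<delta> \<in> {0..1}" if "t \<in> {0..\<delta>}" for t using that \<delta> by auto
  have sum: "(\<Sum>j\<in>UNIV. (u0 $ j) *\<^sub>R X j y) = (s / \<delta>) *\<^sub>R X i y" for y
  proof -
    have "(\<Sum>j\<in>UNIV. (u0 $ j) *\<^sub>R X j y) = (\<Sum>j\<in>UNIV. if j = i then (s / \<delta>) *\<^sub>R X i y else 0)"
      by (rule sum.cong) (auto simp: u0_def axis_def)
    then show ?thesis by simp
  qed
  have der: "(\<eta> has_vector_derivative (e + (\<Sum>j\<in>UNIV. (u0 $ j) *\<^sub>R X j (\<eta> t)))) (at t within {0..\<delta>})"
    if t: "t \<in> {0..\<delta>}" for t
  proof -
    have "((Y \<delta> i s x \<circ> (\<lambda>t. t / \<delta>)) has_vector_derivative (1 / \<delta>) *\<^sub>R (\<delta> *\<^sub>R e + s *\<^sub>R X i (Y \<delta> i s x (t / \<delta>)))) (at t within {0..\<delta>})"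
    proof (rule vector_diff_chain_within)
      show "((\<lambda>t. t / \<delta>) has_vector_derivative 1 / \<delta>) (at t within {0..\<delta>})"
        using \<delta> by (auto intro!: derivative_eq_intros simp: has_real_derivative_iff_has_vector_derivative[symmetric])
      show "(Y \<delta> i s x has_vector_derivative \<delta> *\<^sub>R e + s *\<^sub>R X i (Y \<delta> i s x (t / \<delta>))) (at (t / \<delta>) within (\<lambda>t. t / \<delta>) ` {0..\<delta>})"
        by (rule has_vector_derivative_within_subset[OF Y_deriv[OF s _ x in01[OF t]]]) (use \<delta> in01 in auto)
    qed
    moreover have "Y \<delta> i s x \<circ> (\<lambda>t. t / \<delta>) = \<eta>" by (simp add: fun_eq_iff \<eta>_def)
    moreover have "(1 / \<delta>) *\<^sub>R (\<delta> *\<^sub>R e + s *\<^sub>R X i (Y \<delta> i s x (t / \<delta>))) = e + (\<Sum>j\<in>UNIV. (u0 $ j) *\<^sub>R X j (\<eta> t))"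
      unfolding sum using \<delta> by (simp add: \<eta>_def scaleR_add_right)
    ultimately show ?thesis by simp
  qed
  have \<eta>in: "\<eta> t \<in> cball 0 R" if "t \<in> {0..\<delta>}" for t
    unfolding \<eta>_def using \<delta> by (intro Y_in[OF s _ x in01[OF that]]) simp
  obtain M where M: "M > 0" "\<And>y. y \<in> cball 0 R \<Longrightarrow> norm (X i y) \<le> M"
    by (rule smooth_on_bounded_compact[OF smooth_X compact_cball R_\<Omega>]) blast
  have "(norm e + \<bar>s / \<delta>\<bar> * M)-lipschitz_on {0..\<delta>} \<eta>"
  proof (rule lipschitz_onI)
    fix t t' assume t: "t \<in> {0..\<delta>}" "t' \<in> {0..\<delta>}"
    have "norm (e + (\<Sum>j\<in>UNIV. (u0 $ j) *\<^sub>R X j (\<eta> t))) \<le> norm e + \<bar>s / \<delta>\<bar> * M" if "t \<in> {0..\<delta>}" for t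
    proof -
      have "norm ((s / \<delta>) *\<^sub>R X i (\<eta> t)) \<le> \<bar>s / \<delta>\<bar> * M"
        unfolding norm_scaleR using M(2)[OF \<eta>in[OF that]] by (intro mult_left_mono) auto
      then show ?thesis unfolding sum by (intro norm_triangle_mono) auto
    qed
    from vector_derivative_bound[OF der this t(2,1)]
    show "dist (\<eta> t) (\<eta> t') \<le> (norm e + \<bar>s / \<delta>\<bar> * M) * dist t t'"
      by (simp add: dist_norm)
  qed (use M(1) in simp)
  moreover have "\<eta> ` {0..\<delta>} \<subseteq> \<Omega>" using \<eta>in R_\<Omega> by blast
  moreover have "\<eta> 0 = x" by (simp add: \<eta>_def Y_start)
  ultimately have "traj \<Omega> X e (T + \<delta>) (c + \<delta> * norm u0) x0 (\<eta> \<delta>)"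
    using \<delta> by (intro traj_snoc[OF tr _ _ _ _ der]) auto
  moreover have "\<delta> * norm u0 = \<bar>s\<bar>" using \<delta> by (simp add: u0_def norm_axis_1)
  moreover have "\<eta> \<delta> = Y \<delta> i s x 1" using \<delta> by (simp add: \<eta>_def)
  ultimately show ?thesis by simp
qed

lemma traj_run:
  fixes t \<delta> T c :: real
  assumes "unit_program W" "\<bar>t\<bar> \<le> s0" "0 < \<delta>" "norm x + length W * (B * \<bar>t\<bar> + \<delta>) \<le> R" "traj \<Omega> X e T c x0 x"
  shows "traj \<Omega> X e (T + length W * \<delta>) (c + length W * \<bar>t\<bar>) x0 (run \<delta> t W x)"
  using assms(1,4,5)
proof (induction W arbitrary: x T c)
  case (Cons ic W)
  obtain i c' where ic: "ic = (i, c')" by (cases ic)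
  let ?b = "B * \<bar>t\<bar> + \<delta>" and ?x = "Y \<delta> i (c' * t) x 1"
  have b: "?b \<ge> 0" using B assms(3) by simp
  have c: "\<bar>c'\<bar> \<le> 1" and W: "unit_program W" using Cons.prems(1) by (auto simp: ic unit_program_Cons)
  have \<delta>: "0 \<le> \<delta>" using assms(3) by simp
  have "norm x + ?b \<le> R" using Cons.prems(2) mult_nonneg_nonneg[OF of_nat_0_le_iff b, of "length W"] by (simp add: algebra_simps)
  note st = Y_step(1,2)[OF c assms(2) \<delta> this] Y_step(3)[OF c assms(2) \<delta> this, of i]
  have "traj \<Omega> X e (T + \<delta>) (c + \<bar>c' * t\<bar>) x0 ?x"
    by (rule traj_flow[OF Cons.prems(3) st(1) assms(3) st(2)])
  moreover have "\<bar>c' * t\<bar> \<le> \<bar>t\<bar>" using c by (simp add: abs_mult mult_left_le_one_le)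
  ultimately have tr: "traj \<Omega> X e (T + \<delta>) (c + \<bar>t\<bar>) x0 ?x" using traj_mono_cost by (metis add_left_mono)
  have "norm ?x + length W * ?b \<le> R"
    using st(3) norm_triangle_sub[of ?x x] Cons.prems(2) by (simp add: algebra_simps)
  from Cons.IH[OF W this tr] show ?case by (simp add: ic algebra_simps)
qed simp

text \<open>Every letter takes time \<delta> and costs at most \<tau>, so the duration grows by a
  multiple of \<delta> and the cost by a multiple of \<tau>. The displacement bound is carried along
  to keep the next move inside the ball.\<close>

lemma traj_bracket_move:
  assumes I: "I \<noteq> []" "length I \<le> r"
  shows "\<exists>K>0. \<forall>s \<tau> x \<delta> T c x0. 0 \<le> \<tau> \<longrightarrow> \<tau> \<le> s0 \<longrightarrow> \<bar>s\<bar> \<le> \<tau> ^ r \<longrightarrow> 0 < \<delta> \<longrightarrow> norm x + K * (\<tau> + \<delta>) \<le> R \<longrightarrow>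
    traj \<Omega> X e T c x0 x \<longrightarrow>
    norm (bracket_move \<delta> I s x - x) \<le> K * (\<tau> + \<delta>) \<and>
    (\<exists>T'\<le>T + K * \<delta>. traj \<Omega> X e T' (c + K * \<tau>) x0 (bracket_move \<delta> I s x))"
proof -
  let ?l = "length I" and ?W = "bracket_program I" and ?V = "inverse_program (bracket_program I)"
  have l: "0 < ?l" using I by simp
  define n where "n = real (length ?W)"
  have n: "n \<ge> 0" by (simp add: n_def)
  define K where "K = 2 * n * (B + 1) + 1"
  have nB: "n * (B + 1) \<ge> 0" "n * B \<ge> 0" using n B by auto
  have K: "K > 0" "2 * n * (B + 1) \<le> K" "2 * n \<le> K"
    unfolding K_def using nB n by (auto simp: algebra_simps)
  have "norm (bracket_move \<delta> I s x - x) \<le> K * (\<tau> + \<delta>) \<and>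
    (\<exists>T'\<le>T + K * \<delta>. traj \<Omega> X e T' (c + K * \<tau>) x0 (bracket_move \<delta> I s x))"
    if \<tau>: "0 \<le> \<tau>" "\<tau> \<le> s0" and s: "\<bar>s\<bar> \<le> \<tau> ^ r" and \<delta>: "0 < \<delta>" and x: "norm x + K * (\<tau> + \<delta>) \<le> R"
      and tr: "traj \<Omega> X e T c x0 x" for s \<tau> x \<delta> T c x0
  proof -
    have \<tau>1: "\<tau> \<le> 1" using \<tau> s0 by simp
    define t1 t2 where "t1 = root ?l (max s 0)" and "t2 = root ?l (max (- s) 0)"
    have s12: "0 \<le> max s 0" "max s 0 \<le> \<tau> ^ r" "0 \<le> max (- s) 0" "max (- s) 0 \<le> \<tau> ^ r" using s by auto
    note t1 = root_bounds[OF l I(2) \<tau>(1) \<tau>1 s12(1,2), folded t1_def]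
    note t2 = root_bounds[OF l I(2) \<tau>(1) \<tau>1 s12(3,4), folded t2_def]
    have t12: "\<bar>t1\<bar> = t1" "\<bar>t2\<bar> = t2" "\<bar>t1\<bar> \<le> s0" "\<bar>t2\<bar> \<le> s0" using t1(1,2) t2(1,2) \<tau>(2) by auto
    define y where "y = run \<delta> t1 ?W x"
    define v where "v = run \<delta> t2 ?V y"
    have v: "bracket_move \<delta> I s x = v" by (simp add: bracket_move_def v_def y_def t1_def t2_def)
    have bt: "n * (B * t + \<delta>) \<le> n * (B + 1) * (\<tau> + \<delta>)" if "0 \<le> t" "t \<le> \<tau>" for t
    proof -
      have "B * t \<le> B * \<tau>" "0 \<le> B * \<delta>" using that(2) B \<delta> by auto
      moreover have "(B + 1) * (\<tau> + \<delta>) = B * \<tau> + B * \<delta> + \<tau> + \<delta>" by (simp add: algebra_simps)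
      ultimately have "B * t + \<delta> \<le> (B + 1) * (\<tau> + \<delta>)" using \<tau>(1) by linarith
      then show ?thesis using n by (simp add: mult.assoc mult_left_mono)
    qed
    have two: "n * (B + 1) * (\<tau> + \<delta>) + n * (B + 1) * (\<tau> + \<delta>) \<le> K * (\<tau> + \<delta>)"
    proof -
      have "2 * n * (B + 1) * (\<tau> + \<delta>) \<le> K * (\<tau> + \<delta>)" using K(2) \<tau> \<delta> by (intro mult_right_mono) auto
      then show ?thesis by simp
    qed
    have nn: "n * (B + 1) * (\<tau> + \<delta>) \<ge> 0" using nB \<tau> \<delta> by simp
    have \<delta>0: "0 \<le> \<delta>" using \<delta> by simp
    have x1: "norm x + length ?W * (B * \<bar>t1\<bar> + \<delta>) \<le> R"
      unfolding t12 using bt[OF t1(1,2)] two x nn by (simp add: n_def[symmetric])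
    have y1: "norm (y - x) \<le> n * (B + 1) * (\<tau> + \<delta>)"
      using run_dist[OF unit_bracket_program t12(3) \<delta>0 x1] bt[OF t1(1,2)]
      by (simp add: y_def t12 n_def[symmetric])
    have y2: "norm y + length ?V * (B * \<bar>t2\<bar> + \<delta>) \<le> R"
      unfolding t12 using y1 norm_triangle_sub[of y x] bt[OF t2(1,2)] two x
      by (simp add: n_def[symmetric] length_inverse_program)
    have v1: "norm (v - y) \<le> n * (B + 1) * (\<tau> + \<delta>)"
      using run_dist[OF unit_inverse_bracket_program t12(4) \<delta>0 y2] bt[OF t2(1,2)]
      by (simp add: v_def t12 n_def[symmetric] length_inverse_program)
    have vx: "norm (v - x) \<le> K * (\<tau> + \<delta>)"
      using norm_triangle_ineq[of "v - y" "y - x"] v1 y1 two by simp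
    have "traj \<Omega> X e (T + n * \<delta> + n * \<delta>) (c + n * t1 + n * t2) x0 v"
      using traj_run[OF unit_inverse_bracket_program t12(4) \<delta> y2
          traj_run[OF unit_bracket_program t12(3) \<delta> x1 tr, folded y_def], folded v_def]
      by (simp add: n_def length_inverse_program t12)
    moreover have "c + n * t1 + n * t2 \<le> c + K * \<tau>"
      using mult_left_mono[OF t1(2) n] mult_left_mono[OF t2(2) n] mult_right_mono[OF K(3) \<tau>(1)] by linarith
    moreover have "T + n * \<delta> + n * \<delta> \<le> T + K * \<delta>"
      using mult_right_mono[OF K(3) \<delta>0] by linarith
    ultimately show ?thesis using vx v traj_mono_cost by blast
  qed
  then show ?thesis using K(1) by blast
qed

lemma traj_move_along:
  assumes "\<And>I. I \<in> set Is \<Longrightarrow> I \<noteq> [] \<and> length I \<le> r"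
  shows "\<exists>K>0. \<forall>\<sigma> \<tau> x \<delta> T c x0. 0 \<le> \<tau> \<longrightarrow> \<tau> \<le> s0 \<longrightarrow> (\<forall>I\<in>set Is. \<bar>\<sigma> I\<bar> \<le> \<tau> ^ r) \<longrightarrow> 0 < \<delta> \<longrightarrow>
    norm x + K * (\<tau> + \<delta>) \<le> R \<longrightarrow> traj \<Omega> X e T c x0 x \<longrightarrow>
    (\<exists>T'\<le>T + K * \<delta>. traj \<Omega> X e T' (c + K * \<tau>) x0 (move_along \<delta> Is \<sigma> x))"
  using assms
proof (induction Is)
  case Nil
  have "\<exists>T'\<le>T + 1 * \<delta>. traj \<Omega> X e T' (c + 1 * \<tau>) x0 x" if "0 \<le> \<tau>" "0 < \<delta>" "traj \<Omega> X e T c x0 x" for T \<delta> c \<tau> x0 x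
    using that traj_mono_cost[OF that(3), of "c + 1 * \<tau>"] by (intro exI[of _ T]) auto
  then show ?case by (intro exI[of _ 1]) (simp only: move_along.simps, blast intro: zero_less_one)
next
  case (Cons I Is)
  have I: "I \<noteq> []" "length I \<le> r" using Cons.prems by auto
  obtain K1 where K1: "K1 > 0" "\<And>\<sigma> \<tau> x \<delta> T c x0. 0 \<le> \<tau> \<Longrightarrow> \<tau> \<le> s0 \<Longrightarrow> (\<forall>I\<in>set Is. \<bar>\<sigma> I\<bar> \<le> \<tau> ^ r) \<Longrightarrow> 0 < \<delta> \<Longrightarrow>
    norm x + K1 * (\<tau> + \<delta>) \<le> R \<Longrightarrow> traj \<Omega> X e T c x0 x \<Longrightarrow>
    \<exists>T'\<le>T + K1 * \<delta>. traj \<Omega> X e T' (c + K1 * \<tau>) x0 (move_along \<delta> Is \<sigma> x)"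
    using Cons.IH[OF Cons.prems] by auto
  obtain K2 where K2: "K2 > 0" "\<And>s \<tau> x \<delta> T c x0. 0 \<le> \<tau> \<Longrightarrow> \<tau> \<le> s0 \<Longrightarrow> \<bar>s\<bar> \<le> \<tau> ^ r \<Longrightarrow> 0 < \<delta> \<Longrightarrow> norm x + K2 * (\<tau> + \<delta>) \<le> R \<Longrightarrow>
    traj \<Omega> X e T c x0 x \<Longrightarrow> norm (bracket_move \<delta> I s x - x) \<le> K2 * (\<tau> + \<delta>) \<and>
    (\<exists>T'\<le>T + K2 * \<delta>. traj \<Omega> X e T' (c + K2 * \<tau>) x0 (bracket_move \<delta> I s x))"
    using traj_bracket_move[OF I] by blast
  have "\<exists>T'\<le>T + (K1 + K2) * \<delta>. traj \<Omega> X e T' (c + (K1 + K2) * \<tau>) x0 (move_along \<delta> (I # Is) \<sigma> x)"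
    if \<tau>: "0 \<le> \<tau>" "\<tau> \<le> s0" and \<sigma>: "\<forall>I\<in>set (I # Is). \<bar>\<sigma> I\<bar> \<le> \<tau> ^ r" and \<delta>: "0 < \<delta>"
      and x: "norm x + (K1 + K2) * (\<tau> + \<delta>) \<le> R" and tr: "traj \<Omega> X e T c x0 x" for \<sigma> \<tau> x \<delta> T c x0
  proof -
    let ?y = "bracket_move \<delta> I (\<sigma> I) x"
    have nn: "K1 * (\<tau> + \<delta>) \<ge> 0" using K1(1) \<tau> \<delta> by simp
    have x': "norm x + K1 * (\<tau> + \<delta>) + K2 * (\<tau> + \<delta>) \<le> R" using x by (simp add: algebra_simps)
    then have "norm x + K2 * (\<tau> + \<delta>) \<le> R" using nn by linarith
    from K2(2)[OF \<tau> _ \<delta> this tr, of "\<sigma> I"] \<sigma> obtain T1 where T1: "norm (?y - x) \<le> K2 * (\<tau> + \<delta>)"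
      "T1 \<le> T + K2 * \<delta>" "traj \<Omega> X e T1 (c + K2 * \<tau>) x0 ?y" by auto
    have "norm ?y + K1 * (\<tau> + \<delta>) \<le> R" using T1(1) norm_triangle_sub[of ?y x] x' by linarith
    from K1(2)[OF \<tau> _ \<delta> this T1(3), of \<sigma>] \<sigma> obtain T2 where
      T2: "T2 \<le> T1 + K1 * \<delta>" "traj \<Omega> X e T2 (c + K2 * \<tau> + K1 * \<tau>) x0 (move_along \<delta> Is \<sigma> ?y)" by auto
    have "c + K2 * \<tau> + K1 * \<tau> = c + (K1 + K2) * \<tau>" by (simp add: algebra_simps)
    with T2(2) have "traj \<Omega> X e T2 (c + (K1 + K2) * \<tau>) x0 (move_along \<delta> Is \<sigma> ?y)" by (simp only:)
    moreover have "T2 \<le> T + (K1 + K2) * \<delta>" using T1(2) T2(1) by (simp add: algebra_simps)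
    ultimately show ?thesis by auto
  qed
  then show ?case using K1(1) K2(1) by (intro exI[of _ "K1 + K2"]) (simp only: add_pos_pos, blast)
qed

text \<open>There are finitely many words of length at most r, so each standard basis vector is a
  finite combination of these brackets. Extending its coefficients linearly makes them continuous in
  v and bounded by a multiple of the norm of v.\<close>

lemma bracket_combination:
  assumes "span {bracket_field I 0 | I. I \<noteq> [] \<and> length I \<le> r} = UNIV"
  obtains Is and \<sigma> :: "real ^ 'n \<Rightarrow> 'm list \<Rightarrow> real" and M where
    "\<And>I. I \<in> set Is \<Longrightarrow> I \<noteq> [] \<and> length I \<le> r" "M > 0" "\<And>v I. \<bar>\<sigma> v I\<bar> \<le> M * norm v"
    "\<And>I. continuous_on UNIV (\<lambda>v. \<sigma> v I)" "\<And>v. (\<Sum>I\<leftarrow>Is. \<sigma> v I *\<^sub>R bracket_field I 0) = v"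
proof -
  let ?W = "{I :: 'm list. I \<noteq> [] \<and> length I \<le> r}"
  have finW: "finite ?W" by (rule finite_subset[OF _ finite_words[of "Suc r"]]) auto
  let ?C = "{\<Sum>I\<in>?W. c I *\<^sub>R bracket_field I 0 | c. True}"
  have "span {bracket_field I 0 | I. I \<in> ?W} \<subseteq> ?C"
  proof (rule span_minimal)
    show "{bracket_field I 0 | I. I \<in> ?W} \<subseteq> ?C"
    proof clarify
      fix J :: "'m list" assume J: "J \<noteq> []" "length J \<le> r"
      have "(\<Sum>I\<in>?W. (if I = J then 1 else 0) *\<^sub>R bracket_field I 0) = (\<Sum>I\<in>?W. if I = J then bracket_field J 0 else 0)"
        by (rule sum.cong) auto
      also have "\<dots> = bracket_field J 0" using finW J by simp
      finally show "\<exists>c. bracket_field J 0 = (\<Sum>I\<in>?W. c I *\<^sub>R bracket_field I 0) \<and> True"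
        by (intro exI[of _ "\<lambda>I. if I = J then 1 else 0"]) simp
    qed
    show "subspace ?C"
      unfolding subspace_def
    proof (intro conjI ballI allI)
      show "0 \<in> ?C" by (auto intro!: exI[of _ "\<lambda>_. 0"])
      fix x assume "x \<in> ?C"
      then obtain c where c: "x = (\<Sum>I\<in>?W. c I *\<^sub>R bracket_field I 0)" by auto
      show "a *\<^sub>R x \<in> ?C" for a
        by (auto simp: c scaleR_sum_right intro!: exI[of _ "\<lambda>I. a * c I"])
      fix y assume "y \<in> ?C"
      then obtain d where d: "y = (\<Sum>I\<in>?W. d I *\<^sub>R bracket_field I 0)" by auto
      show "x + y \<in> ?C"
        by (auto simp: c d sum.distrib scaleR_add_left intro!: exI[of _ "\<lambda>I. c I + d I"])
    qed
  qed
  then have "?C = UNIV" using assms by auto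
  then have "\<forall>j. \<exists>c. (axis j 1 :: real ^ 'n) = (\<Sum>I\<in>?W. c I *\<^sub>R bracket_field I 0)" by blast
  from choice[OF this] obtain c :: "'n \<Rightarrow> 'm list \<Rightarrow> real" where
    c: "\<And>j. (axis j 1 :: real ^ 'n) = (\<Sum>I\<in>?W. c j I *\<^sub>R bracket_field I 0)" by blast
  obtain Is where Is: "set Is = ?W" "distinct Is" using finite_distinct_list[OF finW] by blast
  define \<sigma> where "\<sigma> v I = (if I \<in> ?W then \<Sum>j\<in>UNIV. v $ j * c j I else 0)" for v :: "real ^ 'n" and I
  define M where "M = 1 + (\<Sum>I\<in>?W. \<Sum>j\<in>UNIV. \<bar>c j I\<bar>)"
  show ?thesis
  proof (rule that[of Is M \<sigma>])
    show "M > 0" unfolding M_def by (intro add_pos_nonneg sum_nonneg) auto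
    show "I \<noteq> [] \<and> length I \<le> r" if "I \<in> set Is" for I using that Is by auto
    show "continuous_on UNIV (\<lambda>v. \<sigma> v I)" for I
      by (cases "I \<in> ?W") (auto simp: \<sigma>_def intro!: continuous_on_sum continuous_on_mult continuous_on_component)
    show "\<bar>\<sigma> v I\<bar> \<le> M * norm v" for v I
    proof (cases "I \<in> ?W")
      case True
      have "\<bar>\<sigma> v I\<bar> \<le> (\<Sum>j\<in>UNIV. \<bar>v $ j * c j I\<bar>)" using True by (simp add: \<sigma>_def)
      also have "\<dots> \<le> (\<Sum>j\<in>UNIV. \<bar>c j I\<bar> * norm v)"
        by (rule sum_mono) (auto simp: abs_mult mult.commute[of _ "norm v"] intro!: mult_right_mono component_le_norm_cart)
      also have "\<dots> = (\<Sum>j\<in>UNIV. \<bar>c j I\<bar>) * norm v" by (simp only: sum_distrib_right)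
      also have "\<dots> \<le> M * norm v"
      proof (rule mult_right_mono)
        show "(\<Sum>j\<in>UNIV. \<bar>c j I\<bar>) \<le> M"
          unfolding M_def using member_le_sum[OF True _ finW, of "\<lambda>I. \<Sum>j\<in>UNIV. \<bar>c j I\<bar>"] by (simp add: sum_nonneg)
      qed simp
      finally show ?thesis .
    next
      case False
      then have "\<sigma> v I = 0" unfolding \<sigma>_def by (rule if_not_P)
      then show ?thesis using \<open>M > 0\<close> by simp
    qed
    show "(\<Sum>I\<leftarrow>Is. \<sigma> v I *\<^sub>R bracket_field I 0) = v" for v
    proof -
      have "(\<Sum>I\<leftarrow>Is. \<sigma> v I *\<^sub>R bracket_field I 0) = (\<Sum>I\<in>?W. \<sigma> v I *\<^sub>R bracket_field I 0)"
        using Is by (simp add: sum_list_distinct_conv_sum_set)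
      also have "\<dots> = (\<Sum>I\<in>?W. \<Sum>j\<in>UNIV. (v $ j) *\<^sub>R (c j I *\<^sub>R bracket_field I 0))"
        by (rule sum.cong) (auto simp: \<sigma>_def scaleR_sum_left)
      also have "\<dots> = (\<Sum>j\<in>UNIV. (v $ j) *\<^sub>R axis j 1)"
        by (subst sum.swap) (simp add: c scaleR_sum_right)
      also have "\<dots> = v" by (rule sum_axis)
      finally show ?thesis .
    qed
  qed
qed

section \<open>Exact steering to a nearby point\<close>

text \<open>The endpoint \<open>G v\<close> of the moves with coefficients \<open>\<sigma> v\<close>
  is p + v up to an error of at most D on the ball of radius 2 D. Since y is within D of p, the map
  from v to \<open>y - G v + v\<close> preserves this ball, and a fixed point satisfies
  \<open>G v = y\<close>. The time allowance h only limits \<delta>, so the cost bound is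
  independent of it.\<close>

lemma local_reachability:
  assumes r: "1 \<le> r" and span: "span {bracket_field I 0 | I. I \<noteq> [] \<and> length I \<le> r} = UNIV"
  shows "\<exists>C>0. \<exists>\<rho>>0. \<forall>p y D h T c x0. norm p \<le> \<rho> \<longrightarrow> 0 < D \<longrightarrow> D \<le> \<rho> \<longrightarrow> norm (y - p) \<le> D \<longrightarrow> 0 < h \<longrightarrow>
    traj \<Omega> X e T c x0 p \<longrightarrow> (\<exists>T'\<le>T + h. traj \<Omega> X e T' (c + C * D powr (1 / real r)) x0 y)"
proof -
  obtain Is M \<sigma> where Is: "\<And>I. I \<in> set Is \<Longrightarrow> I \<noteq> [] \<and> length I \<le> r" and M: "M > 0" "\<And>v I. \<bar>\<sigma> v I\<bar> \<le> M * norm v"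
    and \<sigma>: "\<And>I. continuous_on UNIV (\<lambda>v. \<sigma> v I)" "\<And>v. (\<Sum>I\<leftarrow>Is. \<sigma> v I *\<^sub>R bracket_field I 0) = v"
    by (rule bracket_combination[OF span]) blast
  obtain K1 where K1: "K1 > 0" "\<And>\<sigma> \<tau> x \<delta>. 0 \<le> \<tau> \<Longrightarrow> \<tau> \<le> s0 \<Longrightarrow> (\<forall>I\<in>set Is. \<bar>\<sigma> I\<bar> \<le> \<tau> ^ r) \<Longrightarrow> 0 \<le> \<delta> \<Longrightarrow>
    norm x + K1 * (\<tau> + \<delta>) \<le> R \<Longrightarrow>
    norm (move_along \<delta> Is \<sigma> x - (x + (\<Sum>I\<leftarrow>Is. \<sigma> I *\<^sub>R bracket_field I 0))) \<le> K1 * (\<tau> ^ r * norm x + \<tau> ^ Suc r + \<delta>)"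
    using move_along_estimate[of Is r, OF Is] by blast
  obtain K2 where K2: "K2 > 0" "\<And>\<sigma> \<tau> x \<delta> T c x0. 0 \<le> \<tau> \<Longrightarrow> \<tau> \<le> s0 \<Longrightarrow> (\<forall>I\<in>set Is. \<bar>\<sigma> I\<bar> \<le> \<tau> ^ r) \<Longrightarrow> 0 < \<delta> \<Longrightarrow>
    norm x + K2 * (\<tau> + \<delta>) \<le> R \<Longrightarrow> traj \<Omega> X e T c x0 x \<Longrightarrow>
    \<exists>T'\<le>T + K2 * \<delta>. traj \<Omega> X e T' (c + K2 * \<tau>) x0 (move_along \<delta> Is \<sigma> x)"
    using traj_move_along[of Is r, OF Is] by blast
  define K where "K = max K1 K2"
  have K: "K > 0" "K1 \<le> K" "K2 \<le> K" using K1(1) K2(1) by (auto simp: K_def)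
  \<comment> \<open>\<open>R / (4 * K)\<close> keeps the moves inside the ball of radius R. The
    bounds by \<open>1 / (6 * K * M)\<close>, here on \<tau> and below on the norm of p, make two of
    the error terms at most D / 3 each, because their factor \<open>\<tau> ^ r\<close> will be
    \<open>2 * M * D\<close>.\<close>
  define \<tau>0 where "\<tau>0 = min s0 (min (R / (4 * K)) (1 / (6 * K * M)))"
  have \<tau>0: "\<tau>0 > 0" "\<tau>0 \<le> s0" "\<tau>0 \<le> R / (4 * K)" "\<tau>0 \<le> 1 / (6 * K * M)"
    using s0 R K(1) M(1) by (auto simp: \<tau>0_def)
  \<comment> \<open>The last entry ensures that D \<le> \<rho> implies \<tau> \<le> \<tau>0.\<close>
  define \<rho> where "\<rho> = min (R / 2) (min (1 / (6 * K * M)) (\<tau>0 ^ r / (2 * M)))"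
  have \<rho>: "\<rho> > 0" "\<rho> \<le> R / 2" "\<rho> \<le> 1 / (6 * K * M)" "\<rho> \<le> \<tau>0 ^ r / (2 * M)"
    using R K(1) M(1) \<tau>0(1) by (auto simp: \<rho>_def)
  define C where "C = K * (2 * M) powr (1 / real r)"
  have C: "C > 0" using K(1) M(1) by (simp add: C_def)
  have "\<exists>T'\<le>T + h. traj \<Omega> X e T' (c + C * D powr (1 / real r)) x0 y"
    if p: "norm p \<le> \<rho>" and D: "0 < D" "D \<le> \<rho>" and y: "norm (y - p) \<le> D" and h: "0 < h"
      and tr: "traj \<Omega> X e T c x0 p" for p y D h T c x0
  proof -
    \<comment> \<open>The scale is fitted to the ball: for v of norm at most 2 D the coefficients
      are bounded by \<open>2 * M * D\<close>, that is by \<open>\<tau> ^ r\<close>.\<close>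
    define \<tau> where "\<tau> = root r (2 * M * D)"
    have MD: "2 * M * D > 0" using M(1) D by simp
    have \<tau>: "\<tau> > 0" "\<tau> ^ r = 2 * M * D" using r MD by (auto simp: \<tau>_def)
    have "D \<le> \<tau>0 ^ r / (2 * M)" using D(2) \<rho>(4) by linarith
    then have "2 * M * D \<le> \<tau>0 ^ r" using M(1) by (simp add: field_simps)
    then have "\<tau> \<le> root r (\<tau>0 ^ r)" unfolding \<tau>_def using r by simp
    then have \<tau>\<tau>0: "\<tau> \<le> \<tau>0" using r \<tau>0(1) by (simp add: real_root_power_cancel)
    \<comment> \<open>Chosen after D and h. The three entries serve the time allowance, the domain
      of the flows and the last third of the error.\<close>
    define \<delta> where "\<delta> = min (h / K) (min (R / (4 * K)) (D / (3 * K)))"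
    have \<delta>: "\<delta> > 0" "\<delta> \<le> h / K" "\<delta> \<le> R / (4 * K)" "\<delta> \<le> D / (3 * K)"
      using h K(1) R D by (auto simp: \<delta>_def)
    have K\<delta>: "K * \<delta> \<le> h" "K * \<delta> \<le> R / 4" "K * \<delta> \<le> D / 3" using \<delta> K(1) by (auto simp: field_simps)
    have "\<tau> \<le> R / (4 * K)" using \<tau>\<tau>0 \<tau>0(3) by linarith
    then have "K * \<tau> \<le> R / 4" using K(1) by (simp add: field_simps)
    then have pK: "norm p + K * (\<tau> + \<delta>) \<le> R" using p \<rho>(2) K\<delta>(2) by (simp add: distrib_left)
    have \<tau>\<delta>: "0 \<le> \<tau> + \<delta>" using \<tau> \<delta> by simp
    have pK1: "norm p + K1 * (\<tau> + \<delta>) \<le> R" and pK2: "norm p + K2 * (\<tau> + \<delta>) \<le> R"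
      using mult_right_mono[OF K(2) \<tau>\<delta>] mult_right_mono[OF K(3) \<tau>\<delta>] pK by linarith+
    have \<sigma>b: "\<forall>I\<in>set Is. \<bar>\<sigma> v I\<bar> \<le> \<tau> ^ r" if "v \<in> cball 0 (2 * D)" for v
    proof
      fix I
      have "M * norm v \<le> M * (2 * D)" using that M(1) by (intro mult_left_mono) auto
      then show "\<bar>\<sigma> v I\<bar> \<le> \<tau> ^ r" using M(2)[of v I] \<tau>(2) by simp
    qed
    have \<tau>s: "0 \<le> \<tau>" "\<tau> \<le> s0" using \<tau>(1) \<tau>\<tau>0 \<tau>0(2) by auto
    define G where "G v = move_along \<delta> Is (\<sigma> v) p" for v
    have err: "norm (G v - (p + v)) \<le> D" if v: "v \<in> cball 0 (2 * D)" for v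
    proof -
      have "norm (G v - (p + v)) \<le> K1 * (\<tau> ^ r * norm p + \<tau> ^ Suc r + \<delta>)"
        using K1(2)[OF \<tau>s \<sigma>b[OF v] _ pK1] \<delta>(1) by (simp add: G_def \<sigma>(2))
      also have "\<dots> \<le> K * (\<tau> ^ r * norm p + \<tau> ^ Suc r + \<delta>)"
        using K(2) \<tau>(1) \<delta>(1) by (intro mult_right_mono) auto
      also have "\<dots> = 2 * M * D * (K * norm p) + 2 * M * D * (K * \<tau>) + K * \<delta>"
        by (simp add: \<tau>(2) algebra_simps)
      also have "\<dots> \<le> D / 3 + D / 3 + D / 3"
      proof (intro add_mono K\<delta>(3))
        have "norm p \<le> 1 / (6 * K * M)" using p \<rho>(3) by linarith
        then have "K * norm p \<le> 1 / (6 * M)" using K(1) M(1) by (simp add: field_simps)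
        from mult_left_mono[OF this, of "2 * M * D"] show "2 * M * D * (K * norm p) \<le> D / 3"
          using MD M(1) by simp
        have "\<tau> \<le> 1 / (6 * K * M)" using \<tau>\<tau>0 \<tau>0(4) by linarith
        then have "K * \<tau> \<le> 1 / (6 * M)" using K(1) M(1) by (simp add: field_simps)
        from mult_left_mono[OF this, of "2 * M * D"] show "2 * M * D * (K * \<tau>) \<le> D / 3"
          using MD M(1) by simp
      qed
      finally show ?thesis by simp
    qed
    have contG: "continuous_on (cball 0 (2 * D)) G"
      unfolding G_def
      by (intro move_along_continuous_on continuous_on_const continuous_on_subset[OF \<sigma>(1)]) auto
    obtain v where v: "v \<in> cball 0 (2 * D)" "y - G v + v = v"
    proof (rule brouwer[of "cball 0 (2 * D) :: (real ^ 'n) set" "\<lambda>v. y - G v + v"])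
      show "continuous_on (cball 0 (2 * D)) (\<lambda>v. y - G v + v)"
        by (intro continuous_on_add continuous_on_diff continuous_on_const continuous_on_id contG)
      show "(\<lambda>v. y - G v + v) \<in> cball 0 (2 * D) \<rightarrow> cball 0 (2 * D)"
      proof
        fix v :: "real ^ 'n" assume "v \<in> cball 0 (2 * D)"
        have "y - G v + v = (y - p) - (G v - (p + v))" by simp
        then have "norm (y - G v + v) \<le> norm (y - p) + norm (G v - (p + v))"
          by (simp only: norm_triangle_ineq4)
        then show "y - G v + v \<in> cball 0 (2 * D)" using y err[OF \<open>v \<in> _\<close>] by simp
      qed
    qed (use D in auto)
    then have Gv: "G v = y" by simp
    obtain T' where T': "T' \<le> T + K2 * \<delta>" "traj \<Omega> X e T' (c + K2 * \<tau>) x0 y"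
      using K2(2)[OF \<tau>s \<sigma>b[OF v(1)] \<delta>(1) pK2 tr] Gv unfolding G_def by auto
    have "K2 * \<delta> \<le> h" using mult_right_mono[OF K(3), of \<delta>] \<delta>(1) K\<delta>(1) by linarith
    moreover have "K2 * \<tau> \<le> C * D powr (1 / real r)"
    proof -
      have "\<tau> = (2 * M * D) powr (1 / real r)"
        unfolding \<tau>_def using r MD by (simp add: root_powr_inverse)
      also have "\<dots> = (2 * M) powr (1 / real r) * D powr (1 / real r)"
        by (rule powr_mult)
      finally have "K * \<tau> = C * D powr (1 / real r)" by (simp add: C_def)
      then show ?thesis using mult_right_mono[OF K(3), of \<tau>] \<tau>(1) by simp
    qed
    ultimately show ?thesis using T' traj_mono_cost[OF T'(2), of "c + C * D powr (1 / real r)"]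
      by (intro exI[of _ T']) auto
  qed
  then show ?thesis using C \<rho>(1) by blast
qed

end

subsection \<open>Smooth functions and tangent vectors on a manifold\<close>

lemma chart_homeomorphism:
  assumes "is_chart (U, \<phi>)"
  shows "open U" "open (\<phi> ` U)" "inj_on \<phi> U" "continuous_on U \<phi>" "continuous_on (\<phi> ` U) (inv_into U \<phi>)"
proof -
  obtain \<psi> where h: "homeomorphism U (\<phi> ` U) \<phi> \<psi>" and o: "open U" "open (\<phi> ` U)"
    using assms by (auto simp: is_chart_def)
  show "open U" "open (\<phi> ` U)" by fact+
  show inj: "inj_on \<phi> U" using h by (auto simp: homeomorphism_def intro: inj_on_inverseI)
  show "continuous_on U \<phi>" using h by (simp add: homeomorphism_def)
  have "continuous_on (\<phi> ` U) \<psi>" using h by (simp add: homeomorphism_def)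
  moreover have "\<psi> x = inv_into U \<phi> x" if "x \<in> \<phi> ` U" for x
    using that h inj by (auto simp: homeomorphism_def inv_into_f_f)
  ultimately show "continuous_on (\<phi> ` U) (inv_into U \<phi>)"
    by (simp cong: continuous_on_cong)
qed

lemma chart_image_open:
  assumes "is_chart (U, \<phi>)" "open W"
  shows "open (\<phi> ` (U \<inter> W))"
proof -
  note c = chart_homeomorphism[OF assms(1)]
  have "\<phi> ` (U \<inter> W) = inv_into U \<phi> -` W \<inter> \<phi> ` U"
    using c(3) by (auto simp: inv_into_f_f)
  then show ?thesis using continuous_open_preimage[OF c(5,2) assms(2)] by (simp add: Int_commute)
qed

locale manifold =
  fixes \<A> :: "('a::t2_space, 'n::finite) chart set"
  assumes atlas: "smooth_atlas \<A>"
begin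

lemma atlas_chart: "(V, \<phi>) \<in> \<A> \<Longrightarrow> is_chart (V, \<phi>)"
  using atlas by (auto simp: smooth_atlas_def)

lemma atlas_cover: obtains V \<phi> where "(V, \<phi>) \<in> \<A>" "p \<in> V"
proof -
  have "p \<in> (\<Union>c\<in>\<A>. fst c)" using atlas by (simp add: smooth_atlas_def)
  then obtain c where "c \<in> \<A>" "p \<in> fst c" by blast
  then show ?thesis using that[of "fst c" "snd c"] by simp
qed

lemma smooth_fun_onI:
  assumes "open W"
    and "\<And>V \<phi> S. (V, \<phi>) \<in> \<A> \<Longrightarrow> S = \<phi> ` (V \<inter> W) \<Longrightarrow> open S \<Longrightarrow> smooth_on S (\<lambda>x. a (inv_into V \<phi> x))"
  shows "smooth_fun_on \<A> W a"
  unfolding smooth_fun_on_def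
proof (intro ballI case_prodI2)
  fix c V \<phi> assume "c \<in> \<A>" "c = (V, \<phi>)"
  then have V: "(V, \<phi>) \<in> \<A>" by simp
  show "smooth_on (\<phi> ` (V \<inter> W)) (a \<circ> inv_into V \<phi>)"
    unfolding o_def by (rule assms(2)[OF V refl chart_image_open[OF atlas_chart[OF V] assms(1)]])
qed

lemma smooth_fun_onD:
  assumes "smooth_fun_on \<A> W a" "(V, \<phi>) \<in> \<A>" "S = \<phi> ` (V \<inter> W)"
  shows "smooth_on S (\<lambda>x. a (inv_into V \<phi> x))"
  using bspec[OF assms(1)[unfolded smooth_fun_on_def] assms(2)] by (simp add: assms(3) o_def)

lemma smooth_fun_on_subset:
  assumes "open W'" "smooth_fun_on \<A> W a" "W' \<subseteq> W"
  shows "smooth_fun_on \<A> W' a"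
proof (rule smooth_fun_onI[OF assms(1)])
  fix V \<phi> S assume V: "(V, \<phi>) \<in> \<A>" and S: "S = \<phi> ` (V \<inter> W')"
  show "smooth_on S (\<lambda>x. a (inv_into V \<phi> x))"
    by (rule smooth_on_subset[OF smooth_fun_onD[OF assms(2) V refl]]) (use S assms(3) in blast)
qed

lemma smooth_fun_on_cong:
  assumes "open W" "smooth_fun_on \<A> W a" "\<And>x. x \<in> W \<Longrightarrow> a x = b x"
  shows "smooth_fun_on \<A> W b"
proof (rule smooth_fun_onI[OF assms(1)])
  fix V \<phi> S assume V: "(V, \<phi>) \<in> \<A>" "S = \<phi> ` (V \<inter> W)" and S: "open S"
  note c = chart_homeomorphism[OF atlas_chart[OF V(1)]]
  show "smooth_on S (\<lambda>x. b (inv_into V \<phi> x))"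
  proof (rule smooth_on_cong[OF smooth_fun_onD[OF assms(2) V] S])
    fix x assume "x \<in> S"
    then obtain y where "y \<in> V" "y \<in> W" "x = \<phi> y" using V(2) by blast
    then show "a (inv_into V \<phi> x) = b (inv_into V \<phi> x)"
      by (simp add: inv_into_f_f[OF c(3)] assms(3))
  qed
qed

lemma smooth_fun_on_const: "open W \<Longrightarrow> smooth_fun_on \<A> W (\<lambda>x. c)"
  by (rule smooth_fun_onI, assumption, rule smooth_on_const)

lemma smooth_fun_on_add:
  assumes "open W" "smooth_fun_on \<A> W a" "smooth_fun_on \<A> W b"
  shows "smooth_fun_on \<A> W (\<lambda>x. a x + b x)"
proof (rule smooth_fun_onI[OF assms(1)])
  fix V \<phi> S assume V: "(V, \<phi>) \<in> \<A>" "S = \<phi> ` (V \<inter> W)" and S: "open S"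
  show "smooth_on S (\<lambda>x. a (inv_into V \<phi> x) + b (inv_into V \<phi> x))"
    by (rule smooth_on_add[OF S smooth_fun_onD[OF assms(2) V] smooth_fun_onD[OF assms(3) V]])
qed

lemma smooth_fun_on_diff:
  assumes "open W" "smooth_fun_on \<A> W a" "smooth_fun_on \<A> W b"
  shows "smooth_fun_on \<A> W (\<lambda>x. a x - b x)"
proof (rule smooth_fun_onI[OF assms(1)])
  fix V \<phi> S assume V: "(V, \<phi>) \<in> \<A>" "S = \<phi> ` (V \<inter> W)" and S: "open S"
  show "smooth_on S (\<lambda>x. a (inv_into V \<phi> x) - b (inv_into V \<phi> x))"
    by (rule smooth_on_diff[OF S smooth_fun_onD[OF assms(2) V] smooth_fun_onD[OF assms(3) V]])
qed

lemma smooth_fun_on_mult: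
  assumes "open W" "smooth_fun_on \<A> W a" "smooth_fun_on \<A> W b"
  shows "smooth_fun_on \<A> W (\<lambda>x. a x * b x)"
proof (rule smooth_fun_onI[OF assms(1)])
  fix V \<phi> S assume V: "(V, \<phi>) \<in> \<A>" "S = \<phi> ` (V \<inter> W)" and S: "open S"
  show "smooth_on S (\<lambda>x. a (inv_into V \<phi> x) * b (inv_into V \<phi> x))"
    by (rule smooth_on_mult[OF S smooth_fun_onD[OF assms(2) V] smooth_fun_onD[OF assms(3) V]])
qed

abbreviation "sn \<equiv> smooth_near \<A>"

lemma snI: "open W \<Longrightarrow> p \<in> W \<Longrightarrow> smooth_fun_on \<A> W a \<Longrightarrow> sn p a"
  by (auto simp: smooth_near_def)

lemma sn2E:
  assumes "sn p a" "sn p b"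
  obtains W where "open W" "p \<in> W" "smooth_fun_on \<A> W a" "smooth_fun_on \<A> W b"
proof -
  obtain W W' where W: "open W" "p \<in> W" "smooth_fun_on \<A> W a" "open W'" "p \<in> W'" "smooth_fun_on \<A> W' b"
    using assms unfolding smooth_near_def by blast
  have o: "open (W \<inter> W')" using W by blast
  show ?thesis
    by (rule that[OF o _ smooth_fun_on_subset[OF o W(3)] smooth_fun_on_subset[OF o W(6)]]) (use W in auto)
qed

lemma sn_const: "sn p (\<lambda>x. c)"
  by (rule snI[of UNIV]) (simp_all add: smooth_fun_on_const)

lemma sn_add: "sn p a \<Longrightarrow> sn p b \<Longrightarrow> sn p (\<lambda>x. a x + b x)"
  by (erule (1) sn2E, rule snI, assumption, assumption, rule smooth_fun_on_add)

lemma sn_diff: "sn p a \<Longrightarrow> sn p b \<Longrightarrow> sn p (\<lambda>x. a x - b x)"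
  by (erule (1) sn2E, rule snI, assumption, assumption, rule smooth_fun_on_diff)

lemma sn_mult: "sn p a \<Longrightarrow> sn p b \<Longrightarrow> sn p (\<lambda>x. a x * b x)"
  by (erule (1) sn2E, rule snI, assumption, assumption, rule smooth_fun_on_mult)

lemma sn_sum: "(\<And>i. i \<in> S \<Longrightarrow> sn p (a i)) \<Longrightarrow> sn p (\<lambda>x. \<Sum>i\<in>S. a i x)"
  by (induction S rule: infinite_finite_induct) (auto intro: sn_const sn_add)

lemma sn_cong:
  assumes "sn p a" "open W" "p \<in> W" "\<And>x. x \<in> W \<Longrightarrow> a x = b x"
  shows "sn p b"
proof -
  obtain W' where W': "open W'" "p \<in> W'" "smooth_fun_on \<A> W' a" using assms(1) unfolding smooth_near_def by blast
  have o: "open (W \<inter> W')" using W'(1) assms(2) by blast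
  have "smooth_fun_on \<A> (W \<inter> W') a" by (rule smooth_fun_on_subset[OF o W'(3)]) simp
  then have "smooth_fun_on \<A> (W \<inter> W') b" by (rule smooth_fun_on_cong[OF o]) (simp add: assms(4))
  then show ?thesis by (rule snI[OF o, rotated]) (use W' assms(3) in simp)
qed

lemma tangent_spaceD:
  assumes "v \<in> tangent_space \<A> p"
  shows "\<forall>a. \<not> sn p a \<longrightarrow> v a = 0"
    and "\<forall>a b. sn p a \<and> sn p b \<longrightarrow>
        (eventually (\<lambda>x. a x = b x) (nhds p) \<longrightarrow> v a = v b) \<and>
        v (\<lambda>x. a x + b x) = v a + v b \<and>
        v (\<lambda>x. a x * b x) = a p * v b + b p * v a"
    and "\<forall>a c. sn p a \<longrightarrow> v (\<lambda>x. c * a x) = c * v a"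
proof -
  note d = assms[unfolded tangent_space_def mem_Collect_eq]
  show "\<forall>a. \<not> sn p a \<longrightarrow> v a = 0" by (rule conjunct1[OF d])
  show "\<forall>a b. sn p a \<and> sn p b \<longrightarrow>
        (eventually (\<lambda>x. a x = b x) (nhds p) \<longrightarrow> v a = v b) \<and>
        v (\<lambda>x. a x + b x) = v a + v b \<and>
        v (\<lambda>x. a x * b x) = a p * v b + b p * v a"
    by (rule conjunct1[OF conjunct2[OF d]])
  show "\<forall>a c. sn p a \<longrightarrow> v (\<lambda>x. c * a x) = c * v a"
    by (rule conjunct2[OF conjunct2[OF d]])
qed

lemma tangent_undefined: "v \<in> tangent_space \<A> p \<Longrightarrow> \<not> sn p a \<Longrightarrow> v a = 0"
  using tangent_spaceD(1) by blast

lemma tangent_cong: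
  assumes "v \<in> tangent_space \<A> p" "sn p a" "open W" "p \<in> W" "\<And>x. x \<in> W \<Longrightarrow> a x = b x"
  shows "v a = v b"
proof -
  have "sn p b" by (rule sn_cong[OF assms(2-5)])
  moreover have "eventually (\<lambda>x. a x = b x) (nhds p)"
    unfolding eventually_nhds using assms(3-5) by blast
  ultimately show ?thesis using spec[OF spec[OF tangent_spaceD(2)[OF assms(1)], of a], of b] assms(2) by blast
qed

lemma tangent_add: "v \<in> tangent_space \<A> p \<Longrightarrow> sn p a \<Longrightarrow> sn p b \<Longrightarrow> v (\<lambda>x. a x + b x) = v a + v b"
  using spec[OF spec[OF tangent_spaceD(2), of v p a], of b] by blast

lemma tangent_mult: "v \<in> tangent_space \<A> p \<Longrightarrow> sn p a \<Longrightarrow> sn p b \<Longrightarrow> v (\<lambda>x. a x * b x) = a p * v b + b p * v a"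
  using spec[OF spec[OF tangent_spaceD(2), of v p a], of b] by blast

lemma tangent_scale: "v \<in> tangent_space \<A> p \<Longrightarrow> sn p a \<Longrightarrow> v (\<lambda>x. c * a x) = c * v a"
  using spec[OF spec[OF tangent_spaceD(3), of v p a], of c] by blast

lemma tangent_const:
  assumes "v \<in> tangent_space \<A> p"
  shows "v (\<lambda>x. c) = 0"
proof -
  have "v (\<lambda>x. 1 * 1) = 1 * v (\<lambda>x. 1) + 1 * v (\<lambda>x. 1)"
    by (rule tangent_mult[OF assms sn_const sn_const])
  then have "v (\<lambda>x. 1) = 0" by simp
  then show ?thesis using tangent_scale[OF assms sn_const[of p 1], of c] by simp
qed

lemma tangent_sum:
  assumes "v \<in> tangent_space \<A> p" "\<And>i. i \<in> S \<Longrightarrow> sn p (a i)"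
  shows "v (\<lambda>x. \<Sum>i\<in>S. a i x) = (\<Sum>i\<in>S. v (a i))"
  using assms(2)
proof (induction S rule: infinite_finite_induct)
  case (insert i S)
  then show ?case using tangent_add[OF assms(1), of "a i" "\<lambda>x. \<Sum>i\<in>S. a i x"] by (simp add: sn_sum)
qed (simp_all add: tangent_const[OF assms(1)])

lemma tangent_diff:
  assumes "v \<in> tangent_space \<A> p" "sn p a" "sn p b"
  shows "v (\<lambda>x. a x - b x) = v a - v b"
proof -
  have "sn p (\<lambda>x. - 1 * b x)" by (intro sn_mult sn_const assms)
  then show ?thesis
    using tangent_add[OF assms(1,2), of "\<lambda>x. - 1 * b x"] tangent_scale[OF assms(1,3), of "- 1"] by simp
qed

lemma tangent_space_ext:
  assumes "v \<in> tangent_space \<A> p" "v' \<in> tangent_space \<A> p" "\<And>a. sn p a \<Longrightarrow> v a = v' a"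
  shows "v = v'"
proof
  fix a show "v a = v' a"
  proof (cases "sn p a")
    case True
    then show ?thesis by (rule assms(3))
  next
    case False
    then show ?thesis using tangent_undefined[OF assms(1) False] tangent_undefined[OF assms(2) False] by (simp only:)
  qed
qed

lemma tangent_spaceI:
  assumes "\<And>a. \<not> sn p a \<Longrightarrow> v a = 0"
    and cong: "\<And>a b W. sn p a \<Longrightarrow> sn p b \<Longrightarrow> open W \<Longrightarrow> p \<in> W \<Longrightarrow> (\<And>x. x \<in> W \<Longrightarrow> a x = b x) \<Longrightarrow> v a = v b"
    and "\<And>a b. sn p a \<Longrightarrow> sn p b \<Longrightarrow> v (\<lambda>x. a x + b x) = v a + v b"
    and "\<And>a b. sn p a \<Longrightarrow> sn p b \<Longrightarrow> v (\<lambda>x. a x * b x) = a p * v b + b p * v a"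
    and "\<And>a c. sn p a \<Longrightarrow> v (\<lambda>x. c * a x) = c * v a"
  shows "v \<in> tangent_space \<A> p"
  unfolding tangent_space_def mem_Collect_eq
proof (intro conjI allI impI; (elim conjE)?)
  fix a b assume ab: "sn p a" "sn p b"
  assume "eventually (\<lambda>x. a x = b x) (nhds p)"
  then obtain W where W: "open W" "p \<in> W" "\<forall>x\<in>W. a x = b x" unfolding eventually_nhds by blast
  show "v a = v b" by (rule cong[OF ab W(1,2)]) (use W(3) in blast)
qed (fact assms)+

lemma tangent_combination:
  assumes v: "v \<in> tangent_space \<A> p" and v': "v' \<in> tangent_space \<A> p"
  shows "c *\<^sub>R v + v' \<in> tangent_space \<A> p"
proof (rule tangent_spaceI)
  have eq: "(c *\<^sub>R v + v') a = c * v a + v' a" for a by (simp add: scaleR_fun_def)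
  show "(c *\<^sub>R v + v') a = 0" if "\<not> sn p a" for a
    unfolding eq by (simp add: tangent_undefined[OF v that] tangent_undefined[OF v' that])
  show "(c *\<^sub>R v + v') a = (c *\<^sub>R v + v') b"
    if "sn p a" "sn p b" and W: "open W" "p \<in> W" "\<And>x. x \<in> W \<Longrightarrow> a x = b x" for a b W
    unfolding eq using tangent_cong[OF v that(1) W] tangent_cong[OF v' that(1) W] by (simp only:)
  show "(c *\<^sub>R v + v') (\<lambda>x. a x + b x) = (c *\<^sub>R v + v') a + (c *\<^sub>R v + v') b" if "sn p a" "sn p b" for a b
    unfolding eq tangent_add[OF v that] tangent_add[OF v' that] by (simp add: algebra_simps)
  show "(c *\<^sub>R v + v') (\<lambda>x. a x * b x) = a p * (c *\<^sub>R v + v') b + b p * (c *\<^sub>R v + v') a" if "sn p a" "sn p b" for a b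
    unfolding eq tangent_mult[OF v that] tangent_mult[OF v' that] by (simp add: algebra_simps)
  show "(c *\<^sub>R v + v') (\<lambda>x. d * a x) = d * (c *\<^sub>R v + v') a" if "sn p a" for a d
    unfolding eq tangent_scale[OF v that] tangent_scale[OF v' that] by (simp add: algebra_simps)
qed

lemma zero_tangent: "0 \<in> tangent_space \<A> p"
  by (rule tangent_spaceI) auto

section \<open>Lie brackets of smooth vector fields\<close>

abbreviation "svf \<equiv> smooth_vector_field \<A>"

lemma svf_tangent: "svf X \<Longrightarrow> X p \<in> tangent_space \<A> p"
  unfolding smooth_vector_field_def by blast

lemma svf_smooth:
  assumes "svf X" "open W" "smooth_fun_on \<A> W a"
  shows "smooth_fun_on \<A> W (\<lambda>p. X p a)"
  using conjunct2[OF assms(1)[unfolded smooth_vector_field_def], THEN spec, THEN spec, of W a] assms(2,3) by blast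

lemma svf_sn:
  assumes "svf X" "sn p a"
  shows "sn p (\<lambda>p. X p a)"
proof -
  obtain W where W: "open W" "p \<in> W" "smooth_fun_on \<A> W a" using assms(2) unfolding smooth_near_def by blast
  show ?thesis by (rule snI[OF W(1,2) svf_smooth[OF assms(1) W(1,3)]])
qed

lemma lie_bracket_apply:
  assumes "sn p a"
  shows "lie_bracket \<A> X Y p a = X p (\<lambda>x. Y x a) - Y p (\<lambda>x. X x a)"
  unfolding lie_bracket_def using assms by (rule if_P)

lemma lie_bracket_undefined: "\<not> sn p a \<Longrightarrow> lie_bracket \<A> X Y p a = 0"
  unfolding lie_bracket_def by (rule if_not_P)

lemma sn_eventually:
  assumes "sn p a"
  shows "\<exists>W. open W \<and> p \<in> W \<and> (\<forall>x\<in>W. sn x a)"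
proof -
  obtain W where W: "open W" "p \<in> W" "smooth_fun_on \<A> W a" using assms unfolding smooth_near_def by blast
  show ?thesis by (intro exI[of _ W] conjI W(1,2) ballI) (rule snI[OF W(1) _ W(3)])
qed

text \<open>The inner derivatives have to agree at all points near p, not only at p, and locality of
  tangent vectors is available only at points near which a is smooth; these points form a
  neighbourhood of p.\<close>

lemma svf_compose_cong:
  assumes Z: "svf Z" "svf Z'" and ab: "sn p a" and W: "open W" "p \<in> W" "\<And>x. x \<in> W \<Longrightarrow> a x = b x"
  shows "Z p (\<lambda>x. Z' x a) = Z p (\<lambda>x. Z' x b)"
proof -
  obtain W' where W': "open W'" "p \<in> W'" "\<forall>x\<in>W'. sn x a" using sn_eventually[OF ab] by blast
  have o: "open (W \<inter> W')" using W(1) W'(1) by (rule open_Int)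
  show ?thesis
  proof (rule tangent_cong[OF svf_tangent[OF Z(1)] svf_sn[OF Z(2) ab] o])
    show "p \<in> W \<inter> W'" using W(2) W'(2) by (rule IntI)
    fix x assume x: "x \<in> W \<inter> W'"
    show "Z' x a = Z' x b"
      by (rule tangent_cong[OF svf_tangent[OF Z(2)] bspec[OF W'(3) IntD2[OF x]] W(1) IntD1[OF x] W(3)])
  qed
qed

lemma svf_compose_add:
  assumes Z: "svf Z" "svf Z'" and a: "sn p a" and b: "sn p b"
  shows "Z p (\<lambda>x. Z' x (\<lambda>x. a x + b x)) = Z p (\<lambda>x. Z' x a) + Z p (\<lambda>x. Z' x b)"
proof -
  note sa = svf_sn[OF Z(2) a] and sb = svf_sn[OF Z(2) b]
  obtain W where W: "open W" "p \<in> W" "smooth_fun_on \<A> W a" "smooth_fun_on \<A> W b" by (rule sn2E[OF a b])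
  have "Z p (\<lambda>x. Z' x a + Z' x b) = Z p (\<lambda>x. Z' x (\<lambda>x. a x + b x))"
  proof (rule tangent_cong[OF svf_tangent[OF Z(1)] sn_add[OF sa sb] W(1,2)])
    fix x assume x: "x \<in> W"
    show "Z' x a + Z' x b = Z' x (\<lambda>x. a x + b x)"
      by (rule tangent_add[OF svf_tangent[OF Z(2)] snI[OF W(1) x W(3)] snI[OF W(1) x W(4)], symmetric])
  qed
  then show ?thesis using tangent_add[OF svf_tangent[OF Z(1)] sa sb] by (simp only:)
qed

lemma svf_compose_scale:
  assumes Z: "svf Z" "svf Z'" and a: "sn p a"
  shows "Z p (\<lambda>x. Z' x (\<lambda>x. c * a x)) = c * Z p (\<lambda>x. Z' x a)"
proof -
  note sa = svf_sn[OF Z(2) a]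
  obtain W where W: "open W" "p \<in> W" "\<forall>x\<in>W. sn x a" using sn_eventually[OF a] by blast
  have "Z p (\<lambda>x. c * Z' x a) = Z p (\<lambda>x. Z' x (\<lambda>x. c * a x))"
  proof (rule tangent_cong[OF svf_tangent[OF Z(1)] sn_mult[OF sn_const sa] W(1,2)])
    fix x assume x: "x \<in> W"
    show "c * Z' x a = Z' x (\<lambda>x. c * a x)"
      by (rule tangent_scale[OF svf_tangent[OF Z(2)] bspec[OF W(3) x], symmetric])
  qed
  then show ?thesis using tangent_scale[OF svf_tangent[OF Z(1)] sa] by (simp only:)
qed

text \<open>The mixed terms are symmetric in Z and Z', which is why the commutator is again a
  derivation.\<close>

lemma svf_compose_mult:
  assumes Z: "svf Z" "svf Z'" and a: "sn p a" and b: "sn p b"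
  shows "Z p (\<lambda>x. Z' x (\<lambda>x. a x * b x)) =
    (a p * Z p (\<lambda>x. Z' x b) + Z' p b * Z p a) + (b p * Z p (\<lambda>x. Z' x a) + Z' p a * Z p b)"
proof -
  note sa = svf_sn[OF Z(2) a] and sb = svf_sn[OF Z(2) b]
  obtain W where W: "open W" "p \<in> W" "smooth_fun_on \<A> W a" "smooth_fun_on \<A> W b" by (rule sn2E[OF a b])
  have "Z p (\<lambda>x. a x * Z' x b + b x * Z' x a) = Z p (\<lambda>x. Z' x (\<lambda>x. a x * b x))"
  proof (rule tangent_cong[OF svf_tangent[OF Z(1)] sn_add[OF sn_mult[OF a sb] sn_mult[OF b sa]] W(1,2)])
    fix x assume x: "x \<in> W"
    show "a x * Z' x b + b x * Z' x a = Z' x (\<lambda>x. a x * b x)"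
      by (rule tangent_mult[OF svf_tangent[OF Z(2)] snI[OF W(1) x W(3)] snI[OF W(1) x W(4)], symmetric])
  qed
  then show ?thesis
    using tangent_add[OF svf_tangent[OF Z(1)] sn_mult[OF a sb] sn_mult[OF b sa]]
      tangent_mult[OF svf_tangent[OF Z(1)] a sb] tangent_mult[OF svf_tangent[OF Z(1)] b sa] by (simp only:)
qed

lemma svfI:
  assumes "\<And>p. X p \<in> tangent_space \<A> p"
    and "\<And>W a. open W \<Longrightarrow> smooth_fun_on \<A> W a \<Longrightarrow> smooth_fun_on \<A> W (\<lambda>p. X p a)"
  shows "svf X"
  unfolding smooth_vector_field_def using assms by blast

lemma svf_lie_bracket:
  assumes X: "svf X" and Y: "svf Y"
  shows "svf (lie_bracket \<A> X Y)"
proof (rule svfI)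
  fix p
  show "lie_bracket \<A> X Y p \<in> tangent_space \<A> p"
  proof (rule tangent_spaceI)
    show "lie_bracket \<A> X Y p a = 0" if "\<not> sn p a" for a using that by (rule lie_bracket_undefined)
    show "lie_bracket \<A> X Y p a = lie_bracket \<A> X Y p b"
      if a: "sn p a" and b: "sn p b" and W: "open W" "p \<in> W" "\<And>x. x \<in> W \<Longrightarrow> a x = b x" for a b W
    proof -
      have 1: "X p (\<lambda>x. Y x a) = X p (\<lambda>x. Y x b)" by (rule svf_compose_cong[OF X Y a W])
      have 2: "Y p (\<lambda>x. X x a) = Y p (\<lambda>x. X x b)" by (rule svf_compose_cong[OF Y X a W])
      show ?thesis unfolding lie_bracket_apply[OF a] lie_bracket_apply[OF b] 1 2 by (rule refl)
    qed
    show "lie_bracket \<A> X Y p (\<lambda>x. a x + b x) = lie_bracket \<A> X Y p a + lie_bracket \<A> X Y p b"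
      if a: "sn p a" and b: "sn p b" for a b
      unfolding lie_bracket_apply[OF a] lie_bracket_apply[OF b] lie_bracket_apply[OF sn_add[OF a b]]
        svf_compose_add[OF X Y a b] svf_compose_add[OF Y X a b] by linarith
    show "lie_bracket \<A> X Y p (\<lambda>x. c * a x) = c * lie_bracket \<A> X Y p a" if a: "sn p a" for a c
      unfolding lie_bracket_apply[OF a] lie_bracket_apply[OF sn_mult[OF sn_const a]]
        svf_compose_scale[OF X Y a] svf_compose_scale[OF Y X a] by (rule right_diff_distrib[symmetric])
    show "lie_bracket \<A> X Y p (\<lambda>x. a x * b x) = a p * lie_bracket \<A> X Y p b + b p * lie_bracket \<A> X Y p a"
      if a: "sn p a" and b: "sn p b" for a b
      unfolding lie_bracket_apply[OF a] lie_bracket_apply[OF b] lie_bracket_apply[OF sn_mult[OF a b]]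
        svf_compose_mult[OF X Y a b] svf_compose_mult[OF Y X a b] right_diff_distrib
      by algebra
  qed
next
  fix W a assume W: "open W" "smooth_fun_on \<A> W a"
  have "smooth_fun_on \<A> W (\<lambda>p. X p (\<lambda>x. Y x a) - Y p (\<lambda>x. X x a))"
    by (intro smooth_fun_on_diff svf_smooth[OF X] svf_smooth[OF Y] W)
  then show "smooth_fun_on \<A> W (\<lambda>p. lie_bracket \<A> X Y p a)"
    by (rule smooth_fun_on_cong[OF W(1)]) (rule lie_bracket_apply[symmetric], rule snI[OF W(1) _ W(2)])
qed

lemma zero_svf: "svf 0"
  by (rule svfI) (simp_all only: zero_fun_apply zero_tangent smooth_fun_on_const)

lemma combination_svf:
  assumes "svf X" "svf Y" "smooth_fun_on \<A> UNIV b"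
  shows "svf ((\<lambda>p. b p *\<^sub>R X p) + Y)"
proof (rule svfI)
  fix p
  have eq: "((\<lambda>p. b p *\<^sub>R X p) + Y) p = b p *\<^sub>R X p + Y p" by (rule plus_fun_apply)
  show "((\<lambda>p. b p *\<^sub>R X p) + Y) p \<in> tangent_space \<A> p"
    unfolding eq by (rule tangent_combination[OF svf_tangent[OF assms(1)] svf_tangent[OF assms(2)]])
next
  fix W a assume W: "open W" "smooth_fun_on \<A> W a"
  have "smooth_fun_on \<A> W (\<lambda>p. b p * X p a + Y p a)"
    by (rule smooth_fun_on_add[OF W(1) smooth_fun_on_mult[OF W(1) smooth_fun_on_subset[OF W(1) assms(3) subset_UNIV]
          svf_smooth[OF assms(1) W]] svf_smooth[OF assms(2) W]])
  then show "smooth_fun_on \<A> W (\<lambda>p. ((\<lambda>p. b p *\<^sub>R X p) + Y) p a)"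
    by (simp only: plus_fun_apply scaleR_fun_def real_scaleR_def)
qed

lemma scaled_svf:
  assumes "svf X" "smooth_fun_on \<A> UNIV b"
  shows "svf (\<lambda>p. b p *\<^sub>R X p)"
  using combination_svf[OF assms(1) zero_svf assms(2)] by (simp only: add_0_right)

lemma vector_field_ext:
  assumes "svf X" "svf Y" "\<And>p a. sn p a \<Longrightarrow> X p a = Y p a"
  shows "X = Y"
  by (rule ext, rule tangent_space_ext[OF svf_tangent[OF assms(1)] svf_tangent[OF assms(2)] assms(3)])

lemma add_svf:
  assumes "svf X" "svf Y"
  shows "svf (X + Y)"
  using combination_svf[OF assms smooth_fun_on_const[OF open_UNIV, of 1]] by (simp only: scaleR_one)

lemma lie_bracket_add_left:
  assumes "svf X" "svf Y" "svf Z"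
  shows "lie_bracket \<A> (X + Y) Z = lie_bracket \<A> X Z + lie_bracket \<A> Y Z"
proof (rule vector_field_ext)
  fix p a assume s: "sn p a"
  have "Z p (\<lambda>x. X x a + Y x a) = Z p (\<lambda>x. X x a) + Z p (\<lambda>x. Y x a)"
    by (rule tangent_add[OF svf_tangent[OF assms(3)] svf_sn[OF assms(1) s] svf_sn[OF assms(2) s]])
  then show "lie_bracket \<A> (X + Y) Z p a = (lie_bracket \<A> X Z + lie_bracket \<A> Y Z) p a"
    unfolding plus_fun_apply lie_bracket_apply[OF s] by linarith
qed (intro svf_lie_bracket add_svf assms)+

lemma lie_bracket_add_right:
  assumes "svf X" "svf Y" "svf Z"
  shows "lie_bracket \<A> Z (X + Y) = lie_bracket \<A> Z X + lie_bracket \<A> Z Y"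
proof (rule vector_field_ext)
  fix p a assume s: "sn p a"
  have "Z p (\<lambda>x. X x a + Y x a) = Z p (\<lambda>x. X x a) + Z p (\<lambda>x. Y x a)"
    by (rule tangent_add[OF svf_tangent[OF assms(3)] svf_sn[OF assms(1) s] svf_sn[OF assms(2) s]])
  then show "lie_bracket \<A> Z (X + Y) p a = (lie_bracket \<A> Z X + lie_bracket \<A> Z Y) p a"
    unfolding plus_fun_apply lie_bracket_apply[OF s] by linarith
qed (intro svf_lie_bracket add_svf assms)+

text \<open>The right side is arranged as a chain of multiples ending in 0, so that
  \<open>combination_svf\<close> applies to every summand.\<close>

lemma lie_bracket_leibniz:
  assumes X: "svf X" and Y: "svf Y" and b: "smooth_fun_on \<A> UNIV b" and c: "smooth_fun_on \<A> UNIV c"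
  shows "lie_bracket \<A> (\<lambda>p. b p *\<^sub>R X p) (\<lambda>p. c p *\<^sub>R Y p) =
    (\<lambda>p. (b p * c p) *\<^sub>R lie_bracket \<A> X Y p) +
    ((\<lambda>p. (b p * X p c) *\<^sub>R Y p) + ((\<lambda>p. (- 1 * (c p * Y p b)) *\<^sub>R X p) + 0))"
proof (rule vector_field_ext)
  fix p a assume s: "sn p a"
  have sb: "sn p b" and sc: "sn p c" by (rule snI[OF open_UNIV UNIV_I b], rule snI[OF open_UNIV UNIV_I c])
  have 1: "X p (\<lambda>x. c x * Y x a) = c p * X p (\<lambda>x. Y x a) + Y p a * X p c"
    by (rule tangent_mult[OF svf_tangent[OF X] sc svf_sn[OF Y s]])
  have 2: "Y p (\<lambda>x. b x * X x a) = b p * Y p (\<lambda>x. X x a) + X p a * Y p b"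
    by (rule tangent_mult[OF svf_tangent[OF Y] sb svf_sn[OF X s]])
  show "lie_bracket \<A> (\<lambda>p. b p *\<^sub>R X p) (\<lambda>p. c p *\<^sub>R Y p) p a =
    ((\<lambda>p. (b p * c p) *\<^sub>R lie_bracket \<A> X Y p) +
    ((\<lambda>p. (b p * X p c) *\<^sub>R Y p) + ((\<lambda>p. (- 1 * (c p * Y p b)) *\<^sub>R X p) + 0))) p a"
    unfolding plus_fun_apply zero_fun_apply scaleR_fun_def real_scaleR_def lie_bracket_apply[OF s] 1 2
    by algebra
qed (intro svf_lie_bracket scaled_svf combination_svf zero_svf X Y b c
      smooth_fun_on_mult smooth_fun_on_const svf_smooth[OF X] svf_smooth[OF Y] open_UNIV)+

lemma lie_bracket_zero_left:
  assumes "svf X"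
  shows "lie_bracket \<A> 0 X = 0"
  using lie_bracket_add_left[OF zero_svf zero_svf assms] by (simp only: add_0_right add_cancel_right_right)

lemma lie_bracket_zero_right:
  assumes "svf X"
  shows "lie_bracket \<A> X 0 = 0"
  using lie_bracket_add_right[OF zero_svf zero_svf assms] by (simp only: add_0_right add_cancel_right_right)

end

subsection \<open>The flag is spanned by iterated brackets\<close>

locale smooth_family = manifold \<A> for \<A> :: "('a::t2_space, 'n::finite) chart set" +
  fixes f :: "'m::finite \<Rightarrow> 'a vector_field"
  assumes f: "svf (f i)"
begin

fun iterated_bracket :: "'m list \<Rightarrow> 'a vector_field" where
  "iterated_bracket [] = 0"
| "iterated_bracket [j] = f j"
| "iterated_bracket (j # i # I) = lie_bracket \<A> (iterated_bracket (i # I)) (f j)"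

lemma svf_iterated_bracket: "svf (iterated_bracket I)"
proof (induction I rule: iterated_bracket.induct)
  case 1
  show ?case unfolding iterated_bracket.simps by (rule zero_svf)
next
  case (2 j)
  show ?case unfolding iterated_bracket.simps by (rule f)
next
  case (3 j i I)
  then show ?case unfolding iterated_bracket.simps by (rule svf_lie_bracket[OF _ f])
qed

text \<open>The module over the smooth functions generated by the iterated brackets of length at
  most k. Adding one multiple at a time replaces finite sums by rule induction.\<close>

inductive_set bracket_module :: "nat \<Rightarrow> 'a vector_field set" for k where
  zero: "0 \<in> bracket_module k"
| combination: "X \<in> bracket_module k \<Longrightarrow> smooth_fun_on \<A> UNIV b \<Longrightarrow> I \<noteq> [] \<Longrightarrow> length I \<le> k \<Longrightarrow>
    (\<lambda>p. b p *\<^sub>R iterated_bracket I p) + X \<in> bracket_module k"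

lemma bracket_module_svf: "X \<in> bracket_module k \<Longrightarrow> svf X"
proof (induction rule: bracket_module.induct)
  case zero
  show ?case by (rule zero_svf)
next
  case (combination X b I)
  then show ?case by (intro combination_svf svf_iterated_bracket)
qed

lemma bracket_module_mono:
  assumes "X \<in> bracket_module k" "k \<le> l"
  shows "X \<in> bracket_module l"
  using assms(1)
proof (induction rule: bracket_module.induct)
  case zero
  show ?case by (rule bracket_module.zero)
next
  case (combination X b I)
  then show ?case using assms(2) by (intro bracket_module.combination order_trans[OF combination(4) assms(2)])
qed

lemma bracket_module_add:
  assumes "X \<in> bracket_module k" "Y \<in> bracket_module k"
  shows "X + Y \<in> bracket_module k"
  using assms(1)
proof (induction rule: bracket_module.induct)
  case zero
  show ?case unfolding add_0_left by (rule assms(2))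
next
  case (combination X b I)
  then show ?case unfolding add.assoc by (intro bracket_module.combination)
qed

lemma bracket_module_scale: "X \<in> bracket_module k \<Longrightarrow> c *\<^sub>R X \<in> bracket_module k"
proof (induction rule: bracket_module.induct)
  case zero
  show ?case unfolding scaleR_zero_right by (rule bracket_module.zero)
next
  case (combination X b I)
  have "c *\<^sub>R (\<lambda>p. b p *\<^sub>R iterated_bracket I p) = (\<lambda>p. (c * b p) *\<^sub>R iterated_bracket I p)"
    unfolding scaleR_fun_def[of c "\<lambda>p. b p *\<^sub>R iterated_bracket I p"] by (simp only: scaleR_scaleR)
  then have eq: "c *\<^sub>R ((\<lambda>p. b p *\<^sub>R iterated_bracket I p) + X) = (\<lambda>p. (c * b p) *\<^sub>R iterated_bracket I p) + c *\<^sub>R X"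
    by (simp only: scaleR_add_right)
  have "smooth_fun_on \<A> UNIV (\<lambda>p. c * b p)"
    by (intro smooth_fun_on_mult smooth_fun_on_const combination open_UNIV)
  then show ?case unfolding eq using combination by (intro bracket_module.combination)
qed

lemma subspace_bracket_module: "subspace (bracket_module k)"
  unfolding subspace_def by (intro conjI ballI allI bracket_module.zero bracket_module_add bracket_module_scale)

lemma bracket_module_generator:
  assumes "smooth_fun_on \<A> UNIV b" "I \<noteq> []" "length I \<le> k"
  shows "(\<lambda>p. b p *\<^sub>R iterated_bracket I p) \<in> bracket_module k"
  using bracket_module.combination[OF bracket_module.zero assms] by (simp only: add_0_right)

text \<open>By the Leibniz rule, the bracket of a multiple of F with a multiple of
  \<open>f j\<close> is a multiple of the bracket of F with \<open>f j\<close>, whose length is one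
  more, plus multiples of \<open>f j\<close> and of F, whose lengths are already allowed.\<close>

lemma bracket_module_bracket:
  assumes "X \<in> bracket_module k" and c: "smooth_fun_on \<A> UNIV c"
  shows "lie_bracket \<A> X (\<lambda>p. c p *\<^sub>R f j p) \<in> bracket_module (Suc k)"
  using assms(1)
proof (induction rule: bracket_module.induct)
  case zero
  show ?case unfolding lie_bracket_zero_left[OF scaled_svf[OF f c]] by (rule bracket_module.zero)
next
  case (combination X b I)
  let ?F = "iterated_bracket I"
  have F: "svf ?F" by (rule svf_iterated_bracket)
  have jI: "iterated_bracket (j # I) = lie_bracket \<A> ?F (f j)"
    using combination(3) by (cases I) (simp_all only: iterated_bracket.simps refl not_True_eq_False)
  have fj: "iterated_bracket [j] = f j" by (rule iterated_bracket.simps)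
  have s1: "smooth_fun_on \<A> UNIV (\<lambda>p. b p * c p)" "smooth_fun_on \<A> UNIV (\<lambda>p. b p * ?F p c)"
    "smooth_fun_on \<A> UNIV (\<lambda>p. - 1 * (c p * f j p b))"
    by (intro smooth_fun_on_mult smooth_fun_on_const svf_smooth[OF F] svf_smooth[OF f] combination(2) c open_UNIV)+
  have "(\<lambda>p. (b p * c p) *\<^sub>R iterated_bracket (j # I) p) \<in> bracket_module (Suc k)"
    using combination(4) by (intro bracket_module_generator s1) simp_all
  moreover have "(\<lambda>p. (b p * ?F p c) *\<^sub>R iterated_bracket [j] p) \<in> bracket_module (Suc k)"
    by (intro bracket_module_generator s1) simp_all
  moreover have "(\<lambda>p. (- 1 * (c p * f j p b)) *\<^sub>R ?F p) \<in> bracket_module (Suc k)"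
    using combination(3,4) by (intro bracket_module_generator s1) simp_all
  ultimately have "lie_bracket \<A> (\<lambda>p. b p *\<^sub>R ?F p) (\<lambda>p. c p *\<^sub>R f j p) \<in> bracket_module (Suc k)"
    unfolding lie_bracket_leibniz[OF F f combination(2) c] jI fj
    by (intro bracket_module_add bracket_module.zero)
  then show ?case
    unfolding lie_bracket_add_left[OF scaled_svf[OF F combination(2)] bracket_module_svf[OF combination(1)] scaled_svf[OF f c]]
    using combination(5) by (rule bracket_module_add)
qed

text \<open>Smoothness of the partial sums is part of the induction because additivity of the
  bracket presupposes it.\<close>

lemma bracket_module_bracket_sum:
  assumes X: "X \<in> bracket_module k" and c': "\<forall>i. smooth_fun_on \<A> UNIV (c i)" and S: "finite S"
  shows "svf (\<lambda>p. \<Sum>i\<in>S. c i p *\<^sub>R f i p) \<and> (\<lambda>p. \<Sum>i\<in>S. c i p *\<^sub>R f i p) \<in> bracket_module (Suc 0) \<and>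
    lie_bracket \<A> X (\<lambda>p. \<Sum>i\<in>S. c i p *\<^sub>R f i p) \<in> bracket_module (Suc k)"
  using S
proof (induction S)
  case empty
  have eq: "(\<lambda>p. \<Sum>i\<in>{}. c i p *\<^sub>R f i p) = 0" by (rule ext) (simp only: sum.empty zero_fun_apply)
  show ?case
    unfolding eq lie_bracket_zero_right[OF bracket_module_svf[OF X]]
    by (intro conjI zero_svf bracket_module.zero)
next
  case (insert j S)
  note c = spec[OF c']
  let ?Z = "\<lambda>p. \<Sum>i\<in>S. c i p *\<^sub>R f i p"
  have eq: "(\<lambda>p. \<Sum>i\<in>insert j S. c i p *\<^sub>R f i p) = (\<lambda>p. c j p *\<^sub>R f j p) + ?Z"
    by (rule ext) (simp only: sum.insert[OF insert(1,2)] plus_fun_apply)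
  have Z: "svf ?Z" "?Z \<in> bracket_module (Suc 0)" "lie_bracket \<A> X ?Z \<in> bracket_module (Suc k)"
    using insert(3) by blast+
  have fj: "iterated_bracket [j] = f j" by (rule iterated_bracket.simps)
  have "(\<lambda>p. c j p *\<^sub>R f j p) + ?Z \<in> bracket_module (Suc 0)"
    using bracket_module.combination[OF Z(2) c, of "[j]" j] unfolding fj by simp
  moreover have "lie_bracket \<A> X ((\<lambda>p. c j p *\<^sub>R f j p) + ?Z) \<in> bracket_module (Suc k)"
    unfolding lie_bracket_add_right[OF scaled_svf[OF f c] Z(1) bracket_module_svf[OF X]]
    by (rule bracket_module_add[OF bracket_module_bracket[OF X c] Z(3)])
  ultimately show ?case
    unfolding eq using combination_svf[OF f Z(1) c, of j j] by (intro conjI)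
qed

lemma Delta_1_E:
  assumes "W \<in> Delta \<A> f (Suc 0)"
  obtains c where "\<forall>i. smooth_fun_on \<A> UNIV (c i)" "W = (\<lambda>p. \<Sum>i\<in>UNIV. c i p *\<^sub>R f i p)"
  using assms unfolding Delta.simps by blast

lemma Delta_1_I: "\<forall>i. smooth_fun_on \<A> UNIV (c i) \<Longrightarrow> (\<lambda>p. \<Sum>i\<in>UNIV. c i p *\<^sub>R f i p) \<in> Delta \<A> f (Suc 0)"
  unfolding Delta.simps by blast

text \<open>\<open>Delta\<close> takes real spans of brackets, and the bracket module is a subspace,
  so the inclusion reduces to single brackets with elements of the first level.\<close>

lemma Delta_subset_bracket_module: "Delta \<A> f k \<subseteq> bracket_module k"
proof (induction k rule: induct_nat_012)
  case 0
  show ?case unfolding Delta.simps using bracket_module.zero by blast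
next
  case 1
  show ?case
  proof
    fix W assume "W \<in> Delta \<A> f (Suc 0)"
    then obtain c where c: "\<forall>i. smooth_fun_on \<A> UNIV (c i)" "W = (\<lambda>p. \<Sum>i\<in>UNIV. c i p *\<^sub>R f i p)" by (rule Delta_1_E)
    show "W \<in> bracket_module (Suc 0)"
      unfolding c(2) using bracket_module_bracket_sum[OF bracket_module.zero c(1) finite] by blast
  qed
next
  case (ge2 k)
  have "lie_bracket \<A> V W \<in> bracket_module (Suc (Suc k))"
    if V: "V \<in> Delta \<A> f (Suc k)" and W: "W \<in> Delta \<A> f (Suc 0)" for V W
  proof -
    obtain c where c: "\<forall>i. smooth_fun_on \<A> UNIV (c i)" "W = (\<lambda>p. \<Sum>i\<in>UNIV. c i p *\<^sub>R f i p)" using W by (rule Delta_1_E)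
    have "V \<in> bracket_module (Suc k)" using ge2(2) V by (rule subsetD)
    then show ?thesis unfolding c(2) using bracket_module_bracket_sum[OF _ c(1) finite] by blast
  qed
  then have "span {lie_bracket \<A> V W | V W. V \<in> Delta \<A> f (Suc k) \<and> W \<in> Delta \<A> f (Suc 0)} \<subseteq> bracket_module (Suc (Suc k))"
    by (intro span_minimal subspace_bracket_module) blast
  moreover have "X \<in> bracket_module (Suc (Suc k))" if "X \<in> Delta \<A> f (Suc k)" for X
    by (rule bracket_module_mono[OF subsetD[OF ge2(2) that]]) simp
  ultimately show ?case unfolding Delta.simps(3) by (blast intro: bracket_module_add)
qed

lemma subspace_Delta: "subspace (Delta \<A> f k)"
proof (induction k rule: induct_nat_012)
  case 0
  show ?case unfolding Delta.simps by (rule subspace_single_0)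
next
  case 1
  show ?case
    unfolding subspace_def
  proof (intro conjI ballI allI)
    have "(\<lambda>p. \<Sum>i\<in>UNIV. (0 :: real) *\<^sub>R f i p) \<in> Delta \<A> f (Suc 0)"
      by (rule Delta_1_I) (intro allI smooth_fun_on_const open_UNIV)
    moreover have "(\<lambda>p. \<Sum>i\<in>UNIV. (0 :: real) *\<^sub>R f i p) = 0"
      by (rule ext) (simp only: scaleR_zero_left sum.neutral_const zero_fun_apply)
    ultimately show "0 \<in> Delta \<A> f (Suc 0)" by (simp only:)
    fix x assume "x \<in> Delta \<A> f (Suc 0)"
    then obtain c where c: "\<forall>i. smooth_fun_on \<A> UNIV (c i)" "x = (\<lambda>p. \<Sum>i\<in>UNIV. c i p *\<^sub>R f i p)" by (rule Delta_1_E)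
    show "a *\<^sub>R x \<in> Delta \<A> f (Suc 0)" for a
    proof -
      have eq: "a *\<^sub>R x = (\<lambda>p. \<Sum>i\<in>UNIV. (a * c i p) *\<^sub>R f i p)"
        unfolding c(2) scaleR_fun_def[of a "\<lambda>p. \<Sum>i\<in>UNIV. c i p *\<^sub>R f i p"] by (simp only: scaleR_sum_right scaleR_scaleR)
      show ?thesis unfolding eq
        by (rule Delta_1_I) (intro allI smooth_fun_on_mult smooth_fun_on_const open_UNIV spec[OF c(1)])
    qed
    fix y assume "y \<in> Delta \<A> f (Suc 0)"
    then obtain d where d: "\<forall>i. smooth_fun_on \<A> UNIV (d i)" "y = (\<lambda>p. \<Sum>i\<in>UNIV. d i p *\<^sub>R f i p)" by (rule Delta_1_E)
    have eq: "x + y = (\<lambda>p. \<Sum>i\<in>UNIV. (c i p + d i p) *\<^sub>R f i p)"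
      unfolding c(2) d(2) by (rule ext) (simp only: plus_fun_apply scaleR_add_left sum.distrib)
    show "x + y \<in> Delta \<A> f (Suc 0)"
      unfolding eq by (rule Delta_1_I) (intro allI smooth_fun_on_add open_UNIV spec[OF c(1)] spec[OF d(1)])
  qed
next
  case (ge2 k)
  have "Delta \<A> f (Suc (Suc k)) = {X + Y | X Y. X \<in> Delta \<A> f (Suc k) \<and>
        Y \<in> span {lie_bracket \<A> V W | V W. V \<in> Delta \<A> f (Suc k) \<and> W \<in> Delta \<A> f (Suc 0)}}"
    by (rule Delta.simps)
  also have "subspace \<dots>" by (rule subspace_sums[OF ge2(2) subspace_span])
  finally show ?case .
qed

lemma Delta_Suc: "Delta \<A> f k \<subseteq> Delta \<A> f (Suc k)"
proof (cases k)
  case 0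
  show ?thesis unfolding 0 using subspace_0[OF subspace_Delta[of "Suc 0"]] unfolding Delta.simps(1) by blast
next
  case (Suc j)
  have "X \<in> Delta \<A> f (Suc (Suc j))" if X: "X \<in> Delta \<A> f (Suc j)" for X
    unfolding Delta.simps(3) mem_Collect_eq
    by (rule exI[of _ X], rule exI[of _ 0]) (intro conjI X span_zero, simp only: add_0_right)
  then show ?thesis unfolding Suc by blast
qed

lemma Delta_mono: "k \<le> l \<Longrightarrow> Delta \<A> f k \<subseteq> Delta \<A> f l"
  by (rule lift_Suc_mono_le[of "Delta \<A> f", OF Delta_Suc])

end

section \<open>Bracket polynomials as differential operators\<close>

lemma wcoeff_mult_letter: "wcoeff (P * letter j) (v @ [k]) = (if k = j then wcoeff P v else 0)"
proof -
  let ?u = "v @ [k]"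
  have "wcoeff (P * letter j) ?u = (\<Sum>i\<le>length ?u. if i = length v then (if k = j then wcoeff P v else 0) else 0)"
    unfolding times_word_series.rep_eq letter.rep_eq
  proof (rule sum.cong)
    fix i assume i: "i \<in> {..length ?u}"
    have "drop i ?u \<noteq> [j]" if "i \<noteq> length v"
    proof
      assume "drop i ?u = [j]"
      then have "length (drop i ?u) = 1" by simp
      then show False using i that by auto
    qed
    then show "wcoeff P (take i ?u) * (if drop i ?u = [j] then 1 else 0)
        = (if i = length v then (if k = j then wcoeff P v else 0) else 0)" by auto
  qed simp
  then show ?thesis by simp
qed

lemma wcoeff_letter_mult: "wcoeff (letter j * P) (k # v) = (if k = j then wcoeff P v else 0)"
proof -
  let ?u = "k # v"
  have "wcoeff (letter j * P) ?u = (\<Sum>i\<le>length ?u. if i = 1 then (if k = j then wcoeff P v else 0) else 0)"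
    unfolding times_word_series.rep_eq letter.rep_eq
  proof (rule sum.cong)
    fix i assume i: "i \<in> {..length ?u}"
    have "take i ?u \<noteq> [j]" if "i \<noteq> 1"
    proof
      assume "take i ?u = [j]"
      then have "length (take i ?u) = 1" by simp
      then show False using i that by auto
    qed
    then show "(if take i ?u = [j] then 1 else 0) * wcoeff P (drop i ?u)
        = (if i = 1 then (if k = j then wcoeff P v else 0) else 0)" by (auto simp: take_Cons')
  qed simp
  also have "\<dots> = (if k = j then wcoeff P v else 0)"
    by (subst sum.delta) simp_all
  finally show ?thesis .
qed

context local_system
begin

definition bracket_operator :: "'m list \<Rightarrow> (real ^ 'n \<Rightarrow> real) \<Rightarrow> real ^ 'n \<Rightarrow> real" where
  "bracket_operator I b x = (\<Sum>w | length w = length I. wcoeff (bracket_polynomial I) w * word_derivative w b x)"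

lemma bracket_field_operator: "bracket_field I x $ j = bracket_operator I (\<lambda>x. x $ j) x"
  by (simp add: bracket_field_def bracket_operator_def)

lemma smooth_bracket_operator: "smooth_on \<Omega> b \<Longrightarrow> smooth_on \<Omega> (bracket_operator I b)"
  unfolding bracket_operator_def
  by (intro smooth_on_sum smooth_on_cmult smooth_word_derivative open_\<Omega>)

lemma lie_derivative_sum:
  assumes "finite S" "\<And>v. v \<in> S \<Longrightarrow> smooth_on \<Omega> (g v)" "x \<in> \<Omega>"
  shows "lie_derivative j (\<lambda>x. \<Sum>v\<in>S. c v * g v x) x = (\<Sum>v\<in>S. c v * lie_derivative j (g v) x)"
proof -
  have "((\<lambda>x. \<Sum>v\<in>S. c v * g v x) has_derivative (\<lambda>h. \<Sum>v\<in>S. c v * frechet_derivative (g v) (at x) h)) (at x)"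
    by (intro has_derivative_sum has_derivative_mult_right smooth_on_has_derivative[OF assms(2) assms(3)])
  from frechet_derivative_at[OF this, symmetric] show ?thesis
    unfolding lie_derivative_def by (rule fun_cong)
qed

text \<open>Multiplication by a letter on the right appends it to the words, where it acts on b
  first; on the left it acts last. The recursion of the polynomials thus becomes the commutator
  formula for a Lie bracket.\<close>

lemma bracket_operator_Cons:
  assumes b: "smooth_on \<Omega> b" and x: "x \<in> \<Omega>"
  shows "bracket_operator (j # i # I) b x
    = bracket_operator (i # I) (lie_derivative j b) x - lie_derivative j (bracket_operator (i # I) b) x"
proof -
  let ?J = "i # I" and ?P = "bracket_polynomial (i # I)"
  let ?A = "{w :: 'm list. length w = length (j # ?J)}" and ?B = "{v :: 'm list. length v = length ?J}"
  have finA: "finite ?A" by (rule finite_subset[OF _ finite_words[of "Suc (length (j # ?J))"]]) auto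
  have finB: "finite ?B" by (rule finite_subset[OF _ finite_words[of "Suc (length ?J)"]]) auto
  have "(\<Sum>w\<in>?A. wcoeff (?P * letter j) w * word_derivative w b x)
      = (\<Sum>w\<in>(\<lambda>v. v @ [j]) ` ?B. wcoeff (?P * letter j) w * word_derivative w b x)"
  proof (rule sum.mono_neutral_right[OF finA])
    show "\<forall>w\<in>?A - (\<lambda>v. v @ [j]) ` ?B. wcoeff (?P * letter j) w * word_derivative w b x = 0"
    proof
      fix w assume w: "w \<in> ?A - (\<lambda>v. v @ [j]) ` ?B"
      then obtain v k where vk: "w = v @ [k]" by (cases w rule: rev_exhaust) auto
      then have "k \<noteq> j" using w by auto
      then show "wcoeff (?P * letter j) w * word_derivative w b x = 0" by (simp add: vk wcoeff_mult_letter)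
    qed
  qed auto
  also have "\<dots> = (\<Sum>v\<in>?B. wcoeff ?P v * word_derivative v (lie_derivative j b) x)"
    by (subst sum.reindex) (auto simp: inj_on_def wcoeff_mult_letter)
  finally have 1: "(\<Sum>w\<in>?A. wcoeff (?P * letter j) w * word_derivative w b x)
      = bracket_operator ?J (lie_derivative j b) x" by (simp add: bracket_operator_def)
  have "(\<Sum>w\<in>?A. wcoeff (letter j * ?P) w * word_derivative w b x)
      = (\<Sum>w\<in>(\<lambda>v. j # v) ` ?B. wcoeff (letter j * ?P) w * word_derivative w b x)"
  proof (rule sum.mono_neutral_right[OF finA])
    show "\<forall>w\<in>?A - (\<lambda>v. j # v) ` ?B. wcoeff (letter j * ?P) w * word_derivative w b x = 0"
    proof
      fix w assume w: "w \<in> ?A - (\<lambda>v. j # v) ` ?B"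
      then obtain v k where vk: "w = k # v" by (cases w) auto
      then have "k \<noteq> j" using w by auto
      then show "wcoeff (letter j * ?P) w * word_derivative w b x = 0" by (simp add: vk wcoeff_letter_mult)
    qed
  qed auto
  also have "\<dots> = (\<Sum>v\<in>?B. wcoeff ?P v * lie_derivative j (word_derivative v b) x)"
    by (subst sum.reindex) (auto simp: inj_on_def wcoeff_letter_mult)
  also have "\<dots> = lie_derivative j (bracket_operator ?J b) x"
    unfolding bracket_operator_def
    by (rule lie_derivative_sum[symmetric, OF finB smooth_word_derivative[OF b] x])
  finally have 2: "(\<Sum>w\<in>?A. wcoeff (letter j * ?P) w * word_derivative w b x)
      = lie_derivative j (bracket_operator ?J b) x" .
  have "bracket_operator (j # i # I) b x = (\<Sum>w\<in>?A. wcoeff (?P * letter j) w * word_derivative w b x)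
      - (\<Sum>w\<in>?A. wcoeff (letter j * ?P) w * word_derivative w b x)"
    by (simp add: bracket_operator_def wcoeff_simps left_diff_distrib sum_subtractf)
  then show ?thesis by (simp only: 1 2)
qed

lemma bracket_operator_single: "bracket_operator [j] b x = lie_derivative j b x"
proof -
  have "{w :: 'm list. length w = length [j]} = (\<lambda>k. [k]) ` UNIV"
    by (auto simp: length_Suc_conv)
  then have "bracket_operator [j] b x = (\<Sum>k\<in>UNIV. (if k = j then 1 else 0) * lie_derivative k b x)"
    unfolding bracket_operator_def by (simp add: sum.reindex inj_on_def letter.rep_eq)
  also have "\<dots> = (\<Sum>k\<in>UNIV. if k = j then lie_derivative j b x else 0)"
    by (rule sum.cong) auto
  finally show ?thesis by simp
qed

end

section \<open>Tangent vectors and fields in a chart\<close>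

locale chart_coordinates = manifold \<A> for \<A> :: "('a::t2_space, 'n::finite) chart set" +
  fixes U :: "'a set" and z :: "'a \<Rightarrow> real ^ 'n"
  assumes local_coordinates: "local_coordinates \<A> (U, z)"
begin

definition "w = inv_into U z"

lemma chart: "is_chart (U, z)"
  using local_coordinates unfolding local_coordinates_def by (rule conjunct1)

lemma open_U: "open U" and open_zU: "open (z ` U)" and inj_z: "inj_on z U"
  and cont_z: "continuous_on U z" and cont_w: "continuous_on (z ` U) w"
  using chart_homeomorphism[OF chart] by (simp_all only: w_def)

lemma z_w: "x \<in> z ` U \<Longrightarrow> z (w x) = x" and w_U: "x \<in> z ` U \<Longrightarrow> w x \<in> U"
  unfolding w_def by (rule f_inv_into_f, assumption, rule inv_into_into)

lemma w_z: "p \<in> U \<Longrightarrow> w (z p) = p"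
  unfolding w_def by (rule inv_into_f_f[OF inj_z])

lemma compatible:
  assumes "(V, \<phi>) \<in> \<A>"
  shows "smooth_on (z ` (U \<inter> V)) (\<lambda>x. \<phi> (w x))" "smooth_on (\<phi> ` (U \<inter> V)) (\<lambda>x. z (inv_into V \<phi> x))"
proof -
  have "smoothly_compatible (U, z) (V, \<phi>)"
    using conjunct2[OF local_coordinates[unfolded local_coordinates_def]] assms by (rule bspec)
  then show "smooth_on (z ` (U \<inter> V)) (\<lambda>x. \<phi> (w x))" "smooth_on (\<phi> ` (U \<inter> V)) (\<lambda>x. z (inv_into V \<phi> x))"
    by (simp_all add: smoothly_compatible_def o_def w_def)
qed

text \<open>Smoothness on the manifold is tested in the charts of the atlas, and (U, z) need not be
  one of them; near each point the function factors through an atlas chart by a smooth transition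
  map.\<close>

lemma smooth_in_chart:
  assumes W: "open W" and a: "smooth_fun_on \<A> W a"
  shows "smooth_on (z ` (U \<inter> W)) (\<lambda>x. a (w x))"
proof (rule smooth_on_locally)
  fix x assume "x \<in> z ` (U \<inter> W)"
  then obtain p where p: "p \<in> U" "p \<in> W" "x = z p" by blast
  obtain V \<phi> where V: "(V, \<phi>) \<in> \<A>" "p \<in> V" by (rule atlas_cover)
  note c = chart_homeomorphism[OF atlas_chart[OF V(1)]]
  let ?T = "z ` (U \<inter> (V \<inter> W))"
  have oVW: "open (V \<inter> W)" using c(1) W by (rule open_Int)
  have oT: "open ?T" by (rule chart_image_open[OF chart oVW])
  have oS: "open (\<phi> ` (V \<inter> W))" by (rule chart_image_open[OF atlas_chart[OF V(1)] W])
  have 1: "smooth_on ?T (\<lambda>x. \<phi> (w x))"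
    by (rule smooth_on_subset[OF compatible(1)[OF V(1)]]) blast
  have 2: "smooth_on (\<phi> ` (V \<inter> W)) (\<lambda>y. a (inv_into V \<phi> y))"
    by (rule smooth_fun_onD[OF a V(1) refl])
  have "(\<lambda>x. \<phi> (w x)) ` ?T \<subseteq> \<phi> ` (V \<inter> W)" using w_z by fastforce
  from smooth_on_compose[OF oT oS 1 2 this]
  have "smooth_on ?T (\<lambda>x. a (w x))"
  proof (rule smooth_on_cong[OF _ oT])
    fix x assume "x \<in> ?T"
    then obtain p' where "p' \<in> U" "p' \<in> V" "x = z p'" by blast
    then show "a (inv_into V \<phi> (\<phi> (w x))) = a (w x)" by (simp only: w_z inv_into_f_f[OF c(3)])
  qed
  then show "\<exists>T. open T \<and> x \<in> T \<and> smooth_on T (\<lambda>x. a (w x))"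
    using oT p V(2) by blast
qed

lemma open_w_image:
  assumes "open S" "S \<subseteq> z ` U"
  shows "open (w ` S)"
proof -
  have "w ` S = U \<inter> z -` S"
  proof
    show "w ` S \<subseteq> U \<inter> z -` S" using assms(2) w_U z_w by (auto simp: subset_iff)
    show "U \<inter> z -` S \<subseteq> w ` S" using w_z by (metis IntE image_eqI subsetI vimageE)
  qed
  then show ?thesis using continuous_open_preimage[OF cont_z open_U assms(1)] by simp
qed

lemma smooth_from_chart:
  assumes S: "open S" "S \<subseteq> z ` U" and b: "smooth_on S b"
  shows "smooth_fun_on \<A> (w ` S) (\<lambda>p. b (z p))"
proof (rule smooth_fun_onI[OF open_w_image[OF S]])
  fix V \<phi> S' assume V: "(V, \<phi>) \<in> \<A>" and S': "S' = \<phi> ` (V \<inter> w ` S)" "open S'"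
  note c = chart_homeomorphism[OF atlas_chart[OF V(1)]]
  have sub: "S' \<subseteq> \<phi> ` (U \<inter> V)" unfolding S'(1) using S(2) w_U by blast
  have "(\<lambda>x. z (inv_into V \<phi> x)) ` S' \<subseteq> S"
  proof
    fix y assume "y \<in> (\<lambda>x. z (inv_into V \<phi> x)) ` S'"
    then obtain s where s: "s \<in> S" "w s \<in> V" "y = z (inv_into V \<phi> (\<phi> (w s)))" unfolding S'(1) by blast
    then have "y = z (w s)" by (simp only: inv_into_f_f[OF c(3)])
    then show "y \<in> S" using s(1) S(2) z_w by (simp add: subset_iff)
  qed
  from smooth_on_compose[OF S'(2) S(1) smooth_on_subset[OF compatible(2)[OF V] sub] b this]
  show "smooth_on S' (\<lambda>x. b (z (inv_into V \<phi> x)))" .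
qed

lemma sn_from_chart:
  assumes "open S" "S \<subseteq> z ` U" "smooth_on S b" "z p \<in> S" "p \<in> U"
  shows "sn p (\<lambda>p. b (z p))"
proof (rule snI[OF open_w_image[OF assms(1,2)] _ smooth_from_chart[OF assms(1-3)]])
  show "p \<in> w ` S" using w_z[OF assms(5)] assms(4) by (metis image_eqI)
qed

lemma sn_coordinate: "p \<in> U \<Longrightarrow> sn p (\<lambda>p. z p $ i)"
  by (rule sn_from_chart[OF open_zU order_refl smooth_on_nth[OF open_zU smooth_on_id[OF open_zU]]]) (simp_all only: imageI)

lemma sn_in_chart:
  assumes "sn p a" "p \<in> U"
  obtains S where "open S" "z p \<in> S" "S \<subseteq> z ` U" "smooth_on S (\<lambda>x. a (w x))"
proof -
  obtain W where W: "open W" "p \<in> W" "smooth_fun_on \<A> W a" using assms(1) unfolding smooth_near_def by blast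
  show ?thesis
    by (rule that[OF chart_image_open[OF chart W(1)] _ _ smooth_in_chart[OF W(1,3)]]) (use W(2) assms(2) in blast)+
qed

text \<open>By Hadamard's lemma a is, near p, a constant plus products of functions
  \<open>h i\<close> with coordinate differences that vanish at p. A derivation kills the constant,
  and of each product only the value of \<open>h i\<close> at p times the derivative of the
  coordinate survives.\<close>

lemma tangent_formula:
  assumes v: "v \<in> tangent_space \<A> p" and p: "p \<in> U" and a: "sn p a"
  shows "v a = frechet_derivative (\<lambda>x. a (w x)) (at (z p)) (pushforward z v)"
proof -
  let ?c = "z p" and ?b = "\<lambda>x. a (w x)"
  obtain S where S: "open S" "?c \<in> S" "S \<subseteq> z ` U" "smooth_on S ?b" by (rule sn_in_chart[OF a p])
  obtain r where r: "r > 0" "ball ?c r \<subseteq> S" using S(1,2) open_contains_ball by blast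
  have bS: "smooth_on (ball ?c r) ?b" by (rule smooth_on_subset[OF S(4) r(2)])
  obtain h where h: "\<And>i. smooth_on (ball ?c r) (h i)"
    "\<And>x. x \<in> ball ?c r \<Longrightarrow> ?b x = ?b ?c + (\<Sum>i\<in>UNIV. (x $ i - ?c $ i) * h i x)"
    "\<And>i. h i ?c = frechet_derivative ?b (at ?c) (axis i 1)"
    using hadamard[OF bS r(1)] by blast
  have rU: "ball ?c r \<subseteq> z ` U" using r(2) S(3) by (rule order_trans)
  have cr: "?c \<in> ball ?c r" using r(1) by simp
  have oG: "open (w ` ball ?c r)" by (rule open_w_image[OF open_ball rU])
  have pG: "p \<in> w ` ball ?c r" using w_z[OF p] cr by (metis image_eqI)
  have snh: "sn p (\<lambda>y. h i (z y))" for i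
    by (rule sn_from_chart[OF open_ball rU h(1) cr p])
  have snd: "sn p (\<lambda>y. z y $ i - ?c $ i)" for i
    by (rule sn_diff[OF sn_coordinate[OF p] sn_const])
  have "v a = v (\<lambda>y. a p + (\<Sum>i\<in>UNIV. (z y $ i - ?c $ i) * h i (z y)))"
  proof (rule tangent_cong[OF v a oG pG])
    fix y assume "y \<in> w ` ball ?c r"
    then obtain x where x: "x \<in> ball ?c r" "y = w x" by blast
    then have "z y = x" using rU z_w by (simp add: subset_iff)
    then show "a y = a p + (\<Sum>i\<in>UNIV. (z y $ i - ?c $ i) * h i (z y))"
      using h(2)[OF x(1)] x(2) by (simp only: w_z[OF p])
  qed
  also have "\<dots> = v (\<lambda>y. a p) + v (\<lambda>y. \<Sum>i\<in>UNIV. (z y $ i - ?c $ i) * h i (z y))"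
    by (rule tangent_add[OF v sn_const sn_sum[OF sn_mult[OF snd snh]]])
  also have "v (\<lambda>y. a p) = 0" by (rule tangent_const[OF v])
  also have "v (\<lambda>y. \<Sum>i\<in>UNIV. (z y $ i - ?c $ i) * h i (z y)) = (\<Sum>i\<in>UNIV. v (\<lambda>y. (z y $ i - ?c $ i) * h i (z y)))"
    by (rule tangent_sum[OF v sn_mult[OF snd snh]])
  also have "\<dots> = (\<Sum>i\<in>UNIV. (pushforward z v $ i) *\<^sub>R frechet_derivative ?b (at ?c) (axis i 1))"
  proof (rule sum.cong)
    fix i
    have "v (\<lambda>y. (z y $ i - ?c $ i) * h i (z y)) = (?c $ i - ?c $ i) * v (\<lambda>y. h i (z y)) + h i ?c * v (\<lambda>y. z y $ i - ?c $ i)"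
      by (rule tangent_mult[OF v snd snh])
    also have "v (\<lambda>y. z y $ i - ?c $ i) = v (\<lambda>y. z y $ i) - v (\<lambda>y. ?c $ i)"
      by (rule tangent_diff[OF v sn_coordinate[OF p] sn_const])
    also have "v (\<lambda>y. ?c $ i) = 0" by (rule tangent_const[OF v])
    finally show "v (\<lambda>y. (z y $ i - ?c $ i) * h i (z y)) = (pushforward z v $ i) *\<^sub>R frechet_derivative ?b (at ?c) (axis i 1)"
      by (simp add: pushforward_def h(3)[symmetric])
  qed (rule refl)
  also have "\<dots> = frechet_derivative ?b (at ?c) (pushforward z v)"
    by (rule frechet_derivative_sum_axis[symmetric, OF smooth_on_differentiable[OF S(4,2)]])
  finally show ?thesis by (simp only: add_0_left)
qed

lemma tangent_vector_eqI:
  assumes "v \<in> tangent_space \<A> p" "v' \<in> tangent_space \<A> p" "p \<in> U" "pushforward z v = pushforward z v'"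
  shows "v = v'"
  by (rule tangent_space_ext[OF assms(1,2)])
     (simp only: tangent_formula[OF assms(1,3)] tangent_formula[OF assms(2,3)] assms(4))

text \<open>Directional derivatives in the chart are derivations. Together with
  \<open>tangent_vector_eqI\<close> this makes \<open>pushforward z\<close> a bijection from the
  tangent space onto the coordinate vectors.\<close>

lemma tangent_vector_exists:
  assumes p: "p \<in> U"
  shows "\<exists>v\<in>tangent_space \<A> p. pushforward z v = \<xi>"
proof -
  \<comment> \<open>The value 0 on functions that are not smooth near p is prescribed by
    \<open>tangent_space\<close>.\<close>
  define v where "v a = (if sn p a then frechet_derivative (\<lambda>x. a (w x)) (at (z p)) \<xi> else 0)" for a
  have v: "v a = frechet_derivative (\<lambda>x. a (w x)) (at (z p)) \<xi>" if "sn p a" for a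
    unfolding v_def using that by (rule if_P)
  have d: "((\<lambda>x. a (w x)) has_derivative frechet_derivative (\<lambda>x. a (w x)) (at (z p))) (at (z p))" if s: "sn p a" for a
  proof -
    obtain S where S: "open S" "z p \<in> S" "S \<subseteq> z ` U" "smooth_on S (\<lambda>x. a (w x))" by (rule sn_in_chart[OF s p])
    show ?thesis by (rule smooth_on_has_derivative[OF S(4,2)])
  qed
  have fd: "frechet_derivative g (at (z p)) \<xi> = D \<xi>" if "(g has_derivative D) (at (z p))" for g :: "real ^ 'n \<Rightarrow> real" and D
    using frechet_derivative_at[OF that] by simp
  have "v \<in> tangent_space \<A> p"
  proof (rule tangent_spaceI)
    show "v a = 0" if "\<not> sn p a" for a unfolding v_def using that by (rule if_not_P)
    show "v a = v b" if a: "sn p a" and b: "sn p b" and W: "open W" "p \<in> W" "\<And>x. x \<in> W \<Longrightarrow> a x = b x" for a b W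
    proof -
      have "frechet_derivative (\<lambda>x. a (w x)) (at (z p)) = frechet_derivative (\<lambda>x. b (w x)) (at (z p))"
      proof (rule frechet_derivative_cong_open[OF chart_image_open[OF chart W(1)]])
        fix x assume "x \<in> z ` (U \<inter> W)"
        then obtain y where "y \<in> U" "y \<in> W" "x = z y" by blast
        then show "a (w x) = b (w x)" using W(3) by (simp only: w_z)
      qed (use p W(2) in blast)
      then show ?thesis by (simp only: v[OF a] v[OF b])
    qed
    show "v (\<lambda>x. a x + b x) = v a + v b" if a: "sn p a" and b: "sn p b" for a b
      unfolding v[OF a] v[OF b] v[OF sn_add[OF a b]] by (rule fd[OF has_derivative_add[OF d[OF a] d[OF b]]])
    show "v (\<lambda>x. a x * b x) = a p * v b + b p * v a" if a: "sn p a" and b: "sn p b" for a b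
      unfolding v[OF a] v[OF b] v[OF sn_mult[OF a b]]
      using fd[OF has_derivative_mult[OF d[OF a] d[OF b]]] by (simp add: w_z[OF p] mult.commute)
    show "v (\<lambda>x. c * a x) = c * v a" if a: "sn p a" for a c
      unfolding v[OF a] v[OF sn_mult[OF sn_const a]] by (rule fd[OF has_derivative_mult_right[OF d[OF a]]])
  qed
  moreover have "v (\<lambda>p. z p $ i) = \<xi> $ i" for i
  proof -
    have "frechet_derivative (\<lambda>x. z (w x) $ i) (at (z p)) = frechet_derivative (\<lambda>x. x $ i) (at (z p))"
      by (rule frechet_derivative_cong_open[OF open_zU]) (use p z_w in auto)
    moreover have "frechet_derivative (\<lambda>x :: real ^ 'n. x $ i) (at (z p)) \<xi> = \<xi> $ i"
      by (rule fd[OF bounded_linear_imp_has_derivative[OF bounded_linear_vec_nth]])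
    ultimately show ?thesis by (simp only: v[OF sn_coordinate[OF p]])
  qed
  then have "pushforward z v = \<xi>" by (simp add: pushforward_def vec_eq_iff)
  ultimately show ?thesis by blast
qed

lemma field_apply:
  assumes X: "svf X" and x: "x \<in> z ` U" and b: "smooth_on (z ` U) b"
  shows "X (w x) (\<lambda>p. b (z p)) = frechet_derivative b (at x) (pushforward z (X (w x)))"
proof -
  have "X (w x) (\<lambda>p. b (z p)) = frechet_derivative (\<lambda>x. b (z (w x))) (at (z (w x))) (pushforward z (X (w x)))"
    by (rule tangent_formula[OF svf_tangent[OF X] w_U[OF x] sn_from_chart[OF open_zU order_refl b _ w_U[OF x]]])
       (simp only: z_w[OF x] x)
  also have "frechet_derivative (\<lambda>x. b (z (w x))) (at (z (w x))) = frechet_derivative b (at x)"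
    unfolding z_w[OF x] by (rule frechet_derivative_cong_open[OF open_zU _ x]) (simp only: z_w)
  finally show ?thesis .
qed

lemma coordinate_field_smooth:
  assumes X: "svf X"
  shows "smooth_on (z ` U) (\<lambda>x. pushforward z (X (w x)))"
proof (rule smooth_on_vec[OF open_zU])
  fix i
  have wU: "w ` (z ` U) = U" using w_z by (force simp: image_image)
  have "smooth_fun_on \<A> U (\<lambda>p. z p $ i)"
    using smooth_from_chart[OF open_zU order_refl smooth_on_nth[OF open_zU smooth_on_id[OF open_zU]], of i]
    unfolding wU .
  from smooth_in_chart[OF open_U svf_smooth[OF X open_U this]]
  show "smooth_on (z ` U) (\<lambda>x. pushforward z (X (w x)) $ i)"
    by (simp only: pushforward_def vec_lambda_beta Int_absorb)
qed

end

locale chart_family = smooth_family \<A> f + chart_coordinates \<A> U z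
  for \<A> :: "('a::t2_space, 'n::finite) chart set" and f :: "'m::finite \<Rightarrow> 'a vector_field"
    and U :: "'a set" and z :: "'a \<Rightarrow> real ^ 'n"
begin

definition coordinate_field :: "'m \<Rightarrow> real ^ 'n \<Rightarrow> real ^ 'n" where
  "coordinate_field i x = pushforward z (f i (w x))"

lemma smooth_coordinate_field: "smooth_on (z ` U) (coordinate_field i)"
  unfolding coordinate_field_def by (rule coordinate_field_smooth[OF f])

text \<open>The link between geometric brackets and noncommutative polynomials. The test function b
  is general because the induction step applies the shorter bracket to
  \<open>lie_derivative j b\<close>; the coordinate functions alone are not stable under
  this.\<close>

lemma iterated_bracket_operator:
  assumes ls: "local_system (z ` U) coordinate_field e R B s0 Y"
    and I: "I \<noteq> []" and b: "smooth_on (z ` U) b" and x: "x \<in> z ` U"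
  shows "iterated_bracket I (w x) (\<lambda>p. b (z p)) = local_system.bracket_operator coordinate_field I b x"
  using I b x
proof (induction I arbitrary: b x rule: iterated_bracket.induct)
  case (2 j)
  interpret L: local_system "z ` U" coordinate_field e R B s0 Y by (rule ls)
  have "f j (w x) (\<lambda>p. b (z p)) = frechet_derivative b (at x) (coordinate_field j x)"
    unfolding coordinate_field_def by (rule field_apply[OF f 2(3,2)])
  then show ?case
    unfolding L.bracket_operator_single L.lie_derivative_def iterated_bracket.simps .
next
  case (3 j i I)
  interpret L: local_system "z ` U" coordinate_field e R B s0 Y by (rule ls)
  let ?p = "w x" and ?F = "iterated_bracket (i # I)"
  have ne: "i # I \<noteq> []" by simp
  have p: "?p \<in> U" by (rule w_U[OF 3(4)])
  have zp: "z ?p \<in> z ` U" using p by (rule imageI)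
  have F: "svf ?F" by (rule svf_iterated_bracket)
  have snb: "sn y (\<lambda>p. b (z p))" if "y \<in> U" for y
    by (rule sn_from_chart[OF open_zU order_refl 3(3) imageI[OF that] that])
  have 1: "f j y (\<lambda>p. b (z p)) = L.lie_derivative j b (z y)" if "y \<in> U" for y
    using field_apply[OF f imageI[OF that] 3(3), of j]
    unfolding w_z[OF that] L.lie_derivative_def coordinate_field_def .
  have 2: "?F y (\<lambda>p. b (z p)) = L.bracket_operator (i # I) b (z y)" if "y \<in> U" for y
    using 3(1)[OF ne 3(3) imageI[OF that]] unfolding w_z[OF that] .
  have "?F ?p (\<lambda>y. f j y (\<lambda>p. b (z p))) = ?F ?p (\<lambda>y. L.lie_derivative j b (z y))"
    by (rule tangent_cong[OF svf_tangent[OF F] svf_sn[OF f snb[OF p]] open_U p 1])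
  also have "\<dots> = L.bracket_operator (i # I) (L.lie_derivative j b) x"
    by (rule 3(1)[OF ne L.smooth_lie_derivative[OF 3(3)] 3(4)])
  finally have A: "?F ?p (\<lambda>y. f j y (\<lambda>p. b (z p))) = L.bracket_operator (i # I) (L.lie_derivative j b) x" .
  have "f j ?p (\<lambda>y. ?F y (\<lambda>p. b (z p))) = f j ?p (\<lambda>y. L.bracket_operator (i # I) b (z y))"
    by (rule tangent_cong[OF svf_tangent[OF f] svf_sn[OF F snb[OF p]] open_U p 2])
  also have "\<dots> = L.lie_derivative j (L.bracket_operator (i # I) b) x"
    using field_apply[OF f 3(4) L.smooth_bracket_operator[OF 3(3)], of j "i # I"]
    unfolding L.lie_derivative_def coordinate_field_def .
  finally have B: "f j ?p (\<lambda>y. ?F y (\<lambda>p. b (z p))) = L.lie_derivative j (L.bracket_operator (i # I) b) x" .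
  show ?case
    unfolding iterated_bracket.simps lie_bracket_apply[OF snb[OF p]] A B
    by (rule L.bracket_operator_Cons[OF 3(3,4), symmetric])
qed simp

lemma pushforward_iterated_bracket:
  assumes ls: "local_system (z ` U) coordinate_field e R B s0 Y" and I: "I \<noteq> []" and x: "x \<in> z ` U"
  shows "pushforward z (iterated_bracket I (w x)) = local_system.bracket_field coordinate_field I x"
proof -
  interpret L: local_system "z ` U" coordinate_field e R B s0 Y by (rule ls)
  show ?thesis
    unfolding vec_eq_iff pushforward_def vec_lambda_beta L.bracket_field_operator
    by (intro allI iterated_bracket_operator[OF ls I L.smooth_coordinate x])
qed

lemma pushforward_combination: "pushforward z (c *\<^sub>R v + v') = c *\<^sub>R pushforward z v + pushforward z v'"
  by (simp add: pushforward_def vec_eq_iff scaleR_fun_def)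

lemma pushforward_zero: "pushforward z 0 = 0"
  by (simp add: pushforward_def vec_eq_iff)

lemma pushforward_bracket_module:
  assumes "X \<in> bracket_module k"
  shows "pushforward z (X p) \<in> span {pushforward z (iterated_bracket I p) | I. I \<noteq> [] \<and> length I \<le> k}"
  using assms
proof (induction rule: bracket_module.induct)
  case zero
  show ?case unfolding zero_fun_apply[of p] pushforward_zero by (rule span_zero)
next
  case (combination X b I)
  have eq: "((\<lambda>p. b p *\<^sub>R iterated_bracket I p) + X) p = b p *\<^sub>R iterated_bracket I p + X p" by (rule plus_fun_apply)
  show ?case
    unfolding eq pushforward_combination
    by (rule span_add[OF span_scale[OF span_base] combination(5)]) (use combination(3,4) in blast)
qed

lemma pushforward_Delta_sum:
  assumes "finite S" "\<And>j. j \<in> S \<Longrightarrow> \<exists>X\<in>Delta \<A> f k. pushforward z (X p) = g j"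
  shows "\<exists>X\<in>Delta \<A> f k. pushforward z (X p) = (\<Sum>j\<in>S. c j *\<^sub>R g j)"
  using assms
proof (induction S)
  case empty
  show ?case
    using subspace_0[OF subspace_Delta] unfolding sum.empty
    by (rule bexI[rotated]) (unfold zero_fun_apply[of p], rule pushforward_zero)
next
  case (insert j S)
  obtain X where X: "X \<in> Delta \<A> f k" "pushforward z (X p) = (\<Sum>j\<in>S. c j *\<^sub>R g j)"
    using insert.IH insert.prems by blast
  obtain X' where X': "X' \<in> Delta \<A> f k" "pushforward z (X' p) = g j" using insert.prems by blast
  have "c j *\<^sub>R X' + X \<in> Delta \<A> f k"
    using subspace_Delta X(1) X'(1) by (intro subspace_add subspace_scale)
  moreover have "pushforward z ((c j *\<^sub>R X' + X) p) = (\<Sum>j\<in>insert j S. c j *\<^sub>R g j)"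
  proof -
    have "(c j *\<^sub>R X' + X) p = (c j *\<^sub>R X') p + X p" by (rule plus_fun_apply)
    also have "(c j *\<^sub>R X') p = c j *\<^sub>R X' p" unfolding scaleR_fun_def[of "c j" X'] by (rule refl)
    finally have "(c j *\<^sub>R X' + X) p = c j *\<^sub>R X' p + X p" .
    then show ?thesis by (simp only: pushforward_combination X(2) X'(2) sum.insert[OF insert(1,2)])
  qed
  ultimately show ?case by blast
qed

text \<open>The Hoermander condition places each tangent vector at q in some level of the flag. The
  levels increase, so lifts of the finitely many basis vectors lie in a common one, which then fills
  the tangent space; hence the minimum in the definition is attained.\<close>

lemma nonholonomy_degree:
  assumes h: "hoermander \<A> f" and q: "q \<in> U"
  shows "1 \<le> nonholonomy_degree \<A> f q \<and> Delta_at \<A> f (nonholonomy_degree \<A> f q) q = tangent_space \<A> q"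
proof -
  have hq: "(\<Union>k\<in>{1..}. Delta_at \<A> f k q) = tangent_space \<A> q" using h unfolding hoermander_def by blast
  have "\<forall>j. \<exists>k. \<exists>X\<in>Delta \<A> f k. pushforward z (X q) = axis j 1"
  proof
    fix j
    obtain v where v: "v \<in> tangent_space \<A> q" "pushforward z v = axis j 1" using tangent_vector_exists[OF q] by blast
    then obtain k X where "X \<in> Delta \<A> f k" "v = X q" unfolding hq[symmetric] Delta_at_def by blast
    then show "\<exists>k. \<exists>X\<in>Delta \<A> f k. pushforward z (X q) = axis j 1" using v(2) by blast
  qed
  from choice[OF this] obtain k where k: "\<And>j. \<exists>X\<in>Delta \<A> f (k j). pushforward z (X q) = axis j 1" by blast
  \<comment> \<open>The entry 1 keeps the level positive, as the definition of the degree
    requires.\<close>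
  define K where "K = Max (insert 1 (range k))"
  have K: "1 \<le> K" "k j \<le> K" for j unfolding K_def by (rule Max_ge; simp)+
  have "Delta_at \<A> f K q = tangent_space \<A> q"
  proof
    show sub: "Delta_at \<A> f K q \<subseteq> tangent_space \<A> q" using hq K(1) by blast
    show "tangent_space \<A> q \<subseteq> Delta_at \<A> f K q"
    proof
      fix v assume v: "v \<in> tangent_space \<A> q"
      have ex: "\<exists>X\<in>Delta \<A> f K. pushforward z (X q) = axis j 1" for j
      proof -
        obtain X where X: "X \<in> Delta \<A> f (k j)" "pushforward z (X q) = axis j 1" using k[of j] ..
        show ?thesis by (rule bexI[where x = X], rule X(2)) (rule subsetD[OF Delta_mono[OF K(2)] X(1)])
      qed
      have "\<exists>X\<in>Delta \<A> f K. pushforward z (X q) = (\<Sum>j\<in>UNIV. (pushforward z v $ j) *\<^sub>R axis j 1)"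
        by (rule pushforward_Delta_sum[OF finite ex])
      then obtain X where X: "X \<in> Delta \<A> f K" "pushforward z (X q) = (\<Sum>j\<in>UNIV. (pushforward z v $ j) *\<^sub>R axis j 1)" ..
      have Xq: "X q \<in> Delta_at \<A> f K q" unfolding Delta_at_def using X(1) by blast
      have "X q = v"
        using X(2) unfolding sum_axis by (rule tangent_vector_eqI[OF subsetD[OF sub Xq] v q])
      then show "v \<in> Delta_at \<A> f K q" using Xq by (simp only:)
    qed
  qed
  then have "\<exists>r. 1 \<le> r \<and> Delta_at \<A> f r q = tangent_space \<A> q" using K(1) by blast
  from LeastI_ex[OF this] show ?thesis unfolding nonholonomy_degree_def .
qed

text \<open>At the point q the coefficient functions of the bracket module become numbers, so the
  level of the flag that fills the tangent space forces the brackets up to that length to span. This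
  is the spanning hypothesis of \<open>local_reachability\<close>.\<close>

lemma bracket_fields_span:
  assumes ls: "local_system (z ` U) coordinate_field e R B s0 Y"
    and h: "hoermander \<A> f" and q: "q \<in> U"
  shows "span {local_system.bracket_field coordinate_field I (z q) | I. I \<noteq> [] \<and> length I \<le> nonholonomy_degree \<A> f q} = UNIV"
proof -
  let ?r = "nonholonomy_degree \<A> f q"
  have bf: "local_system.bracket_field coordinate_field I (z q) = pushforward z (iterated_bracket I q)" if "I \<noteq> []" for I
    using pushforward_iterated_bracket[OF ls that imageI[OF q]] unfolding w_z[OF q] by (rule sym)
  have "{pushforward z (iterated_bracket I q) | I. I \<noteq> [] \<and> length I \<le> ?r}
      \<subseteq> {local_system.bracket_field coordinate_field I (z q) | I. I \<noteq> [] \<and> length I \<le> ?r}"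
  proof
    fix \<xi> assume "\<xi> \<in> {pushforward z (iterated_bracket I q) | I. I \<noteq> [] \<and> length I \<le> ?r}"
    then obtain I where I: "\<xi> = pushforward z (iterated_bracket I q)" "I \<noteq> []" "length I \<le> ?r" by blast
    show "\<xi> \<in> {local_system.bracket_field coordinate_field I (z q) | I. I \<noteq> [] \<and> length I \<le> ?r}"
      unfolding I(1) bf[OF I(2), symmetric] using I(2,3) by blast
  qed
  from span_mono[OF this]
  have sub: "span {pushforward z (iterated_bracket I q) | I. I \<noteq> [] \<and> length I \<le> ?r}
      \<subseteq> span {local_system.bracket_field coordinate_field I (z q) | I. I \<noteq> [] \<and> length I \<le> ?r}" .
  have "\<xi> \<in> span {pushforward z (iterated_bracket I q) | I. I \<noteq> [] \<and> length I \<le> ?r}" for \<xi>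
  proof -
    obtain v where v: "v \<in> tangent_space \<A> q" "pushforward z v = \<xi>" using tangent_vector_exists[OF q] by blast
    then have "v \<in> Delta_at \<A> f ?r q" using nonholonomy_degree[OF h q] by blast
    then obtain X where X: "X \<in> Delta \<A> f ?r" "v = X q" unfolding Delta_at_def by blast
    show ?thesis
      using pushforward_bracket_module[OF subsetD[OF Delta_subset_bracket_module X(1)], of q] v(2) X(2) by (simp only:)
  qed
  then show ?thesis using sub by blast
qed

end

subsection \<open>Curves in a chart\<close>

lemma has_vector_derivative_vec:
  fixes g :: "real \<Rightarrow> real ^ 'n"
  assumes "\<And>i. ((\<lambda>s. g s $ i) has_real_derivative d $ i) F"
  shows "(g has_vector_derivative d) F"
proof -
  have "((\<lambda>s. (g s $ i) *\<^sub>R (axis i 1 :: real ^ 'n)) has_vector_derivative (d $ i) *\<^sub>R axis i 1) F" for i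
    using assms[of i] unfolding has_real_derivative_iff_has_vector_derivative
    by (rule bounded_linear.has_vector_derivative[OF bounded_linear_scaleR_left])
  then have "((\<lambda>s. \<Sum>i\<in>UNIV. (g s $ i) *\<^sub>R (axis i 1 :: real ^ 'n)) has_vector_derivative (\<Sum>i\<in>UNIV. (d $ i) *\<^sub>R axis i 1)) F"
    by (intro has_vector_derivative_sum)
  then show ?thesis by (simp only: sum_axis)
qed

text \<open>G need not be convex, so the mean value inequality is applied on balls centred on the
  curve. By compactness they have a common radius and lie in the compact set K, on which the
  derivative is bounded; points of the curve at nearby times share such a ball.\<close>

lemma abs_continuous_on_ivl_smooth_compose:
  fixes g :: "real ^ 'n \<Rightarrow> 'b::real_normed_vector" and \<eta> :: "real \<Rightarrow> real ^ 'n"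
  assumes G: "open G" "smooth_on G g" and \<eta>: "L-lipschitz_on {s..t} \<eta>" "\<eta> ` {s..t} \<subseteq> G"
  shows "abs_continuous_on_ivl s t (\<lambda>x. g (\<eta> x))"
proof -
  have "compact (\<eta> ` {s..t})"
    by (intro compact_continuous_image lipschitz_on_continuous_on[OF \<eta>(1)] compact_Icc)
  from compact_subset_open_imp_cball_epsilon_subset[OF this G(1) \<eta>(2)]
  obtain \<epsilon> where \<epsilon>: "\<epsilon> > 0" "(\<Union>x\<in>\<eta> ` {s..t}. cball x \<epsilon>) \<subseteq> G" by blast
  define K where "K = {x + y | x y. x \<in> \<eta> ` {s..t} \<and> y \<in> cball 0 \<epsilon>}"
  have K: "compact K" unfolding K_def by (rule compact_sums[OF \<open>compact (\<eta> ` {s..t})\<close> compact_cball])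
  have KG: "K \<subseteq> G"
  proof
    fix p assume "p \<in> K"
    then obtain x y where xy: "p = x + y" "x \<in> \<eta> ` {s..t}" "y \<in> cball 0 \<epsilon>" unfolding K_def by blast
    then have "p \<in> cball x \<epsilon>" by (simp add: dist_norm)
    then show "p \<in> G" using \<epsilon>(2) xy(2) by blast
  qed
  have cK: "cball x \<epsilon> \<subseteq> K" if "x \<in> \<eta> ` {s..t}" for x
  proof
    fix p assume "p \<in> cball x \<epsilon>"
    then have "p = x + (p - x)" "p - x \<in> cball 0 \<epsilon>" by (simp_all add: dist_norm norm_minus_commute)
    then show "p \<in> K" unfolding K_def using that by blast
  qed
  obtain B where B: "B > 0" "\<And>x v. x \<in> K \<Longrightarrow> norm (frechet_derivative g (at x) v) \<le> B * norm v"
    using smooth_on_derivative_bounded[OF G(2) K KG] by blast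
  have L: "L \<ge> 0" using \<eta>(1) by (rule lipschitz_on_nonneg)
  show ?thesis
  proof (rule abs_continuous_on_ivl_locally_lipschitz[of "\<epsilon> / (L + 1)" "B * L"])
    show "\<epsilon> / (L + 1) > 0" "B * L \<ge> 0" using \<epsilon>(1) L B(1) by simp_all
    fix x y assume xy: "s \<le> x" "x \<le> y" "y \<le> t" "y - x < \<epsilon> / (L + 1)"
    have d: "dist (\<eta> y) (\<eta> x) \<le> L * (y - x)"
      using lipschitz_onD[OF \<eta>(1), of y x] xy by (simp add: dist_real_def)
    also have "\<dots> \<le> (L + 1) * (y - x)" using xy by (intro mult_right_mono) auto
    also have "\<dots> \<le> \<epsilon>" using xy(4) L by (simp add: field_simps)
    finally have "\<eta> y \<in> cball (\<eta> x) \<epsilon>" by (simp add: dist_commute)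
    moreover have "\<eta> x \<in> cball (\<eta> x) \<epsilon>" using \<epsilon>(1) by simp
    ultimately have "norm (g (\<eta> y) - g (\<eta> x)) \<le> B * norm (\<eta> y - \<eta> x)"
    proof (rule differentiable_bound[OF convex_cball, rotated 2])
      fix p assume p: "p \<in> cball (\<eta> x) \<epsilon>"
      have pK: "p \<in> K" using cK[of "\<eta> x"] p xy by auto
      show "(g has_derivative frechet_derivative g (at p)) (at p within cball (\<eta> x) \<epsilon>)"
        by (rule has_derivative_at_withinI[OF smooth_on_has_derivative[OF G(2) subsetD[OF KG pK]]])
      show "onorm (frechet_derivative g (at p)) \<le> B"
        using B(1) B(2)[OF pK] by (intro onorm_bound) auto
    qed
    also have "\<dots> \<le> B * (L * (y - x))" using d B(1) by (intro mult_left_mono) (auto simp: dist_norm)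
    finally show "norm (g (\<eta> y) - g (\<eta> x)) \<le> B * L * (y - x)" by (simp add: mult.assoc)
  qed
qed

lemma abs_continuous_on_ivl_add:
  assumes f: "abs_continuous_on_ivl s t f" and g: "abs_continuous_on_ivl s t g"
  shows "abs_continuous_on_ivl s t (\<lambda>x. f x + g x)"
  unfolding abs_continuous_on_ivl_def
proof (intro allI impI)
  fix e :: real assume "e > 0"
  then have e: "e / 2 > 0" by simp
  let ?ok = "\<lambda>D \<delta>. finite D \<and> (\<forall>(x, y)\<in>D. s \<le> x \<and> x \<le> y \<and> y \<le> t) \<and>
     disjoint_family_on (\<lambda>(x, y). {x<..<y}) D \<and> (\<Sum>(x, y)\<in>D. y - x) < \<delta>"
  obtain d1 where d1: "d1 > 0" "\<forall>D. ?ok D d1 \<longrightarrow> (\<Sum>(x, y)\<in>D. norm (f y - f x)) < e / 2"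
    using spec[OF f[unfolded abs_continuous_on_ivl_def], of "e / 2"] e by auto
  obtain d2 where d2: "d2 > 0" "\<forall>D. ?ok D d2 \<longrightarrow> (\<Sum>(x, y)\<in>D. norm (g y - g x)) < e / 2"
    using spec[OF g[unfolded abs_continuous_on_ivl_def], of "e / 2"] e by auto
  show "\<exists>\<delta>>0. \<forall>D. ?ok D \<delta> \<longrightarrow> (\<Sum>(x, y)\<in>D. norm (f y + g y - (f x + g x))) < e"
  proof (intro exI[of _ "min d1 d2"] conjI allI impI)
    show "min d1 d2 > 0" using d1(1) d2(1) by simp
    fix D assume D: "?ok D (min d1 d2)"
    have "(\<Sum>(x, y)\<in>D. norm (f y + g y - (f x + g x))) \<le> (\<Sum>p\<in>D. (case p of (x, y) \<Rightarrow> norm (f y - f x)) + (case p of (x, y) \<Rightarrow> norm (g y - g x)))"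
      by (rule sum_mono) (auto simp: add_diff_add norm_triangle_ineq)
    also have "\<dots> = (\<Sum>(x, y)\<in>D. norm (f y - f x)) + (\<Sum>(x, y)\<in>D. norm (g y - g x))"
      by (rule sum.distrib)
    also have "\<dots> < e / 2 + e / 2"
      using D by (intro add_strict_mono d1(2)[rule_format] d2(2)[rule_format]) auto
    finally show "(\<Sum>(x, y)\<in>D. norm (f y + g y - (f x + g x))) < e" by simp
  qed
qed

lemma abs_continuous_on_ivl_linear: "abs_continuous_on_ivl s t (\<lambda>x. x *\<^sub>R (c :: 'a::real_normed_vector))"
proof (rule abs_continuous_on_ivl_locally_lipschitz[of 1 "norm c"])
  fix x y :: real assume "x \<le> y"
  then show "norm (y *\<^sub>R c - x *\<^sub>R c) \<le> norm c * (y - x)"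
    by (simp add: scaleR_diff_left[symmetric] mult.commute)
qed simp_all

context chart_coordinates
begin

lemma has_velocity_in_chart:
  assumes "has_velocity \<A> \<gamma> v t I" "\<gamma> t \<in> U"
  shows "((\<lambda>s. z (\<gamma> s)) has_vector_derivative pushforward z v) (at t within I)"
proof (rule has_vector_derivative_vec)
  fix i
  have "((\<lambda>s. z (\<gamma> s) $ i) has_real_derivative v (\<lambda>x. z x $ i)) (at t within I)"
    using assms(1)[unfolded has_velocity_def, THEN spec, of "\<lambda>x. z x $ i"] sn_coordinate[OF assms(2), of i] by blast
  then show "((\<lambda>s. z (\<gamma> s) $ i) has_real_derivative pushforward z v $ i) (at t within I)"
    by (simp only: pushforward_def vec_lambda_beta)
qed

lemma has_velocity_from_chart:
  assumes \<eta>: "(\<eta> has_vector_derivative pushforward z v) (at t within I)" and v: "v \<in> tangent_space \<A> (w (\<eta> t))"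
    and t: "\<eta> t \<in> z ` U"
  shows "has_velocity \<A> (\<lambda>s. w (\<eta> s)) v t I"
  unfolding has_velocity_def
proof (intro allI impI)
  fix a assume a: "sn (w (\<eta> t)) a"
  let ?b = "\<lambda>x. a (w x)"
  obtain S where S: "open S" "z (w (\<eta> t)) \<in> S" "S \<subseteq> z ` U" "smooth_on S ?b" by (rule sn_in_chart[OF a w_U[OF t]])
  have d: "(?b has_derivative frechet_derivative ?b (at (\<eta> t))) (at (\<eta> t) within \<eta> ` I)"
    using smooth_on_has_derivative[OF S(4,2)] unfolding z_w[OF t] by (rule has_derivative_at_withinI)
  interpret linear "frechet_derivative ?b (at (\<eta> t))" using d by (rule has_derivative_linear)
  have "((?b \<circ> \<eta>) has_derivative (frechet_derivative ?b (at (\<eta> t)) \<circ> (\<lambda>h. h *\<^sub>R pushforward z v))) (at t within I)"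
    using diff_chain_within[OF \<eta>[unfolded has_vector_derivative_def] d] .
  moreover have "frechet_derivative ?b (at (\<eta> t)) \<circ> (\<lambda>h. h *\<^sub>R pushforward z v) = (\<lambda>h. v a * h)"
    using tangent_formula[OF v w_U[OF t] a] unfolding z_w[OF t] by (simp add: fun_eq_iff scale mult.commute)
  ultimately show "((\<lambda>s. a (w (\<eta> s))) has_real_derivative v a) (at t within I)"
    unfolding has_field_derivative_def o_def by (simp only:)
qed

lemma abs_continuous_curve_from_chart:
  assumes \<eta>: "L-lipschitz_on {0..T} \<eta>" "\<eta> ` {0..T} \<subseteq> z ` U"
  shows "abs_continuous_curve \<A> T (\<lambda>t. w (\<eta> t))"
  unfolding abs_continuous_curve_def
proof (intro conjI ballI case_prodI2 allI impI)
  show "continuous_on {0..T} (\<lambda>t. w (\<eta> t))"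
    by (rule continuous_on_compose2[OF cont_w lipschitz_on_continuous_on[OF \<eta>(1)] \<eta>(2)])
  fix c V \<phi> s t assume c: "c \<in> \<A>" "c = (V, \<phi>)"
    and st: "0 \<le> s \<and> s \<le> t \<and> t \<le> T \<and> (\<lambda>t. w (\<eta> t)) ` {s..t} \<subseteq> V"
  have V: "(V, \<phi>) \<in> \<A>" using c by (simp only:)
  have sub: "{s..t} \<subseteq> {0..T}" using st by auto
  have "abs_continuous_on_ivl s t (\<lambda>x. \<phi> (w (\<eta> x)))"
  proof (rule abs_continuous_on_ivl_smooth_compose[OF _ compatible(1)[OF V] lipschitz_on_subset[OF \<eta>(1) sub]])
    show "open (z ` (U \<inter> V))" by (rule chart_image_open[OF chart chart_homeomorphism(1)[OF atlas_chart[OF V]]])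
    show "\<eta> ` {s..t} \<subseteq> z ` (U \<inter> V)"
    proof
      fix x assume "x \<in> \<eta> ` {s..t}"
      then obtain r where r: "r \<in> {s..t}" "x = \<eta> r" by blast
      then have xU: "x \<in> z ` U" using \<eta>(2) sub by blast
      have "w x \<in> V" using st r by blast
      then show "x \<in> z ` (U \<inter> V)" using w_U[OF xU] z_w[OF xU] by (metis IntI image_eqI)
    qed
  qed
  then show "abs_continuous_on_ivl s t (\<phi> \<circ> (\<lambda>t. w (\<eta> t)))" unfolding o_def .
qed

text \<open>Absolute continuity is given in atlas charts, so it passes to z only on short time
  intervals. The estimate is additive over adjacent intervals, and Bolzano's bisection principle
  turns the local estimates into the global one.\<close>

lemma abs_continuous_curve_estimate:
  assumes \<gamma>: "abs_continuous_curve \<A> T \<gamma>" and b: "0 \<le> b" "b \<le> T" and U: "\<gamma> ` {0..b} \<subseteq> U"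
    and k: "k integrable_on {0..b}" and N: "negligible N"
    and der: "\<And>t. t \<in> {0..b} - N \<Longrightarrow>
      \<exists>D. ((\<lambda>s. z (\<gamma> s)) has_vector_derivative e + D) (at t within {0..b}) \<and> norm D \<le> k t"
  shows "norm ((z (\<gamma> b) - b *\<^sub>R e) - z (\<gamma> 0)) \<le> integral {0..b} k"
proof -
  \<comment> \<open>Removing the drift leaves a curve whose derivative is bounded by k off
    N.\<close>
  define h where "h t = z (\<gamma> t) + t *\<^sub>R (- e)" for t
  have cont: "continuous_on {0..T} \<gamma>" using \<gamma> unfolding abs_continuous_curve_def by blast
  \<comment> \<open>Bisection asks for all short intervals around x, even those that stick out of
    [0, b]; for these \<open>Q\<close> holds vacuously.\<close>
  define Q where "Q u v \<longleftrightarrow> (0 \<le> u \<longrightarrow> v \<le> b \<longrightarrow> norm (h v - h u) \<le> integral {u..v} k)" for u v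
  have "Q 0 b"
  proof (rule Bolzano[OF b(1)])
    fix u v x assume Q: "Q u v" "Q v x" and le: "u \<le> v" "v \<le> x"
    show "Q u x" unfolding Q_def
    proof (intro impI)
      assume ux: "0 \<le> u" "x \<le> b"
      then have "norm (h v - h u) \<le> integral {u..v} k" "norm (h x - h v) \<le> integral {v..x} k"
        using Q le unfolding Q_def by auto
      moreover have "integral {u..v} k + integral {v..x} k = integral {u..x} k"
        using le ux
        by (intro Henstock_Kurzweil_Integration.integral_combine integrable_on_subinterval[OF k]) auto
      moreover have "norm (h x - h u) \<le> norm (h x - h v) + norm (h v - h u)"
        using norm_triangle_ineq[of "h x - h v" "h v - h u"] by simp
      ultimately show "norm (h x - h u) \<le> integral {u..x} k" by linarith
    qed
  next
    fix x assume local: "0 \<le> x" "x \<le> b"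
    have x: "x \<in> {0..b}" using local by simp
    have \<gamma>x: "\<gamma> x \<in> U" using U x by blast
    obtain V \<phi> where V: "(V, \<phi>) \<in> \<A>" "\<gamma> x \<in> V" by (rule atlas_cover)
    note c = chart_homeomorphism[OF atlas_chart[OF V(1)]]
    let ?G = "\<phi> ` (U \<inter> V)"
    have "open ?G" using chart_image_open[OF atlas_chart[OF V(1)] open_U] by (simp only: Int_commute)
    moreover have "\<phi> (\<gamma> x) \<in> ?G" using \<gamma>x V(2) by blast
    ultimately obtain r where r: "r > 0" "cball (\<phi> (\<gamma> x)) r \<subseteq> ?G" using open_contains_cball by blast
    \<comment> \<open>On a ball the transition map is Lipschitz, and Lipschitz maps preserve
      absolute continuity.\<close>
    obtain B where B: "B > 0" "B-lipschitz_on (cball (\<phi> (\<gamma> x)) r) (\<lambda>y. z (inv_into V \<phi> y))"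
      by (rule smooth_on_lipschitz[OF compatible(2)[OF V(1)] compact_cball r(2) convex_cball])
    let ?O = "V \<inter> \<phi> -` ball (\<phi> (\<gamma> x)) r"
    have "open ?O" by (rule continuous_open_preimage[OF c(4,1) open_ball])
    moreover have "\<gamma> x \<in> ?O" using V(2) r(1) by simp
    ultimately obtain A where A: "open A" "x \<in> A" "\<And>y. y \<in> {0..T} \<Longrightarrow> y \<in> A \<Longrightarrow> \<gamma> y \<in> ?O"
      using cont[unfolded continuous_on_topological, rule_format, of x ?O] x b(2) by auto
    obtain d where d: "d > 0" "ball x d \<subseteq> A" using A(1,2) open_contains_ball by blast
    have "norm (h v - h u) \<le> integral {u..v} k" if uv: "u \<le> x" "x \<le> v" "v - u < d" "0 \<le> u" "v \<le> b" for u v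
    proof -
      have inO: "\<gamma> y \<in> ?O" if y: "y \<in> {u..v}" for y
      proof (rule A(3))
        show "y \<in> {0..T}" using y uv b(2) by auto
        have "y \<in> ball x d" using y uv by (auto simp: dist_real_def)
        then show "y \<in> A" using d(2) by blast
      qed
      have "\<forall>(U, \<phi>)\<in>\<A>. \<forall>s t. 0 \<le> s \<and> s \<le> t \<and> t \<le> T \<and> \<gamma> ` {s..t} \<subseteq> U \<longrightarrow> abs_continuous_on_ivl s t (\<phi> \<circ> \<gamma>)"
        using \<gamma> unfolding abs_continuous_curve_def by blast
      from bspec[OF this V(1)] have "0 \<le> u \<and> u \<le> v \<and> v \<le> T \<and> \<gamma> ` {u..v} \<subseteq> V \<longrightarrow> abs_continuous_on_ivl u v (\<phi> \<circ> \<gamma>)"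
        by simp
      moreover have "\<gamma> ` {u..v} \<subseteq> V" using inO by blast
      ultimately have "abs_continuous_on_ivl u v (\<phi> \<circ> \<gamma>)" using uv b(2) by linarith
      moreover have "(\<phi> \<circ> \<gamma>) ` {u..v} \<subseteq> cball (\<phi> (\<gamma> x)) r"
        using inO by (auto simp: less_imp_le)
      ultimately have "abs_continuous_on_ivl u v (\<lambda>s. z (inv_into V \<phi> ((\<phi> \<circ> \<gamma>) s)))"
        using abs_continuous_on_ivl_lipschitz_compose[OF _ B(2)] by blast
      from abs_continuous_on_ivl_add[OF this abs_continuous_on_ivl_linear[of u v "- e"]]
      have AC: "abs_continuous_on_ivl u v (\<lambda>s. z (inv_into V \<phi> ((\<phi> \<circ> \<gamma>) s)) + s *\<^sub>R (- e))" .
      have eq: "z (inv_into V \<phi> ((\<phi> \<circ> \<gamma>) s)) + s *\<^sub>R (- e) = h s" if "s \<in> {u..v}" for s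
        using inO[OF that] by (simp add: h_def inv_into_f_f[OF c(3)])
      have "norm ((z (inv_into V \<phi> ((\<phi> \<circ> \<gamma>) v)) + v *\<^sub>R (- e)) - (z (inv_into V \<phi> ((\<phi> \<circ> \<gamma>) u)) + u *\<^sub>R (- e))) \<le> integral {u..v} k"
      proof (rule abs_continuous_norm_bound[OF _ AC _ N])
        show "u \<le> v" using uv by simp
        show "k integrable_on {u..v}" by (rule integrable_on_subinterval[OF k]) (use uv in auto)
        fix t assume t: "t \<in> {u..v} - N"
        then obtain D where D: "((\<lambda>s. z (\<gamma> s)) has_vector_derivative e + D) (at t within {0..b})" "norm D \<le> k t"
          using der[of t] uv by auto
        have "((\<lambda>s. s *\<^sub>R (- e)) has_vector_derivative - e) (at t within {0..b})"
          by (auto intro!: derivative_eq_intros)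
        from has_vector_derivative_add[OF D(1) this]
        have "(h has_vector_derivative D) (at t within {0..b})" unfolding h_def[abs_def] by simp
        then have "(h has_vector_derivative D) (at t within {u..v})"
          by (rule has_vector_derivative_within_subset) (use uv in auto)
        then have "((\<lambda>s. z (inv_into V \<phi> ((\<phi> \<circ> \<gamma>) s)) + s *\<^sub>R (- e)) has_vector_derivative D) (at t within {u..v})"
          by (rule has_vector_derivative_transform[rotated 2]) (use t eq in auto)
        then show "\<exists>D. ((\<lambda>s. z (inv_into V \<phi> ((\<phi> \<circ> \<gamma>) s)) + s *\<^sub>R (- e)) has_vector_derivative D) (at t within {u..v}) \<and> norm D \<le> k t"
          using D(2) by blast
      qed
      then show ?thesis using eq[of u] eq[of v] uv by simp
    qed
    then show "\<exists>d>0. \<forall>u v. u \<le> x \<and> x \<le> v \<and> v - u < d \<longrightarrow> Q u v"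
      unfolding Q_def using d(1) by blast
  qed
  then have "norm (h b - h 0) \<le> integral {0..b} k" using b(1) unfolding Q_def by simp
  then show ?thesis by (simp add: h_def algebra_simps)
qed

end

subsection \<open>Bounds for the value function\<close>

locale drift_system = chart_family \<A> f U z
  for \<A> :: "('a::t2_space, 'n::finite) chart set" and f :: "'m::finite \<Rightarrow> 'a vector_field"
    and U :: "'a set" and z :: "'a \<Rightarrow> real ^ 'n" +
  fixes f0 :: "'a vector_field" and e :: "real ^ 'n" and q :: 'a
  assumes f0: "svf f0" and straight: "p \<in> U \<Longrightarrow> pushforward z (f0 p) = e"
    and e: "norm e \<le> 1" and q: "q \<in> U" and zq: "z q = 0"
begin

lemma w_0: "w 0 = q"
  using w_z[OF q] by (simp only: zq)

lemma control_velocity: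
  assumes p: "p \<in> U"
  shows "f0 p + (\<Sum>i\<in>UNIV. c i *\<^sub>R f i p) \<in> tangent_space \<A> p"
    "pushforward z (f0 p + (\<Sum>i\<in>UNIV. c i *\<^sub>R f i p)) = e + (\<Sum>i\<in>UNIV. c i *\<^sub>R coordinate_field i (z p))"
proof -
  have "f0 p + (\<Sum>i\<in>S. c i *\<^sub>R f i p) \<in> tangent_space \<A> p \<and>
    pushforward z (f0 p + (\<Sum>i\<in>S. c i *\<^sub>R f i p)) = e + (\<Sum>i\<in>S. c i *\<^sub>R coordinate_field i (z p))" if "finite S" for S
    using that
  proof (induction S)
    case empty
    show ?case unfolding sum.empty add_0_right by (intro conjI svf_tangent[OF f0] straight[OF p])
  next
    case (insert j S)
    have eq: "f0 p + (\<Sum>i\<in>insert j S. c i *\<^sub>R f i p) = c j *\<^sub>R f j p + (f0 p + (\<Sum>i\<in>S. c i *\<^sub>R f i p))"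
      unfolding sum.insert[OF insert(1,2)] by (rule add.left_commute)
    have IH: "f0 p + (\<Sum>i\<in>S. c i *\<^sub>R f i p) \<in> tangent_space \<A> p"
      "pushforward z (f0 p + (\<Sum>i\<in>S. c i *\<^sub>R f i p)) = e + (\<Sum>i\<in>S. c i *\<^sub>R coordinate_field i (z p))"
      using insert.IH by blast+
    have cf: "coordinate_field j (z p) = pushforward z (f j p)" unfolding coordinate_field_def w_z[OF p] ..
    have "pushforward z (c j *\<^sub>R f j p + (f0 p + (\<Sum>i\<in>S. c i *\<^sub>R f i p))) =
        e + (\<Sum>i\<in>insert j S. c i *\<^sub>R coordinate_field i (z p))"
      unfolding pushforward_combination IH(2) sum.insert[OF insert(1,2)] cf by (rule add.left_commute)
    then show ?case
      unfolding eq using tangent_combination[OF svf_tangent[OF f] IH(1)] by (intro conjI)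
  qed
  from this[OF finite_class.finite_UNIV]
  show "f0 p + (\<Sum>i\<in>UNIV. c i *\<^sub>R f i p) \<in> tangent_space \<A> p"
    "pushforward z (f0 p + (\<Sum>i\<in>UNIV. c i *\<^sub>R f i p)) = e + (\<Sum>i\<in>UNIV. c i *\<^sub>R coordinate_field i (z p))"
    by blast+
qed

text \<open>The finite exceptional set of a trajectory is a null set, so its image in the manifold
  is an admissible curve. A duration below T' is harmless because the value function ranges over all
  durations up to T'.\<close>

lemma value_fun_le_traj:
  assumes tr: "traj (z ` U) coordinate_field e T c x y" and T: "T \<le> T'"
  shows "value_fun \<A> f0 f T' (w x) (w y) \<le> ereal c"
proof -
  obtain \<eta> and u :: "real \<Rightarrow> real ^ 'm" and L S where T0: "0 \<le> T" and S: "finite S" and \<eta>: "L-lipschitz_on {0..T} \<eta>"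
     "\<eta> ` {0..T} \<subseteq> z ` U" "\<eta> 0 = x" "\<eta> T = y" and u: "u absolutely_integrable_on {0..T}"
     "integral {0..T} (\<lambda>t. norm (u t)) \<le> c"
     and der: "\<forall>t\<in>{0..T} - S. (\<eta> has_vector_derivative (e + (\<Sum>i\<in>UNIV. (u t $ i) *\<^sub>R coordinate_field i (\<eta> t)))) (at t within {0..T})"
    using tr unfolding traj_def by blast
  let ?\<gamma> = "\<lambda>t. w (\<eta> t)"
  have AC: "abs_continuous_curve \<A> T ?\<gamma>" by (rule abs_continuous_curve_from_chart[OF \<eta>(1,2)])
  have vel: "has_velocity \<A> ?\<gamma> (f0 (?\<gamma> t) + (\<Sum>i\<in>UNIV. (u t $ i) *\<^sub>R f i (?\<gamma> t))) t {0..T}" if t: "t \<in> {0..T} - S" for t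
  proof -
    have \<eta>t: "\<eta> t \<in> z ` U" using \<eta>(2) t by blast
    show ?thesis
    proof (rule has_velocity_from_chart)
      show "\<eta> t \<in> z ` U" by (rule \<eta>t)
      show "f0 (?\<gamma> t) + (\<Sum>i\<in>UNIV. (u t $ i) *\<^sub>R f i (?\<gamma> t)) \<in> tangent_space \<A> (w (\<eta> t))"
        by (rule control_velocity(1)[OF w_U[OF \<eta>t]])
      show "(\<eta> has_vector_derivative pushforward z (f0 (?\<gamma> t) + (\<Sum>i\<in>UNIV. (u t $ i) *\<^sub>R f i (?\<gamma> t)))) (at t within {0..T})"
        unfolding control_velocity(2)[OF w_U[OF \<eta>t]] z_w[OF \<eta>t] using der t by blast
    qed
  qed
  have "AE t in lebesgue. t \<notin> S"
    using S by (intro AE_not_in) (simp add: negligible_iff_null_sets[symmetric] negligible_finite)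
  then have "AE t\<in>{0..T} in lebesgue. has_velocity \<A> ?\<gamma> (f0 (?\<gamma> t) + (\<Sum>i\<in>UNIV. (u t $ i) *\<^sub>R f i (?\<gamma> t))) t {0..T}"
    by (rule eventually_mono) (use vel in blast)
  then have uc: "u \<in> controls \<A> f0 f T ?\<gamma>" unfolding controls_def using u(1) by blast
  then have adm: "admissible \<A> f0 f T ?\<gamma>" unfolding admissible_def using AC by blast
  have "cost \<A> f0 f T ?\<gamma> \<le> ereal (LINT t:{0..T}|lebesgue. norm (u t))"
    unfolding cost_def using uc by (rule INF_lower)
  also have "(LINT t:{0..T}|lebesgue. norm (u t)) = integral {0..T} (\<lambda>t. norm (u t))"
    by (rule set_lebesgue_integral_eq_integral(2)[OF absolutely_integrable_norm[OF u(1), unfolded o_def]])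
  also have "ereal (integral {0..T} (\<lambda>t. norm (u t))) \<le> ereal c" using u(2) by simp
  finally have le: "cost \<A> f0 f T ?\<gamma> \<le> ereal c" .
  show ?thesis unfolding value_fun_def
  proof (rule Inf_lower2[OF _ le], rule CollectI, intro exI conjI refl)
    show "w (\<eta> 0) = w x" "w (\<eta> T) = w y" by (simp_all only: \<eta>)
  qed (use T0 T adm in auto)
qed

section \<open>Confinement to the chart and the drift segment\<close>

text \<open>A first exit argument: up to the first time t0 outside the open ball the curve stays in
  the closed ball, so the estimate applies at t0 and gives a norm of at most t0 + \<eta> < R, a
  contradiction. It serves controlled curves and integral curves of the drift alike.\<close>

lemma trap:
  assumes R: "R > 0" "cball 0 R \<subseteq> z ` U" and \<gamma>: "continuous_on {0..T} \<gamma>" "\<gamma> 0 = q"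
    and est: "\<And>t. t \<in> {0..T} \<Longrightarrow> \<gamma> ` {0..t} \<subseteq> w ` cball 0 R \<Longrightarrow> norm (z (\<gamma> t) - t *\<^sub>R e) \<le> \<eta>"
    and T: "T + \<eta> < R" and t: "t \<in> {0..T}"
  shows "\<gamma> t \<in> U" "norm (z (\<gamma> t) - t *\<^sub>R e) \<le> \<eta>"
proof -
  have sub: "ball 0 R \<subseteq> z ` U" using R(2) ball_subset_cball by blast
  have oG: "open (w ` ball 0 R)" by (rule open_w_image[OF open_ball sub])
  \<comment> \<open>The manifold is Hausdorff, so this compact set is closed in it and contains the
    position of the curve at the first exit time.\<close>
  have "compact (w ` cball 0 R)"
    by (rule compact_continuous_image[OF continuous_on_subset[OF cont_w R(2)] compact_cball])
  then have cK: "closed (w ` cball 0 R)" by (rule compact_imp_closed)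
  have in_G: "\<gamma> s \<in> w ` ball 0 R" if s: "s \<in> {0..T}" for s
  proof (rule ccontr)
    assume "\<gamma> s \<notin> w ` ball 0 R"
    define A where "A = {0..T} \<inter> \<gamma> -` (- (w ` ball 0 R))"
    have "closed A" unfolding A_def using oG by (intro continuous_closed_preimage[OF \<gamma>(1)]) auto
    moreover have "A = {0..T} \<inter> A" unfolding A_def by (rule Int_left_absorb[symmetric])
    ultimately have "compact A" using compact_Int_closed[OF compact_Icc, of A 0 T] by (simp only:)
    moreover have "A \<noteq> {}" unfolding A_def using s \<open>\<gamma> s \<notin> _\<close> by blast
    ultimately have "\<exists>t0\<in>A. \<forall>t\<in>A. t0 \<le> t" by (rule compact_attains_inf)
    then obtain t0 where t0A: "t0 \<in> A" "\<forall>t\<in>A. t0 \<le> t" ..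
    have t0: "t0 \<in> {0..T}" "\<gamma> t0 \<notin> w ` ball 0 R" using t0A(1) unfolding A_def by blast+
    have "q \<in> w ` ball 0 R" by (rule image_eqI[of _ _ 0]) (use w_0 R(1) in simp_all)
    then have "t0 \<noteq> 0" using t0(2) \<gamma>(2) by auto
    then have t0pos: "0 < t0" using t0(1) by auto
    define C where "C = {0..T} \<inter> \<gamma> -` (w ` cball 0 R)"
    have "closed C" unfolding C_def by (intro continuous_closed_preimage[OF \<gamma>(1) closed_atLeastAtMost cK])
    moreover have "{0..<t0} \<subseteq> C"
    proof
      fix r assume r: "r \<in> {0..<t0}"
      then have rT: "r \<in> {0..T}" using t0(1) by auto
      moreover have "r \<notin> A" using t0A(2) r by force
      ultimately have "\<gamma> r \<in> w ` ball 0 R" unfolding A_def by blast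
      then have "\<gamma> r \<in> w ` cball 0 R" by (rule subsetD[OF image_mono[OF ball_subset_cball]])
      then show "r \<in> C" unfolding C_def using rT by blast
    qed
    ultimately have "closure {0..<t0} \<subseteq> C" by (rule closure_minimal[rotated])
    then have C: "{0..t0} \<subseteq> C" using closure_atLeastLessThan[OF t0pos] by (simp only:)
    then have sub0: "\<gamma> ` {0..t0} \<subseteq> w ` cball 0 R" unfolding C_def by blast
    have "norm (z (\<gamma> t0) - t0 *\<^sub>R e) \<le> \<eta>" by (rule est[OF t0(1) sub0])
    moreover have "norm (t0 *\<^sub>R e) \<le> T"
      using t0(1) e mult_mono[of t0 T "norm e" 1] by simp
    ultimately have n: "norm (z (\<gamma> t0)) < R"
      using norm_triangle_sub[of "z (\<gamma> t0)" "t0 *\<^sub>R e"] T by linarith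
    have "\<gamma> t0 \<in> w ` cball 0 R" by (rule subsetD[OF sub0], rule imageI) (use t0pos in simp)
    then obtain x where x: "x \<in> cball 0 R" "\<gamma> t0 = w x" by blast
    have "\<gamma> t0 \<in> U" unfolding x(2) by (rule w_U[OF subsetD[OF R(2) x(1)]])
    then have "\<gamma> t0 = w (z (\<gamma> t0))" by (rule w_z[symmetric])
    moreover have "z (\<gamma> t0) \<in> ball 0 R" using n by simp
    ultimately have "\<gamma> t0 \<in> w ` ball 0 R" by (rule image_eqI)
    with t0(2) show False by (rule notE)
  qed
  have "\<gamma> ` {0..t} \<subseteq> w ` cball 0 R"
  proof
    fix p assume "p \<in> \<gamma> ` {0..t}"
    then obtain s where s: "s \<in> {0..t}" "p = \<gamma> s" by blast
    then have "s \<in> {0..T}" using t by auto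
    from in_G[OF this] show "p \<in> w ` cball 0 R"
      unfolding s(2) by (rule subsetD[OF image_mono[OF ball_subset_cball]])
  qed
  from est[OF t this] show "norm (z (\<gamma> t) - t *\<^sub>R e) \<le> \<eta>" .
  from in_G[OF t] obtain x where x: "\<gamma> t = w x" "x \<in> ball 0 R" by (rule imageE)
  show "\<gamma> t \<in> U" unfolding x(1) by (rule w_U[OF subsetD[OF sub x(2)]])
qed

text \<open>Integral curves are only required to have velocities, tested on functions smooth near
  the current point. The indicator of an open V around \<open>\<gamma> s\<close> is such a function,
  and its continuity along the curve at s keeps the curve in V for nearby times.\<close>

lemma integral_curve_continuous:
  assumes "integral_curve \<A> X T \<gamma>"
  shows "continuous_on {0..T} \<gamma>"
  unfolding continuous_on_def
proof (intro ballI topological_tendstoI)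
  fix s V assume s: "s \<in> {0..T}" and V: "open V" "\<gamma> s \<in> V"
  let ?a = "\<lambda>y. if y \<in> V then 1 else 0 :: real"
  have "sn (\<gamma> s) ?a"
    by (rule sn_cong[OF sn_const[of _ 1] V]) simp
  then have "((\<lambda>s. ?a (\<gamma> s)) has_real_derivative X (\<gamma> s) ?a) (at s within {0..T})"
    using assms s unfolding integral_curve_def has_velocity_def by blast
  then have "continuous (at s within {0..T}) (\<lambda>s. ?a (\<gamma> s))" by (rule DERIV_continuous)
  then have "((\<lambda>s. ?a (\<gamma> s)) \<longlongrightarrow> 1) (at s within {0..T})"
    using V(2) by (simp add: continuous_within)
  then have "eventually (\<lambda>s. ?a (\<gamma> s) > 0) (at s within {0..T})"
    by (rule order_tendstoD) simp
  then show "eventually (\<lambda>s. \<gamma> s \<in> V) (at s within {0..T})"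
    by (rule eventually_mono) (simp split: if_splits)
qed

text \<open>\<open>flow_segment\<close> admits every integral curve from q, including those that
  might leave the chart; \<open>trap\<close> with \<eta> = 0 confines them, and in the chart their
  velocity is the constant e.\<close>

lemma integral_curve_straight:
  assumes R: "R > 0" "cball 0 R \<subseteq> z ` U" and \<gamma>: "integral_curve \<A> f0 T \<gamma>" "\<gamma> 0 = q" and T: "0 \<le> T" "T < R"
  shows "z (\<gamma> T) = T *\<^sub>R e"
proof -
  have "norm (z (\<gamma> T) - T *\<^sub>R e) \<le> 0"
  proof (rule trap(2)[OF R integral_curve_continuous[OF \<gamma>(1)] \<gamma>(2)])
    fix t assume t: "t \<in> {0..T}" and sub: "\<gamma> ` {0..t} \<subseteq> w ` cball 0 R"
    have "((\<lambda>s. z (\<gamma> s) - s *\<^sub>R e) has_vector_derivative 0) (at s within {0..t})" if s: "s \<in> {0..t}" for s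
    proof -
      have sT: "s \<in> {0..T}" "{0..t} \<subseteq> {0..T}" using s t by auto
      have "\<gamma> s \<in> w ` cball 0 R" by (rule subsetD[OF sub imageI[OF s]])
      then obtain x where x: "\<gamma> s = w x" "x \<in> cball 0 R" by (rule imageE)
      have U: "\<gamma> s \<in> U" unfolding x(1) by (rule w_U[OF subsetD[OF R(2) x(2)]])
      have "has_velocity \<A> \<gamma> (f0 (\<gamma> s)) s {0..T}" using \<gamma>(1) sT(1) unfolding integral_curve_def by blast
      from has_velocity_in_chart[OF this U]
      have "((\<lambda>s. z (\<gamma> s)) has_vector_derivative e) (at s within {0..t})"
        unfolding straight[OF U] by (rule has_vector_derivative_within_subset[OF _ sT(2)])
      moreover have "((\<lambda>s. s *\<^sub>R e) has_vector_derivative e) (at s within {0..t})"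
        by (auto intro!: derivative_eq_intros)
      ultimately show ?thesis using has_vector_derivative_diff by fastforce
    qed
    from vector_derivative_bound[OF this, of 0 0 t]
    show "norm (z (\<gamma> t) - t *\<^sub>R e) \<le> 0" using t by (simp add: \<gamma>(2) zq)
  qed (use T in auto)
  then show ?thesis by simp
qed

lemma straight_integral_curve:
  assumes R: "R > 0" "cball 0 R \<subseteq> z ` U" and T: "0 \<le> T" "T < R"
  shows "integral_curve \<A> f0 T (\<lambda>t. w (t *\<^sub>R e))" "(\<lambda>t. w (t *\<^sub>R e)) ` {0..T} \<subseteq> U" "(\<lambda>t. 0 + t *\<^sub>R e) ` {0..T} \<subseteq> z ` U"
proof -
  have in_zU: "t *\<^sub>R e \<in> z ` U" if t: "t \<in> {0..T}" for t
  proof -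
    have "norm (t *\<^sub>R e) \<le> R" using t T e mult_mono[of t R "norm e" 1] by simp
    then show ?thesis using R(2) by (simp add: subset_iff)
  qed
  show "(\<lambda>t. w (t *\<^sub>R e)) ` {0..T} \<subseteq> U"
    by (rule image_subsetI) (rule w_U[OF in_zU])
  show "(\<lambda>t. 0 + t *\<^sub>R e) ` {0..T} \<subseteq> z ` U" unfolding add_0_left
    by (rule image_subsetI) (rule in_zU)
  show "integral_curve \<A> f0 T (\<lambda>t. w (t *\<^sub>R e))"
    unfolding integral_curve_def
  proof
    fix s assume s: "s \<in> {0..T}"
    show "has_velocity \<A> (\<lambda>t. w (t *\<^sub>R e)) (f0 (w (s *\<^sub>R e))) s {0..T}"
    proof (rule has_velocity_from_chart)
      show "s *\<^sub>R e \<in> z ` U" by (rule in_zU[OF s])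
      show "f0 (w (s *\<^sub>R e)) \<in> tangent_space \<A> (w (s *\<^sub>R e))" by (rule svf_tangent[OF f0])
      show "((\<lambda>t. t *\<^sub>R e) has_vector_derivative pushforward z (f0 (w (s *\<^sub>R e)))) (at s within {0..T})"
        unfolding straight[OF w_U[OF in_zU[OF s]]] by (auto intro!: derivative_eq_intros)
    qed
  qed
qed

lemma flow_segment_straight:
  assumes R: "R > 0" "cball 0 R \<subseteq> z ` U" and T: "0 \<le> T" "T < R"
  shows "z ` flow_segment \<A> f0 T q = (\<lambda>t. t *\<^sub>R e) ` {0..T}"
proof
  show "z ` flow_segment \<A> f0 T q \<subseteq> (\<lambda>t. t *\<^sub>R e) ` {0..T}"
  proof
    fix x assume "x \<in> z ` flow_segment \<A> f0 T q"
    then obtain \<gamma> t where h: "x = z (\<gamma> t)" "0 \<le> t" "t \<le> T" "integral_curve \<A> f0 t \<gamma>" "\<gamma> 0 = q"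
      unfolding flow_segment_def by blast
    have "x = t *\<^sub>R e" unfolding h(1) using T h(3) by (intro integral_curve_straight[OF R h(4,5,2)]) linarith
    then show "x \<in> (\<lambda>t. t *\<^sub>R e) ` {0..T}" by (rule image_eqI) (use h(2,3) in simp)
  qed
  show "(\<lambda>t. t *\<^sub>R e) ` {0..T} \<subseteq> z ` flow_segment \<A> f0 T q"
  proof
    fix x assume "x \<in> (\<lambda>t. t *\<^sub>R e) ` {0..T}"
    then obtain t where t: "0 \<le> t" "t \<le> T" "x = t *\<^sub>R e" by auto
    then have tR: "t < R" using T by linarith
    have c: "integral_curve \<A> f0 t (\<lambda>t. w (t *\<^sub>R e))" by (rule straight_integral_curve[OF R t(1) tR])
    have "w (0 *\<^sub>R e) = q" unfolding scaleR_zero_left by (rule w_0)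
    then have "w x \<in> flow_segment \<A> f0 T q"
      unfolding flow_segment_def t(3)
      by (intro CollectI exI[of _ "\<lambda>t. w (t *\<^sub>R e)"] exI[of _ t] conjI refl t(1,2) c)
    moreover have "x = z (w x)"
    proof -
      have "x \<in> z ` U"
        by (rule subsetD[OF straight_integral_curve(3)[OF R t(1) tR, unfolded add_0_left]])
           (use t in \<open>auto intro: image_eqI[of _ _ t]\<close>)
      then show ?thesis by (rule z_w[symmetric])
    qed
    ultimately show "x \<in> z ` flow_segment \<A> f0 T q" by (rule image_eqI[rotated])
  qed
qed

lemma control_bound:
  assumes R: "cball 0 R \<subseteq> z ` U"
  obtains M where "M > 0"
    "\<And>x (u :: real ^ 'm). x \<in> cball 0 R \<Longrightarrow> norm (\<Sum>i\<in>UNIV. (u $ i) *\<^sub>R coordinate_field i x) \<le> M * norm u"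
proof -
  have "\<forall>i. \<exists>B>0. \<forall>x\<in>cball 0 R. norm (coordinate_field i x) \<le> B"
  proof
    fix i show "\<exists>B>0. \<forall>x\<in>cball 0 R. norm (coordinate_field i x) \<le> B"
      by (rule smooth_on_bounded_compact[OF smooth_coordinate_field compact_cball R]) blast
  qed
  from choice[OF this] obtain B where B: "\<And>i. B i > 0" "\<And>i x. x \<in> cball 0 R \<Longrightarrow> norm (coordinate_field i x) \<le> B i" by blast
  show ?thesis
  proof (rule that[of "sum B UNIV"])
    show "sum B UNIV > 0" using B(1) by (intro sum_pos) auto
    fix x :: "real ^ 'n" and u :: "real ^ 'm" assume x: "x \<in> cball 0 R"
    have "norm (\<Sum>i\<in>UNIV. (u $ i) *\<^sub>R coordinate_field i x) \<le> (\<Sum>i\<in>UNIV. B i * norm u)"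
    proof (rule sum_norm_le)
      fix i
      have "\<bar>u $ i\<bar> * norm (coordinate_field i x) \<le> norm u * B i"
        by (intro mult_mono component_le_norm_cart B(2) x) auto
      then show "norm ((u $ i) *\<^sub>R coordinate_field i x) \<le> B i * norm u" by (simp add: mult.commute)
    qed
    then show "norm (\<Sum>i\<in>UNIV. (u $ i) *\<^sub>R coordinate_field i x) \<le> sum B UNIV * norm u"
      by (simp only: sum_distrib_right)
  qed
qed

text \<open>While the curve is in the ball, its deviation from the drift has, almost everywhere, a
  derivative of at most M times the norm of the control. When duration and cost are small,
  \<open>trap\<close> removes the proviso.\<close>

lemma controlled_curve_estimate:
  assumes R: "R > 0" "cball 0 R \<subseteq> z ` U"
    and M: "M > 0" "\<And>x (u :: real ^ 'm). x \<in> cball 0 R \<Longrightarrow> norm (\<Sum>i\<in>UNIV. (u $ i) *\<^sub>R coordinate_field i x) \<le> M * norm u"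
    and \<gamma>: "abs_continuous_curve \<A> T \<gamma>" "\<gamma> 0 = q" and u: "u \<in> controls \<A> f0 f T \<gamma>"
    and T: "0 \<le> T" "T + M * (LINT t:{0..T}|lebesgue. norm (u t)) < R"
  shows "\<gamma> T \<in> U" "norm (z (\<gamma> T) - T *\<^sub>R e) \<le> M * (LINT t:{0..T}|lebesgue. norm (u t))"
proof -
  let ?I = "LINT t:{0..T}|lebesgue. norm (u t)"
  have ui: "u absolutely_integrable_on {0..T}"
    and ae: "AE t\<in>{0..T} in lebesgue. has_velocity \<A> \<gamma> (f0 (\<gamma> t) + (\<Sum>i\<in>UNIV. (u t $ i) *\<^sub>R f i (\<gamma> t))) t {0..T}"
    using u unfolding controls_def by blast+
  have nint: "(\<lambda>t. norm (u t)) integrable_on {0..T}" and I: "?I = integral {0..T} (\<lambda>t. norm (u t))"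
    by (rule set_lebesgue_integral_eq_integral[OF absolutely_integrable_norm[OF ui, unfolded o_def]])+
  obtain N where N: "{t \<in> space lebesgue. \<not> (t \<in> {0..T} \<longrightarrow> has_velocity \<A> \<gamma> (f0 (\<gamma> t) + (\<Sum>i\<in>UNIV. (u t $ i) *\<^sub>R f i (\<gamma> t))) t {0..T})} \<subseteq> N"
    "emeasure lebesgue N = 0" "N \<in> sets lebesgue"
    by (rule AE_E[OF ae])
  have neg: "negligible N" unfolding negligible_iff_null_sets using N(2,3) by (rule null_setsI)
  have cont: "continuous_on {0..T} \<gamma>" using \<gamma>(1) unfolding abs_continuous_curve_def by blast
  have est: "norm (z (\<gamma> t) - t *\<^sub>R e) \<le> M * ?I" if t: "t \<in> {0..T}" and sub: "\<gamma> ` {0..t} \<subseteq> w ` cball 0 R" for t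
  proof -
    have sub2: "{0..t} \<subseteq> {0..T}" using t by auto
    have U: "\<gamma> s \<in> U" "z (\<gamma> s) \<in> cball 0 R" if s: "s \<in> {0..t}" for s
    proof -
      have "\<gamma> s \<in> w ` cball 0 R" by (rule subsetD[OF sub imageI[OF s]])
      then obtain x where x: "x \<in> cball 0 R" "\<gamma> s = w x" by (rule imageE)
      have xU: "x \<in> z ` U" by (rule subsetD[OF R(2) x(1)])
      show "\<gamma> s \<in> U" unfolding x(2) by (rule w_U[OF xU])
      show "z (\<gamma> s) \<in> cball 0 R" unfolding x(2) z_w[OF xU] by (rule x(1))
    qed
    have ni: "(\<lambda>s. norm (u s)) integrable_on {0..t}" by (rule integrable_on_subinterval[OF nint sub2])
    have ki: "(\<lambda>s. M * norm (u s)) integrable_on {0..t}"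
      using integrable_cmul[OF ni, of M] by simp
    have "norm ((z (\<gamma> t) - t *\<^sub>R e) - z (\<gamma> 0)) \<le> integral {0..t} (\<lambda>s. M * norm (u s))"
    proof (rule abs_continuous_curve_estimate[OF \<gamma>(1) _ _ _ ki neg])
      show "0 \<le> t" "t \<le> T" using t by auto
      show "\<gamma> ` {0..t} \<subseteq> U" using U(1) by blast
      fix s assume s: "s \<in> {0..t} - N"
      then have st: "s \<in> {0..t}" and sT: "s \<in> {0..T}" using sub2 by blast+
      have "has_velocity \<A> \<gamma> (f0 (\<gamma> s) + (\<Sum>i\<in>UNIV. (u s $ i) *\<^sub>R f i (\<gamma> s))) s {0..T}"
      proof (rule ccontr)
        assume "\<not> ?thesis"
        then have "s \<in> N" using N(1) sT by auto
        then show False using s by blast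
      qed
      from has_velocity_in_chart[OF this U(1)[OF st]]
      have "((\<lambda>s. z (\<gamma> s)) has_vector_derivative e + (\<Sum>i\<in>UNIV. (u s $ i) *\<^sub>R coordinate_field i (z (\<gamma> s)))) (at s within {0..t})"
        unfolding control_velocity(2)[OF U(1)[OF st]] by (rule has_vector_derivative_within_subset[OF _ sub2])
      then show "\<exists>D. ((\<lambda>s. z (\<gamma> s)) has_vector_derivative e + D) (at s within {0..t}) \<and> norm D \<le> M * norm (u s)"
        using M(2)[OF U(2)[OF st]] by blast
    qed
    also have "\<dots> = M * integral {0..t} (\<lambda>s. norm (u s))" by simp
    also have "\<dots> \<le> M * ?I"
      unfolding I using M(1) by (intro mult_left_mono integral_subset_le[OF sub2 ni nint]) auto
    finally show ?thesis by (simp add: \<gamma>(2) zq)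
  qed
  have TT: "T \<in> {0..T}" using T(1) by simp
  show "\<gamma> T \<in> U" "norm (z (\<gamma> T) - T *\<^sub>R e) \<le> M * ?I"
    by (rule trap[OF R cont \<gamma>(2) est T(2) TT], assumption, assumption)+
qed

section \<open>The two-sided estimate\<close>

lemma value_fun_bounds:
  assumes h: "hoermander \<A> f"
  shows "\<exists>T0>0. \<exists>\<epsilon>0>0. \<exists>C>0. \<forall>T \<epsilon>. 0 < T \<and> T < T0 \<and> 0 < \<epsilon> \<and> \<epsilon> < \<epsilon>0 \<longrightarrow>
    (\<exists>\<gamma>. integral_curve \<A> f0 T \<gamma> \<and> \<gamma> 0 = q \<and> \<gamma> ` {0..T} \<subseteq> U) \<and>
    (\<forall>q'\<in>reachable_set \<A> f0 f T q \<epsilon>. q' \<in> U \<and>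
       ereal (1 / C * infdist (z q') (z ` flow_segment \<A> f0 T q)) \<le> value_fun \<A> f0 f T q q' \<and>
       value_fun \<A> f0 f T q q' \<le>
         ereal (C * infdist (z q') (z ` flow_segment \<A> f0 T q) powr (1 / real (nonholonomy_degree \<A> f q))))"
proof -
  let ?r = "nonholonomy_degree \<A> f q"
  have r: "1 \<le> ?r" using nonholonomy_degree[OF h q] by blast
  have "0 \<in> z ` U" using imageI[OF q, of z] unfolding zq .
  then obtain R B s0 Y where ls: "local_system (z ` U) coordinate_field e R B s0 Y"
    by (rule local_system_exists[OF open_zU _ smooth_coordinate_field e])
  interpret L: local_system "z ` U" coordinate_field e R B s0 Y by (rule ls)
  note R = L.R L.R_\<Omega>
  have "span {L.bracket_field I 0 | I. I \<noteq> [] \<and> length I \<le> ?r} = UNIV"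
    using bracket_fields_span[OF ls h q] unfolding zq .
  from L.local_reachability[OF r this] obtain C1 \<rho> where C1: "C1 > 0" and \<rho>: "\<rho> > 0"
    and reach: "\<forall>p y D h T c x0. norm p \<le> \<rho> \<longrightarrow> 0 < D \<longrightarrow> D \<le> \<rho> \<longrightarrow> norm (y - p) \<le> D \<longrightarrow> 0 < h \<longrightarrow>
      traj (z ` U) coordinate_field e T c x0 p \<longrightarrow> (\<exists>T'\<le>T + h. traj (z ` U) coordinate_field e T' (c + C1 * D powr (1 / real ?r)) x0 y)"
    by (elim exE conjE) (rule that, assumption+)
  obtain M where M: "M > 0" "\<And>x (u :: real ^ 'm). x \<in> cball 0 R \<Longrightarrow> norm (\<Sum>i\<in>UNIV. (u $ i) *\<^sub>R coordinate_field i x) \<le> M * norm u"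
    by (rule control_bound[OF R(2)]) (rule that; assumption)
  \<comment> \<open>T0 and \<epsilon>0 ensure \<open>T + M * \<epsilon>0 < R\<close>, so that cheap
    curves cannot escape; they put the drift segment within \<rho> of 0 and bound 2 D by \<rho>. In
    C, M serves the lower bound; the power of 2 in the upper bound comes from steering over the
    distance 2 D.\<close>
  define T0 where "T0 = min (R / 2) \<rho>"
  define \<epsilon>0 where "\<epsilon>0 = min (R / (2 * M)) (\<rho> / (2 * M))"
  define C where "C = max M (C1 * 2 powr (1 / real ?r))"
  have T0: "T0 > 0" "T0 \<le> R / 2" "T0 \<le> \<rho>" using R(1) \<rho> by (auto simp: T0_def)
  have \<epsilon>0: "\<epsilon>0 > 0" "\<epsilon>0 \<le> R / (2 * M)" "\<epsilon>0 \<le> \<rho> / (2 * M)" using R(1) \<rho> M(1) by (auto simp: \<epsilon>0_def)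
  have M\<epsilon>0: "M * \<epsilon>0 \<le> R / 2" "2 * (M * \<epsilon>0) \<le> \<rho>" using \<epsilon>0 M(1) by (auto simp: field_simps)
  have C: "C > 0" "M \<le> C" "C1 * 2 powr (1 / real ?r) \<le> C" using M(1) by (auto simp: C_def)
  have main: "(\<exists>\<gamma>. integral_curve \<A> f0 T \<gamma> \<and> \<gamma> 0 = q \<and> \<gamma> ` {0..T} \<subseteq> U) \<and>
    (\<forall>q'\<in>reachable_set \<A> f0 f T q \<epsilon>. q' \<in> U \<and>
       ereal (1 / C * infdist (z q') (z ` flow_segment \<A> f0 T q)) \<le> value_fun \<A> f0 f T q q' \<and>
       value_fun \<A> f0 f T q q' \<le> ereal (C * infdist (z q') (z ` flow_segment \<A> f0 T q) powr (1 / real ?r)))"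
    if T: "0 < T" "T < T0" and \<epsilon>: "0 < \<epsilon>" "\<epsilon> < \<epsilon>0" for T \<epsilon>
  proof (intro conjI ballI)
    have TR: "T < R" and T': "0 \<le> T" using T T0(2) R(1) by linarith+
    show "\<exists>\<gamma>. integral_curve \<A> f0 T \<gamma> \<and> \<gamma> 0 = q \<and> \<gamma> ` {0..T} \<subseteq> U"
    proof (intro exI conjI)
      show "integral_curve \<A> f0 T (\<lambda>t. w (t *\<^sub>R e))" by (rule straight_integral_curve(1)[OF R T' TR])
      show "w (0 *\<^sub>R e) = q" unfolding scaleR_zero_left by (rule w_0)
      show "(\<lambda>t. w (t *\<^sub>R e)) ` {0..T} \<subseteq> U" by (rule straight_integral_curve(2)[OF R T' TR])
    qed
    fix q' assume q': "q' \<in> reachable_set \<A> f0 f T q \<epsilon>"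
    define Seg where "Seg = (\<lambda>t. t *\<^sub>R e) ` {0..T}"
    have seg: "z ` flow_segment \<A> f0 T q = Seg" unfolding Seg_def by (rule flow_segment_straight[OF R T' TR])
    have estimate: "\<gamma> T1 \<in> U \<and> infdist (z (\<gamma> T1)) Seg \<le> M * (LINT t:{0..T1}|lebesgue. norm (u t))"
      if T1: "0 \<le> T1" "T1 \<le> T" and adm: "abs_continuous_curve \<A> T1 \<gamma>" "\<gamma> 0 = q" and u: "u \<in> controls \<A> f0 f T1 \<gamma>"
        and small: "(LINT t:{0..T1}|lebesgue. norm (u t)) < \<epsilon>0" for T1 \<gamma> u
    proof -
      have "M * (LINT t:{0..T1}|lebesgue. norm (u t)) < M * \<epsilon>0" using small M(1) by (rule mult_strict_left_mono)
      then have lt: "T1 + M * (LINT t:{0..T1}|lebesgue. norm (u t)) < R" using M\<epsilon>0(1) T1(2) T(2) T0(2) by linarith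
      have ce: "\<gamma> T1 \<in> U" "norm (z (\<gamma> T1) - T1 *\<^sub>R e) \<le> M * (LINT t:{0..T1}|lebesgue. norm (u t))"
        by (rule controlled_curve_estimate[OF R M(1) _ adm u T1(1) lt]; rule M(2); assumption)+
      have "T1 *\<^sub>R e \<in> Seg" unfolding Seg_def by (rule imageI) (simp add: T1)
      then have "infdist (z (\<gamma> T1)) Seg \<le> dist (z (\<gamma> T1)) (T1 *\<^sub>R e)" by (rule infdist_le)
      then show ?thesis

        unfolding dist_norm by (intro conjI ce(1)) (rule order_trans[OF _ ce(2)])
    qed
    have "value_fun \<A> f0 f T q q' < ereal \<epsilon>" using q' unfolding reachable_set_def by blast
    then obtain T1 \<gamma>1 where g1: "cost \<A> f0 f T1 \<gamma>1 < ereal \<epsilon>" "0 \<le> T1" "T1 \<le> T" "admissible \<A> f0 f T1 \<gamma>1" "\<gamma>1 0 = q" "\<gamma>1 T1 = q'"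
      unfolding value_fun_def Inf_less_iff by blast
    then obtain u1 where u1: "u1 \<in> controls \<A> f0 f T1 \<gamma>1" "(LINT t:{0..T1}|lebesgue. norm (u1 t)) < \<epsilon>"
      unfolding cost_def INF_less_iff by auto
    have ac1: "abs_continuous_curve \<A> T1 \<gamma>1" using g1(4) unfolding admissible_def by blast
    have s1: "(LINT t:{0..T1}|lebesgue. norm (u1 t)) < \<epsilon>0" using u1(2) \<epsilon>(2) by linarith
    have e1: "q' \<in> U" "infdist (z q') Seg \<le> M * (LINT t:{0..T1}|lebesgue. norm (u1 t))"
      using estimate[OF g1(2,3) ac1 g1(5) u1(1) s1] unfolding g1(6) by blast+
    show "q' \<in> U" by (rule e1(1))
    define D where "D = infdist (z q') Seg"
    have D0: "0 \<le> D" unfolding D_def by (rule infdist_nonneg)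
    have "M * (LINT t:{0..T1}|lebesgue. norm (u1 t)) \<le> M * \<epsilon>0" using s1 M(1) by (intro mult_left_mono) auto
    then have DM: "D \<le> M * \<epsilon>0" using e1(2) unfolding D_def by linarith
    show "ereal (1 / C * infdist (z q') (z ` flow_segment \<A> f0 T q)) \<le> value_fun \<A> f0 f T q q'"
      unfolding seg D_def[symmetric] value_fun_def
    proof (rule Inf_greatest)
      fix a assume "a \<in> {cost \<A> f0 f T' \<gamma> | T' \<gamma>. 0 \<le> T' \<and> T' \<le> T \<and> admissible \<A> f0 f T' \<gamma> \<and> \<gamma> 0 = q \<and> \<gamma> T' = q'}"
      then obtain T2 \<gamma> where g: "a = cost \<A> f0 f T2 \<gamma>" "0 \<le> T2" "T2 \<le> T" "admissible \<A> f0 f T2 \<gamma>" "\<gamma> 0 = q" "\<gamma> T2 = q'" by blast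
      have ac: "abs_continuous_curve \<A> T2 \<gamma>" using g(4) unfolding admissible_def by blast
      show "ereal (1 / C * D) \<le> a"
        unfolding g(1) cost_def
      proof (rule INF_greatest)
        fix u assume u: "u \<in> controls \<A> f0 f T2 \<gamma>"
        let ?I = "LINT t:{0..T2}|lebesgue. norm (u t)"
        have "D \<le> M * ?I"
        \<comment> \<open>The infimum runs over all curves to q'. For an expensive one, which may
          leave the chart, the cheap curve from membership in the reachable set supplies
          \<open>D \<le> M * \<epsilon>0\<close>.\<close>
        proof (cases "?I < \<epsilon>0")
          case True
          then show ?thesis using estimate[OF g(2,3) ac g(5) u] unfolding g(6) D_def by blast
        next
          case False
          then have "M * \<epsilon>0 \<le> M * ?I" using M(1) by (intro mult_left_mono) auto
          then show ?thesis using DM by linarith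
        qed
        moreover have "0 \<le> ?I"
          unfolding set_lebesgue_integral_def by (intro integral_nonneg_AE) auto
        ultimately have "D \<le> C * ?I" using mult_right_mono[OF C(2), of ?I] by linarith
        then show "ereal (1 / C * D) \<le> ereal ?I" using C(1) by (simp add: field_simps)
      qed
    qed
    have compS: "compact Seg" unfolding Seg_def
      by (intro compact_continuous_image continuous_on_scaleR continuous_on_id continuous_on_const compact_Icc)
    have neS: "Seg \<noteq> {}" unfolding Seg_def using T' by auto
    obtain s where s: "s \<in> Seg" "D = dist (z q') s"
      using infdist_attains_inf[OF compact_imp_closed[OF compS] neS, of "z q'"] unfolding D_def by blast
    then obtain t0 where t0: "0 \<le> t0" "t0 \<le> T" "s = t0 *\<^sub>R e" unfolding Seg_def by auto
    have Dt0: "D = norm (z q' - t0 *\<^sub>R e)" using s(2) unfolding t0(3) dist_norm .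
    have drift: "traj (z ` U) coordinate_field e t 0 0 (0 + t *\<^sub>R e)" if t: "0 \<le> t" "t \<le> T" for t
    proof (rule traj_drift[OF t(1)])
      have "t < R" using t TR by linarith
      then show "(\<lambda>t. 0 + t *\<^sub>R e) ` {0..t} \<subseteq> z ` U" by (rule straight_integral_curve(3)[OF R t(1)])
    qed
    show "value_fun \<A> f0 f T q q' \<le> ereal (C * infdist (z q') (z ` flow_segment \<A> f0 T q) powr (1 / real ?r))"
      unfolding seg D_def[symmetric]
    \<comment> \<open>A point of the segment is reached by the drift at cost 0, whereas
      \<open>local_reachability\<close> starts from a positive distance.\<close>
    proof (cases "D = 0")
      case True
      then have "z q' = 0 + t0 *\<^sub>R e" using Dt0 by simp
      then have "value_fun \<A> f0 f T (w 0) (w (z q')) \<le> ereal 0"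
        using value_fun_le_traj[OF drift[OF t0(1,2)] t0(2)] by (simp only:)
      then show "value_fun \<A> f0 f T q q' \<le> ereal (C * D powr (1 / real ?r))"
        unfolding w_0 w_z[OF e1(1)] True by simp
    next
      case False
      then have Dpos: "D > 0" using D0 by simp
      \<comment> \<open>The correction takes time, so the drift is left up to \<delta> before t0.
        Bounding \<delta> by T keeps the total duration within T; bounding it by D at most doubles
        the distance to the target.\<close>
      define \<delta> where "\<delta> = min T D"
      have \<delta>: "0 < \<delta>" "\<delta> \<le> T" "\<delta> \<le> D" using Dpos T by (auto simp: \<delta>_def)
      define t1 where "t1 = max 0 (t0 - \<delta>)"
      have t1: "0 \<le> t1" "t1 \<le> T" "t1 + \<delta> \<le> T" "\<bar>t0 - t1\<bar> \<le> \<delta>" using t0 \<delta> by (auto simp: t1_def)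
      have "norm (t0 *\<^sub>R e - t1 *\<^sub>R e) \<le> D"
      proof -
        have "norm (t0 *\<^sub>R e - t1 *\<^sub>R e) = \<bar>t0 - t1\<bar> * norm e" by (simp add: scaleR_diff_left[symmetric])
        also have "\<dots> \<le> D * 1" using t1(4) \<delta>(3) e Dpos by (intro mult_mono) auto
        finally show ?thesis by simp
      qed
      moreover have "norm (z q' - (0 + t1 *\<^sub>R e)) \<le> norm (z q' - t0 *\<^sub>R e) + norm (t0 *\<^sub>R e - t1 *\<^sub>R e)"
        using norm_triangle_ineq[of "z q' - t0 *\<^sub>R e" "t0 *\<^sub>R e - t1 *\<^sub>R e"] by simp
      ultimately have near: "norm (z q' - (0 + t1 *\<^sub>R e)) \<le> 2 * D" using Dt0 by linarith
      have p: "norm (0 + t1 *\<^sub>R e) \<le> \<rho>"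
      proof -
        have "t1 * norm e \<le> T * 1" using t1 e by (intro mult_mono) auto
        then show ?thesis using T(2) T0(3) t1(1) by simp
      qed
      have D2: "0 < 2 * D" "2 * D \<le> \<rho>" using Dpos DM M\<epsilon>0(2) by auto
      from reach[rule_format, OF p D2 near \<delta>(1) drift[OF t1(1,2)]]
      obtain T3 where T3: "T3 \<le> t1 + \<delta>" "traj (z ` U) coordinate_field e T3 (0 + C1 * (2 * D) powr (1 / real ?r)) 0 (z q')" by blast
      have "value_fun \<A> f0 f T (w 0) (w (z q')) \<le> ereal (0 + C1 * (2 * D) powr (1 / real ?r))"
        using T3(1) t1(3) by (intro value_fun_le_traj[OF T3(2)]) linarith
      also have "0 + C1 * (2 * D) powr (1 / real ?r) = (C1 * 2 powr (1 / real ?r)) * D powr (1 / real ?r)"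
        by (simp add: powr_mult)
      also have "ereal \<dots> \<le> ereal (C * D powr (1 / real ?r))"
        using C(3) by (simp add: mult_right_mono)
      finally show "value_fun \<A> f0 f T q q' \<le> ereal (C * D powr (1 / real ?r))"
        unfolding w_0 w_z[OF e1(1)] .
    qed
  qed
  show ?thesis
    by (rule exI[of _ T0], rule conjI[OF T0(1)], rule exI[of _ \<epsilon>0], rule conjI[OF \<epsilon>0(1)], rule exI[of _ C], rule conjI[OF C(1)])
       (use main in blast)
qed

end

text \<open>Besides the two inequalities, the drift is shown to flow from q inside U for the whole
  time T and the reachable points to lie in U, so that \<open>flow_segment\<close> and
  \<open>z q'\<close> have their intended meaning rather than default values.\<close>

theorem theorem26:
  fixes \<A> :: "('a::{t2_space,second_countable_topology}, 'n::{finite,linorder}) chart set"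
    and f0 :: "'a vector_field"
    and f :: "'m::finite \<Rightarrow> 'a vector_field"
    and q :: 'a
    and U :: "'a set"
    and z :: "'a \<Rightarrow> (real, 'n) vec"
    and k :: 'n
  assumes "smooth_atlas \<A>"
    and "connected (UNIV :: 'a set)"
    and "smooth_vector_field \<A> f0"
    and "\<And>i. smooth_vector_field \<A> (f i)"
    and "hoermander \<A> f"
    and "regular_point \<A> f f0 q"
    and "privileged_coordinates \<A> f q U z"
    and "\<And>p. p \<in> U \<Longrightarrow> pushforward z (f0 p) = axis k 1"
  shows "\<exists>T0>0. \<exists>\<epsilon>0>0. \<exists>C>0. \<forall>T \<epsilon>. 0 < T \<and> T < T0 \<and> 0 < \<epsilon> \<and> \<epsilon> < \<epsilon>0 \<longrightarrow>
    (\<exists>\<gamma>. integral_curve \<A> f0 T \<gamma> \<and> \<gamma> 0 = q \<and> \<gamma> ` {0..T} \<subseteq> U) \<and>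
    (\<forall>q'\<in>reachable_set \<A> f0 f T q \<epsilon>. q' \<in> U \<and>
       ereal (1 / C * infdist (z q') (z ` flow_segment \<A> f0 T q)) \<le> value_fun \<A> f0 f T q q' \<and>
       value_fun \<A> f0 f T q q' \<le>
         ereal (C * infdist (z q') (z ` flow_segment \<A> f0 T q) powr (1 / real (nonholonomy_degree \<A> f q))))"
proof -
  have lc: "local_coordinates \<A> (U, z)" and q: "q \<in> U" "z q = 0"
    using assms(7) unfolding privileged_coordinates_def by blast+
  interpret drift_system \<A> f U z f0 "axis k 1" q
    by unfold_locales (use assms(1,3,4,8) lc q in \<open>simp_all only: norm_axis_1 order_refl\<close>)
  show ?thesis by (rule value_fun_bounds[OF assms(5)])
qed

end
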